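(* Let $G\subset SL_n(\mathbb{C})$ be a finite abelian subgroup and let $X=X(\Sigma)$ be a relative minimal model obtained by repeated blowing-ups of $\mathbb{C}^n/G$ (i.e. $\Sigma$ is obtained from the fan of faces of $\sigma_0^G$ by applying star subdivisions repeatedly at all the points $v_g$, $g\in G$ junior, in some order). Then there is a gnat family $\mathcal{F}$ on $X$ such that the projection $q_G:(N_{\mathcal{V}})_{\mathbb{R}}\to(N_G)_{\mathbb{R}}$ induces a good quotient $q_2:\bar{\mathcal{V}}_{\Sigma,\mathcal{F}}\to X$ by $\bar T^{r-1}$ (i.e. $q_G^{-1}(\sigma)\cap|\tilde\Sigma|\in\tilde\Sigma$ for any $\sigma\in\Sigma$), and such that moreover $q_G^{-1}(\tau_k)\cap|\tilde\Sigma|=\tau_{\mathcal{F},E_k}$ for all $k=1,\dots,m$.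
   Context: **$G$-constellations.** $G\subset SL_n(\mathbb{C})$ is finite abelian, $V=\mathbb{C}^n$, $r=|G|$; coordinates $x_1,\dots,x_n$ of $V$ are chosen with $g\cdot x_j=\chi_j(g)x_j$ for characters $\chi_j$ of $G$. $\mathrm{Irr}(G)=\{\rho_0,\dots,\rho_{r-1}\}$, $\rho_0$ trivial, and $k(i,j)$ is the index with $\rho_{k(i,j)}=\rho_i\otimes\chi_j$. A $G$-constellation is a $G$-equivariant $\mathbb{C}[V]$-module isomorphic to the regular representation of $G$ as a $G$-module. Let $A=\mathbb{C}[x_{i,j}]_{0\le i\le r-1,1\le j\le n}$, let $I\subset A$ be generated by all $x_{k(i,j),j'}x_{i,j}-x_{k(i,j'),j}x_{i,j'}$, and $\mathcal{R}=\mathrm{Spec}\,A/I$. A point $p=(p_{i,j})\in\mathcal{R}$ gives the $G$-constellation $\bigoplus_i\mathbb{C}\varepsilon_i$ ($G$ acting on $\mathbb{C}\varepsilon_i$ by $\rho_i$) with $x_j\cdot\varepsilon_i=p_{i,j}\varepsilon_{k(i,j)}$. The torus $\bar T^{r-1}=(\mathbb{C}^* )^r/\{(t,\dots,t)\}$ acts on $\mathcal{R}$ by $(t_i)\cdot(p_{i,j})=(t_i^{-1}t_{k(i,j)}p_{i,j})$. $\mathcal{V}\subset\mathcal{R}$ is the unique irreducible component not contained in any coordinate hyperplane; it is a possibly non-normal toric variety with big torus $T_{\mathcal{V}}=\{p\in\mathcal{V}\mid p_{i,j}\neq0\ \forall i,j\}$, whose character lattice $M_{\mathcal{V}}$ is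 generated by the functions $\bar x_{i,j}=x_{i,j}|_{\mathcal V}$; $N_{\mathcal{V}}$ is the dual lattice, and $\bar T^{r-1}\subset T_{\mathcal V}$. **Toric description.** For $g\in G$ of order $r_g$ write $g\cdot x_j=e^{2\pi\sqrt{-1}a_j/r_g}x_j$, $0\le a_j<r_g$, and $v_g=\frac1{r_g}(a_1,\dots,a_n)\in\mathbb{Q}^n$. $N=\mathbb{Z}^n$ with standard basis $e_j$; $M=N^\vee$ with dual basis $f_j$; $N_G\subset\mathbb{Q}^n$ is generated by $N$ and all $v_g$; $M_G=N_G^\vee\subset M$. The element $g$ is junior if the coordinates of $v_g$ sum to $1$; $g_1,\dots,g_m$ are the junior elements, $r_k$ is the order of $g_k$, $v_{g_k}=\frac1{r_k}(a_{1,k},\dots,a_{n,k})$. $\mathbb{C}^n/G$ is the toric variety of $\sigma_0^G=\mathrm{Cone}(e_1,\dots,e_n)\subset(N_G)_{\mathbb{R}}$. A relative minimal model is a proper birational crepant morphism $X\to\mathbb{C}^n/G$ with $X$ normal with at worst $\mathbb{Q}$-factorial terminal singularities; every such $X$ is $X(\Sigma)$ for a simplicial fan $\Sigma$ with support $\sigma_0^G$ whose rays are generated exactly by $e_1,\dots,e_n,v_{g_1},\dots,v_{g_m}$. $\tau_k=\mathbb{R}_{\ge0}v_{g_k}$, $E_k$ is the corresponding exceptional divisor, and $\Sigma_{\max}$ is the set of maximal cones. The star subdivision of a simplicial fan $\Sigma'$ with support $\sigma_0^G$ at a lattice point $v\in N_G\cap|\Sigma'|$ is the minimal refinement of $\Sigma'$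 containing the simplicial cones $\mathrm{Cone}(u_1,\dots,\hat u_\ell,\dots,u_n,v)$ for all $n$-dimensional $\sigma=\mathrm{Cone}(u_1,\dots,u_n)\in\Sigma'$ containing $v$ and all $\ell=1,\dots,n$. Applying star subdivisions to the fan of faces of $\sigma_0^G$ successively at $v_{g_1},\dots,v_{g_m}$ in any order gives a relative minimal model. **Gnat families.** A gnat family on a relative minimal model $X$ is the sheaf $\mathcal{F}=\bigoplus_i\mathcal{O}_X(-D_{\rho_i})$, $D_{\rho_i}=\sum_kb_{i,k}E_k$, given by rational numbers $b_{i,k}$ ($0\le i\le r-1$, $1\le k\le m$) with $b_{0,k}=0$ and $b_{i,k}+\frac{a_{j,k}}{r_k}-b_{k(i,j),k}\in\mathbb{Z}_{\ge0}$ for all $i,j,k$. For $\sigma\in\Sigma$, the $G$-constellation $\mathcal{F}_{x_\sigma}$ at the distinguished point $x_\sigma$ is $\{p^\sigma_{i,j}\}$ with $p^\sigma_{i,j}=0$ if $\mathbb{R}_{\ge0}e_j\subset\sigma$ or if $b_{i,k}+\frac{a_{j,k}}{r_k}-b_{k(i,j),k}>0$ for some $k$ with $\tau_k\subset\sigma$, and $p^\sigma_{i,j}=1$ otherwise. **Notation in the claim.** For $\sigma\in\Sigma_{\max}$ put $\mathcal{V}_{\sigma,\mathcal{F}}=\{p\in\mathcal{V}\mid p_{i,j}\ne0\text{ whenever }p^\sigma_{i,j}=1\}$, $\mathcal{V}_{\Sigma,\mathcal{F}}=\bigcup_{\sigma\in\Sigma_{\max}}\mathcal{V}_{\sigma,\mathcal{F}}$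 (open and $T_{\mathcal V}$-invariant in $\mathcal{V}$). $\bar{\mathcal{V}}_{\Sigma,\mathcal{F}}$ is its normalization, a toric variety with fan $\tilde\Sigma$ in $(N_{\mathcal{V}})_{\mathbb{R}}$ and support $|\tilde\Sigma|$. The homomorphism $M_{\mathcal{V}}\to M$, $\bar x_{i,j}\mapsto f_j$, identifies the $\bar T^{r-1}$-invariant part of $M_{\mathcal{V}}$ with $M_G$; dualizing $M_G\subset M_{\mathcal{V}}$ gives $q_G$. For each $k$, the closure in $\mathcal{V}_{\Sigma,\mathcal{F}}$ of the $T_{\mathcal{V}}$-orbit of the point $(p^{\tau_k}_{i,j})$ is a torus-invariant irreducible divisor, and $\tau_{\mathcal{F},E_k}\in\tilde\Sigma$ is the ray it defines. For a reductive group $H$ acting on a variety $Y$, an $H$-invariant morphism $p:Y\to Z$ to a variety is a good quotient if it is affine and $\mathcal{O}_Z\to(p_*\mathcal{O}_Y)^H$ is an isomorphism. *)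

theory Defs
  imports "HOL-Analysis.Analysis" "HOL-Algebra.Multiplicative_Group"
begin

section \<open>Varieties as spaces with functions\<close>

text \<open>Varieties over the complex numbers are represented by their closed points, with the Zariski
  topology and, for every open \<open>W\<close>, the set of regular functions on \<open>W\<close> (made extensional on \<open>W\<close>).\<close>

record 'a fspace =
  ztop :: "'a topology"
  reg :: "'a set \<Rightarrow> ('a \<Rightarrow> complex) set"

text \<open>Gluing of charts \<open>(U, A)\<close>, where \<open>A\<close> is a ring of functions on \<open>U\<close> (used only through
  the values on \<open>U\<close>): principal opens of the charts generate the topology, and a function is regular
  if it is locally a fraction of elements of the ring of some chart.\<close>

definition glue :: "('a set \<times> ('a \<Rightarrow> complex) set) set \<Rightarrow> 'a fspace" where
  "glue \<A> = \<lparr>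
     ztop = topology_generated_by {{x\<in>U. g x \<noteq> 0} | U A g. (U, A) \<in> \<A> \<and> g \<in> A},
     reg = (\<lambda>W. {h \<in> extensional W. \<forall>x\<in>W. \<exists>(U, A)\<in>\<A>. \<exists>f\<in>A. \<exists>g\<in>A.
              x \<in> U \<and> g x \<noteq> 0 \<and> {y\<in>U. g y \<noteq> 0} \<subseteq> W \<and>
              (\<forall>y\<in>U. g y \<noteq> 0 \<longrightarrow> h y = f y / g y)}) \<rparr>"

definition restrict_fspace :: "'a fspace \<Rightarrow> 'a set \<Rightarrow> 'a fspace" where
  "restrict_fspace X U = \<lparr> ztop = subtopology (ztop X) U, reg = reg X \<rparr>"

abbreviation pts :: "'a fspace \<Rightarrow> 'a set" where
  "pts X \<equiv> topspace (ztop X)"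

definition preim :: "'a fspace \<Rightarrow> ('a \<Rightarrow> 'b) \<Rightarrow> 'b set \<Rightarrow> 'a set" where
  "preim Y p W = {y \<in> pts Y. p y \<in> W}"

definition fmorphism :: "'a fspace \<Rightarrow> 'b fspace \<Rightarrow> ('a \<Rightarrow> 'b) \<Rightarrow> bool" where
  "fmorphism Y Z p \<longleftrightarrow> continuous_map (ztop Y) (ztop Z) p \<and>
     (\<forall>W. openin (ztop Z) W \<longrightarrow> (\<forall>h\<in>reg Z W. (\<lambda>y\<in>preim Y p W. h (p y)) \<in> reg Y (preim Y p W)))"

definition fisomorphic :: "'a fspace \<Rightarrow> 'b fspace \<Rightarrow> bool" where
  "fisomorphic Y Z \<longleftrightarrow> (\<exists>p q. fmorphism Y Z p \<and> fmorphism Z Y q \<and>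
     (\<forall>y\<in>pts Y. q (p y) = y) \<and> (\<forall>z\<in>pts Z. p (q z) = z))"

text \<open>Affine space with coordinates indexed by \<open>I\<close> consists of the functions in \<open>I \<rightarrow>\<^sub>E UNIV\<close>.\<close>

inductive_set poly_fns :: "'v set \<Rightarrow> (('v \<Rightarrow> complex) \<Rightarrow> complex) set" for I :: "'v set" where
  const: "(\<lambda>_. c) \<in> poly_fns I"
| coord: "v \<in> I \<Longrightarrow> (\<lambda>x. x v) \<in> poly_fns I"
| add: "f \<in> poly_fns I \<Longrightarrow> g \<in> poly_fns I \<Longrightarrow> (\<lambda>x. f x + g x) \<in> poly_fns I"
| mult: "f \<in> poly_fns I \<Longrightarrow> g \<in> poly_fns I \<Longrightarrow> (\<lambda>x. f x * g x) \<in> poly_fns I"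

definition zariski :: "'v set \<Rightarrow> ('v \<Rightarrow> complex) topology" where
  "zariski I = ztop (glue {(I \<rightarrow>\<^sub>E UNIV, poly_fns I)})"

definition affine_variety :: "'a fspace \<Rightarrow> bool" where
  "affine_variety Y \<longleftrightarrow> (\<exists>(N::nat) Z. closedin (zariski {..<N}) Z \<and>
     fisomorphic Y (glue {(Z, poly_fns {..<N})}))"

definition affine_morphism :: "'a fspace \<Rightarrow> 'b fspace \<Rightarrow> ('a \<Rightarrow> 'b) \<Rightarrow> bool" where
  "affine_morphism Y Z p \<longleftrightarrow> fmorphism Y Z p \<and>
     (\<forall>z\<in>pts Z. \<exists>W. openin (ztop Z) W \<and> z \<in> W \<and> affine_variety (restrict_fspace Z W) \<and>
        affine_variety (restrict_fspace Y (preim Y p W)))"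

definition good_quotient ::
  "'h set \<Rightarrow> ('h \<Rightarrow> 'a \<Rightarrow> 'a) \<Rightarrow> 'a fspace \<Rightarrow> 'b fspace \<Rightarrow> ('a \<Rightarrow> 'b) \<Rightarrow> bool" where
  "good_quotient H act Y Z p \<longleftrightarrow>
     affine_morphism Y Z p \<and>
     (\<forall>s\<in>H. \<forall>y\<in>pts Y. p (act s y) = p y) \<and>
     (\<forall>W. openin (ztop Z) W \<longrightarrow>
        bij_betw (\<lambda>h. \<lambda>y\<in>preim Y p W. h (p y)) (reg Z W)
          {h \<in> reg Y (preim Y p W). \<forall>s\<in>H. \<forall>y\<in>preim Y p W. h (act s y) = h y})"

definition irreducible_in :: "'a topology \<Rightarrow> 'a set \<Rightarrow> bool" where
  "irreducible_in T S \<longleftrightarrow> S \<noteq> {} \<and> S \<subseteq> topspace T \<and>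
     (\<forall>A B. closedin T A \<and> closedin T B \<and> S \<subseteq> A \<union> B \<longrightarrow> S \<subseteq> A \<or> S \<subseteq> B)"

definition irreducible_component :: "'a topology \<Rightarrow> 'a set \<Rightarrow> 'a set \<Rightarrow> bool" where
  "irreducible_component T Y C \<longleftrightarrow> C \<subseteq> Y \<and> irreducible_in T C \<and>
     (\<forall>C'. C \<subseteq> C' \<and> C' \<subseteq> Y \<and> irreducible_in T C' \<longrightarrow> C' = C)"


section \<open>Toric varieties\<close>

definition Cstar :: "complex monoid" where
  "Cstar = \<lparr> carrier = - {0}, mult = (*), one = 1 \<rparr>"

text \<open>A toric variety is given by a character lattice \<open>M\<close> (a commutative group), a
  pairing \<open>pr\<close> of \<open>M\<close> with a real vector space of type \<open>'u\<close>, and a fan \<open>\<Sigma>\<close> there. Its points are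
  taken orbit by orbit: the orbit of \<open>\<tau> \<in> \<Sigma>\<close> is the set of homomorphisms from
  \<open>\<tau>\<^sup>\<bottom> \<inter> M\<close> to the multiplicative group.\<close>

definition perp :: "'m monoid \<Rightarrow> ('m \<Rightarrow> 'u \<Rightarrow> real) \<Rightarrow> 'u set \<Rightarrow> 'm set" where
  "perp M pr \<tau> = {m \<in> carrier M. \<forall>u\<in>\<tau>. pr m u = 0}"

definition dual_semigroup :: "'m monoid \<Rightarrow> ('m \<Rightarrow> 'u \<Rightarrow> real) \<Rightarrow> 'u set \<Rightarrow> 'm set" where
  "dual_semigroup M pr \<sigma> = {m \<in> carrier M. \<forall>u\<in>\<sigma>. pr m u \<ge> 0}"

definition toric_points ::
  "'m monoid \<Rightarrow> ('m \<Rightarrow> 'u \<Rightarrow> real) \<Rightarrow> 'u set set \<Rightarrow> ('u set \<times> ('m \<Rightarrow> complex)) set" where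
  "toric_points M pr \<Sigma> = {(\<tau>, \<gamma>). \<tau> \<in> \<Sigma> \<and>
     \<gamma> \<in> hom (M\<lparr>carrier := perp M pr \<tau>\<rparr>) Cstar \<inter> extensional (perp M pr \<tau>)}"

text \<open>The chart of \<open>\<sigma>\<close> is the union of the orbits of its faces, which are the cones of the fan contained
  in \<open>\<sigma>\<close>. On it, a character \<open>m \<in> \<sigma>\<^sup>\<or> \<inter> M\<close> vanishes exactly on the orbits of the faces \<open>\<tau>\<close>
  with \<open>m \<notin> \<tau>\<^sup>\<bottom>\<close>.\<close>

definition toric_chart ::
  "'m monoid \<Rightarrow> ('m \<Rightarrow> 'u \<Rightarrow> real) \<Rightarrow> 'u set set \<Rightarrow> 'u set \<Rightarrow> ('u set \<times> ('m \<Rightarrow> complex)) set" where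
  "toric_chart M pr \<Sigma> \<sigma> = {x \<in> toric_points M pr \<Sigma>. fst x \<subseteq> \<sigma>}"

definition toric_char ::
  "'m monoid \<Rightarrow> ('m \<Rightarrow> 'u \<Rightarrow> real) \<Rightarrow> 'm \<Rightarrow> 'u set \<times> ('m \<Rightarrow> complex) \<Rightarrow> complex" where
  "toric_char M pr m x = (if m \<in> perp M pr (fst x) then snd x m else 0)"

definition toric_ring ::
  "'m monoid \<Rightarrow> ('m \<Rightarrow> 'u \<Rightarrow> real) \<Rightarrow> 'u set \<Rightarrow> ('u set \<times> ('m \<Rightarrow> complex) \<Rightarrow> complex) set" where
  "toric_ring M pr \<sigma> =
     {\<lambda>x. \<Sum>m\<in>F. c m * toric_char M pr m x | F c. finite F \<and> F \<subseteq> dual_semigroup M pr \<sigma>}"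

definition toric_variety ::
  "'m monoid \<Rightarrow> ('m \<Rightarrow> 'u \<Rightarrow> real) \<Rightarrow> 'u set set \<Rightarrow> ('u set \<times> ('m \<Rightarrow> complex)) fspace" where
  "toric_variety M pr \<Sigma> = glue {(toric_chart M pr \<Sigma> \<sigma>, toric_ring M pr \<sigma>) | \<sigma>. \<sigma> \<in> \<Sigma>}"

text \<open>The toric morphism induced by a linear map \<open>q\<close> dual to \<open>\<iota> : M' \<rightarrow> M\<close>, for which every
  \<open>q(\<tau>)\<close> lies in a cone of \<open>\<Sigma>'\<close>: the orbit of \<open>\<tau>\<close> goes to the orbit of
  the smallest cone containing \<open>q(\<tau>)\<close>.\<close>

definition toric_morphism ::
  "('u \<Rightarrow> 'u') \<Rightarrow> ('m' \<Rightarrow> 'm) \<Rightarrow> 'm' monoid \<Rightarrow> ('m' \<Rightarrow> 'u' \<Rightarrow> real) \<Rightarrow> 'u' set set \<Rightarrow>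
   'u set \<times> ('m \<Rightarrow> complex) \<Rightarrow> 'u' set \<times> ('m' \<Rightarrow> complex)" where
  "toric_morphism q \<iota> M' pr' \<Sigma>' x =
     (let \<tau>' = \<Inter> {\<sigma> \<in> \<Sigma>'. q ` fst x \<subseteq> \<sigma>} in (\<tau>', \<lambda>m\<in>perp M' pr' \<tau>'. snd x (\<iota> m)))"


section \<open>Fans and star subdivisions\<close>

definition is_fan :: "'u::euclidean_space set \<Rightarrow> 'u set set \<Rightarrow> bool" where
  "is_fan N \<Sigma> \<longleftrightarrow> finite \<Sigma> \<and>
     (\<forall>\<sigma>\<in>\<Sigma>. (\<exists>S. finite S \<and> S \<subseteq> N \<and> \<sigma> = convex_cone hull S) \<and> (\<forall>x. x \<in> \<sigma> \<and> - x \<in> \<sigma> \<longrightarrow> x = 0)) \<and>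
     (\<forall>\<sigma>\<in>\<Sigma>. \<forall>\<tau>. \<tau> face_of \<sigma> \<and> \<tau> \<noteq> {} \<longrightarrow> \<tau> \<in> \<Sigma>) \<and>
     (\<forall>\<sigma>\<in>\<Sigma>. \<forall>\<sigma>'\<in>\<Sigma>. (\<sigma> \<inter> \<sigma>') face_of \<sigma> \<and> (\<sigma> \<inter> \<sigma>') face_of \<sigma>')"

definition fan_refines :: "'u set set \<Rightarrow> 'u set set \<Rightarrow> bool" where
  "fan_refines \<Sigma>2 \<Sigma>1 \<longleftrightarrow> \<Union> \<Sigma>2 = \<Union> \<Sigma>1 \<and> (\<forall>\<tau>\<in>\<Sigma>2. \<exists>\<sigma>\<in>\<Sigma>1. \<tau> \<subseteq> \<sigma>)"

definition max_cones :: "'u set set \<Rightarrow> 'u set set" where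
  "max_cones \<Sigma> = {\<sigma> \<in> \<Sigma>. \<forall>\<tau>\<in>\<Sigma>. \<sigma> \<subseteq> \<tau> \<longrightarrow> \<tau> = \<sigma>}"

text \<open>\<open>\<Sigma>2\<close> is a refinement of \<open>\<Sigma>1\<close> containing the cones spanned by \<open>v\<close> and all but one of the
  generators of a full-dimensional simplicial cone containing \<open>v\<close>. If the coefficient
  of \<open>v\<close> at the omitted generator is zero, these vectors are dependent, and nothing is required.\<close>

definition star_refinement ::
  "'u::euclidean_space set \<Rightarrow> 'u set set \<Rightarrow> 'u \<Rightarrow> 'u set set \<Rightarrow> bool" where
  "star_refinement N \<Sigma>1 v \<Sigma>2 \<longleftrightarrow> is_fan N \<Sigma>2 \<and> fan_refines \<Sigma>2 \<Sigma>1 \<and>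
     (\<forall>U. independent U \<and> card U = DIM('u) \<and> convex_cone hull U \<in> \<Sigma>1 \<and> v \<in> convex_cone hull U \<longrightarrow>
        (\<forall>u\<in>U. independent (insert v (U - {u})) \<and> card (insert v (U - {u})) = DIM('u) \<longrightarrow>
           convex_cone hull (insert v (U - {u})) \<in> \<Sigma>2))"

definition star_subdivision ::
  "'u::euclidean_space set \<Rightarrow> 'u set set \<Rightarrow> 'u \<Rightarrow> 'u set set \<Rightarrow> bool" where
  "star_subdivision N \<Sigma>1 v \<Sigma>2 \<longleftrightarrow> star_refinement N \<Sigma>1 v \<Sigma>2 \<and>
     (\<forall>\<Sigma>3. star_refinement N \<Sigma>1 v \<Sigma>3 \<longrightarrow> fan_refines \<Sigma>3 \<Sigma>2)"

inductive iterated_star ::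
  "'u::euclidean_space set \<Rightarrow> 'u set set \<Rightarrow> 'u list \<Rightarrow> 'u set set \<Rightarrow> bool" for N where
  Nil: "iterated_star N \<Sigma> [] \<Sigma>"
| Cons: "star_subdivision N \<Sigma> v \<Sigma>' \<Longrightarrow> iterated_star N \<Sigma>' vs \<Sigma>'' \<Longrightarrow> iterated_star N \<Sigma> (v # vs) \<Sigma>''"


section \<open>The group, its characters and the lattices \<open>N_G\<close>, \<open>M_G\<close>\<close>

definition SL :: "(complex^'n^'n) monoid" where
  "SL = \<lparr> carrier = {A. det A = 1}, mult = (**), one = mat 1 \<rparr>"

type_synonym 'n gchar = "complex^'n^'n \<Rightarrow> complex"
type_synonym 'n arrow = "'n gchar \<times> 'n"
type_synonym 'n rpoint = "'n arrow \<Rightarrow> complex"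

text \<open>The irreducible representations of an abelian group are its characters; the index \<open>i\<close> of
  \<open>\<rho>\<^sub>i\<close> is replaced by the character itself.\<close>

definition Irr :: "(complex^'n^'n) set \<Rightarrow> 'n gchar set" where
  "Irr G = hom (SL\<lparr>carrier := G\<rparr>) Cstar \<inter> extensional G"

definition triv :: "(complex^'n^'n) set \<Rightarrow> 'n gchar" where
  "triv G = (\<lambda>g\<in>G. 1)"

text \<open>The rows of \<open>X\<close> are the coordinates: \<open>x\<^sub>j(v) = (X *v v) $ j\<close>. They are eigenvectors of \<open>G\<close>
  with \<open>x\<^sub>j(g v) = \<chi>\<^sub>j(g) x\<^sub>j(v)\<close>. (Letting \<open>g\<close> act on functions through its inverse would replace
  every character by its inverse.)\<close>

definition eigen_coordinates :: "(complex^'n^'n) set \<Rightarrow> complex^'n^'n \<Rightarrow> bool" where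
  "eigen_coordinates G X \<longleftrightarrow> invertible X \<and>
     (\<forall>g\<in>G. \<forall>j. \<exists>c. \<forall>v. (X *v (g *v v)) $ j = c * (X *v v) $ j)"

definition chi :: "(complex^'n^'n) set \<Rightarrow> complex^'n^'n \<Rightarrow> 'n \<Rightarrow> 'n gchar" where
  "chi G X j = (\<lambda>g\<in>G. THE c. \<forall>v. (X *v (g *v v)) $ j = c * (X *v v) $ j)"

definition tens :: "(complex^'n^'n) set \<Rightarrow> complex^'n^'n \<Rightarrow> 'n gchar \<Rightarrow> 'n \<Rightarrow> 'n gchar" where
  "tens G X i j = (\<lambda>g\<in>G. i g * chi G X j g)"

definition weight_vec :: "(complex^'n^'n) set \<Rightarrow> complex^'n^'n \<Rightarrow> complex^'n^'n \<Rightarrow> real^'n" where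
  "weight_vec G X g = (let r = group.ord SL g in
     \<chi> j. real (THE a. a < r \<and> chi G X j g = exp (2 * complex_of_real pi * \<i> * of_nat a / of_nat r)) / real r)"

definition junior :: "(complex^'n^'n) set \<Rightarrow> complex^'n^'n \<Rightarrow> (complex^'n^'n) set" where
  "junior G X = {g\<in>G. (\<Sum>j\<in>UNIV. weight_vec G X g $ j) = 1}"

definition N_G :: "(complex^'n^'n) set \<Rightarrow> complex^'n^'n \<Rightarrow> (real^'n) set" where
  "N_G G X = {z + (\<Sum>g\<in>G. of_int (c g) *\<^sub>R weight_vec G X g) | z c. \<forall>j. z $ j \<in> \<int>}"

definition M_G :: "(complex^'n^'n) set \<Rightarrow> complex^'n^'n \<Rightarrow> (real^'n) monoid" where
  "M_G G X = \<lparr> carrier = {m. \<forall>v\<in>N_G G X. m \<bullet> v \<in> \<int>}, mult = (+), one = 0 \<rparr>"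

definition faces_sigma0 :: "(real^'n) set set" where
  "faces_sigma0 = {\<tau>. \<tau> face_of (convex_cone hull (range (\<lambda>j. axis j 1))) \<and> \<tau> \<noteq> {}}"

definition iterated_blowup_fan ::
  "(complex^'n^'n) set \<Rightarrow> complex^'n^'n \<Rightarrow> (real^'n) set set \<Rightarrow> bool" where
  "iterated_blowup_fan G X \<Sigma> \<longleftrightarrow> (\<exists>gs. distinct gs \<and> set gs = junior G X \<and>
     iterated_star (N_G G X) faces_sigma0 (map (weight_vec G X) gs) \<Sigma>)"

definition X_toric ::
  "(complex^'n^'n) set \<Rightarrow> complex^'n^'n \<Rightarrow> (real^'n) set set \<Rightarrow>
   ((real^'n) set \<times> (real^'n \<Rightarrow> complex)) fspace" where
  "X_toric G X \<Sigma> = toric_variety (M_G G X) (\<bullet>) \<Sigma>"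


section \<open>Gnat families\<close>

text \<open>A gnat family is given by the numbers \<open>b i g\<close>, where the exceptional
  divisors \<open>E\<^sub>k\<close> are indexed by the junior elements \<open>g = g\<^sub>k\<close> themselves.\<close>

definition gnat_defect ::
  "(complex^'n^'n) set \<Rightarrow> complex^'n^'n \<Rightarrow> ('n gchar \<Rightarrow> complex^'n^'n \<Rightarrow> rat) \<Rightarrow>
   'n gchar \<Rightarrow> 'n \<Rightarrow> complex^'n^'n \<Rightarrow> real" where
  "gnat_defect G X b i j g =
     real_of_rat (b i g) + weight_vec G X g $ j - real_of_rat (b (tens G X i j) g)"

definition gnat_family ::
  "(complex^'n^'n) set \<Rightarrow> complex^'n^'n \<Rightarrow> ('n gchar \<Rightarrow> complex^'n^'n \<Rightarrow> rat) \<Rightarrow> bool" where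
  "gnat_family G X b \<longleftrightarrow> (\<forall>g\<in>junior G X. b (triv G) g = 0) \<and>
     (\<forall>i\<in>Irr G. \<forall>j. \<forall>g\<in>junior G X. gnat_defect G X b i j g \<in> \<nat>)"

definition ray :: "'u::real_vector \<Rightarrow> 'u set" where
  "ray v = convex_cone hull {v}"

definition Arr :: "(complex^'n^'n) set \<Rightarrow> 'n arrow set" where
  "Arr G = Irr G \<times> UNIV"

definition dist_point ::
  "(complex^'n^'n) set \<Rightarrow> complex^'n^'n \<Rightarrow> ('n gchar \<Rightarrow> complex^'n^'n \<Rightarrow> rat) \<Rightarrow>
   (real^'n) set \<Rightarrow> 'n rpoint" where
  "dist_point G X b \<sigma> = (\<lambda>(i, j)\<in>Arr G.
     if ray (axis j 1) \<subseteq> \<sigma> \<or>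
        (\<exists>g\<in>junior G X. ray (weight_vec G X g) \<subseteq> \<sigma> \<and> gnat_defect G X b i j g > 0)
     then 0 else 1)"


section \<open>The component \<open>\<V>\<close>, its torus and its lattices\<close>

definition R_var :: "(complex^'n^'n) set \<Rightarrow> complex^'n^'n \<Rightarrow> 'n rpoint set" where
  "R_var G X = {p \<in> Arr G \<rightarrow>\<^sub>E UNIV. \<forall>i\<in>Irr G. \<forall>j j'.
     p (tens G X i j, j') * p (i, j) - p (tens G X i j', j) * p (i, j') = 0}"

definition V_var :: "(complex^'n^'n) set \<Rightarrow> complex^'n^'n \<Rightarrow> 'n rpoint set" where
  "V_var G X = (THE C. irreducible_component (zariski (Arr G)) (R_var G X) C \<and>
     (\<forall>e\<in>Arr G. \<not> C \<subseteq> {p. p e = 0}))"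

definition T_V :: "(complex^'n^'n) set \<Rightarrow> complex^'n^'n \<Rightarrow> 'n rpoint set" where
  "T_V G X = {p \<in> V_var G X. \<forall>e\<in>Arr G. p e \<noteq> 0}"

definition tmult :: "(complex^'n^'n) set \<Rightarrow> 'n rpoint \<Rightarrow> 'n rpoint \<Rightarrow> 'n rpoint" where
  "tmult G s p = (\<lambda>e\<in>Arr G. s e * p e)"

definition T_orbit :: "(complex^'n^'n) set \<Rightarrow> complex^'n^'n \<Rightarrow> 'n rpoint \<Rightarrow> 'n rpoint set" where
  "T_orbit G X p = (\<lambda>s. tmult G s p) ` T_V G X"

text \<open>The torus \<open>(\<complex>\<^sup>*)\<^sup>r / {(t,\<dots>,t)}\<close>, as the subgroup of \<open>T_V\<close> through which it acts.\<close>

definition T_bar :: "(complex^'n^'n) set \<Rightarrow> complex^'n^'n \<Rightarrow> 'n rpoint set" where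
  "T_bar G X = {(\<lambda>(i, j)\<in>Arr G. inverse (t i) * t (tens G X i j)) | t. \<forall>i\<in>Irr G. t i \<noteq> (0::complex)}"

text \<open>\<open>M_V\<close> consists of the Laurent monomials in the \<open>x\<^sub>i\<^sub>,\<^sub>j\<close>, as functions on \<open>T_V\<close>.\<close>

definition laurent ::
  "(complex^'n^'n) set \<Rightarrow> complex^'n^'n \<Rightarrow> ('n arrow \<Rightarrow> int) \<Rightarrow> ('n rpoint \<Rightarrow> complex)" where
  "laurent G X c = (\<lambda>p\<in>T_V G X. \<Prod>e\<in>Arr G. p e powi c e)"

definition xbar :: "(complex^'n^'n) set \<Rightarrow> complex^'n^'n \<Rightarrow> 'n arrow \<Rightarrow> ('n rpoint \<Rightarrow> complex)" where
  "xbar G X e = (\<lambda>p\<in>T_V G X. p e)"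

definition M_V :: "(complex^'n^'n) set \<Rightarrow> complex^'n^'n \<Rightarrow> ('n rpoint \<Rightarrow> complex) monoid" where
  "M_V G X = \<lparr> carrier = range (laurent G X), mult = (\<lambda>m m'. \<lambda>p\<in>T_V G X. m p * m' p),
     one = (\<lambda>p\<in>T_V G X. 1) \<rparr>"

type_synonym 'n nvec = "('n rpoint \<Rightarrow> complex) \<Rightarrow> real"

text \<open>\<open>(N_V)_\<real> = Hom(M_V, \<real>)\<close>, containing \<open>N_V = Hom(M_V, \<int>)\<close>.\<close>

definition N_V_R :: "(complex^'n^'n) set \<Rightarrow> complex^'n^'n \<Rightarrow> 'n nvec set" where
  "N_V_R G X = hom (M_V G X) \<lparr> carrier = UNIV, mult = (+), one = 0 \<rparr> \<inter> extensional (carrier (M_V G X))"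

definition N_V :: "(complex^'n^'n) set \<Rightarrow> complex^'n^'n \<Rightarrow> 'n nvec set" where
  "N_V G X = {u \<in> N_V_R G X. \<forall>m\<in>carrier (M_V G X). u m \<in> \<int>}"

definition M_V_inv :: "(complex^'n^'n) set \<Rightarrow> complex^'n^'n \<Rightarrow> ('n rpoint \<Rightarrow> complex) set" where
  "M_V_inv G X = {m \<in> carrier (M_V G X). \<forall>s\<in>T_bar G X. \<forall>p\<in>T_V G X. m (tmult G s p) = m p}"

text \<open>The homomorphism \<open>M_V \<rightarrow> M\<close> with \<open>x\<^sub>i\<^sub>,\<^sub>j \<mapsto> f\<^sub>j\<close>.\<close>

definition M_V_to_M :: "(complex^'n^'n) set \<Rightarrow> complex^'n^'n \<Rightarrow> ('n rpoint \<Rightarrow> complex) \<Rightarrow> real^'n" where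
  "M_V_to_M G X m = (THE f. \<exists>c. m = laurent G X c \<and> f = (\<Sum>(i, j)\<in>Arr G. of_int (c (i, j)) *\<^sub>R axis j 1))"

definition M_G_to_M_V :: "(complex^'n^'n) set \<Rightarrow> complex^'n^'n \<Rightarrow> real^'n \<Rightarrow> ('n rpoint \<Rightarrow> complex)" where
  "M_G_to_M_V G X f = (THE m. m \<in> M_V_inv G X \<and> M_V_to_M G X m = f)"

definition q_G :: "(complex^'n^'n) set \<Rightarrow> complex^'n^'n \<Rightarrow> 'n nvec \<Rightarrow> real^'n" where
  "q_G G X w = (THE v. \<forall>f\<in>carrier (M_G G X). f \<bullet> v = w (M_G_to_M_V G X f))"


section \<open>\<open>\<V>\<^bsub>\<Sigma>,\<F>\<^esub>\<close>, its normalization and the fan of the normalization\<close>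

definition V_chart ::
  "(complex^'n^'n) set \<Rightarrow> complex^'n^'n \<Rightarrow> ('n gchar \<Rightarrow> complex^'n^'n \<Rightarrow> rat) \<Rightarrow>
   (real^'n) set \<Rightarrow> 'n rpoint set" where
  "V_chart G X b \<sigma> = {p \<in> V_var G X. \<forall>e\<in>Arr G. dist_point G X b \<sigma> e = 1 \<longrightarrow> p e \<noteq> 0}"

definition V_Sigma ::
  "(complex^'n^'n) set \<Rightarrow> complex^'n^'n \<Rightarrow> ('n gchar \<Rightarrow> complex^'n^'n \<Rightarrow> rat) \<Rightarrow>
   (real^'n) set set \<Rightarrow> 'n rpoint set" where
  "V_Sigma G X b \<Sigma> = (\<Union>\<sigma>\<in>max_cones \<Sigma>. V_chart G X b \<sigma>)"

text \<open>The one-parameter subgroup of \<open>T_V\<close> given by \<open>u \<in> N_V\<close>.\<close>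

definition one_ps :: "(complex^'n^'n) set \<Rightarrow> complex^'n^'n \<Rightarrow> 'n nvec \<Rightarrow> complex \<Rightarrow> 'n rpoint" where
  "one_ps G X u t = (\<lambda>e\<in>Arr G. t powi \<lfloor>u (xbar G X e)\<rfloor>)"

definition one_ps_limit ::
  "(complex^'n^'n) set \<Rightarrow> complex^'n^'n \<Rightarrow> 'n nvec \<Rightarrow> 'n rpoint \<Rightarrow> bool" where
  "one_ps_limit G X u p \<longleftrightarrow> (one_ps G X u \<longlongrightarrow> p) (at 0)"

text \<open>The orbit-cone correspondence: in a toric variety, the lattice points in the relative interior of
  the cone of an orbit \<open>O\<close> are the \<open>u\<close> whose one-parameter subgroup has a limit in \<open>O\<close>. Since the
  normalization of a toric variety is finite and bijective on torus orbits, limits exist upstairs if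
  and only if they exist downstairs, and the cones of the normalization can be read off from the
  given variety. The topology on \<open>Hom(M_V, \<real>)\<close> is that of pointwise convergence.\<close>

definition orbit_cone ::
  "(complex^'n^'n) set \<Rightarrow> complex^'n^'n \<Rightarrow> 'n rpoint set \<Rightarrow> 'n nvec set" where
  "orbit_cone G X Orb = closure {(\<lambda>m\<in>carrier (M_V G X). c * u m) | c u p.
     c \<ge> 0 \<and> u \<in> N_V G X \<and> p \<in> Orb \<and> one_ps_limit G X u p}"

definition toric_fan_of ::
  "(complex^'n^'n) set \<Rightarrow> complex^'n^'n \<Rightarrow> 'n rpoint set \<Rightarrow> 'n nvec set set" where
  "toric_fan_of G X Y = {orbit_cone G X (T_orbit G X p) | u p.
     u \<in> N_V G X \<and> p \<in> Y \<and> one_ps_limit G X u p}"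

definition Sigma_tilde ::
  "(complex^'n^'n) set \<Rightarrow> complex^'n^'n \<Rightarrow> ('n gchar \<Rightarrow> complex^'n^'n \<Rightarrow> rat) \<Rightarrow>
   (real^'n) set set \<Rightarrow> 'n nvec set set" where
  "Sigma_tilde G X b \<Sigma> = toric_fan_of G X (V_Sigma G X b \<Sigma>)"

text \<open>\<open>\<tau>\<^bsub>\<F>,E\<^sub>k\<^esub>\<close>: the ray of a torus-invariant prime divisor is the cone of its open orbit.\<close>

definition tau_E ::
  "(complex^'n^'n) set \<Rightarrow> complex^'n^'n \<Rightarrow> ('n gchar \<Rightarrow> complex^'n^'n \<Rightarrow> rat) \<Rightarrow>
   complex^'n^'n \<Rightarrow> 'n nvec set" where
  "tau_E G X b g = orbit_cone G X (T_orbit G X (dist_point G X b (ray (weight_vec G X g))))"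

definition V_bar ::
  "(complex^'n^'n) set \<Rightarrow> complex^'n^'n \<Rightarrow> ('n gchar \<Rightarrow> complex^'n^'n \<Rightarrow> rat) \<Rightarrow>
   (real^'n) set set \<Rightarrow> ('n nvec set \<times> (('n rpoint \<Rightarrow> complex) \<Rightarrow> complex)) fspace" where
  "V_bar G X b \<Sigma> = toric_variety (M_V G X) (\<lambda>m w. w m) (Sigma_tilde G X b \<Sigma>)"

text \<open>The action of \<open>s \<in> T_V\<close> on \<open>V_bar\<close>.\<close>

definition V_bar_act ::
  "(complex^'n^'n) set \<Rightarrow> complex^'n^'n \<Rightarrow> 'n rpoint \<Rightarrow>
   'n nvec set \<times> (('n rpoint \<Rightarrow> complex) \<Rightarrow> complex) \<Rightarrow>
   'n nvec set \<times> (('n rpoint \<Rightarrow> complex) \<Rightarrow> complex)" where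
  "V_bar_act G X s x = (fst x, \<lambda>m\<in>perp (M_V G X) (\<lambda>m w. w m) (fst x). m s * snd x m)"

definition q_2 ::
  "(complex^'n^'n) set \<Rightarrow> complex^'n^'n \<Rightarrow> (real^'n) set set \<Rightarrow>
   'n nvec set \<times> (('n rpoint \<Rightarrow> complex) \<Rightarrow> complex) \<Rightarrow> (real^'n) set \<times> (real^'n \<Rightarrow> complex)" where
  "q_2 G X \<Sigma> = toric_morphism (q_G G X) (M_G_to_M_V G X) (M_G G X) (\<bullet>) \<Sigma>"

definition q_G_preimage ::
  "(complex^'n^'n) set \<Rightarrow> complex^'n^'n \<Rightarrow> (real^'n) set \<Rightarrow> 'n nvec set" where
  "q_G_preimage G X \<sigma> = {w \<in> N_V_R G X. q_G G X w \<in> \<sigma>}"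

end

theory Submission
  imports Defs "HOL-Complex_Analysis.Conformal_Mappings"
begin

text \<open>A point of the torus of \<open>\<V>\<close> is a product \<open>s\<^sub>j t(\<chi>\<^sub>j \<rho>\<^sub>i) / t(\<rho>\<^sub>i)\<close>, being given by commuting operators
  with a common eigenvector. Hence \<open>(N\<^sub>\<V>)\<^sub>\<real>\<close> is the space of the cocycles
  \<open>w\<^sub>i\<^sub>j = y\<^sub>j + \<theta>(\<chi>\<^sub>j \<rho>\<^sub>i) - \<theta>(\<rho>\<^sub>i)\<close> on the arrows, with \<open>q\<^sub>G(w) = y\<close>, and the
  cones of the fan of the normalization are the sets of nonnegative cocycles supported in a given set of arrows.

  The gnat family comes from functions \<open>f\<^sub>v : \<int>\<^sup>n \<rightarrow> \<int>\<close>, one for each ray of the fan, with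
  \<open>b = x \<bullet> v - f\<^sub>v(x)\<close> for every \<open>x\<close> of the given class. For \<open>v = e\<^sub>j\<close> take \<open>f\<^sub>v(x) = x\<^sub>j\<close>. When a star
  subdivision introduces \<open>v = \<Sum> \<lambda>\<^sub>t t\<close>, take the floor of \<open>\<Sum> \<lambda>\<^sub>t f\<^sub>t\<close>. For the set \<open>U\<close> of generators
  of a maximal cone it follows by induction that the \<open>f\<^sub>u\<close> with \<open>u \<in> U\<close> map \<open>\<int>\<^sup>n\<close> onto \<open>\<int>\<^sup>U\<close>, and that if
  \<open>f\<^sub>u(x) \<le> f\<^sub>u(x')\<close> for all \<open>u \<in> U\<close>, then one gets from \<open>x\<close> to \<open>x'\<close> by steps along the \<open>e\<^sub>j\<close> and
  backward steps that change no \<open>f\<^sub>u\<close>; here one needs \<open>\<Sum> \<lambda>\<^sub>t = 1\<close>, that is, that \<open>v\<close> is junior. A cocycle gives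
  the function \<open>W(x) = x \<bullet> y + \<theta>(x)\<close>, and if it vanishes on the arrows where all \<open>f\<^sub>u\<close> stay constant, then
  \<open>W\<close> is monotone in the \<open>f\<^sub>u\<close>, which forces \<open>y\<close> into the cone of \<open>U\<close>. So a single
  cone lies over each cone of the fan.

  Given this, an invariant function on the preimage of a chart is near a point \<open>F/G\<close> with \<open>F\<close> and \<open>G\<close> sums of
  characters, and comparing weights makes \<open>F\<close> and \<open>G\<close> invariant.\<close>

section \<open>Generated topologies and charts\<close>

text \<open>For \<open>m\<close> of trivial class, \<open>W (x + m) = W x + m \<bullet> y\<close>,
  so \<open>W\<close> is affine along the lattice M_G. Surjectivity of the rounding functions and
  the pigeonhole principle provide such \<open>m\<close> whose pairings with the
  \<open>u \<in> U\<close> are prescribed up to one positive factor. Monotonicity of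
  \<open>W\<close> along them gives the signs of the coordinates of \<open>y\<close> in the basis
  \<open>U\<close>. With an \<open>m\<close> that vanishes on a face \<open>A \<subseteq> U\<close>,
  the same comparison bounds the support of every cocycle over the cone of \<open>A\<close>, so
  cocycles coming from different charts over a common face lie in one cone. Rounding forgets
  \<open>f t\<close> for the generator \<open>t\<close> that is replaced by \<open>v\<close>. A path
  may lower \<open>f t\<close> while the floor stays the same; when the floor is about to drop, the
  fractional part is below \<lambda>_t, and one unit of another \<open>f s\<close> still fits below
  the next integer because \<lambda>_s + \<lambda>_t is at most 1. The cones are real, but orbits
  are detected by integral one-parameter subgroups; simultaneous Dirichlet approximation passes from
  one to the other.\<close>

lemma generate_topology_on_Int_basis:
  assumes "generate_topology_on \<B> W"
    and "\<And>A B x. A \<in> \<B> \<Longrightarrow> B \<in> \<B> \<Longrightarrow> x \<in> A \<Longrightarrow> x \<in> B \<Longrightarrow> \<exists>C\<in>\<B>. x \<in> C \<and> C \<subseteq> A \<inter> B"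
    and "x \<in> W"
  shows "\<exists>B\<in>\<B>. x \<in> B \<and> B \<subseteq> W"
  using assms(1,3)
proof (induction arbitrary: x rule: generate_topology_on.induct)
  case (Int a b)
  then obtain A B where A: "A \<in> \<B>" "x \<in> A" "A \<subseteq> a" and B: "B \<in> \<B>" "x \<in> B" "B \<subseteq> b"
    by (metis IntD1 IntD2)
  from assms(2)[OF A(1) B(1) A(2) B(2)] obtain C where "C \<in> \<B>" "x \<in> C" "C \<subseteq> A \<inter> B" by auto
  with A(3) B(3) show ?case by (intro bexI[of _ C]) auto
next
  case (UN K)
  then obtain k where "k \<in> K" "x \<in> k" by auto
  with UN.IH[OF this] show ?case by (meson Union_upper order_trans)
qed auto

text \<open>Both \<open>glue {(U, A)}\<close> and the restriction of a glued space to one chart have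
  this property. An isomorphism with an affine variety thereby reduces to a bijection of points that
  matches the two rings of functions.\<close>

definition chart_like :: "'a fspace \<Rightarrow> 'a set \<Rightarrow> ('a \<Rightarrow> complex) set \<Rightarrow> bool" where
  "chart_like X U A \<longleftrightarrow>
     (\<forall>V. openin (ztop X) V \<longleftrightarrow> V \<subseteq> U \<and> (\<forall>x\<in>V. \<exists>g\<in>A. g x \<noteq> 0 \<and> {y\<in>U. g y \<noteq> 0} \<subseteq> V)) \<and>
     (\<forall>V. openin (ztop X) V \<longrightarrow> (\<forall>h. h \<in> reg X V \<longleftrightarrow> h \<in> extensional V \<and> (\<forall>x\<in>V. \<exists>f\<in>A. \<exists>g\<in>A.
        g x \<noteq> 0 \<and> {y\<in>U. g y \<noteq> 0} \<subseteq> V \<and> (\<forall>y\<in>U. g y \<noteq> 0 \<longrightarrow> h y = f y / g y))))"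

lemma chart_like_openI:
  assumes "chart_like X U A" "S \<subseteq> U" "\<And>x. x \<in> S \<Longrightarrow> \<exists>g\<in>A. g x \<noteq> 0 \<and> {y\<in>U. g y \<noteq> 0} \<subseteq> S"
  shows "openin (ztop X) S"
  using assms unfolding chart_like_def by simp

lemma chart_like_openD:
  assumes "chart_like X U A" "openin (ztop X) S" "x \<in> S"
  obtains g where "g \<in> A" "g x \<noteq> 0" "{y\<in>U. g y \<noteq> 0} \<subseteq> S"
proof -
  have "\<forall>x\<in>S. \<exists>g\<in>A. g x \<noteq> 0 \<and> {y\<in>U. g y \<noteq> 0} \<subseteq> S"
    using assms(1,2) unfolding chart_like_def by simp
  then obtain g where "g \<in> A" "g x \<noteq> 0 \<and> {y\<in>U. g y \<noteq> 0} \<subseteq> S"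
    using assms(3) by (auto dest!: bspec[of S _ x])
  then show ?thesis using that[of g] by simp
qed

lemma chart_like_regI:
  assumes "chart_like X U A" "openin (ztop X) V" "h \<in> extensional V"
    and "\<And>x. x \<in> V \<Longrightarrow> \<exists>f\<in>A. \<exists>g\<in>A. g x \<noteq> 0 \<and> {y\<in>U. g y \<noteq> 0} \<subseteq> V \<and> (\<forall>y\<in>U. g y \<noteq> 0 \<longrightarrow> h y = f y / g y)"
  shows "h \<in> reg X V"
  using assms unfolding chart_like_def by simp

lemma chart_like_regD:
  assumes "chart_like X U A" "openin (ztop X) V" "h \<in> reg X V" "x \<in> V"
  obtains f g where "f \<in> A" "g \<in> A" "g x \<noteq> 0" "{y\<in>U. g y \<noteq> 0} \<subseteq> V"
    "\<forall>y\<in>U. g y \<noteq> 0 \<longrightarrow> h y = f y / g y"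
proof -
  have "\<forall>x\<in>V. \<exists>f\<in>A. \<exists>g\<in>A. g x \<noteq> 0 \<and> {y\<in>U. g y \<noteq> 0} \<subseteq> V \<and> (\<forall>y\<in>U. g y \<noteq> 0 \<longrightarrow> h y = f y / g y)"
    using assms(1,2,3) unfolding chart_like_def by simp
  then obtain f g where "f \<in> A" "g \<in> A" "g x \<noteq> 0 \<and> {y\<in>U. g y \<noteq> 0} \<subseteq> V \<and> (\<forall>y\<in>U. g y \<noteq> 0 \<longrightarrow> h y = f y / g y)"
    using assms(4) by (auto dest!: bspec[of V _ x])
  then show ?thesis using that[of f g] by simp
qed

lemma chart_like_pts:
  assumes "chart_like X U A" "\<exists>g\<in>A. \<forall>x\<in>U. g x \<noteq> 0"
  shows "pts X = U"
proof -
  have "openin (ztop X) U"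
    by (rule chart_like_openI[OF assms(1)]) (use assms(2) in auto)
  moreover have "pts X \<subseteq> U" using assms(1) openin_topspace unfolding chart_like_def by auto
  ultimately show ?thesis by (metis openin_subset subset_antisym)
qed

text \<open>Openness and regularity are both expressed through the rings, so pulling back functions
  of the rings settles continuity and regularity alike.\<close>

lemma chart_like_morphism:
  assumes X: "chart_like X U A" and Y: "chart_like Y V B" and one: "\<exists>g\<in>A. \<forall>x\<in>U. g x \<noteq> 0" "\<exists>g\<in>B. \<forall>x\<in>V. g x \<noteq> 0"
    and e: "\<And>x. x \<in> U \<Longrightarrow> e x \<in> V"
    and pull: "\<And>f. f \<in> B \<Longrightarrow> \<exists>f'\<in>A. \<forall>x\<in>U. f' x = f (e x)"
  shows "fmorphism X Y e"
proof -
  have ptsX: "pts X = U" and ptsY: "pts Y = V" using chart_like_pts[OF X] chart_like_pts[OF Y] one by auto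
  have op: "openin (ztop X) (preim X e W)" if W: "openin (ztop Y) W" for W
  proof (rule chart_like_openI[OF X])
    show "preim X e W \<subseteq> U" by (auto simp: preim_def ptsX)
  next
    fix x assume x: "x \<in> preim X e W"
    then obtain g where g: "g \<in> B" "g (e x) \<noteq> 0" "{y\<in>V. g y \<noteq> 0} \<subseteq> W"
      using chart_like_openD[OF Y W, of "e x"] unfolding preim_def by auto
    from pull[OF g(1)] obtain g' where "g' \<in> A" "\<forall>x\<in>U. g' x = g (e x)" by auto
    then show "\<exists>g\<in>A. g x \<noteq> 0 \<and> {y\<in>U. g y \<noteq> 0} \<subseteq> preim X e W"
      using g x e by (intro bexI[of _ g']) (auto simp: preim_def ptsX)
  qed
  show ?thesis unfolding fmorphism_def
  proof (intro conjI allI impI ballI)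
    show "continuous_map (ztop X) (ztop Y) e"
      unfolding continuous_map_def using op e ptsX ptsY by (auto simp: preim_def)
  next
    fix W h assume W: "openin (ztop Y) W" and h: "h \<in> reg Y W"
    show "(\<lambda>y\<in>preim X e W. h (e y)) \<in> reg X (preim X e W)"
    proof (rule chart_like_regI[OF X op[OF W]])
      fix x assume x: "x \<in> preim X e W"
      have ex: "e x \<in> W" and xU: "x \<in> U" using x by (auto simp: preim_def ptsX)
      obtain f g where fg: "f \<in> B" "g \<in> B" "g (e x) \<noteq> 0" "{y\<in>V. g y \<noteq> 0} \<subseteq> W"
          "\<forall>y\<in>V. g y \<noteq> 0 \<longrightarrow> h y = f y / g y"
        by (rule chart_like_regD[OF Y W h ex])
      from pull[OF fg(1)] obtain f' where f': "f' \<in> A" "\<forall>x\<in>U. f' x = f (e x)" by auto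
      from pull[OF fg(2)] obtain g' where g': "g' \<in> A" "\<forall>x\<in>U. g' x = g (e x)" by auto
      have sub: "{y\<in>U. g' y \<noteq> 0} \<subseteq> preim X e W"
        using fg(4) g' e by (auto simp: preim_def ptsX)
      have val: "(\<lambda>y\<in>preim X e W. h (e y)) y = f' y / g' y" if y: "y \<in> U" "g' y \<noteq> 0" for y
      proof -
        have "y \<in> preim X e W" using sub y by blast
        then show ?thesis using y fg(5) e f'(2) g'(2) by simp
      qed
      show "\<exists>f\<in>A. \<exists>g\<in>A. g x \<noteq> 0 \<and> {y\<in>U. g y \<noteq> 0} \<subseteq> preim X e W \<and>
          (\<forall>y\<in>U. g y \<noteq> 0 \<longrightarrow> (\<lambda>y\<in>preim X e W. h (e y)) y = f y / g y)"
        using fg(3) g'(2) xU sub val by (intro bexI[OF _ f'(1)] bexI[OF _ g'(1)]) auto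
    qed simp
  qed
qed

lemma chart_like_isomorphic:
  assumes X: "chart_like X U A" and Y: "chart_like Y V B" and one: "\<exists>g\<in>A. \<forall>x\<in>U. g x \<noteq> 0" "\<exists>g\<in>B. \<forall>x\<in>V. g x \<noteq> 0"
    and e: "bij_betw e U V"
    and pull: "\<And>f. f \<in> B \<Longrightarrow> \<exists>f'\<in>A. \<forall>x\<in>U. f' x = f (e x)"
    and push: "\<And>f. f \<in> A \<Longrightarrow> \<exists>f'\<in>B. \<forall>x\<in>U. f x = f' (e x)"
  shows "fisomorphic X Y"
proof -
  define q where "q = the_inv_into U e"
  have qe: "q (e x) = x" if "x \<in> U" for x
    using e that unfolding q_def bij_betw_def by (simp add: the_inv_into_f_f)
  have eq: "e (q y) = y" "q y \<in> U" if "y \<in> V" for y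
    using e that qe unfolding bij_betw_def by auto
  have eV: "e x \<in> V" if "x \<in> U" for x using e that unfolding bij_betw_def by auto
  have "fmorphism X Y e" by (rule chart_like_morphism[OF X Y one eV]) (use pull in auto)
  moreover have "fmorphism Y X q"
  proof (rule chart_like_morphism[OF Y X one(2,1)])
    fix f assume "f \<in> A"
    from push[OF this] obtain f' where "f' \<in> B" "\<forall>x\<in>U. f x = f' (e x)" by auto
    then show "\<exists>f'\<in>B. \<forall>x\<in>V. f' x = f (q x)" using eq by (intro bexI[of _ f']) auto
  qed (use eq in auto)
  ultimately show ?thesis unfolding fisomorphic_def
      chart_like_pts[OF X one(1)] chart_like_pts[OF Y one(2)] using qe eq by metis
qed

text \<open>Closure under products makes the principal opens a basis: two of them intersect in the
  principal open of the product.\<close>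

lemma chart_like_glue_single:
  assumes one: "(\<lambda>_. 1) \<in> A" and mult: "\<And>f g. f \<in> A \<Longrightarrow> g \<in> A \<Longrightarrow> (\<lambda>x. f x * g x) \<in> A"
  shows "chart_like (glue {(U, A)}) U A"
proof -
  let ?\<B> = "{{x\<in>U. g x \<noteq> 0} | g. g \<in> A}"
  have \<B>: "{{x\<in>U'. g x \<noteq> 0} | U' A' g. (U', A') \<in> {(U, A)} \<and> g \<in> A'} = ?\<B>" by auto
  have op: "openin (ztop (glue {(U, A)})) V \<longleftrightarrow> V \<subseteq> U \<and> (\<forall>x\<in>V. \<exists>g\<in>A. g x \<noteq> 0 \<and> {y\<in>U. g y \<noteq> 0} \<subseteq> V)" for V
  proof -
    have "openin (ztop (glue {(U, A)})) V \<longleftrightarrow> generate_topology_on ?\<B> V"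
      unfolding glue_def \<B> by (simp add: openin_topology_generated_by_iff)
    also have "\<dots> \<longleftrightarrow> V \<subseteq> U \<and> (\<forall>x\<in>V. \<exists>g\<in>A. g x \<noteq> 0 \<and> {y\<in>U. g y \<noteq> 0} \<subseteq> V)"
    proof
      assume V: "generate_topology_on ?\<B> V"
      have "\<exists>B\<in>?\<B>. x \<in> B \<and> B \<subseteq> V" if "x \<in> V" for x
      proof (rule generate_topology_on_Int_basis[OF V _ that])
        fix P Q x assume "P \<in> ?\<B>" "Q \<in> ?\<B>" and x: "x \<in> P" "x \<in> Q"
        then obtain f g where fg: "f \<in> A" "g \<in> A" "P = {x\<in>U. f x \<noteq> 0}" "Q = {x\<in>U. g x \<noteq> 0}" by blast
        with mult[OF fg(1,2)] have "P \<inter> Q \<in> ?\<B>"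
          by (intro CollectI exI[of _ "\<lambda>x. f x * g x"]) auto
        with x show "\<exists>C\<in>?\<B>. x \<in> C \<and> C \<subseteq> P \<inter> Q" by blast
      qed
      then show "V \<subseteq> U \<and> (\<forall>x\<in>V. \<exists>g\<in>A. g x \<noteq> 0 \<and> {y\<in>U. g y \<noteq> 0} \<subseteq> V)" by blast
    next
      assume r: "V \<subseteq> U \<and> (\<forall>x\<in>V. \<exists>g\<in>A. g x \<noteq> 0 \<and> {y\<in>U. g y \<noteq> 0} \<subseteq> V)"
      then have "V = \<Union>{B\<in>?\<B>. B \<subseteq> V}" by blast
      moreover have "generate_topology_on ?\<B> (\<Union>{B\<in>?\<B>. B \<subseteq> V})"
        by (rule generate_topology_on.UN) (blast intro: generate_topology_on.Basis)
      ultimately show "generate_topology_on ?\<B> V" by simp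
    qed
    finally show ?thesis .
  qed
  show ?thesis unfolding chart_like_def
    using op by (intro conjI allI impI) (auto simp: glue_def)
qed

lemma chart_like_poly: "chart_like (glue {(Z, poly_fns I)}) Z (poly_fns I)"
  by (rule chart_like_glue_single) (auto intro: poly_fns.intros)

lemma openin_zariski:
  "openin (zariski I) V \<longleftrightarrow> V \<subseteq> I \<rightarrow>\<^sub>E UNIV \<and>
     (\<forall>x\<in>V. \<exists>g\<in>poly_fns I. g x \<noteq> 0 \<and> {y \<in> I \<rightarrow>\<^sub>E UNIV. g y \<noteq> 0} \<subseteq> V)"
  using chart_like_poly[of "I \<rightarrow>\<^sub>E UNIV" I] unfolding chart_like_def zariski_def by simp

lemma topspace_zariski: "topspace (zariski I) = I \<rightarrow>\<^sub>E UNIV"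
  unfolding zariski_def by (rule chart_like_pts[OF chart_like_poly]) (auto intro: bexI[OF _ poly_fns.const[of 1]])

lemma closedin_zariski:
  "closedin (zariski I) V \<longleftrightarrow> V \<subseteq> I \<rightarrow>\<^sub>E UNIV \<and>
     (\<forall>x\<in>(I \<rightarrow>\<^sub>E UNIV) - V. \<exists>g\<in>poly_fns I. g x \<noteq> 0 \<and> (\<forall>y\<in>V. g y = 0))"
proof (cases "V \<subseteq> I \<rightarrow>\<^sub>E UNIV")
  case True
  have "V \<subseteq> E \<Longrightarrow> {y \<in> E. g y \<noteq> 0} \<subseteq> E - V \<longleftrightarrow> (\<forall>y\<in>V. g y = 0)" for E and g :: "('a \<Rightarrow> complex) \<Rightarrow> complex"
    by auto
  note this[OF True]
  with True show ?thesis unfolding closedin_def openin_zariski topspace_zariski by simp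
qed (simp add: closedin_def topspace_zariski)

lemma poly_fns_diff:
  assumes "f \<in> poly_fns I" "g \<in> poly_fns I"
  shows "(\<lambda>x. f x - g x) \<in> poly_fns I"
  using poly_fns.add[OF assms(1) poly_fns.mult[OF poly_fns.const[of "-1"] assms(2)]] by simp

lemma poly_fns_sum:
  assumes "finite F" "\<And>a. a \<in> F \<Longrightarrow> f a \<in> poly_fns I"
  shows "(\<lambda>x. \<Sum>a\<in>F. f a x) \<in> poly_fns I"
  using assms by (induction F rule: finite_induct) (auto intro: poly_fns.intros)

lemma poly_fns_prod_list:
  assumes "set l \<subseteq> I"
  shows "(\<lambda>z. prod_list (map z l)) \<in> poly_fns I"
  using assms by (induction l) (auto intro: poly_fns.intros)

section \<open>Finite generation of dual semigroups\<close>

text \<open>Induction on the coordinates. The finite set \<open>B\<close> handles the old ones; as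
  its members have new coordinate at most \<open>N\<close>, it also serves every \<open>m\<close>
  whose new coordinate is at least \<open>N\<close>. Each of the \<open>N\<close> smaller values has
  its own finite set \<open>C k\<close>.\<close>

lemma Dickson:
  fixes f :: "'m \<Rightarrow> 'i \<Rightarrow> nat"
  assumes "finite I"
  shows "\<exists>B\<subseteq>S. finite B \<and> (\<forall>m\<in>S. \<exists>b\<in>B. \<forall>i\<in>I. f b i \<le> f m i)"
  using assms
proof (induction I arbitrary: S rule: finite_induct)
  case empty
  show ?case
  proof (cases "S = {}")
    case False
    then obtain s where "s \<in> S" by blast
    then show ?thesis by (intro exI[of _ "{s}"]) auto
  qed auto
next
  case (insert i I)
  obtain B where B: "B \<subseteq> S" "finite B" "\<forall>m\<in>S. \<exists>b\<in>B. \<forall>j\<in>I. f b j \<le> f m j"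
    using insert.IH[of S] by auto
  have "\<forall>k. \<exists>C\<subseteq>{m\<in>S. f m i = k}. finite C \<and> (\<forall>m\<in>{m\<in>S. f m i = k}. \<exists>b\<in>C. \<forall>j\<in>I. f b j \<le> f m j)"
    by (intro allI insert.IH)
  then obtain C where C': "\<forall>k. C k \<subseteq> {m\<in>S. f m i = k} \<and> finite (C k) \<and>
      (\<forall>m\<in>{m\<in>S. f m i = k}. \<exists>b\<in>C k. \<forall>j\<in>I. f b j \<le> f m j)"
    by (rule choice[THEN exE])
  have C: "C k \<subseteq> {m\<in>S. f m i = k}" "finite (C k)"
    "m \<in> S \<Longrightarrow> f m i = k \<Longrightarrow> \<exists>b\<in>C k. \<forall>j\<in>I. f b j \<le> f m j" for k m
    using C'[rule_format, of k] by auto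
  define N where "N = Max (insert 0 ((\<lambda>b. f b i) ` B))"
  have N: "f b i \<le> N" if "b \<in> B" for b unfolding N_def using B(2) that by simp
  let ?D = "B \<union> (\<Union>k<N. C k)"
  have "\<exists>b\<in>?D. \<forall>j\<in>insert i I. f b j \<le> f m j" if m: "m \<in> S" for m
  proof (cases "f m i < N")
    case True
    from C(3)[OF m refl] obtain b where b: "b \<in> C (f m i)" "\<forall>j\<in>I. f b j \<le> f m j" by auto
    then have "f b i = f m i" using C(1)[of "f m i"] by auto
    with b True show ?thesis by (intro bexI[of _ b]) auto
  next
    case False
    from B(3) m obtain b where b: "b \<in> B" "\<forall>j\<in>I. f b j \<le> f m j" by auto
    with N[OF b(1)] False show ?thesis by (intro bexI[of _ b]) auto
  qed
  moreover have "?D \<subseteq> S" "finite ?D" using B(1,2) C' by auto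
  ultimately show ?case by (intro exI[of _ ?D]) simp
qed

section \<open>Toric varieties of fans\<close>

text \<open>No linear structure is required of the space containing \<open>\<Sigma>\<close>. Pairing with the lattice points
  in \<open>K\<close> embeds \<open>M\<close> into a power of the integers.\<close>

locale toric_setting =
  fixes M :: "'m monoid" and pr :: "'m \<Rightarrow> 'u \<Rightarrow> real" and \<Sigma> :: "'u set set" and K :: "'u set"
  assumes comm_group_M: "comm_group M"
    and finite_fan: "finite \<Sigma>"
    and pr_mult: "\<And>m m' u. m \<in> carrier M \<Longrightarrow> m' \<in> carrier M \<Longrightarrow> u \<in> \<Union>\<Sigma> \<union> K \<Longrightarrow>
      pr (m \<otimes>\<^bsub>M\<^esub> m') u = pr m u + pr m' u"
    and finite_K: "finite K"
    and K_int: "\<And>m u. m \<in> carrier M \<Longrightarrow> u \<in> K \<Longrightarrow> pr m u \<in> \<int>"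
    and K_sep: "\<And>m. m \<in> carrier M \<Longrightarrow> (\<And>u. u \<in> K \<Longrightarrow> pr m u = 0) \<Longrightarrow> m = \<one>\<^bsub>M\<^esub>"
    and gens: "\<And>\<sigma>. \<sigma> \<in> \<Sigma> \<Longrightarrow> \<exists>\<Gamma>. finite \<Gamma> \<and> \<Gamma> \<subseteq> \<sigma> \<and>
      (\<forall>u\<in>\<Gamma>. \<forall>m\<in>carrier M. pr m u \<in> \<int>) \<and>
      (\<forall>m\<in>carrier M. (\<forall>u\<in>\<Gamma>. 0 \<le> pr m u) \<longrightarrow> (\<forall>u\<in>\<sigma>. 0 \<le> pr m u))"
    and face_closed: "\<And>\<sigma> m. \<sigma> \<in> \<Sigma> \<Longrightarrow> m \<in> dual_semigroup M pr \<sigma> \<Longrightarrow> {u\<in>\<sigma>. pr m u = 0} \<in> \<Sigma>"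
    and inter_face: "\<And>\<sigma> \<sigma>'. \<sigma> \<in> \<Sigma> \<Longrightarrow> \<sigma>' \<in> \<Sigma> \<Longrightarrow>
      \<exists>m\<in>dual_semigroup M pr \<sigma>. \<sigma> \<inter> \<sigma>' = {u\<in>\<sigma>. pr m u = 0}"
begin

sublocale comm_group M by (rule comm_group_M)

abbreviation "S \<equiv> dual_semigroup M pr"
abbreviation "P \<equiv> perp M pr"
abbreviation "ch \<equiv> toric_char M pr"
abbreviation "U \<equiv> toric_chart M pr \<Sigma>"
abbreviation "R \<equiv> toric_ring M pr"
abbreviation "Y \<equiv> toric_variety M pr \<Sigma>"

lemma pr_one: "u \<in> \<Union>\<Sigma> \<union> K \<Longrightarrow> pr \<one>\<^bsub>M\<^esub> u = 0"
  using pr_mult[of "\<one>\<^bsub>M\<^esub>" "\<one>\<^bsub>M\<^esub>" u] by simp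

lemma pr_inv: "m \<in> carrier M \<Longrightarrow> u \<in> \<Union>\<Sigma> \<union> K \<Longrightarrow> pr (inv\<^bsub>M\<^esub> m) u = - pr m u"
  using pr_mult[of m "inv\<^bsub>M\<^esub> m" u] pr_one[of u] by simp

lemma pr_pow: "m \<in> carrier M \<Longrightarrow> u \<in> \<Union>\<Sigma> \<union> K \<Longrightarrow> pr (m [^]\<^bsub>M\<^esub> (k::nat)) u = k * pr m u"
  by (induction k) (auto simp: pr_one pr_mult algebra_simps)

lemma pr_cone:
  assumes "\<sigma> \<in> \<Sigma>" "u \<in> \<sigma>"
  shows "pr \<one>\<^bsub>M\<^esub> u = 0" "m \<in> carrier M \<Longrightarrow> pr (inv\<^bsub>M\<^esub> m) u = - pr m u"
    "m \<in> carrier M \<Longrightarrow> m' \<in> carrier M \<Longrightarrow> pr (m \<otimes>\<^bsub>M\<^esub> m') u = pr m u + pr m' u"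
    "m \<in> carrier M \<Longrightarrow> pr (m [^]\<^bsub>M\<^esub> (k::nat)) u = k * pr m u"
proof -
  have "u \<in> \<Union>\<Sigma> \<union> K" using assms by auto
  note pr_one[OF this] pr_inv[OF _ this] pr_mult[OF _ _ this] pr_pow[OF _ this]
  then show "pr \<one>\<^bsub>M\<^esub> u = 0" "m \<in> carrier M \<Longrightarrow> pr (inv\<^bsub>M\<^esub> m) u = - pr m u"
    "m \<in> carrier M \<Longrightarrow> m' \<in> carrier M \<Longrightarrow> pr (m \<otimes>\<^bsub>M\<^esub> m') u = pr m u + pr m' u"
    "m \<in> carrier M \<Longrightarrow> pr (m [^]\<^bsub>M\<^esub> (k::nat)) u = k * pr m u" by auto
qed

lemma S_carrier: "m \<in> S \<sigma> \<Longrightarrow> m \<in> carrier M" by (simp add: dual_semigroup_def)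
lemma P_carrier: "m \<in> P \<sigma> \<Longrightarrow> m \<in> carrier M" by (simp add: perp_def)

lemma S_one: "\<sigma> \<in> \<Sigma> \<Longrightarrow> \<one>\<^bsub>M\<^esub> \<in> S \<sigma>"
  by (auto simp: dual_semigroup_def pr_cone)

lemma S_mult: "\<sigma> \<in> \<Sigma> \<Longrightarrow> m \<in> S \<sigma> \<Longrightarrow> m' \<in> S \<sigma> \<Longrightarrow> m \<otimes>\<^bsub>M\<^esub> m' \<in> S \<sigma>"
  by (auto simp: dual_semigroup_def pr_cone)

lemma S_pow: "\<sigma> \<in> \<Sigma> \<Longrightarrow> m \<in> S \<sigma> \<Longrightarrow> m [^]\<^bsub>M\<^esub> (k::nat) \<in> S \<sigma>"
  by (induction k) (auto simp: S_one S_mult)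

lemma P_one: "\<tau> \<in> \<Sigma> \<Longrightarrow> \<one>\<^bsub>M\<^esub> \<in> P \<tau>"
  by (auto simp: perp_def pr_cone)

lemma P_mult: "\<tau> \<in> \<Sigma> \<Longrightarrow> m \<in> P \<tau> \<Longrightarrow> m' \<in> P \<tau> \<Longrightarrow> m \<otimes>\<^bsub>M\<^esub> m' \<in> P \<tau>"
  by (auto simp: perp_def pr_cone)

lemma P_inv: "\<tau> \<in> \<Sigma> \<Longrightarrow> m \<in> P \<tau> \<Longrightarrow> inv\<^bsub>M\<^esub> m \<in> P \<tau>"
  by (auto simp: perp_def pr_cone)

lemma P_sub_S: "P \<tau> \<subseteq> S \<tau>"
  by (auto simp: perp_def dual_semigroup_def)

lemma S_anti: "\<tau> \<subseteq> \<sigma> \<Longrightarrow> S \<sigma> \<subseteq> S \<tau>"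
  by (auto simp: dual_semigroup_def)

lemma face_in_fan:
  assumes "\<sigma> \<in> \<Sigma>" "\<tau> \<in> \<Sigma>" "\<tau> \<subseteq> \<sigma>"
  obtains m where "m \<in> S \<sigma>" "\<tau> = {u\<in>\<sigma>. pr m u = 0}"
  using inter_face[OF assms(1,2)] assms(3) by (metis Int_absorb1)

lemma inter_in_fan: "\<sigma> \<in> \<Sigma> \<Longrightarrow> \<tau> \<in> \<Sigma> \<Longrightarrow> \<sigma> \<inter> \<tau> \<in> \<Sigma>"
  using inter_face[of \<sigma> \<tau>] face_closed[of \<sigma>] by metis

lemma Inter_in_fan:
  assumes "F \<subseteq> \<Sigma>" "F \<noteq> {}"
  shows "\<Inter>F \<in> \<Sigma>"
proof -
  have "finite F" using finite_fan assms(1) finite_subset by metis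
  then show ?thesis using assms(2,1)
    by (induction F rule: finite_ne_induct) (auto intro: inter_in_fan)
qed

text \<open>Off the face \<tau> the character \<open>m\<close> is at least 1 on the integral
  generators of \<sigma>, so a large power of it outweighs the negative values of \<open>m'\<close>.
  Geometrically, functions on the chart of a face become regular on the chart of \<sigma> after
  multiplication by a power of the character that cuts out the face.\<close>

lemma localize:
  assumes \<sigma>: "\<sigma> \<in> \<Sigma>" and m: "m \<in> S \<sigma>" and \<tau>: "\<tau> = {u\<in>\<sigma>. pr m u = 0}" and m': "m' \<in> S \<tau>"
  shows "\<exists>k0::nat. \<forall>k\<ge>k0. m' \<otimes>\<^bsub>M\<^esub> m [^]\<^bsub>M\<^esub> k \<in> S \<sigma>"
proof -
  from gens[OF \<sigma>] obtain \<Gamma> where \<Gamma>: "finite \<Gamma>" "\<Gamma> \<subseteq> \<sigma>" "\<And>u m. u \<in> \<Gamma> \<Longrightarrow> m \<in> carrier M \<Longrightarrow> pr m u \<in> \<int>"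
    "\<And>m u. m \<in> carrier M \<Longrightarrow> (\<forall>u\<in>\<Gamma>. 0 \<le> pr m u) \<Longrightarrow> u \<in> \<sigma> \<Longrightarrow> 0 \<le> pr m u" by metis
  have c: "m \<in> carrier M" "m' \<in> carrier M" using m m' S_carrier by auto
  define k0 where "k0 = (\<Sum>u\<in>\<Gamma>. nat \<lceil>\<bar>pr m' u\<bar>\<rceil>)"
  show ?thesis
  proof (intro exI[of _ k0] allI impI)
    fix k :: nat assume k: "k \<ge> k0"
    have "0 \<le> pr (m' \<otimes>\<^bsub>M\<^esub> m [^]\<^bsub>M\<^esub> k) u" if u: "u \<in> \<Gamma>" for u
    proof -
      have uS: "u \<in> \<Union>\<Sigma> \<union> K" and us: "u \<in> \<sigma>" using u \<Gamma>(2) \<sigma> by auto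
      have eq: "pr (m' \<otimes>\<^bsub>M\<^esub> m [^]\<^bsub>M\<^esub> k) u = pr m' u + k * pr m u"
        using c uS by (simp add: pr_mult pr_pow)
      show ?thesis
      proof (cases "pr m u = 0")
        case True
        then have "u \<in> \<tau>" using us \<tau> by simp
        then show ?thesis using m' eq True by (simp add: dual_semigroup_def)
      next
        case False
        moreover have "pr m u \<ge> 0" using m us by (simp add: dual_semigroup_def)
        moreover have "pr m u \<in> \<int>" using \<Gamma>(3)[OF u c(1)] .
        ultimately have "pr m u \<ge> 1" by (auto elim!: Ints_cases)
        moreover have "nat \<lceil>\<bar>pr m' u\<bar>\<rceil> \<le> k0"
          unfolding k0_def by (rule member_le_sum[OF u]) (use \<Gamma> in auto)
        ultimately have "real (nat \<lceil>\<bar>pr m' u\<bar>\<rceil>) * 1 \<le> k * pr m u"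
          using k by (intro mult_mono of_nat_mono) linarith+
        then show ?thesis using eq by linarith
      qed
    qed
    then have "\<forall>u\<in>\<sigma>. 0 \<le> pr (m' \<otimes>\<^bsub>M\<^esub> m [^]\<^bsub>M\<^esub> k) u" using \<Gamma>(4) c by simp
    then show "m' \<otimes>\<^bsub>M\<^esub> m [^]\<^bsub>M\<^esub> k \<in> S \<sigma>" using c by (simp add: dual_semigroup_def)
  qed
qed

lemma chart_fst:
  assumes "x \<in> U \<sigma>"
  shows "fst x \<in> \<Sigma>" "fst x \<subseteq> \<sigma>"
  using assms by (auto simp: toric_chart_def toric_points_def)

lemma points_snd:
  assumes "x \<in> toric_points M pr \<Sigma>"
  shows "fst x \<in> \<Sigma>"
    "m \<in> P (fst x) \<Longrightarrow> snd x m \<noteq> 0"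
    "m \<in> P (fst x) \<Longrightarrow> m' \<in> P (fst x) \<Longrightarrow> snd x (m \<otimes>\<^bsub>M\<^esub> m') = snd x m * snd x m'"
    "snd x \<in> extensional (P (fst x))"
  using assms by (auto simp: toric_points_def hom_def Cstar_def)

lemma points_one:
  assumes "x \<in> toric_points M pr \<Sigma>"
  shows "snd x \<one>\<^bsub>M\<^esub> = 1"
proof -
  have one: "\<one>\<^bsub>M\<^esub> \<in> P (fst x)" using P_one points_snd(1)[OF assms] .
  with points_snd(2,3)[OF assms one] have "snd x \<one>\<^bsub>M\<^esub> * snd x \<one>\<^bsub>M\<^esub> = snd x \<one>\<^bsub>M\<^esub>" "snd x \<one>\<^bsub>M\<^esub> \<noteq> 0"
    by (metis l_one one_closed, simp)
  then show ?thesis by simp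
qed

lemma chart_points: "x \<in> U \<sigma> \<Longrightarrow> x \<in> toric_points M pr \<Sigma>"
  by (simp add: toric_chart_def)

lemma ch_nonzero:
  assumes "x \<in> toric_points M pr \<Sigma>"
  shows "ch m x \<noteq> 0 \<longleftrightarrow> m \<in> P (fst x)"
  using points_snd(2)[OF assms] by (auto simp: toric_char_def)

lemma ch_one: "x \<in> toric_points M pr \<Sigma> \<Longrightarrow> ch \<one>\<^bsub>M\<^esub> x = 1"
  using points_one[of x] P_one[OF points_snd(1)] by (simp add: toric_char_def)

lemma ch_mult:
  assumes x: "x \<in> U \<sigma>" and m: "m \<in> S \<sigma>" and m': "m' \<in> S \<sigma>"
  shows "ch (m \<otimes>\<^bsub>M\<^esub> m') x = ch m x * ch m' x"
proof (cases "m \<in> P (fst x) \<and> m' \<in> P (fst x)")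
  case True
  then show ?thesis
    using points_snd(3)[OF chart_points[OF x]] P_mult[OF chart_fst(1)[OF x]] by (simp add: toric_char_def)
next
  case False
  have "m \<otimes>\<^bsub>M\<^esub> m' \<notin> P (fst x)"
  proof
    assume a: "m \<otimes>\<^bsub>M\<^esub> m' \<in> P (fst x)"
    have "pr m u = 0 \<and> pr m' u = 0" if u: "u \<in> fst x" for u
    proof -
      have "u \<in> \<sigma>" "u \<in> \<Union>\<Sigma>" using chart_fst[OF x] u by auto
      then have "pr m u \<ge> 0" "pr m' u \<ge> 0" "pr (m \<otimes>\<^bsub>M\<^esub> m') u = pr m u + pr m' u"
        using m m' by (auto simp: dual_semigroup_def pr_mult)
      moreover have "pr (m \<otimes>\<^bsub>M\<^esub> m') u = 0" using a u by (simp add: perp_def)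
      ultimately show ?thesis by simp
    qed
    then show False using False m m' by (auto simp: perp_def dual_semigroup_def)
  qed
  then show ?thesis using False by (auto simp: toric_char_def)
qed

lemma ch_pow: "\<sigma> \<in> \<Sigma> \<Longrightarrow> x \<in> U \<sigma> \<Longrightarrow> m \<in> S \<sigma> \<Longrightarrow> ch (m [^]\<^bsub>M\<^esub> (k::nat)) x = ch m x ^ k"
  by (induction k) (auto simp: ch_one chart_points ch_mult S_pow)

lemma U_face:
  assumes \<sigma>: "\<sigma> \<in> \<Sigma>" and m: "m \<in> S \<sigma>" and \<tau>: "\<tau> = {u\<in>\<sigma>. pr m u = 0}" and x: "x \<in> U \<sigma>"
  shows "ch m x \<noteq> 0 \<longleftrightarrow> x \<in> U \<tau>"
  using ch_nonzero[OF chart_points[OF x]] x m chart_fst[OF x] unfolding \<tau>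
  by (auto simp: perp_def dual_semigroup_def toric_chart_def)



lemma U_inter: "U \<sigma> \<inter> U \<tau> = U (\<sigma> \<inter> \<tau>)"
  by (auto simp: toric_chart_def)

lemma ch_snd:
  assumes "x \<in> toric_points M pr \<Sigma>" "m \<in> P (fst x)"
  shows "ch m x = snd x m"
  using assms by (simp add: toric_char_def)

text \<open>The orbit is recovered first: the character cutting out the cone of \<open>w\<close> is
  nonzero at \<open>w\<close>, hence at \<open>z\<close>, which bounds the cone of \<open>z\<close>.
  A character of \<open>P (fst x)\<close> outside \<open>S \<sigma>\<close> is then moved into
  \<open>S \<sigma>\<close> by a power of the character that cuts out \<open>fst x\<close>.\<close>

lemma point_eqI:
  assumes \<sigma>: "\<sigma> \<in> \<Sigma>" and x: "x \<in> U \<sigma>" and y: "y \<in> U \<sigma>" and eq: "\<And>m. m \<in> S \<sigma> \<Longrightarrow> ch m x = ch m y"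
  shows "x = y"
proof -
  have sub: "fst z \<subseteq> fst w" if z: "z \<in> U \<sigma>" and w: "w \<in> U \<sigma>" and e: "\<And>m. m \<in> S \<sigma> \<Longrightarrow> ch m w = ch m z" for z w
  proof -
    obtain m where m: "m \<in> S \<sigma>" "fst w = {u\<in>\<sigma>. pr m u = 0}"
      by (rule face_in_fan[OF \<sigma> chart_fst[OF w]])
    then have "m \<in> P (fst w)" by (auto simp: perp_def dual_semigroup_def)
    then have "m \<in> P (fst z)" using e[OF m(1)] ch_nonzero[OF chart_points[OF z]] ch_nonzero[OF chart_points[OF w]] by metis
    then show ?thesis using m chart_fst[OF z] by (auto simp: perp_def)
  qed
  have f: "fst x = fst y" using sub[OF x y] sub[OF y x] eq by auto
  obtain m where m: "m \<in> S \<sigma>" "fst x = {u\<in>\<sigma>. pr m u = 0}"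
    by (rule face_in_fan[OF \<sigma> chart_fst[OF x]])
  then have mP: "m \<in> P (fst x)" by (auto simp: perp_def dual_semigroup_def)
  have "snd x m' = snd y m'" if m': "m' \<in> P (fst x)" for m'
  proof -
    from m' have "m' \<in> S (fst x)" using P_sub_S by auto
    then obtain k0 :: nat where k: "\<forall>k\<ge>k0. m' \<otimes>\<^bsub>M\<^esub> m [^]\<^bsub>M\<^esub> k \<in> S \<sigma>" using localize[OF \<sigma> m] by auto
    have pk: "m [^]\<^bsub>M\<^esub> k0 \<in> P (fst x)" "m [^]\<^bsub>M\<^esub> k0 \<in> S \<sigma>"
      using mP m(1) S_pow[OF \<sigma> m(1)] chart_fst(1)[OF x] by (auto simp: perp_def pr_cone)
    have "snd x (m' \<otimes>\<^bsub>M\<^esub> m [^]\<^bsub>M\<^esub> k0) = snd y (m' \<otimes>\<^bsub>M\<^esub> m [^]\<^bsub>M\<^esub> k0)"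
      using eq[OF k[rule_format, OF order_refl]] ch_snd[OF chart_points[OF x]] ch_snd[OF chart_points[OF y]]
        P_mult[OF chart_fst(1)[OF x] m' pk(1)] f by metis
    moreover have "snd x (m [^]\<^bsub>M\<^esub> k0) = snd y (m [^]\<^bsub>M\<^esub> k0)"
      using eq[OF pk(2)] ch_snd[OF chart_points[OF x]] ch_snd[OF chart_points[OF y]] pk(1) f by metis
    moreover have "snd x (m' \<otimes>\<^bsub>M\<^esub> m [^]\<^bsub>M\<^esub> k0) = snd x m' * snd x (m [^]\<^bsub>M\<^esub> k0)"
      by (rule points_snd(3)[OF chart_points[OF x] m' pk(1)])
    moreover have "snd y (m' \<otimes>\<^bsub>M\<^esub> m [^]\<^bsub>M\<^esub> k0) = snd y m' * snd y (m [^]\<^bsub>M\<^esub> k0)"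
      by (rule points_snd(3)[OF chart_points[OF y]]) (use m' pk f in auto)
    moreover have "snd y (m [^]\<^bsub>M\<^esub> k0) \<noteq> 0"
      by (rule points_snd(2)[OF chart_points[OF y]]) (use pk f in auto)
    ultimately show ?thesis by simp
  qed
  then have "snd x = snd y"
    using points_snd(4)[OF chart_points[OF x]] points_snd(4)[OF chart_points[OF y]] f
    by (intro extensionalityI[of _ "P (fst x)"]) auto
  with f show ?thesis by (simp add: prod_eq_iff)
qed

text \<open>Semigroup homomorphisms are points of the chart: the characters on which such a homomorphism
  does not vanish are those orthogonal to a face.\<close>

lemma point_exists:
  assumes \<sigma>: "\<sigma> \<in> \<Sigma>" and one: "\<phi> \<one>\<^bsub>M\<^esub> = (1::complex)"
    and mult: "\<And>m m'. m \<in> S \<sigma> \<Longrightarrow> m' \<in> S \<sigma> \<Longrightarrow> \<phi> (m \<otimes>\<^bsub>M\<^esub> m') = \<phi> m * \<phi> m'"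
  shows "\<exists>x\<in>U \<sigma>. \<forall>m\<in>S \<sigma>. ch m x = \<phi> m"
proof -
  from gens[OF \<sigma>] obtain \<Gamma> where \<Gamma>: "finite \<Gamma>" "\<Gamma> \<subseteq> \<sigma>" "\<And>u m. u \<in> \<Gamma> \<Longrightarrow> m \<in> carrier M \<Longrightarrow> pr m u \<in> \<int>"
    "\<And>m u. m \<in> carrier M \<Longrightarrow> (\<forall>u\<in>\<Gamma>. 0 \<le> pr m u) \<Longrightarrow> u \<in> \<sigma> \<Longrightarrow> 0 \<le> pr m u" by metis
  define supp where "supp m = {u\<in>\<Gamma>. pr m u > 0}" for m
  have supp_fin: "finite (supp m)" for m using \<Gamma>(1) by (simp add: supp_def)
  define F where "F = {m \<in> S \<sigma>. \<phi> m \<noteq> 0}"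
  have "\<one>\<^bsub>M\<^esub> \<in> F" using one S_one[OF \<sigma>] by (simp add: F_def)
  moreover have "\<forall>m. m \<in> F \<longrightarrow> card (supp m) < Suc (card \<Gamma>)"
    by (auto simp: supp_def less_Suc_eq_le intro!: card_mono \<Gamma>(1))
  \<comment> \<open>A character with \<open>\<phi> mF \<noteq> 0\<close> that is positive on as many
    generators as possible. Products with the other members of \<open>F\<close> show that its
    support contains all of theirs, so its zeros cut out the face to which \<open>\<phi>\<close>
    belongs.\<close>
  ultimately obtain mF where mF: "mF \<in> F" and max: "\<And>m. m \<in> F \<Longrightarrow> card (supp m) \<le> card (supp mF)"
    using ex_has_greatest_nat[of "\<lambda>m. m \<in> F" "\<one>\<^bsub>M\<^esub>" "\<lambda>m. card (supp m)" "Suc (card \<Gamma>)"] by auto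
  have mFS: "mF \<in> S \<sigma>" and mFc: "mF \<in> carrier M" and mF0: "\<phi> mF \<noteq> 0"
    using mF S_carrier by (auto simp: F_def)
  define \<tau> where "\<tau> = {u\<in>\<sigma>. pr mF u = 0}"
  have \<tau>: "\<tau> \<in> \<Sigma>" unfolding \<tau>_def by (rule face_closed[OF \<sigma> mFS])
  have pow: "\<phi> (m [^]\<^bsub>M\<^esub> (k::nat)) = \<phi> m ^ k" if "m \<in> S \<sigma>" for m k
    using that by (induction k) (auto simp: one mult S_pow[OF \<sigma>])
  have FP: "m \<in> P \<tau>" if m: "m \<in> F" for m
  proof -
    have mS: "m \<in> S \<sigma>" and mc: "m \<in> carrier M" using m S_carrier by (auto simp: F_def)
    have "m \<otimes>\<^bsub>M\<^esub> mF \<in> F" using m mF mult S_mult[OF \<sigma>] by (auto simp: F_def)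
    moreover have "supp (m \<otimes>\<^bsub>M\<^esub> mF) = supp m \<union> supp mF"
    proof -
      have "0 < pr (m \<otimes>\<^bsub>M\<^esub> mF) u \<longleftrightarrow> 0 < pr m u \<or> 0 < pr mF u" if "u \<in> \<Gamma>" for u
      proof -
        have "u \<in> \<sigma>" using that \<Gamma>(2) by auto
        then have "0 \<le> pr m u" "0 \<le> pr mF u" "pr (m \<otimes>\<^bsub>M\<^esub> mF) u = pr m u + pr mF u"
          using mS mFS mc mFc pr_cone(3)[OF \<sigma>] by (auto simp: dual_semigroup_def)
        then show ?thesis by linarith
      qed
      then show ?thesis unfolding supp_def by auto
    qed
    ultimately have "supp m \<subseteq> supp mF"
      using max supp_fin by (metis Un_upper1 Un_upper2 card_seteq finite_Un)
    then have zero: "pr m u = 0" if "u \<in> \<Gamma>" "pr mF u = 0" for u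
    proof -
      have "u \<in> \<sigma>" "u \<notin> supp m" using that \<Gamma>(2) \<open>supp m \<subseteq> supp mF\<close> by (auto simp: supp_def)
      with that mS show ?thesis by (force simp: supp_def dual_semigroup_def)
    qed
    \<comment> \<open>\<open>k\<close> times \<open>mF\<close> is at least \<open>m\<close> on all
      generators, so the difference lies in the dual semigroup. On \<tau> this difference is minus
      \<open>m\<close>, which forces \<open>m\<close> to vanish there.\<close>
    define k where "k = (\<Sum>u\<in>\<Gamma>. nat \<lceil>\<bar>pr m u\<bar>\<rceil>)"
    let ?n = "inv\<^bsub>M\<^esub> m \<otimes>\<^bsub>M\<^esub> mF [^]\<^bsub>M\<^esub> k"
    have pn: "pr ?n u = k * pr mF u - pr m u" if "u \<in> \<sigma>" for u
      using that \<sigma> mc mFc by (simp add: pr_cone[OF \<sigma>])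
    have "0 \<le> pr ?n u" if u: "u \<in> \<Gamma>" for u
    proof (cases "pr mF u = 0")
      case True
      then show ?thesis using pn[of u] zero u \<Gamma>(2) by auto
    next
      case False
      moreover have "pr mF u \<ge> 0" using mFS u \<Gamma>(2) by (auto simp: dual_semigroup_def)
      moreover have "pr mF u \<in> \<int>" using \<Gamma>(3)[OF u mFc] .
      ultimately have "pr mF u \<ge> 1" by (auto elim!: Ints_cases)
      moreover have "nat \<lceil>\<bar>pr m u\<bar>\<rceil> \<le> k"
        unfolding k_def by (rule member_le_sum[OF u]) (use \<Gamma> in auto)
      ultimately have "real (nat \<lceil>\<bar>pr m u\<bar>\<rceil>) * 1 \<le> k * pr mF u"
        by (intro mult_mono of_nat_mono) linarith+
      moreover have "pr ?n u = k * pr mF u - pr m u" using pn u \<Gamma>(2) by auto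
      ultimately show ?thesis by linarith
    qed
    then have n: "0 \<le> pr ?n u" if "u \<in> \<sigma>" for u using \<Gamma>(4)[of ?n u] that mc mFc by auto
    have "pr m u = 0" if u: "u \<in> \<tau>" for u
      using n[of u] pn[of u] u mS by (auto simp: \<tau>_def dual_semigroup_def)
    then show ?thesis using mc by (simp add: perp_def)
  qed
  have loc: "\<exists>k0::nat. \<forall>k\<ge>k0. m \<otimes>\<^bsub>M\<^esub> mF [^]\<^bsub>M\<^esub> k \<in> S \<sigma>" if "m \<in> P \<tau>" for m
    using localize[OF \<sigma> mFS \<tau>_def, of m] P_sub_S that by auto
  have PF: "m \<in> F" if m: "m \<in> P \<tau>" "m \<in> S \<sigma>" for m
  proof -
    obtain k :: nat where k: "inv\<^bsub>M\<^esub> m \<otimes>\<^bsub>M\<^esub> mF [^]\<^bsub>M\<^esub> k \<in> S \<sigma>"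
      using loc[OF P_inv[OF \<tau> m(1)]] by auto
    have "m \<otimes>\<^bsub>M\<^esub> (inv\<^bsub>M\<^esub> m \<otimes>\<^bsub>M\<^esub> mF [^]\<^bsub>M\<^esub> k) = mF [^]\<^bsub>M\<^esub> k"
      using P_carrier[OF m(1)] mFc by (simp add: m_assoc[symmetric])
    then have "\<phi> m * \<phi> (inv\<^bsub>M\<^esub> m \<otimes>\<^bsub>M\<^esub> mF [^]\<^bsub>M\<^esub> k) = \<phi> mF ^ k"
      using mult[OF m(2) k] pow[OF mFS] by simp
    then show ?thesis using mF0 m by (auto simp: F_def)
  qed
  \<comment> \<open>\<open>\<gamma>\<close> extends \<open>\<phi>\<close> to characters outside
    \<open>S \<sigma>\<close> by clearing denominators with powers of \<open>mF\<close>; the fact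
    \<open>\<gamma>\<close> below says that the exponent does not matter.\<close>
  define kk where "kk m = (SOME k::nat. m \<otimes>\<^bsub>M\<^esub> mF [^]\<^bsub>M\<^esub> k \<in> S \<sigma>)" for m
  define \<gamma> where "\<gamma> = (\<lambda>m\<in>P \<tau>. \<phi> (m \<otimes>\<^bsub>M\<^esub> mF [^]\<^bsub>M\<^esub> kk m) / \<phi> mF ^ kk m)"
  have kk: "m \<otimes>\<^bsub>M\<^esub> mF [^]\<^bsub>M\<^esub> kk m \<in> S \<sigma>" if "m \<in> P \<tau>" for m
    unfolding kk_def by (rule someI_ex) (use loc[OF that] in auto)
  have \<gamma>: "\<gamma> m = \<phi> (m \<otimes>\<^bsub>M\<^esub> mF [^]\<^bsub>M\<^esub> k) / \<phi> mF ^ k" if m: "m \<in> P \<tau>" and k: "m \<otimes>\<^bsub>M\<^esub> mF [^]\<^bsub>M\<^esub> k \<in> S \<sigma>" for m k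
  proof -
    have c: "m \<in> carrier M" using P_carrier[OF m] .
    have "(m \<otimes>\<^bsub>M\<^esub> mF [^]\<^bsub>M\<^esub> kk m) \<otimes>\<^bsub>M\<^esub> mF [^]\<^bsub>M\<^esub> k = (m \<otimes>\<^bsub>M\<^esub> mF [^]\<^bsub>M\<^esub> k) \<otimes>\<^bsub>M\<^esub> mF [^]\<^bsub>M\<^esub> kk m"
      using c mFc by (simp add: m_ac nat_pow_mult add.commute)
    then have "\<phi> (m \<otimes>\<^bsub>M\<^esub> mF [^]\<^bsub>M\<^esub> kk m) * \<phi> mF ^ k = \<phi> (m \<otimes>\<^bsub>M\<^esub> mF [^]\<^bsub>M\<^esub> k) * \<phi> mF ^ kk m"
      using mult[OF kk[OF m] S_pow[OF \<sigma> mFS]] mult[OF k S_pow[OF \<sigma> mFS]] pow[OF mFS] by metis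
    then show ?thesis using m mF0 unfolding \<gamma>_def by (simp add: field_simps)
  qed
  have \<gamma>S: "\<gamma> m = \<phi> m" if "m \<in> P \<tau>" "m \<in> S \<sigma>" for m
    using \<gamma>[of m 0] that S_carrier by simp
  have \<gamma>_mult: "\<gamma> (m \<otimes>\<^bsub>M\<^esub> m') = \<gamma> m * \<gamma> m'" if m: "m \<in> P \<tau>" and m': "m' \<in> P \<tau>" for m m'
  proof -
    have c: "m \<in> carrier M" "m' \<in> carrier M" using P_carrier m m' by auto
    have eq: "(m \<otimes>\<^bsub>M\<^esub> mF [^]\<^bsub>M\<^esub> kk m) \<otimes>\<^bsub>M\<^esub> (m' \<otimes>\<^bsub>M\<^esub> mF [^]\<^bsub>M\<^esub> kk m') = (m \<otimes>\<^bsub>M\<^esub> m') \<otimes>\<^bsub>M\<^esub> mF [^]\<^bsub>M\<^esub> (kk m + kk m')"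
      using c mFc by (simp add: m_ac nat_pow_mult[symmetric])
    have "(m \<otimes>\<^bsub>M\<^esub> m') \<otimes>\<^bsub>M\<^esub> mF [^]\<^bsub>M\<^esub> (kk m + kk m') \<in> S \<sigma>"
      using S_mult[OF \<sigma> kk[OF m] kk[OF m']] eq by simp
    from \<gamma>[OF P_mult[OF \<tau> m m'] this] show ?thesis
      unfolding eq[symmetric] mult[OF kk[OF m] kk[OF m']] using m m' by (simp add: \<gamma>_def power_add)
  qed
  have \<gamma>1: "\<gamma> \<one>\<^bsub>M\<^esub> = 1" using \<gamma>S[OF P_one[OF \<tau>] S_one[OF \<sigma>]] one by simp
  have \<gamma>0: "\<gamma> m \<noteq> 0" if m: "m \<in> P \<tau>" for m
    using \<gamma>_mult[OF m P_inv[OF \<tau> m]] \<gamma>1 P_carrier[OF m] by auto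
  define x where "x = (\<tau>, \<gamma>)"
  have x: "x \<in> U \<sigma>"
    using \<tau> \<gamma>_mult \<gamma>0 unfolding x_def toric_chart_def toric_points_def
    by (auto simp: \<tau>_def hom_def Cstar_def \<gamma>_def)
  moreover have "ch m x = \<phi> m" if m: "m \<in> S \<sigma>" for m
    using \<gamma>S[of m] m FP[of m] by (cases "m \<in> P \<tau>") (auto simp: toric_char_def x_def F_def)
  ultimately show ?thesis by auto
qed

end

section \<open>Generators of the dual semigroups, the rings of the charts, and passage between
  charts\<close>

context toric_setting
begin

text \<open>A word is a monomial in the generators. With words in place of exponent vectors, the
  relations of the semigroup are equalities between two words of equal product.\<close>

fun word :: "'m list \<Rightarrow> 'm" where
  "word [] = \<one>\<^bsub>M\<^esub>"
| "word (m # ms) = m \<otimes>\<^bsub>M\<^esub> word ms"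

lemma word_S: "\<sigma> \<in> \<Sigma> \<Longrightarrow> set l \<subseteq> S \<sigma> \<Longrightarrow> word l \<in> S \<sigma>"
  by (induction l) (auto simp: S_one S_mult)

lemma word_append: "set l \<subseteq> carrier M \<Longrightarrow> set l' \<subseteq> carrier M \<Longrightarrow> word (l @ l') = word l \<otimes>\<^bsub>M\<^esub> word l'"
proof (induction l)
  case Nil
  have "set l' \<subseteq> carrier M \<Longrightarrow> word l' \<in> carrier M" by (induction l') auto
  with Nil show ?case by simp
next
  case (Cons a l)
  have "set l' \<subseteq> carrier M \<Longrightarrow> word l' \<in> carrier M" for l' by (induction l') auto
  with Cons show ?case by (simp add: m_assoc)
qed

text \<open>Gordan's lemma: after fixing the signs of the coordinates given by \<open>K\<close>, the minimal elements
  supplied by Dickson's lemma generate.\<close>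

lemma Gordan:
  assumes \<sigma>: "\<sigma> \<in> \<Sigma>"
  obtains bs where "set bs \<subseteq> S \<sigma>" "\<And>m. m \<in> S \<sigma> \<Longrightarrow> \<exists>l. set l \<subseteq> set bs \<and> word l = m"
proof -
  from gens[OF \<sigma>] obtain \<Gamma> where \<Gamma>: "finite \<Gamma>" "\<Gamma> \<subseteq> \<sigma>" "\<And>u m. u \<in> \<Gamma> \<Longrightarrow> m \<in> carrier M \<Longrightarrow> pr m u \<in> \<int>"
    "\<And>m u. m \<in> carrier M \<Longrightarrow> (\<forall>u\<in>\<Gamma>. 0 \<le> pr m u) \<Longrightarrow> u \<in> \<sigma> \<Longrightarrow> 0 \<le> pr m u" by metis
  \<comment> \<open>An orthant of signs on \<open>K\<close>. Inside one orthant, subtracting an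
    element with coordinates smaller in absolute value cannot change a sign, so the difference stays
    in the orthant.\<close>
  define Se where "Se e = {m \<in> S \<sigma>. m \<noteq> \<one>\<^bsub>M\<^esub> \<and> (\<forall>u\<in>K. if u \<in> e then pr m u \<le> 0 else pr m u \<ge> 0)}" for e
  \<comment> \<open>Dominance at \<open>Inl\<close> keeps the difference in the dual semigroup;
    dominance at \<open>Inr\<close> makes the coordinates at \<open>K\<close> shrink, which drives
    the induction.\<close>
  define f :: "'m \<Rightarrow> 'u + 'u \<Rightarrow> nat" where
    "f m i = (case i of Inl u \<Rightarrow> nat \<lfloor>pr m u\<rfloor> | Inr u \<Rightarrow> nat \<lfloor>\<bar>pr m u\<bar>\<rfloor>)" for m i
  have "finite (Inl ` \<Gamma> \<union> Inr ` K)" using \<Gamma>(1) finite_K by simp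
  then have "\<forall>e. \<exists>B\<subseteq>Se e. finite B \<and> (\<forall>m\<in>Se e. \<exists>b\<in>B. \<forall>i\<in>Inl ` \<Gamma> \<union> Inr ` K. f b i \<le> f m i)"
    by (intro allI Dickson)
  then obtain B where B': "\<forall>e. B e \<subseteq> Se e \<and> finite (B e) \<and> (\<forall>m\<in>Se e. \<exists>b\<in>B e. \<forall>i\<in>Inl ` \<Gamma> \<union> Inr ` K. f b i \<le> f m i)"
    by (rule choice[THEN exE])
  have B: "B e \<subseteq> Se e" "finite (B e)" for e using B' by auto
  have "finite (\<Union>e\<in>Pow K. B e)" using finite_K B(2) by simp
  from finite_list[OF this] obtain bs where bs: "set bs = (\<Union>e\<in>Pow K. B e)" by (rule exE)
  have gen: "\<exists>l. set l \<subseteq> B e \<and> word l = m" if "m \<in> insert \<one>\<^bsub>M\<^esub> (Se e)" for m e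
    using that
  proof (induction "\<Sum>u\<in>K. nat \<lfloor>\<bar>pr m u\<bar>\<rfloor>" arbitrary: m rule: less_induct)
    case less
    show ?case
    proof (cases "m = \<one>\<^bsub>M\<^esub>")
      case True
      then show ?thesis by (intro exI[of _ "[]"]) simp
    next
      case False
      with less.prems have m: "m \<in> Se e" by simp
      then obtain b where b: "b \<in> B e" and le: "\<forall>i\<in>Inl ` \<Gamma> \<union> Inr ` K. f b i \<le> f m i"
        using B' by meson
      have bS: "b \<in> Se e" using b B by auto
      have c: "m \<in> carrier M" "b \<in> carrier M" using m bS S_carrier by (auto simp: Se_def)
      define d where "d = m \<otimes>\<^bsub>M\<^esub> inv\<^bsub>M\<^esub> b"
      have dc: "d \<in> carrier M" using c by (simp add: d_def)
      have m_eq: "m = b \<otimes>\<^bsub>M\<^esub> d" using c by (simp add: d_def m_lcomm[of b m])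
      have prK: "pr d u = pr m u - pr b u" if "u \<in> K" for u
        using that c by (simp add: d_def pr_mult pr_inv)
      have pr\<sigma>: "pr d u = pr m u - pr b u" if "u \<in> \<sigma>" for u
        using that c by (simp add: d_def pr_cone[OF \<sigma>])
      have K1: "\<bar>pr b u\<bar> \<le> \<bar>pr m u\<bar>" if u: "u \<in> K" for u
      proof -
        have "nat \<lfloor>\<bar>pr b u\<bar>\<rfloor> \<le> nat \<lfloor>\<bar>pr m u\<bar>\<rfloor>" using bspec[OF le, of "Inr u"] u by (simp add: f_def)
        moreover have "\<bar>pr b u\<bar> \<in> \<int>" "\<bar>pr m u\<bar> \<in> \<int>" using K_int u c by auto
        ultimately show ?thesis by (auto elim!: Ints_cases simp: nat_le_eq_zle)
      qed
      have K2: "\<bar>pr d u\<bar> = \<bar>pr m u\<bar> - \<bar>pr b u\<bar> \<and> (if u \<in> e then pr d u \<le> 0 else pr d u \<ge> 0)" if u: "u \<in> K" for u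
        using K1[OF u] prK[OF u] m bS u by (auto simp: Se_def split: if_splits)
      have "0 \<le> pr d u" if u: "u \<in> \<Gamma>" for u
      proof -
        have "u \<in> \<sigma>" using u \<Gamma>(2) by auto
        then have "0 \<le> pr b u" "0 \<le> pr m u" using bS m by (auto simp: Se_def dual_semigroup_def)
        moreover have "nat \<lfloor>pr b u\<rfloor> \<le> nat \<lfloor>pr m u\<rfloor>" using bspec[OF le, of "Inl u"] u by (simp add: f_def)
        moreover have "pr b u \<in> \<int>" "pr m u \<in> \<int>" using \<Gamma>(3) u c by auto
        ultimately show ?thesis using pr\<sigma>[OF \<open>u \<in> \<sigma>\<close>] by (auto elim!: Ints_cases)
      qed
      then have "d \<in> S \<sigma>" using \<Gamma>(4) dc by (simp add: dual_semigroup_def)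
      then have dSe: "d \<in> insert \<one>\<^bsub>M\<^esub> (Se e)" using K2 by (auto simp: Se_def)
      have "b \<noteq> \<one>\<^bsub>M\<^esub>" using bS by (simp add: Se_def)
      then obtain u0 where u0: "u0 \<in> K" "pr b u0 \<noteq> 0" using K_sep[OF c(2)] by auto
      have nat_diff: "nat \<lfloor>\<bar>pr d u\<bar>\<rfloor> + nat \<lfloor>\<bar>pr b u\<bar>\<rfloor> = nat \<lfloor>\<bar>pr m u\<bar>\<rfloor>" if u: "u \<in> K" for u
      proof -
        have "\<bar>pr b u\<bar> \<in> \<int>" "\<bar>pr m u\<bar> \<in> \<int>" using K_int u c by auto
        then obtain x y where xy: "\<bar>pr b u\<bar> = of_int x" "\<bar>pr m u\<bar> = of_int y" by (auto elim!: Ints_cases)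
        then have "\<bar>pr d u\<bar> = of_int (y - x)" "0 \<le> x" "x \<le> y" using K1[OF u] K2[OF u] by auto
        with xy show ?thesis by simp
      qed
      have "(\<Sum>u\<in>K. nat \<lfloor>\<bar>pr d u\<bar>\<rfloor>) < (\<Sum>u\<in>K. nat \<lfloor>\<bar>pr m u\<bar>\<rfloor>)"
      proof (rule sum_strict_mono_ex1[OF finite_K])
        show "\<forall>u\<in>K. nat \<lfloor>\<bar>pr d u\<bar>\<rfloor> \<le> nat \<lfloor>\<bar>pr m u\<bar>\<rfloor>" using nat_diff by (metis le_add1)
        have "\<bar>pr b u0\<bar> \<in> \<int>" using K_int u0 c by auto
        then have "nat \<lfloor>\<bar>pr b u0\<bar>\<rfloor> > 0" using u0(2) by (auto elim!: Ints_cases)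
        then have "nat \<lfloor>\<bar>pr d u0\<bar>\<rfloor> < nat \<lfloor>\<bar>pr m u0\<bar>\<rfloor>" using nat_diff[OF u0(1)] by linarith
        then show "\<exists>u\<in>K. nat \<lfloor>\<bar>pr d u\<bar>\<rfloor> < nat \<lfloor>\<bar>pr m u\<bar>\<rfloor>"
          using u0(1) by (intro bexI[of _ u0])
      qed
      from less.hyps[OF this dSe] obtain l where "set l \<subseteq> B e" "word l = d" by auto
      then show ?thesis using b m_eq by (intro exI[of _ "b # l"]) auto
    qed
  qed
  show thesis
  proof (rule that[of bs])
    show "set bs \<subseteq> S \<sigma>" using bs B by (auto simp: Se_def)
    fix m assume m: "m \<in> S \<sigma>"
    let ?e = "{u\<in>K. pr m u < 0}"
    have "m \<in> insert \<one>\<^bsub>M\<^esub> (Se ?e)" using m by (auto simp: Se_def)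
    from gen[OF this] obtain l where "set l \<subseteq> B ?e" "word l = m" by auto
    moreover have "B ?e \<subseteq> set bs" unfolding bs by (rule UN_upper) auto
    ultimately show "\<exists>l. set l \<subseteq> set bs \<and> word l = m" by (intro exI[of _ l]) auto
  qed
qed

lemma R_add:
  assumes "f \<in> R \<sigma>" "g \<in> R \<sigma>"
  shows "(\<lambda>x. f x + g x) \<in> R \<sigma>"
proof -
  obtain F c where f: "f = (\<lambda>x. \<Sum>m\<in>F. c m * ch m x)" "finite F" "F \<subseteq> S \<sigma>"
    using assms(1) by (auto simp: toric_ring_def)
  obtain F' c' where g: "g = (\<lambda>x. \<Sum>m\<in>F'. c' m * ch m x)" "finite F'" "F' \<subseteq> S \<sigma>"
    using assms(2) by (auto simp: toric_ring_def)
  define d where "d m = (if m \<in> F then c m else 0) + (if m \<in> F' then c' m else 0)" for m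
  have "(\<Sum>m\<in>F \<union> F'. d m * ch m x) = f x + g x" for x
  proof -
    have "(\<Sum>m\<in>F \<union> F'. d m * ch m x) = (\<Sum>m\<in>F \<union> F'. (if m \<in> F then c m * ch m x else 0)) + (\<Sum>m\<in>F \<union> F'. (if m \<in> F' then c' m * ch m x else 0))"
      unfolding d_def sum.distrib[symmetric] by (rule sum.cong) (auto simp: algebra_simps)
    also have "\<dots> = f x + g x"
      using f g by (simp add: sum.If_cases Int_absorb1 sum.inter_restrict[symmetric])
    finally show ?thesis .
  qed
  then have "(\<lambda>x. f x + g x) = (\<lambda>x. \<Sum>m\<in>F \<union> F'. d m * ch m x)" by simp
  then show ?thesis unfolding toric_ring_def using f g
    by (intro CollectI exI[of _ "F \<union> F'"] exI[of _ d]) auto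
qed

lemma R_monom: "m \<in> S \<sigma> \<Longrightarrow> (\<lambda>x. c * ch m x) \<in> R \<sigma>"
  unfolding toric_ring_def by (intro CollectI exI[of _ "{m}"] exI[of _ "\<lambda>_. c"]) auto

lemma R_zero: "(\<lambda>x. 0) \<in> R \<sigma>"
  unfolding toric_ring_def by (intro CollectI exI[of _ "{}"]) auto

lemma R_sum:
  assumes "finite A" "\<And>a. a \<in> A \<Longrightarrow> h a \<in> R \<sigma>"
  shows "(\<lambda>x. \<Sum>a\<in>A. h a x) \<in> R \<sigma>"
  using assms by (induction A rule: finite_induct) (auto intro: R_zero R_add)

lemma R_sumI:
  assumes "finite F" "\<And>m. m \<in> F \<Longrightarrow> t m \<in> S \<sigma>"
  shows "(\<lambda>x. \<Sum>m\<in>F. c m * ch (t m) x) \<in> R \<sigma>"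
  by (rule R_sum[OF assms(1)]) (rule R_monom[OF assms(2)])

lemma RE:
  assumes "f \<in> R \<sigma>"
  obtains F c where "f = (\<lambda>x. \<Sum>m\<in>F. c m * ch m x)" "finite F" "F \<subseteq> S \<sigma>"
  using assms by (auto simp: toric_ring_def)

text \<open>The function \<open>\<lambda>x. f x * g x\<close> itself need not be in the ring, since off the chart a
  character of a product is not the product of the characters.\<close>

lemma R_mult:
  assumes \<sigma>: "\<sigma> \<in> \<Sigma>" and "f \<in> R \<sigma>" "g \<in> R \<sigma>"
  obtains h where "h \<in> R \<sigma>" "\<And>x. x \<in> U \<sigma> \<Longrightarrow> h x = f x * g x"
proof -
  obtain F c where f: "f = (\<lambda>x. \<Sum>m\<in>F. c m * ch m x)" "finite F" "F \<subseteq> S \<sigma>" by (rule RE[OF assms(2)])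
  obtain F' c' where g: "g = (\<lambda>x. \<Sum>m\<in>F'. c' m * ch m x)" "finite F'" "F' \<subseteq> S \<sigma>" by (rule RE[OF assms(3)])
  let ?h = "\<lambda>x. \<Sum>p\<in>F \<times> F'. (c (fst p) * c' (snd p)) * ch (fst p \<otimes>\<^bsub>M\<^esub> snd p) x"
  show thesis
  proof (rule that[of ?h])
    show "?h \<in> R \<sigma>" using f(2,3) g(2,3) by (intro R_sumI) (auto intro!: S_mult[OF \<sigma>])
    fix x assume x: "x \<in> U \<sigma>"
    have "?h x = (\<Sum>p\<in>F \<times> F'. (c (fst p) * ch (fst p) x) * (c' (snd p) * ch (snd p) x))"
      using f(3) g(3) by (intro sum.cong refl) (auto simp: ch_mult[OF x, OF subsetD subsetD])
    also have "\<dots> = f x * g x" unfolding f(1) g(1) sum_product sum.cartesian_product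
      by (simp add: case_prod_beta)
    finally show "?h x = f x * g x" .
  qed
qed

lemma R_one: "\<sigma> \<in> \<Sigma> \<Longrightarrow> \<exists>h\<in>R \<sigma>. \<forall>x\<in>toric_points M pr \<Sigma>. h x = 1"
  using R_monom[OF S_one, of \<sigma> 1] ch_one by (intro bexI[of _ "\<lambda>x. 1 * ch \<one>\<^bsub>M\<^esub> x"]) auto

text \<open>By \<open>inter_face\<close> the two charts meet where \<open>ch m\<close> is nonzero on
  the chart of \<sigma>, and \<open>localize\<close> clears the poles that a function of the other
  chart has along the rest.\<close>

lemma R_transfer:
  assumes \<sigma>: "\<sigma> \<in> \<Sigma>" and \<sigma>': "\<sigma>' \<in> \<Sigma>"
  obtains m where "m \<in> S \<sigma>" "\<And>y. y \<in> U \<sigma> \<Longrightarrow> ch m y \<noteq> 0 \<longleftrightarrow> y \<in> U \<sigma>'"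
    "\<And>f. f \<in> R \<sigma>' \<Longrightarrow> \<exists>k0::nat. \<forall>k\<ge>k0. \<exists>f'\<in>R \<sigma>. \<forall>y\<in>U \<sigma> \<inter> U \<sigma>'. f' y = f y * ch m y ^ k"
proof -
  obtain m where m: "m \<in> S \<sigma>" "\<sigma> \<inter> \<sigma>' = {u\<in>\<sigma>. pr m u = 0}" using inter_face[OF \<sigma> \<sigma>'] by auto
  have mc: "m \<in> carrier M" using m(1) S_carrier by auto
  have mST: "m \<in> S (\<sigma> \<inter> \<sigma>')" using m(1) S_anti[of "\<sigma> \<inter> \<sigma>'" \<sigma>] by auto
  have \<tau>: "\<sigma> \<inter> \<sigma>' \<in> \<Sigma>" using inter_in_fan[OF \<sigma> \<sigma>'] .
  show thesis
  proof (rule that[OF m(1)])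
    fix y assume y: "y \<in> U \<sigma>"
    show "ch m y \<noteq> 0 \<longleftrightarrow> y \<in> U \<sigma>'" using U_face[OF \<sigma> m y] y U_inter by blast
  next
    fix f assume "f \<in> R \<sigma>'"
    then obtain F c where f: "f = (\<lambda>x. \<Sum>m\<in>F. c m * ch m x)" "finite F" "F \<subseteq> S \<sigma>'" by (rule RE)
    have FS: "n \<in> S (\<sigma> \<inter> \<sigma>')" if "n \<in> F" for n using that f(3) S_anti[of "\<sigma> \<inter> \<sigma>'" \<sigma>'] by auto
    have "\<forall>n. \<exists>k0::nat. n \<in> F \<longrightarrow> (\<forall>k\<ge>k0. n \<otimes>\<^bsub>M\<^esub> m [^]\<^bsub>M\<^esub> k \<in> S \<sigma>)"
      using localize[OF \<sigma> m FS] by blast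
    then obtain k0 :: "'m \<Rightarrow> nat" where k0': "\<forall>n. n \<in> F \<longrightarrow> (\<forall>k\<ge>k0 n. n \<otimes>\<^bsub>M\<^esub> m [^]\<^bsub>M\<^esub> k \<in> S \<sigma>)"
      by (rule choice[THEN exE])
    have k0: "n \<otimes>\<^bsub>M\<^esub> m [^]\<^bsub>M\<^esub> k \<in> S \<sigma>" if "n \<in> F" "k \<ge> sum k0 F" for n and k :: nat
    proof -
      have "k0 n \<le> sum k0 F" by (rule member_le_sum[OF that(1)]) (use f in auto)
      then show ?thesis using k0' that by auto
    qed
    have "\<exists>f'\<in>R \<sigma>. \<forall>y\<in>U \<sigma> \<inter> U \<sigma>'. f' y = f y * ch m y ^ k" if k: "k \<ge> sum k0 F" for k
    proof (intro bexI ballI)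
      let ?f = "\<lambda>x. \<Sum>n\<in>F. c n * ch (n \<otimes>\<^bsub>M\<^esub> m [^]\<^bsub>M\<^esub> k) x"
      show "?f \<in> R \<sigma>" by (rule R_sumI[OF f(2) k0[OF _ k]])
      fix y assume "y \<in> U \<sigma> \<inter> U \<sigma>'"
      then have y: "y \<in> U (\<sigma> \<inter> \<sigma>')" using U_inter by blast
      show "?f y = f y * ch m y ^ k" unfolding f(1) sum_distrib_right
        by (intro sum.cong refl)
           (simp add: ch_mult[OF y FS S_pow[OF \<tau> mST]] ch_pow[OF \<tau> y mST])
    qed
    then show "\<exists>k0::nat. \<forall>k\<ge>k0. \<exists>f'\<in>R \<sigma>. \<forall>y\<in>U \<sigma> \<inter> U \<sigma>'. f' y = f y * ch m y ^ k" by blast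
  qed
qed

lemma R_fraction:
  assumes \<sigma>: "\<sigma> \<in> \<Sigma>" and \<sigma>': "\<sigma>' \<in> \<Sigma>" and f: "f \<in> R \<sigma>'" and g: "g \<in> R \<sigma>'"
  obtains f' g' where "f' \<in> R \<sigma>" "g' \<in> R \<sigma>"
    "\<And>y. y \<in> U \<sigma> \<Longrightarrow> g' y \<noteq> 0 \<longleftrightarrow> y \<in> U \<sigma>' \<and> g y \<noteq> 0"
    "\<And>y. y \<in> U \<sigma> \<Longrightarrow> g' y \<noteq> 0 \<Longrightarrow> f' y / g' y = f y / g y"
proof -
  obtain m where m: "m \<in> S \<sigma>" "\<And>y. y \<in> U \<sigma> \<Longrightarrow> ch m y \<noteq> 0 \<longleftrightarrow> y \<in> U \<sigma>'"
    "\<And>f. f \<in> R \<sigma>' \<Longrightarrow> \<exists>k0::nat. \<forall>k\<ge>k0. \<exists>f'\<in>R \<sigma>. \<forall>y\<in>U \<sigma> \<inter> U \<sigma>'. f' y = f y * ch m y ^ k"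
    using R_transfer[OF \<sigma> \<sigma>'] by metis
  obtain k1 :: nat where k1: "\<forall>k\<ge>k1. \<exists>f'\<in>R \<sigma>. \<forall>y\<in>U \<sigma> \<inter> U \<sigma>'. f' y = f y * ch m y ^ k"
    using m(3)[OF f] by auto
  obtain k2 :: nat where k2: "\<forall>k\<ge>k2. \<exists>g'\<in>R \<sigma>. \<forall>y\<in>U \<sigma> \<inter> U \<sigma>'. g' y = g y * ch m y ^ k"
    using m(3)[OF g] by auto
  define k where "k = max k1 k2"
  obtain f1 where f1: "f1 \<in> R \<sigma>" "\<forall>y\<in>U \<sigma> \<inter> U \<sigma>'. f1 y = f y * ch m y ^ k"
    using k1[rule_format, of k] by (auto simp: k_def)
  obtain g1 where g1: "g1 \<in> R \<sigma>" "\<forall>y\<in>U \<sigma> \<inter> U \<sigma>'. g1 y = g y * ch m y ^ k"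
    using k2[rule_format, of k] by (auto simp: k_def)
  \<comment> \<open>One more factor \<open>ch m\<close> is needed: outside
    \<open>U \<sigma>'\<close> nothing is known about \<open>f1\<close> and \<open>g1\<close>, and
    the factor makes the denominator vanish there.\<close>
  have mR: "(\<lambda>x. 1 * ch m x) \<in> R \<sigma>" by (rule R_monom[OF m(1)])
  obtain f' where f': "f' \<in> R \<sigma>" "\<And>x. x \<in> U \<sigma> \<Longrightarrow> f' x = f1 x * (1 * ch m x)"
    using R_mult[OF \<sigma> f1(1) mR] by metis
  obtain g' where g': "g' \<in> R \<sigma>" "\<And>x. x \<in> U \<sigma> \<Longrightarrow> g' x = g1 x * (1 * ch m x)"
    using R_mult[OF \<sigma> g1(1) mR] by metis
  show thesis
  proof (rule that[OF f'(1) g'(1)])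
    fix y assume y: "y \<in> U \<sigma>"
    show "g' y \<noteq> 0 \<longleftrightarrow> y \<in> U \<sigma>' \<and> g y \<noteq> 0"
      using g'(2)[OF y] g1(2) m(2)[OF y] y by auto
    assume "g' y \<noteq> 0"
    then show "f' y / g' y = f y / g y"
      using g'(2)[OF y] f'(2)[OF y] g1(2) f1(2) m(2)[OF y] y by auto
  qed
qed

text \<open>Openness can be tested in any chart through the point, because \<open>R_fraction\<close>
  turns a principal open of another chart into a principal open of this one.\<close>

lemma Y_open_local:
  assumes W: "openin (ztop Y) W" and \<sigma>: "\<sigma> \<in> \<Sigma>" and x: "x \<in> W" "x \<in> U \<sigma>"
  obtains g where "g \<in> R \<sigma>" "g x \<noteq> 0" "{y\<in>U \<sigma>. g y \<noteq> 0} \<subseteq> W"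
proof -
  let ?\<B> = "{{x\<in>V. g x \<noteq> 0} | V A g. (V, A) \<in> {(U \<sigma>, R \<sigma>) | \<sigma>. \<sigma> \<in> \<Sigma>} \<and> g \<in> A}"
  have gen: "generate_topology_on ?\<B> W"
    using W unfolding toric_variety_def glue_def by (simp add: openin_topology_generated_by_iff)
  have "\<exists>g\<in>R \<sigma>. g x \<noteq> 0 \<and> {y\<in>U \<sigma>. g y \<noteq> 0} \<subseteq> W"
    using gen x
  proof (induction rule: generate_topology_on.induct)
    case (Int a b)
    then obtain g h where gh: "g \<in> R \<sigma>" "g x \<noteq> 0" "{y\<in>U \<sigma>. g y \<noteq> 0} \<subseteq> a"
      "h \<in> R \<sigma>" "h x \<noteq> 0" "{y\<in>U \<sigma>. h y \<noteq> 0} \<subseteq> b" by auto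
    obtain k where "k \<in> R \<sigma>" "\<And>x. x \<in> U \<sigma> \<Longrightarrow> k x = g x * h x" using R_mult[OF \<sigma> gh(1,4)] by metis
    then show ?case using gh Int.prems by (intro bexI[of _ k]) auto
  next
    case (UN K)
    then obtain k where k: "k \<in> K" "x \<in> k" by auto
    from UN.IH[OF this(1)] this(2) UN.prems have "\<exists>g\<in>R \<sigma>. g x \<noteq> 0 \<and> {y\<in>U \<sigma>. g y \<noteq> 0} \<subseteq> k" by auto
    then show ?case using k(1) by (meson Union_upper order_trans)
  next
    case (Basis s)
    then obtain \<sigma>' g where g: "\<sigma>' \<in> \<Sigma>" "g \<in> R \<sigma>'" "s = {x\<in>U \<sigma>'. g x \<noteq> 0}" by auto
    obtain f' g' where g': "g' \<in> R \<sigma>" "\<And>y. y \<in> U \<sigma> \<Longrightarrow> g' y \<noteq> 0 \<longleftrightarrow> y \<in> U \<sigma>' \<and> g y \<noteq> 0"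
      using R_fraction[OF \<sigma> g(1,2,2)] by metis
    then show ?case using g Basis.prems by (intro bexI[of _ g']) auto
  qed auto
  then show thesis using that by auto
qed

lemma Y_openI:
  assumes "\<sigma> \<in> \<Sigma>" "V \<subseteq> U \<sigma>" "\<And>x. x \<in> V \<Longrightarrow> \<exists>g\<in>R \<sigma>. g x \<noteq> 0 \<and> {y\<in>U \<sigma>. g y \<noteq> 0} \<subseteq> V"
  shows "openin (ztop Y) V"
proof -
  let ?\<B> = "{{x\<in>V. g x \<noteq> 0} | V A g. (V, A) \<in> {(U \<sigma>, R \<sigma>) | \<sigma>. \<sigma> \<in> \<Sigma>} \<and> g \<in> A}"
  let ?K = "{{x\<in>U \<sigma>. g x \<noteq> 0} | g. g \<in> R \<sigma> \<and> {x\<in>U \<sigma>. g x \<noteq> 0} \<subseteq> V}"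
  have V: "V = \<Union>?K"
  proof
    show "V \<subseteq> \<Union>?K"
    proof
      fix x assume x: "x \<in> V"
      from assms(3)[OF x] obtain g where "g \<in> R \<sigma>" "g x \<noteq> 0" "{y\<in>U \<sigma>. g y \<noteq> 0} \<subseteq> V" by auto
      then show "x \<in> \<Union>?K" using x assms(2) by (intro UnionI[of "{y\<in>U \<sigma>. g y \<noteq> 0}"]) auto
    qed
  qed auto
  have "generate_topology_on ?\<B> (\<Union>?K)"
    by (rule generate_topology_on.UN, rule generate_topology_on.Basis) (use assms(1) in auto)
  with V show ?thesis unfolding toric_variety_def glue_def by (simp add: openin_topology_generated_by_iff)
qed

lemma U_open:
  assumes "\<sigma> \<in> \<Sigma>"
  shows "openin (ztop Y) (U \<sigma>)"
proof (rule Y_openI[OF assms order_refl])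
  fix x assume x: "x \<in> U \<sigma>"
  obtain h where "h \<in> R \<sigma>" "\<forall>x\<in>toric_points M pr \<Sigma>. h x = 1" using R_one[OF assms] by auto
  then show "\<exists>g\<in>R \<sigma>. g x \<noteq> 0 \<and> {y\<in>U \<sigma>. g y \<noteq> 0} \<subseteq> U \<sigma>"
    using chart_points[OF x] by (intro bexI[of _ h]) auto
qed

lemma pts_Y: "pts Y = toric_points M pr \<Sigma>"
proof
  have "openin (ztop Y) (pts Y)" by simp
  then have gen: "generate_topology_on {{x\<in>V. g x \<noteq> 0} | V A g. (V, A) \<in> {(U \<sigma>, R \<sigma>) | \<sigma>. \<sigma> \<in> \<Sigma>} \<and> g \<in> A} (pts Y)"
    unfolding toric_variety_def glue_def by (simp add: openin_topology_generated_by_iff)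
  then show "pts Y \<subseteq> toric_points M pr \<Sigma>"
    by (induction rule: generate_topology_on.induct) (auto dest: chart_points)
  show "toric_points M pr \<Sigma> \<subseteq> pts Y"
  proof
    fix x assume x: "x \<in> toric_points M pr \<Sigma>"
    then have "x \<in> U (fst x)" by (simp add: toric_chart_def)
    then show "x \<in> pts Y" using openin_subset[OF U_open[OF points_snd(1)[OF x]]] by auto
  qed
qed

lemma Y_reg_iff:
  "h \<in> reg Y W \<longleftrightarrow> h \<in> extensional W \<and> (\<forall>x\<in>W. \<exists>\<sigma>\<in>\<Sigma>. \<exists>f\<in>R \<sigma>. \<exists>g\<in>R \<sigma>.
      x \<in> U \<sigma> \<and> g x \<noteq> 0 \<and> {y\<in>U \<sigma>. g y \<noteq> 0} \<subseteq> W \<and> (\<forall>y\<in>U \<sigma>. g y \<noteq> 0 \<longrightarrow> h y = f y / g y))"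
proof -
  have "(\<exists>(V, A)\<in>{(U \<sigma>, R \<sigma>) | \<sigma>. \<sigma> \<in> \<Sigma>}. Q V A) \<longleftrightarrow> (\<exists>\<sigma>\<in>\<Sigma>. Q (U \<sigma>) (R \<sigma>))" for Q
    by blast
  then show ?thesis unfolding toric_variety_def glue_def by simp
qed

lemma Y_reg_local:
  assumes h: "h \<in> reg Y W" and \<sigma>: "\<sigma> \<in> \<Sigma>" and x: "x \<in> W" "x \<in> U \<sigma>"
  obtains f g where "f \<in> R \<sigma>" "g \<in> R \<sigma>" "g x \<noteq> 0" "{y\<in>U \<sigma>. g y \<noteq> 0} \<subseteq> W"
    "\<forall>y\<in>U \<sigma>. g y \<noteq> 0 \<longrightarrow> h y = f y / g y"
proof -
  from h x(1) obtain \<sigma>' f g where fg: "\<sigma>' \<in> \<Sigma>" "f \<in> R \<sigma>'" "g \<in> R \<sigma>'" "x \<in> U \<sigma>'" "g x \<noteq> 0"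
    "{y\<in>U \<sigma>'. g y \<noteq> 0} \<subseteq> W" "\<forall>y\<in>U \<sigma>'. g y \<noteq> 0 \<longrightarrow> h y = f y / g y"
    unfolding Y_reg_iff by meson
  obtain f' g' where fg': "f' \<in> R \<sigma>" "g' \<in> R \<sigma>"
    "\<And>y. y \<in> U \<sigma> \<Longrightarrow> g' y \<noteq> 0 \<longleftrightarrow> y \<in> U \<sigma>' \<and> g y \<noteq> 0"
    "\<And>y. y \<in> U \<sigma> \<Longrightarrow> g' y \<noteq> 0 \<Longrightarrow> f' y / g' y = f y / g y"
    using R_fraction[OF \<sigma> fg(1,2,3)] by metis
  show thesis
    by (rule that[OF fg'(1,2)]) (use fg fg' x in auto)
qed



end

section \<open>Affineness of the charts\<close>

context toric_setting
begin

lemma chart_like_toric: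
  assumes \<sigma>: "\<sigma> \<in> \<Sigma>"
  shows "chart_like (restrict_fspace Y (U \<sigma>)) (U \<sigma>) (R \<sigma>)"
proof -
  have op: "openin (ztop (restrict_fspace Y (U \<sigma>))) V \<longleftrightarrow> openin (ztop Y) V \<and> V \<subseteq> U \<sigma>" for V
    unfolding restrict_fspace_def using openin_open_subtopology[OF U_open[OF \<sigma>]] by simp
  have op': "openin (ztop (restrict_fspace Y (U \<sigma>))) V \<longleftrightarrow>
      V \<subseteq> U \<sigma> \<and> (\<forall>x\<in>V. \<exists>g\<in>R \<sigma>. g x \<noteq> 0 \<and> {y\<in>U \<sigma>. g y \<noteq> 0} \<subseteq> V)" for V
  proof
    assume V: "openin (ztop (restrict_fspace Y (U \<sigma>))) V"
    have "\<exists>g\<in>R \<sigma>. g x \<noteq> 0 \<and> {y\<in>U \<sigma>. g y \<noteq> 0} \<subseteq> V" if x: "x \<in> V" for x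
    proof -
      have "openin (ztop Y) V" "x \<in> U \<sigma>" using V op x by auto
      then obtain g where "g \<in> R \<sigma>" "g x \<noteq> 0" "{y\<in>U \<sigma>. g y \<noteq> 0} \<subseteq> V"
        by (rule Y_open_local[OF _ \<sigma> x])
      then show ?thesis by (intro bexI[of _ g]) auto
    qed
    then show "V \<subseteq> U \<sigma> \<and> (\<forall>x\<in>V. \<exists>g\<in>R \<sigma>. g x \<noteq> 0 \<and> {y\<in>U \<sigma>. g y \<noteq> 0} \<subseteq> V)" using V op by simp
  next
    assume "V \<subseteq> U \<sigma> \<and> (\<forall>x\<in>V. \<exists>g\<in>R \<sigma>. g x \<noteq> 0 \<and> {y\<in>U \<sigma>. g y \<noteq> 0} \<subseteq> V)"
    then show "openin (ztop (restrict_fspace Y (U \<sigma>))) V" using op Y_openI[OF \<sigma>, of V] by simp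
  qed
  have rg: "h \<in> reg (restrict_fspace Y (U \<sigma>)) V \<longleftrightarrow> h \<in> extensional V \<and> (\<forall>x\<in>V. \<exists>f\<in>R \<sigma>. \<exists>g\<in>R \<sigma>.
        g x \<noteq> 0 \<and> {y\<in>U \<sigma>. g y \<noteq> 0} \<subseteq> V \<and> (\<forall>y\<in>U \<sigma>. g y \<noteq> 0 \<longrightarrow> h y = f y / g y))"
    if V: "openin (ztop (restrict_fspace Y (U \<sigma>))) V" for V h
  proof
    assume "h \<in> reg (restrict_fspace Y (U \<sigma>)) V"
    then have h: "h \<in> reg Y V" by (simp add: restrict_fspace_def)
    have "\<exists>f\<in>R \<sigma>. \<exists>g\<in>R \<sigma>. g x \<noteq> 0 \<and> {y\<in>U \<sigma>. g y \<noteq> 0} \<subseteq> V \<and> (\<forall>y\<in>U \<sigma>. g y \<noteq> 0 \<longrightarrow> h y = f y / g y)"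
      if "x \<in> V" for x
    proof -
      have "x \<in> U \<sigma>" using that V op by auto
      obtain f g where fg: "f \<in> R \<sigma>" "g \<in> R \<sigma>" "g x \<noteq> 0" "{y\<in>U \<sigma>. g y \<noteq> 0} \<subseteq> V"
        "\<forall>y\<in>U \<sigma>. g y \<noteq> 0 \<longrightarrow> h y = f y / g y"
        by (rule Y_reg_local[OF h \<sigma> \<open>x \<in> V\<close> \<open>x \<in> U \<sigma>\<close>])
      then show ?thesis by (intro bexI[OF _ fg(1)] bexI[OF _ fg(2)] conjI)
    qed
    then show "h \<in> extensional V \<and> (\<forall>x\<in>V. \<exists>f\<in>R \<sigma>. \<exists>g\<in>R \<sigma>.
        g x \<noteq> 0 \<and> {y\<in>U \<sigma>. g y \<noteq> 0} \<subseteq> V \<and> (\<forall>y\<in>U \<sigma>. g y \<noteq> 0 \<longrightarrow> h y = f y / g y))"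
      using h unfolding Y_reg_iff by simp
  next
    assume r: "h \<in> extensional V \<and> (\<forall>x\<in>V. \<exists>f\<in>R \<sigma>. \<exists>g\<in>R \<sigma>.
        g x \<noteq> 0 \<and> {y\<in>U \<sigma>. g y \<noteq> 0} \<subseteq> V \<and> (\<forall>y\<in>U \<sigma>. g y \<noteq> 0 \<longrightarrow> h y = f y / g y))"
    have "V \<subseteq> U \<sigma>" using V op by auto
    with r have "\<forall>x\<in>V. \<exists>f\<in>R \<sigma>. \<exists>g\<in>R \<sigma>. x \<in> U \<sigma> \<and>
        g x \<noteq> 0 \<and> {y\<in>U \<sigma>. g y \<noteq> 0} \<subseteq> V \<and> (\<forall>y\<in>U \<sigma>. g y \<noteq> 0 \<longrightarrow> h y = f y / g y)" by auto
    then have "h \<in> reg Y V" using r \<sigma> unfolding Y_reg_iff by (intro conjI ballI bexI[OF _ \<sigma>]) auto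
    then show "h \<in> reg (restrict_fspace Y (U \<sigma>)) V" by (simp add: restrict_fspace_def)
  qed
  show ?thesis unfolding chart_like_def
    by (intro conjI allI impI op' rg)
qed

text \<open>The generators found by \<open>Gordan\<close> serve as coordinates, and the image is cut
  out by the binomial equations between words of equal product. A solution of these equations is a
  homomorphism on the dual semigroup, hence a point by \<open>point_exists\<close>;
  \<open>point_eqI\<close> gives injectivity.\<close>

theorem chart_affine:
  assumes \<sigma>: "\<sigma> \<in> \<Sigma>"
  shows "affine_variety (restrict_fspace Y (U \<sigma>))"
proof -
  obtain bs0 where bs0: "set bs0 \<subseteq> S \<sigma>" "\<And>m. m \<in> S \<sigma> \<Longrightarrow> \<exists>l. set l \<subseteq> set bs0 \<and> word l = m"
    using Gordan[OF \<sigma>] by metis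
  define bs where "bs = remdups bs0"
  have bs: "set bs \<subseteq> S \<sigma>" "\<And>m. m \<in> S \<sigma> \<Longrightarrow> \<exists>l. set l \<subseteq> set bs \<and> word l = m" "distinct bs"
    using bs0 by (auto simp: bs_def)
  define N where "N = length bs"
  define idx where "idx b = (THE i. i < N \<and> bs ! i = b)" for b
  have idx_nth: "idx (bs ! i) = i" if "i < N" for i
    unfolding idx_def using that bs(3) by (intro the_equality) (auto simp: N_def nth_eq_iff_index_eq)
  have idx: "idx b < N" "bs ! idx b = b" if b: "b \<in> set bs" for b
  proof -
    from b obtain i where "i < N" "bs ! i = b" unfolding N_def in_set_conv_nth by auto
    then show "idx b < N" "bs ! idx b = b" using idx_nth by auto
  qed
  define val :: "(nat \<Rightarrow> complex) \<Rightarrow> 'm list \<Rightarrow> complex" where "val z l = prod_list (map z (map idx l))" for z l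
  \<comment> \<open>A fixed word for every character; on the solutions of the binomial equations the
    choice does not matter.\<close>
  define L where "L m = (SOME l. set l \<subseteq> set bs \<and> word l = m)" for m
  have L: "set (L m) \<subseteq> set bs" "word (L m) = m" if "m \<in> S \<sigma>" for m
    using someI_ex[OF bs(2)[OF that]] unfolding L_def by auto
  define e where "e x = (\<lambda>i\<in>{..<N}. ch (bs ! i) x)" for x
  define Z where "Z = {z \<in> {..<N} \<rightarrow>\<^sub>E UNIV. \<forall>l l'. set l \<subseteq> set bs \<and> set l' \<subseteq> set bs \<and> word l = word l' \<longrightarrow> val z l = val z l'}"
  have val_e: "val (e x) l = ch (word l) x" if "x \<in> U \<sigma>" "set l \<subseteq> set bs" for x l
    using that(2)
  proof (induction l)
    case (Cons b l)
    then have "set l \<subseteq> S \<sigma>" "b \<in> S \<sigma>" using bs(1) by auto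
    with Cons show ?case using ch_mult[OF that(1) _ word_S[OF \<sigma>]] idx[of b] by (simp add: val_def e_def)
  qed (simp add: val_def ch_one chart_points[OF that(1)])
  have val_poly: "(\<lambda>z. val z l) \<in> poly_fns {..<N}" if "set l \<subseteq> set bs" for l
    unfolding val_def by (rule poly_fns_prod_list) (use that idx in auto)
  have Zv: "val z l = val z l'" if z: "z \<in> Z" and l: "set l \<subseteq> set bs" "set l' \<subseteq> set bs" "word l = word l'" for z l l'
  proof -
    from z have "\<forall>l l'. set l \<subseteq> set bs \<and> set l' \<subseteq> set bs \<and> word l = word l' \<longrightarrow> val z l = val z l'"
      unfolding Z_def mem_Collect_eq by (rule conjunct2)
    from this[rule_format, OF conjI[OF l(1) conjI[OF l(2,3)]]] show ?thesis .
  qed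
  have inj: "inj_on e (U \<sigma>)"
  proof (rule inj_onI)
    fix x y assume xy: "x \<in> U \<sigma>" "y \<in> U \<sigma>" "e x = e y"
    show "x = y"
    proof (rule point_eqI[OF \<sigma> xy(1,2)])
      fix m assume "m \<in> S \<sigma>"
      then show "ch m x = ch m y" using val_e[OF xy(1) L(1)] val_e[OF xy(2) L(1)] L(2) xy(3) by metis
    qed
  qed
  have "e ` U \<sigma> = Z"
  proof
    show "e ` U \<sigma> \<subseteq> Z"
    proof
      fix z assume "z \<in> e ` U \<sigma>"
      then obtain x where x: "x \<in> U \<sigma>" "z = e x" by auto
      have "e x \<in> {..<N} \<rightarrow>\<^sub>E UNIV" by (auto simp: e_def)
      then show "z \<in> Z" unfolding Z_def x(2) using val_e[OF x(1)] by simp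
    qed
    show "Z \<subseteq> e ` U \<sigma>"
    proof
      fix z assume z: "z \<in> Z"
      note zv = Zv[OF z]
      define \<phi> where "\<phi> m = val z (L m)" for m
      have \<phi>: "\<phi> (word l) = val z l" if "set l \<subseteq> set bs" for l
      proof -
        have "word l \<in> S \<sigma>" using word_S[OF \<sigma>] that bs(1) by auto
        then show ?thesis unfolding \<phi>_def using L that by (intro zv) auto
      qed
      have "\<phi> \<one>\<^bsub>M\<^esub> = 1" using \<phi>[of "[]"] by (simp add: val_def)
      moreover have "\<phi> (m \<otimes>\<^bsub>M\<^esub> m') = \<phi> m * \<phi> m'" if m: "m \<in> S \<sigma>" "m' \<in> S \<sigma>" for m m'
      proof -
        have "set (L m) \<subseteq> carrier M" "set (L m') \<subseteq> carrier M" using L(1) m bs(1) S_carrier by blast+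
        then have "word (L m @ L m') = m \<otimes>\<^bsub>M\<^esub> m'" using word_append L(2) m by simp
        then show ?thesis using \<phi>[of "L m @ L m'"] L(1) m by (simp add: \<phi>_def val_def)
      qed
      ultimately obtain x where x: "x \<in> U \<sigma>" "\<forall>m\<in>S \<sigma>. ch m x = \<phi> m" using point_exists[OF \<sigma>] by metis
      have "e x = z"
      proof (rule extensionalityI[of _ "{..<N}"])
        show "z \<in> extensional {..<N}" using z by (auto simp: Z_def PiE_def)
        fix i assume i: "i \<in> {..<N}"
        then have b: "bs ! i \<in> set bs" by (simp add: N_def)
        then have "\<phi> (word [bs ! i]) = val z [bs ! i]" by (intro \<phi>) auto
        then show "e x i = z i" using x(2) b bs(1) S_carrier i idx_nth by (auto simp: e_def val_def subset_iff)
      qed (simp add: e_def)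
      with x show "z \<in> e ` U \<sigma>" by auto
    qed
  qed
  with inj have bij: "bij_betw e (U \<sigma>) Z" by (simp add: bij_betw_def)
  have "closedin (zariski {..<N}) Z"
    unfolding closedin_zariski
  proof (intro conjI ballI)
    fix z assume z: "z \<in> ({..<N} \<rightarrow>\<^sub>E UNIV) - Z"
    then have "\<not> (\<forall>l l'. set l \<subseteq> set bs \<and> set l' \<subseteq> set bs \<and> word l = word l' \<longrightarrow> val z l = val z l')"
      unfolding Z_def by simp
    then obtain l l' where l: "set l \<subseteq> set bs" "set l' \<subseteq> set bs" "word l = word l'" "val z l \<noteq> val z l'"
      by auto
    have "val y l - val y l' = 0" if "y \<in> Z" for y using Zv[OF that l(1,2,3)] by simp
    then show "\<exists>g\<in>poly_fns {..<N}. g z \<noteq> 0 \<and> (\<forall>y\<in>Z. g y = 0)"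
      using l(4) by (intro bexI[OF _ poly_fns_diff[OF val_poly[OF l(1)] val_poly[OF l(2)]]]) simp
  next
    show "Z \<subseteq> {..<N} \<rightarrow>\<^sub>E UNIV" unfolding Z_def by (rule Collect_subset)
  qed
  moreover have "fisomorphic (restrict_fspace Y (U \<sigma>)) (glue {(Z, poly_fns {..<N})})"
  proof (rule chart_like_isomorphic[OF chart_like_toric[OF \<sigma>] chart_like_poly _ _ bij])
    obtain h where "h \<in> R \<sigma>" "\<forall>x\<in>toric_points M pr \<Sigma>. h x = 1" using R_one[OF \<sigma>] by auto
    then show "\<exists>g\<in>R \<sigma>. \<forall>x\<in>U \<sigma>. g x \<noteq> 0" by (intro bexI[of _ h]) (auto dest: chart_points)
    show "\<exists>g\<in>poly_fns {..<N}. \<forall>x\<in>Z. g x \<noteq> 0" by (rule bexI[OF _ poly_fns.const[of 1]]) simp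
  next
    fix f assume "f \<in> poly_fns {..<N}"
    then show "\<exists>f'\<in>R \<sigma>. \<forall>x\<in>U \<sigma>. f' x = f (e x)"
    proof (induction rule: poly_fns.induct)
      case (const c)
      have "(\<lambda>x. c * ch \<one>\<^bsub>M\<^esub> x) \<in> R \<sigma>" by (rule R_monom[OF S_one[OF \<sigma>]])
      then show ?case by (rule bexI[rotated]) (auto simp: ch_one dest: chart_points)
    next
      case (coord i)
      then have "bs ! i \<in> S \<sigma>" using bs(1) by (auto simp: N_def)
      then have "(\<lambda>x. 1 * ch (bs ! i) x) \<in> R \<sigma>" by (rule R_monom)
      then show ?case using coord by (intro bexI[of _ "\<lambda>x. 1 * ch (bs ! i) x"]) (auto simp: e_def)
    next
      case (add f g)
      then obtain f' g' where f: "f' \<in> R \<sigma>" "\<forall>x\<in>U \<sigma>. f' x = f (e x)" and g: "g' \<in> R \<sigma>" "\<forall>x\<in>U \<sigma>. g' x = g (e x)" by auto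
      then show ?case by (intro bexI[OF _ R_add[OF f(1) g(1)]]) auto
    next
      case (mult f g)
      then obtain f' g' where f: "f' \<in> R \<sigma>" "\<forall>x\<in>U \<sigma>. f' x = f (e x)" and g: "g' \<in> R \<sigma>" "\<forall>x\<in>U \<sigma>. g' x = g (e x)" by auto
      obtain h where "h \<in> R \<sigma>" "\<And>x. x \<in> U \<sigma> \<Longrightarrow> h x = f' x * g' x" using R_mult[OF \<sigma> f(1) g(1)] by metis
      then show ?case using f g by (intro bexI[of _ h]) auto
    qed
  next
    fix f assume "f \<in> R \<sigma>"
    then obtain F c where f: "f = (\<lambda>x. \<Sum>m\<in>F. c m * ch m x)" "finite F" "F \<subseteq> S \<sigma>" by (rule RE)
    have "(\<lambda>z. \<Sum>m\<in>F. c m * val z (L m)) \<in> poly_fns {..<N}"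
      using f L by (intro poly_fns_sum poly_fns.mult poly_fns.const val_poly) auto
    moreover have "f x = (\<Sum>m\<in>F. c m * val (e x) (L m))" if "x \<in> U \<sigma>" for x
      unfolding f(1) using f(3) L by (intro sum.cong refl) (auto simp: val_e[OF that])
    ultimately show "\<exists>f'\<in>poly_fns {..<N}. \<forall>x\<in>U \<sigma>. f x = f' (e x)"
      by (intro bexI[of _ "\<lambda>z. \<Sum>m\<in>F. c m * val z (L m)"]) auto
  qed
  ultimately show ?thesis unfolding affine_variety_def by (intro exI conjI)
qed

end

section \<open>Good quotients of toric varieties induced by projections of fans\<close>

lemma Dedekind_independence:
  fixes X :: "'i \<Rightarrow> 'g \<Rightarrow> complex"
  assumes "finite I"
    and closed: "\<And>s t. s \<in> G \<Longrightarrow> t \<in> G \<Longrightarrow> \<exists>r\<in>G. \<forall>i\<in>I. X i r = X i s * X i t"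
    and distinct: "\<And>i j. i \<in> I \<Longrightarrow> j \<in> I \<Longrightarrow> i \<noteq> j \<Longrightarrow> \<exists>s\<in>G. X i s \<noteq> X j s"
    and nonzero: "\<And>i. i \<in> I \<Longrightarrow> \<exists>s\<in>G. X i s \<noteq> 0"
    and zero: "\<And>s. s \<in> G \<Longrightarrow> (\<Sum>i\<in>I. c i * X i s) = 0"
    and "i \<in> I"
  shows "c i = 0"
  using assms
proof (induction I arbitrary: c i rule: finite_induct)
  case (insert k I)
  have cl: "\<exists>r\<in>G. \<forall>i\<in>I. X i r = X i s * X i t" if "s \<in> G" "t \<in> G" for s t
    using insert.prems(1)[OF that] by auto
  \<comment> \<open>Apply the relation at the product of \<open>s\<close> and \<open>t\<close> and
    subtract \<open>X k t\<close> times the relation at \<open>s\<close>: the term of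
    \<open>k\<close> cancels, and the other coefficients are multiplied by
    \<open>X i t - X k t\<close>.\<close>
  have z: "(\<Sum>i\<in>I. (c i * (X i t - X k t)) * X i s) = 0" if s: "s \<in> G" and t: "t \<in> G" for s t
  proof -
    obtain r where r: "r \<in> G" "\<And>i. i \<in> insert k I \<Longrightarrow> X i r = X i s * X i t"
      using insert.prems(1)[OF s t] by auto
    have "c k * (X k s * X k t) + (\<Sum>i\<in>I. c i * (X i s * X i t)) = 0"
      using insert.prems(4)[OF r(1)] r(2) insert.hyps by simp
    moreover have "X k t * (c k * X k s + (\<Sum>i\<in>I. c i * X i s)) = 0"
      using insert.prems(4)[OF s] insert.hyps by simp
    moreover have "e * (a * b) + u = 0 \<Longrightarrow> b * (e * a + v) = 0 \<Longrightarrow> u - b * v = 0" for a b e u v :: complex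
    proof -
      assume "e * (a * b) + u = 0" "b * (e * a + v) = 0"
      then have "(e * (a * b) + u) - b * (e * a + v) = 0" by simp
      then show ?thesis by (simp add: algebra_simps)
    qed
    ultimately have "(\<Sum>i\<in>I. c i * (X i s * X i t)) - X k t * (\<Sum>i\<in>I. c i * X i s) = 0"
      by meson
    then show ?thesis
      by (simp add: sum_distrib_left sum_subtractf[symmetric] algebra_simps)
  qed
  have c0: "c i = 0" if i: "i \<in> I" for i
  proof -
    have "i \<noteq> k" using i insert.hyps by auto
    then obtain t where t: "t \<in> G" "X i t \<noteq> X k t" using insert.prems(2)[of i k] i by auto
    have "c i * (X i t - X k t) = 0"
      by (rule insert.IH[OF cl _ _ z[OF _ t(1)] i]) (use insert.prems(2,3) in auto)
    then show ?thesis using t(2) by simp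
  qed
  obtain s where "s \<in> G" "X k s \<noteq> 0" using insert.prems(3)[of k] by auto
  then have "c k = 0" using insert.prems(4)[of s] c0 insert.hyps by simp
  then show ?case using c0 insert.prems(5) by auto
qed simp

text \<open>\<open>TT\<close> stands for the points of the big torus, \<open>H\<close> for the group that acts, and \<open>pb \<sigma>\<close> for the
  single cone over \<open>\<sigma>\<close>.\<close>

locale toric_quotient =
  Y: toric_setting M pr \<Sigma> K + Z: toric_setting M' pr' \<Sigma>' K'
  for M :: "'m monoid" and pr :: "'m \<Rightarrow> 'u \<Rightarrow> real" and \<Sigma> K
    and M' :: "'n monoid" and pr' :: "'n \<Rightarrow> 'v \<Rightarrow> real" and \<Sigma>' K' +
  fixes \<iota> :: "'n \<Rightarrow> 'm" and q :: "'u \<Rightarrow> 'v" and pb :: "'v set \<Rightarrow> 'u set" and z0 :: "'u set"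
    and TT :: "('m \<Rightarrow> complex) set" and H :: "'h set" and ev :: "'h \<Rightarrow> 'm \<Rightarrow> complex"
  assumes \<iota>_closed: "\<And>m. m \<in> carrier M' \<Longrightarrow> \<iota> m \<in> carrier M"
    and \<iota>_mult: "\<And>m m'. m \<in> carrier M' \<Longrightarrow> m' \<in> carrier M' \<Longrightarrow> \<iota> (m \<otimes>\<^bsub>M'\<^esub> m') = \<iota> m \<otimes>\<^bsub>M\<^esub> \<iota> m'"
    and pr_q: "\<And>m u. m \<in> carrier M' \<Longrightarrow> u \<in> \<Union>\<Sigma> \<Longrightarrow> pr' m (q u) = pr (\<iota> m) u"
    and q_cone: "\<And>\<tau>. \<tau> \<in> \<Sigma> \<Longrightarrow> \<exists>\<sigma>\<in>\<Sigma>'. q ` \<tau> \<subseteq> \<sigma>"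
    and pb_cone: "\<And>\<sigma>. \<sigma> \<in> \<Sigma>' \<Longrightarrow> pb \<sigma> \<in> \<Sigma>"
    and pb_iff: "\<And>\<sigma> \<tau>. \<sigma> \<in> \<Sigma>' \<Longrightarrow> \<tau> \<in> \<Sigma> \<Longrightarrow> \<tau> \<subseteq> pb \<sigma> \<longleftrightarrow> q ` \<tau> \<subseteq> \<sigma>"
    and pb_dual: "\<And>\<sigma> m. \<sigma> \<in> \<Sigma>' \<Longrightarrow> m \<in> carrier M' \<Longrightarrow> (\<And>u. u \<in> pb \<sigma> \<Longrightarrow> 0 \<le> pr' m (q u)) \<Longrightarrow>
      m \<in> dual_semigroup M' pr' \<sigma>"
    and z0: "z0 \<in> \<Sigma>" "\<And>\<tau>. \<tau> \<in> \<Sigma> \<Longrightarrow> z0 \<subseteq> \<tau>" "perp M pr z0 = carrier M"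
    and TT_hom: "\<And>\<gamma>. \<gamma> \<in> TT \<Longrightarrow> \<gamma> \<in> hom M Cstar"
    and TT_mult: "\<And>\<gamma> \<delta>. \<gamma> \<in> TT \<Longrightarrow> \<delta> \<in> TT \<Longrightarrow> \<exists>\<epsilon>\<in>TT. \<forall>m\<in>carrier M. \<epsilon> m = \<gamma> m * \<delta> m"
    and TT_ex: "TT \<noteq> {}"
    and TT_sep: "\<And>m m'. m \<in> carrier M \<Longrightarrow> m' \<in> carrier M \<Longrightarrow> m \<noteq> m' \<Longrightarrow> \<exists>\<gamma>\<in>TT. \<gamma> m \<noteq> \<gamma> m'"
    and TT_irred: "\<And>A B c d. finite A \<Longrightarrow> A \<subseteq> carrier M \<Longrightarrow> finite B \<Longrightarrow> B \<subseteq> carrier M \<Longrightarrow>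
      (\<And>\<gamma>. \<gamma> \<in> TT \<Longrightarrow> (\<Sum>m\<in>A. c m * \<gamma> m) * (\<Sum>m\<in>B. d m * \<gamma> m) = 0) \<Longrightarrow>
      (\<forall>\<gamma>\<in>TT. (\<Sum>m\<in>A. c m * \<gamma> m) = 0) \<or> (\<forall>\<gamma>\<in>TT. (\<Sum>m\<in>B. d m * \<gamma> m) = 0)"
    and lift: "\<And>\<sigma> \<gamma>. \<sigma> \<in> \<Sigma>' \<Longrightarrow> \<gamma> \<in> hom (M'\<lparr>carrier := perp M' pr' \<sigma>\<rparr>) Cstar \<Longrightarrow>
      \<exists>\<gamma>'\<in>hom (M\<lparr>carrier := perp M pr (pb \<sigma>)\<rparr>) Cstar. \<forall>m\<in>perp M' pr' \<sigma>. \<gamma>' (\<iota> m) = \<gamma> m"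
    and H_mult: "\<And>s t. s \<in> H \<Longrightarrow> t \<in> H \<Longrightarrow> \<exists>r\<in>H. \<forall>m\<in>carrier M. ev r m = ev s m * ev t m"
    and H_one: "\<exists>e\<in>H. \<forall>m\<in>carrier M. ev e m = 1"
    and ev_mult: "\<And>s m m'. s \<in> H \<Longrightarrow> m \<in> carrier M \<Longrightarrow> m' \<in> carrier M \<Longrightarrow> ev s (m \<otimes>\<^bsub>M\<^esub> m') = ev s m * ev s m'"
    and ev_nonzero: "\<And>s m. s \<in> H \<Longrightarrow> m \<in> carrier M \<Longrightarrow> ev s m \<noteq> 0"
    and ev_\<iota>: "\<And>s m. s \<in> H \<Longrightarrow> m \<in> carrier M' \<Longrightarrow> ev s (\<iota> m) = 1"
    and ev_inv: "\<And>m. m \<in> carrier M \<Longrightarrow> (\<And>s. s \<in> H \<Longrightarrow> ev s m = 1) \<Longrightarrow> \<exists>m'\<in>carrier M'. m = \<iota> m'"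
begin

definition "p = toric_morphism q \<iota> M' pr' \<Sigma>'"
definition "act s x = (fst x, \<lambda>m\<in>perp M pr (fst x). ev s m * snd x m)"

text \<open>A function of the chart is determined by its values on the big torus, because distinct
  characters are linearly independent there; so the lack of zero divisors is inherited from
  \<open>TT_irred\<close>.\<close>

lemma domain:
  assumes \<sigma>: "\<sigma> \<in> \<Sigma>" and f: "f \<in> Y.R \<sigma>" and g: "g \<in> Y.R \<sigma>" and fg: "\<And>x. x \<in> Y.U \<sigma> \<Longrightarrow> f x * g x = 0"
  shows "(\<forall>x\<in>Y.U \<sigma>. f x = 0) \<or> (\<forall>x\<in>Y.U \<sigma>. g x = 0)"
proof -
  define pt where "pt \<gamma> = (z0, restrict \<gamma> (carrier M))" for \<gamma> :: "'m \<Rightarrow> complex"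
  have pt: "pt \<gamma> \<in> Y.U \<sigma>" if "\<gamma> \<in> TT" for \<gamma>
    using TT_hom[OF that] z0 \<sigma> unfolding pt_def toric_chart_def toric_points_def
    by (auto simp: hom_def Cstar_def)
  have ch_pt: "Y.ch m (pt \<gamma>) = \<gamma> m" if "m \<in> carrier M" for m \<gamma>
    using that z0 by (simp add: toric_char_def pt_def)
  obtain A c where f_eq: "f = (\<lambda>x. \<Sum>m\<in>A. c m * Y.ch m x)" "finite A" "A \<subseteq> Y.S \<sigma>" by (rule Y.RE[OF f])
  obtain B d where g_eq: "g = (\<lambda>x. \<Sum>m\<in>B. d m * Y.ch m x)" "finite B" "B \<subseteq> Y.S \<sigma>" by (rule Y.RE[OF g])
  have AB: "A \<subseteq> carrier M" "B \<subseteq> carrier M" using f_eq g_eq Y.S_carrier by auto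
  have fpt: "f (pt \<gamma>) = (\<Sum>m\<in>A. c m * \<gamma> m)" for \<gamma>
    unfolding f_eq(1) using AB by (intro sum.cong refl) (auto simp: ch_pt)
  have gpt: "g (pt \<gamma>) = (\<Sum>m\<in>B. d m * \<gamma> m)" for \<gamma>
    unfolding g_eq(1) using AB by (intro sum.cong refl) (auto simp: ch_pt)
  have zero: "\<forall>m\<in>C. e m = 0" if C: "finite C" "C \<subseteq> carrier M" and z: "\<forall>\<gamma>\<in>TT. (\<Sum>m\<in>C. e m * \<gamma> m) = 0" for C e
  proof
    fix m assume m: "m \<in> C"
    show "e m = 0"
    proof (rule Dedekind_independence[OF C(1), of TT "\<lambda>m \<gamma>. \<gamma> m" e m])
      show "\<exists>\<epsilon>\<in>TT. \<forall>i\<in>C. \<epsilon> i = \<gamma> i * \<delta> i" if "\<gamma> \<in> TT" "\<delta> \<in> TT" for \<gamma> \<delta>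
        using TT_mult[OF that] C(2) by blast
      show "\<exists>\<gamma>\<in>TT. \<gamma> i \<noteq> \<gamma> j" if "i \<in> C" "j \<in> C" "i \<noteq> j" for i j
        using TT_sep[of i j] that C(2) by blast
      show "\<exists>\<gamma>\<in>TT. \<gamma> i \<noteq> 0" if "i \<in> C" for i
        using TT_ex TT_hom that C(2) by (fastforce simp: hom_def Cstar_def)
    qed (use z m in auto)
  qed
  have "(\<forall>\<gamma>\<in>TT. (\<Sum>m\<in>A. c m * \<gamma> m) = 0) \<or> (\<forall>\<gamma>\<in>TT. (\<Sum>m\<in>B. d m * \<gamma> m) = 0)"
  proof (rule TT_irred[OF f_eq(2) AB(1) g_eq(2) AB(2)])
    fix \<gamma> assume "\<gamma> \<in> TT"
    then show "(\<Sum>m\<in>A. c m * \<gamma> m) * (\<Sum>m\<in>B. d m * \<gamma> m) = 0" using fg[OF pt] fpt gpt by simp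
  qed
  then show ?thesis
  proof
    assume "\<forall>\<gamma>\<in>TT. (\<Sum>m\<in>A. c m * \<gamma> m) = 0"
    from zero[OF f_eq(2) AB(1) this] show ?thesis unfolding f_eq(1) by simp
  next
    assume "\<forall>\<gamma>\<in>TT. (\<Sum>m\<in>B. d m * \<gamma> m) = 0"
    from zero[OF g_eq(2) AB(2) this] show ?thesis unfolding g_eq(1) by simp
  qed
qed

lemma q_pb: "\<sigma> \<in> \<Sigma>' \<Longrightarrow> q ` pb \<sigma> \<subseteq> \<sigma>"
  using pb_iff[of \<sigma> "pb \<sigma>"] pb_cone by auto

lemma \<iota>_S:
  assumes "\<sigma> \<in> \<Sigma>'" "m \<in> Z.S \<sigma>"
  shows "\<iota> m \<in> Y.S (pb \<sigma>)"
proof -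
  have m: "m \<in> carrier M'" using Z.S_carrier assms by auto
  have "0 \<le> pr (\<iota> m) u" if "u \<in> pb \<sigma>" for u
  proof -
    have "u \<in> \<Union>\<Sigma>" "q u \<in> \<sigma>" using that pb_cone q_pb assms(1) by auto
    then show ?thesis using pr_q[OF m, of u] assms(2) by (auto simp: dual_semigroup_def)
  qed
  then show ?thesis using \<iota>_closed[OF m] by (simp add: dual_semigroup_def)
qed

lemma p_fst:
  assumes y: "y \<in> toric_points M pr \<Sigma>"
  shows "fst (p y) \<in> \<Sigma>'" "q ` fst y \<subseteq> fst (p y)" "\<And>\<sigma>. \<sigma> \<in> \<Sigma>' \<Longrightarrow> q ` fst y \<subseteq> \<sigma> \<Longrightarrow> fst (p y) \<subseteq> \<sigma>"
proof -
  have eq: "fst (p y) = \<Inter>{\<sigma>\<in>\<Sigma>'. q ` fst y \<subseteq> \<sigma>}" by (simp add: p_def toric_morphism_def Let_def)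
  show "fst (p y) \<in> \<Sigma>'" unfolding eq
    by (rule Z.Inter_in_fan) (use q_cone[OF Y.points_snd(1)[OF y]] in auto)
  show "q ` fst y \<subseteq> fst (p y)" "\<And>\<sigma>. \<sigma> \<in> \<Sigma>' \<Longrightarrow> q ` fst y \<subseteq> \<sigma> \<Longrightarrow> fst (p y) \<subseteq> \<sigma>" unfolding eq by auto
qed

lemma p_snd: "snd (p y) = (\<lambda>m\<in>perp M' pr' (fst (p y)). snd y (\<iota> m))"
  by (simp add: p_def toric_morphism_def Let_def)

lemma \<iota>_P:
  assumes y: "y \<in> toric_points M pr \<Sigma>" and m: "m \<in> Z.P (fst (p y))"
  shows "\<iota> m \<in> Y.P (fst y)"
proof -
  have mc: "m \<in> carrier M'" using m Z.P_carrier by auto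
  have "pr (\<iota> m) u = 0" if "u \<in> fst y" for u
  proof -
    have "u \<in> \<Union>\<Sigma>" "q u \<in> fst (p y)" using that Y.points_snd(1)[OF y] p_fst(2)[OF y] by auto
    then show ?thesis using pr_q[OF mc, of u] m by (simp add: perp_def)
  qed
  then show ?thesis using \<iota>_closed[OF mc] by (simp add: perp_def)
qed

lemma p_point:
  assumes y: "y \<in> toric_points M pr \<Sigma>"
  shows "p y \<in> toric_points M' pr' \<Sigma>'"
proof -
  have "snd (p y) \<in> hom (M'\<lparr>carrier := Z.P (fst (p y))\<rparr>) Cstar"
    unfolding p_snd hom_def Cstar_def
    using Y.points_snd(2,3)[OF y] \<iota>_P[OF y] Z.P_mult[OF p_fst(1)[OF y]] Z.P_carrier
    by (auto simp: \<iota>_mult)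
  moreover have "snd (p y) \<in> extensional (Z.P (fst (p y)))" unfolding p_snd by simp
  ultimately show ?thesis using p_fst(1)[OF y] unfolding toric_points_def by (simp add: case_prod_beta)
qed

text \<open>By \<open>pb_iff\<close> the cones over \<sigma> are exactly those contained in
  \<open>pb \<sigma>\<close>. Hence the preimage of a chart is a single chart, which is what makes
  the map affine.\<close>

lemma p_chart:
  assumes y: "y \<in> toric_points M pr \<Sigma>" and \<sigma>: "\<sigma> \<in> \<Sigma>'"
  shows "p y \<in> Z.U \<sigma> \<longleftrightarrow> y \<in> Y.U (pb \<sigma>)"
  using p_fst[OF y] p_point[OF y] pb_iff[OF \<sigma> Y.points_snd(1)[OF y]] \<sigma> y
  unfolding toric_chart_def by auto

lemma p_ch:
  assumes \<sigma>: "\<sigma> \<in> \<Sigma>'" and y: "y \<in> Y.U (pb \<sigma>)" and m: "m \<in> Z.S \<sigma>"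
  shows "Z.ch m (p y) = Y.ch (\<iota> m) y"
proof -
  have yp: "y \<in> toric_points M pr \<Sigma>" using Y.chart_points[OF y] .
  have mc: "m \<in> carrier M'" using m Z.S_carrier by auto
  have "m \<in> Z.P (fst (p y)) \<longleftrightarrow> \<iota> m \<in> Y.P (fst y)"
  proof
    assume i: "\<iota> m \<in> Y.P (fst y)"
    have "pr' m (q u) = 0" if "u \<in> fst y" for u
      using pr_q[OF mc, of u] that i Y.points_snd(1)[OF yp] by (auto simp: perp_def)
    then have "q ` fst y \<subseteq> {u\<in>\<sigma>. pr' m u = 0}"
      using pb_iff[OF \<sigma> Y.points_snd(1)[OF yp]] Y.chart_fst(2)[OF y] by auto
    from p_fst(3)[OF yp Z.face_closed[OF \<sigma> m] this] show "m \<in> Z.P (fst (p y))"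
      using mc by (auto simp: perp_def)
  qed (rule \<iota>_P[OF yp])
  then show ?thesis by (auto simp: toric_char_def p_snd)
qed

lemma R_pull:
  assumes \<sigma>: "\<sigma> \<in> \<Sigma>'" and f: "f \<in> Z.R \<sigma>"
  obtains f' where "f' \<in> Y.R (pb \<sigma>)" "\<forall>y\<in>Y.U (pb \<sigma>). f' y = f (p y)"
proof -
  obtain F c where f_eq: "f = (\<lambda>x. \<Sum>m\<in>F. c m * Z.ch m x)" "finite F" "F \<subseteq> Z.S \<sigma>" by (rule Z.RE[OF f])
  show thesis
  proof (rule that[of "\<lambda>x. \<Sum>m\<in>F. c m * Y.ch (\<iota> m) x"])
    show "(\<lambda>x. \<Sum>m\<in>F. c m * Y.ch (\<iota> m) x) \<in> Y.R (pb \<sigma>)"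
      using f_eq \<iota>_S[OF \<sigma>] by (intro Y.R_sumI) auto
    show "\<forall>y\<in>Y.U (pb \<sigma>). (\<Sum>m\<in>F. c m * Y.ch (\<iota> m) y) = f (p y)"
      unfolding f_eq(1) using f_eq(3) p_ch[OF \<sigma>] by (intro ballI sum.cong refl) auto
  qed
qed

lemma Y_open_localI:
  assumes "\<And>x. x \<in> V \<Longrightarrow> \<exists>\<sigma>\<in>\<Sigma>. \<exists>g\<in>Y.R \<sigma>. x \<in> Y.U \<sigma> \<and> g x \<noteq> 0 \<and> {y\<in>Y.U \<sigma>. g y \<noteq> 0} \<subseteq> V"
  shows "openin (ztop Y.Y) V"
proof (subst openin_subopen, intro ballI)
  fix x assume "x \<in> V"
  from assms[OF this] obtain \<sigma> g where g: "\<sigma> \<in> \<Sigma>" "g \<in> Y.R \<sigma>" "x \<in> Y.U \<sigma>" "g x \<noteq> 0" "{y\<in>Y.U \<sigma>. g y \<noteq> 0} \<subseteq> V"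
    by auto
  have "openin (ztop Y.Y) {y\<in>Y.U \<sigma>. g y \<noteq> 0}"
    by (rule Y.Y_openI[OF g(1)]) (use g(2) in auto)
  with g show "\<exists>T. openin (ztop Y.Y) T \<and> x \<in> T \<and> T \<subseteq> V" by auto
qed

lemma preim_local:
  assumes W: "openin (ztop Z.Y) W" and y: "y \<in> preim Y.Y p W"
  shows "\<exists>\<sigma>\<in>\<Sigma>. \<exists>g\<in>Y.R \<sigma>. y \<in> Y.U \<sigma> \<and> g y \<noteq> 0 \<and> {x\<in>Y.U \<sigma>. g x \<noteq> 0} \<subseteq> preim Y.Y p W"
proof -
  have yp: "y \<in> toric_points M pr \<Sigma>" "p y \<in> W" using y by (auto simp: preim_def Y.pts_Y)
  define \<sigma> where "\<sigma> = fst (p y)"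
  have \<sigma>: "\<sigma> \<in> \<Sigma>'" unfolding \<sigma>_def by (rule p_fst(1)[OF yp(1)])
  have pU: "p y \<in> Z.U \<sigma>" using p_point[OF yp(1)] by (simp add: toric_chart_def \<sigma>_def)
  obtain g where g: "g \<in> Z.R \<sigma>" "g (p y) \<noteq> 0" "{x\<in>Z.U \<sigma>. g x \<noteq> 0} \<subseteq> W"
    by (rule Z.Y_open_local[OF W \<sigma> yp(2) pU])
  obtain g' where g': "g' \<in> Y.R (pb \<sigma>)" "\<forall>y\<in>Y.U (pb \<sigma>). g' y = g (p y)" by (rule R_pull[OF \<sigma> g(1)])
  have yU: "y \<in> Y.U (pb \<sigma>)" using p_chart[OF yp(1) \<sigma>] pU by simp
  have "{x\<in>Y.U (pb \<sigma>). g' x \<noteq> 0} \<subseteq> preim Y.Y p W"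
  proof
    fix x assume "x \<in> {x\<in>Y.U (pb \<sigma>). g' x \<noteq> 0}"
    then have x: "x \<in> Y.U (pb \<sigma>)" "g (p x) \<noteq> 0" using g' by auto
    have xp: "x \<in> toric_points M pr \<Sigma>" using Y.chart_points[OF x(1)] .
    then have "p x \<in> Z.U \<sigma>" using p_chart[OF xp \<sigma>] x(1) by simp
    then show "x \<in> preim Y.Y p W" using g(3) x(2) xp by (auto simp: preim_def Y.pts_Y)
  qed
  then show ?thesis using g' yU g(2) by (intro bexI[OF _ pb_cone[OF \<sigma>]] bexI[OF _ g'(1)]) auto
qed

lemma preim_open: "openin (ztop Z.Y) W \<Longrightarrow> openin (ztop Y.Y) (preim Y.Y p W)"
  by (rule Y_open_localI) (rule preim_local)

lemma p_morphism: "fmorphism Y.Y Z.Y p"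
  unfolding fmorphism_def
proof (intro conjI allI impI ballI)
  show "continuous_map (ztop Y.Y) (ztop Z.Y) p"
    unfolding continuous_map_def using preim_open p_point Y.pts_Y Z.pts_Y by (auto simp: preim_def)
next
  fix W h assume W: "openin (ztop Z.Y) W" and h: "h \<in> reg Z.Y W"
  show "(\<lambda>y\<in>preim Y.Y p W. h (p y)) \<in> reg Y.Y (preim Y.Y p W)"
    unfolding Y.Y_reg_iff
  proof (intro conjI ballI)
    fix y assume y: "y \<in> preim Y.Y p W"
    have yp: "y \<in> toric_points M pr \<Sigma>" "p y \<in> W" using y by (auto simp: preim_def Y.pts_Y)
    define \<sigma> where "\<sigma> = fst (p y)"
    have \<sigma>: "\<sigma> \<in> \<Sigma>'" unfolding \<sigma>_def by (rule p_fst(1)[OF yp(1)])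
    have pU: "p y \<in> Z.U \<sigma>" using p_point[OF yp(1)] by (simp add: toric_chart_def \<sigma>_def)
    obtain f g where fg: "f \<in> Z.R \<sigma>" "g \<in> Z.R \<sigma>" "g (p y) \<noteq> 0" "{x\<in>Z.U \<sigma>. g x \<noteq> 0} \<subseteq> W"
      "\<forall>x\<in>Z.U \<sigma>. g x \<noteq> 0 \<longrightarrow> h x = f x / g x"
      by (rule Z.Y_reg_local[OF h \<sigma> yp(2) pU])
    obtain f' where f': "f' \<in> Y.R (pb \<sigma>)" "\<forall>y\<in>Y.U (pb \<sigma>). f' y = f (p y)" by (rule R_pull[OF \<sigma> fg(1)])
    obtain g' where g': "g' \<in> Y.R (pb \<sigma>)" "\<forall>y\<in>Y.U (pb \<sigma>). g' y = g (p y)" by (rule R_pull[OF \<sigma> fg(2)])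
    have yU: "y \<in> Y.U (pb \<sigma>)" using p_chart[OF yp(1) \<sigma>] pU by simp
    have sub: "x \<in> preim Y.Y p W \<and> h (p x) = f' x / g' x" if x: "x \<in> Y.U (pb \<sigma>)" "g' x \<noteq> 0" for x
    proof -
      have xp: "x \<in> toric_points M pr \<Sigma>" using Y.chart_points[OF x(1)] .
      then have "p x \<in> Z.U \<sigma>" using p_chart[OF xp \<sigma>] x(1) by simp
      then show ?thesis using fg(4,5) x f'(2) g'(2) xp by (auto simp: preim_def Y.pts_Y)
    qed
    then have "{x\<in>Y.U (pb \<sigma>). g' x \<noteq> 0} \<subseteq> preim Y.Y p W" by auto
    then show "\<exists>\<sigma>\<in>\<Sigma>. \<exists>f\<in>Y.R \<sigma>. \<exists>g\<in>Y.R \<sigma>. y \<in> Y.U \<sigma> \<and> g y \<noteq> 0 \<and> {y\<in>Y.U \<sigma>. g y \<noteq> 0} \<subseteq> preim Y.Y p W \<and>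
      (\<forall>x\<in>Y.U \<sigma>. g x \<noteq> 0 \<longrightarrow> (\<lambda>y\<in>preim Y.Y p W. h (p y)) x = f x / g x)"
      using yU fg(3) g'(2) sub
      by (intro bexI[OF _ pb_cone[OF \<sigma>]] bexI[OF _ f'(1)] bexI[OF _ g'(1)] conjI) auto
  qed simp
qed

lemma p_affine: "affine_morphism Y.Y Z.Y p"
  unfolding affine_morphism_def
proof (intro conjI ballI p_morphism)
  fix z assume z: "z \<in> pts Z.Y"
  then have zp: "z \<in> toric_points M' pr' \<Sigma>'" by (simp add: Z.pts_Y)
  define \<sigma> where "\<sigma> = fst z"
  have \<sigma>: "\<sigma> \<in> \<Sigma>'" unfolding \<sigma>_def by (rule Z.points_snd(1)[OF zp])
  have "preim Y.Y p (Z.U \<sigma>) = Y.U (pb \<sigma>)"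
    unfolding preim_def Y.pts_Y using p_chart[OF _ \<sigma>] by (auto dest: Y.chart_points)
  then show "\<exists>W. openin (ztop Z.Y) W \<and> z \<in> W \<and> affine_variety (restrict_fspace Z.Y W) \<and>
        affine_variety (restrict_fspace Y.Y (preim Y.Y p W))"
    using Z.U_open[OF \<sigma>] Z.chart_affine[OF \<sigma>] Y.chart_affine[OF pb_cone[OF \<sigma>]] zp
    by (intro exI[of _ "Z.U \<sigma>"]) (auto simp: toric_chart_def \<sigma>_def)
qed

lemma act_point:
  assumes "y \<in> toric_points M pr \<Sigma>" "s \<in> H"
  shows "act s y \<in> toric_points M pr \<Sigma>"
proof -
  have "snd (act s y) \<in> hom (M\<lparr>carrier := Y.P (fst y)\<rparr>) Cstar"
    unfolding act_def hom_def Cstar_def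
    using Y.points_snd(2,3)[OF assms(1)] Y.P_mult[OF Y.points_snd(1)[OF assms(1)]] Y.P_carrier
      ev_nonzero[OF assms(2)] ev_mult[OF assms(2)] by (auto simp: algebra_simps)
  then show ?thesis using Y.points_snd(1)[OF assms(1)] unfolding toric_points_def act_def
    by (simp add: case_prod_beta)
qed

lemma p_act:
  assumes "y \<in> toric_points M pr \<Sigma>" "s \<in> H"
  shows "p (act s y) = p y"
proof -
  have f: "fst (p (act s y)) = fst (p y)" by (simp add: p_def toric_morphism_def Let_def act_def)
  have "snd (act s y) (\<iota> m) = snd y (\<iota> m)" if "m \<in> Z.P (fst (p y))" for m
    using \<iota>_P[OF assms(1) that] ev_\<iota>[OF assms(2)] Z.P_carrier[OF that] by (simp add: act_def)
  then have "snd (p (act s y)) = snd (p y)" unfolding p_snd f by (intro restrict_ext) auto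
  with f show ?thesis by (simp add: prod_eq_iff)
qed

text \<open>Choosing the preimage in the orbit of \<open>pb (fst z)\<close> pays off in
  \<open>invariant_descends\<close>: a character that is nonzero there lies in
  \<open>P (pb \<sigma>)\<close> and is therefore invertible on the whole chart.\<close>

lemma p_surj:
  assumes z: "z \<in> toric_points M' pr' \<Sigma>'"
  obtains y where "y \<in> toric_points M pr \<Sigma>" "p y = z" "fst y = pb (fst z)"
proof -
  define \<sigma> where "\<sigma> = fst z"
  have \<sigma>: "\<sigma> \<in> \<Sigma>'" unfolding \<sigma>_def by (rule Z.points_snd(1)[OF z])
  have "snd z \<in> hom (M'\<lparr>carrier := Z.P \<sigma>\<rparr>) Cstar" using z unfolding \<sigma>_def toric_points_def by auto
  from lift[OF \<sigma> this] obtain \<gamma>' where \<gamma>': "\<gamma>' \<in> hom (M\<lparr>carrier := Y.P (pb \<sigma>)\<rparr>) Cstar"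
    "\<forall>m\<in>Z.P \<sigma>. \<gamma>' (\<iota> m) = snd z m" by auto
  define y where "y = (pb \<sigma>, restrict \<gamma>' (Y.P (pb \<sigma>)))"
  have "restrict \<gamma>' (Y.P (pb \<sigma>)) \<in> hom (M\<lparr>carrier := Y.P (pb \<sigma>)\<rparr>) Cstar"
    using \<gamma>'(1) Y.P_mult[OF pb_cone[OF \<sigma>]] by (auto simp: hom_def)
  then have y: "y \<in> toric_points M pr \<Sigma>" using pb_cone[OF \<sigma>] by (simp add: y_def toric_points_def)
  have f: "fst (p y) = \<sigma>"
  proof
    show "fst (p y) \<subseteq> \<sigma>" using p_fst(3)[OF y \<sigma>] q_pb[OF \<sigma>] by (simp add: y_def)
    have "fst (p y) \<in> \<Sigma>'" by (rule p_fst(1)[OF y])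
    \<comment> \<open>A smaller cone would be cut out of \<sigma> by some \<open>m\<close> that
      vanishes on the image of \<open>pb \<sigma>\<close>. Then \<open>pb_dual\<close>, applied to
      the inverse of \<open>m\<close>, makes \<open>m\<close> vanish on all of \<sigma>.\<close>
    from Z.inter_face[OF \<sigma> this] obtain m where m: "m \<in> Z.S \<sigma>" "\<sigma> \<inter> fst (p y) = {u\<in>\<sigma>. pr' m u = 0}" by auto
    have mc: "m \<in> carrier M'" using m Z.S_carrier by auto
    have "0 \<le> pr' (inv\<^bsub>M'\<^esub> m) (q u)" if "u \<in> pb \<sigma>" for u
    proof -
      have "q u \<in> \<sigma> \<inter> fst (p y)" using that q_pb[OF \<sigma>] p_fst(2)[OF y] by (auto simp: y_def)
      then show ?thesis using m(2) mc by (auto simp: Z.pr_cone[OF \<sigma>])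
    qed
    then have "inv\<^bsub>M'\<^esub> m \<in> Z.S \<sigma>" using pb_dual[OF \<sigma>, of "inv\<^bsub>M'\<^esub> m"] mc by simp
    then have "pr' m u = 0" if "u \<in> \<sigma>" for u
      using m(1) that mc by (force simp: dual_semigroup_def Z.pr_cone[OF \<sigma>])
    then show "\<sigma> \<subseteq> fst (p y)" using m(2) by auto
  qed
  have "snd (p y) = snd z"
  proof (rule extensionalityI[of _ "Z.P \<sigma>"])
    show "snd (p y) \<in> extensional (Z.P \<sigma>)" unfolding p_snd f by simp
    show "snd z \<in> extensional (Z.P \<sigma>)" using Z.points_snd(4)[OF z] by (simp add: \<sigma>_def)
    fix m assume m: "m \<in> Z.P \<sigma>"
    then have "\<iota> m \<in> Y.P (pb \<sigma>)" using \<iota>_P[OF y, of m] f by (simp add: y_def)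
    then show "snd (p y) m = snd z m" unfolding p_snd f using m \<gamma>'(2) by (simp add: y_def)
  qed
  with f have "p y = z" by (simp add: prod_eq_iff \<sigma>_def)
  with y show thesis using that[of y] by (simp add: y_def \<sigma>_def)
qed

end

context toric_quotient
begin

lemma ch_act:
  assumes "y \<in> toric_points M pr \<Sigma>" "m \<in> carrier M"
  shows "Y.ch m (act s y) = ev s m * Y.ch m y"
  using assms by (simp add: toric_char_def act_def)

text \<open>Near \<open>y\<close> the function is another fraction \<open>F2 / G2\<close>. The two
  fractions agree where both denominators are nonzero, so the product of \<open>F2 G - F G2\<close>
  with \<open>G G2\<close> is zero on the chart, and \<open>domain\<close> cancels the second
  factor.\<close>

lemma relation_extends:
  assumes W: "openin (ztop Z.Y) W" and h: "h \<in> reg Y.Y (preim Y.Y p W)" and \<sigma>: "\<sigma> \<in> \<Sigma>"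
    and F: "F \<in> Y.R \<sigma>" and G: "G \<in> Y.R \<sigma>" and y0: "y0 \<in> Y.U \<sigma>" "G y0 \<noteq> 0"
    and D: "{y\<in>Y.U \<sigma>. G y \<noteq> 0} \<subseteq> preim Y.Y p W"
    and rel: "\<forall>y\<in>Y.U \<sigma>. G y \<noteq> 0 \<longrightarrow> h y = F y / G y"
    and y: "y \<in> Y.U \<sigma>" "y \<in> preim Y.Y p W"
  shows "h y * G y = F y"
proof -
  obtain F2 G2 where FG2: "F2 \<in> Y.R \<sigma>" "G2 \<in> Y.R \<sigma>" "G2 y \<noteq> 0" "{x\<in>Y.U \<sigma>. G2 x \<noteq> 0} \<subseteq> preim Y.Y p W"
    "\<forall>x\<in>Y.U \<sigma>. G2 x \<noteq> 0 \<longrightarrow> h x = F2 x / G2 x"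
    by (rule Y.Y_reg_local[OF h \<sigma> y(2,1)])
  obtain a where a: "a \<in> Y.R \<sigma>" "\<And>x. x \<in> Y.U \<sigma> \<Longrightarrow> a x = F2 x * G x" using Y.R_mult[OF \<sigma> FG2(1) G] by metis
  obtain b where b: "b \<in> Y.R \<sigma>" "\<And>x. x \<in> Y.U \<sigma> \<Longrightarrow> b x = F x * G2 x" using Y.R_mult[OF \<sigma> F FG2(2)] by metis
  obtain b' where b': "b' \<in> Y.R \<sigma>" "\<And>x. x \<in> Y.U \<sigma> \<Longrightarrow> b' x = - 1 * b x"
  proof -
    obtain e where e: "e \<in> Y.R \<sigma>" "\<forall>x\<in>toric_points M pr \<Sigma>. e x = - 1"
      using Y.R_monom[OF Y.S_one[OF \<sigma>], of "- 1"] Y.ch_one by (metis mult.right_neutral)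
    obtain b' where b': "b' \<in> Y.R \<sigma>" "\<And>x. x \<in> Y.U \<sigma> \<Longrightarrow> b' x = e x * b x" using Y.R_mult[OF \<sigma> e(1) b(1)] by metis
    show ?thesis by (rule that[OF b'(1)]) (use b'(2) e(2) in \<open>auto dest!: Y.chart_points\<close>)
  qed
  define d where "d x = a x + b' x" for x
  have d: "d \<in> Y.R \<sigma>" unfolding d_def by (rule Y.R_add[OF a(1) b'(1)])
  have d_eq: "d x = F2 x * G x - F x * G2 x" if "x \<in> Y.U \<sigma>" for x
    using that a b b' by (simp add: d_def)
  obtain g where g: "g \<in> Y.R \<sigma>" "\<And>x. x \<in> Y.U \<sigma> \<Longrightarrow> g x = G x * G2 x" using Y.R_mult[OF \<sigma> G FG2(2)] by metis
  have "d x * g x = 0" if x: "x \<in> Y.U \<sigma>" for x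
  proof (cases "G x = 0 \<or> G2 x = 0")
    case False
    then have "F x / G x = F2 x / G2 x" using rel FG2(5) x by metis
    then show ?thesis using False d_eq[OF x] by (simp add: field_simps)
  qed (use g x in auto)
  from domain[OF \<sigma> d g(1) this] have "\<forall>x\<in>Y.U \<sigma>. d x = 0"
  proof
    assume g0: "\<forall>x\<in>Y.U \<sigma>. g x = 0"
    have "(\<forall>x\<in>Y.U \<sigma>. G x = 0) \<or> (\<forall>x\<in>Y.U \<sigma>. G2 x = 0)"
      by (rule domain[OF \<sigma> G FG2(2)]) (use g0 g(2) in auto)
    then show ?thesis using y0 y(1) FG2(3) by blast
  qed
  then have "F2 y * G y = F y * G2 y" using d_eq y(1) by simp
  moreover have "h y = F2 y / G2 y" using FG2(3,5) y(1) by simp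
  ultimately have "G2 y * (h y * G y) = G2 y * F y" using FG2(3) by simp
  then show ?thesis using FG2(3) by simp
qed

text \<open>An invariant regular function is \<open>F/G\<close> near a point of the largest orbit over \<open>z\<close>.
  The relation \<open>h * G = F\<close> splits into weight components, and a component of \<open>G\<close> not vanishing there
  becomes invariant after multiplication by a character, which is a unit on the chart.\<close>

lemma invariant_descends:
  assumes W: "openin (ztop Z.Y) W" and h: "h \<in> reg Y.Y (preim Y.Y p W)"
    and inv: "\<And>s y. s \<in> H \<Longrightarrow> y \<in> preim Y.Y p W \<Longrightarrow> h (act s y) = h y"
    and z: "z \<in> W"
  shows "\<exists>\<sigma>\<in>\<Sigma>'. \<exists>f\<in>Z.R \<sigma>. \<exists>g\<in>Z.R \<sigma>. z \<in> Z.U \<sigma> \<and> g z \<noteq> 0 \<and> {x\<in>Z.U \<sigma>. g x \<noteq> 0} \<subseteq> W \<and>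
    (\<forall>y\<in>Y.U (pb \<sigma>). g (p y) \<noteq> 0 \<longrightarrow> h y = f (p y) / g (p y))"
proof -
  have zp: "z \<in> toric_points M' pr' \<Sigma>'" using openin_subset[OF W] z Z.pts_Y by auto
  define \<sigma> where "\<sigma> = fst z"
  have \<sigma>: "\<sigma> \<in> \<Sigma>'" unfolding \<sigma>_def by (rule Z.points_snd(1)[OF zp])
  have zU: "z \<in> Z.U \<sigma>" using zp by (simp add: toric_chart_def \<sigma>_def)
  obtain y0 where y0: "y0 \<in> toric_points M pr \<Sigma>" "p y0 = z" "fst y0 = pb \<sigma>"
    using p_surj[OF zp] unfolding \<sigma>_def by metis
  have y0U: "y0 \<in> Y.U (pb \<sigma>)" using y0 by (simp add: toric_chart_def)
  have y0W: "y0 \<in> preim Y.Y p W" using y0 z by (simp add: preim_def Y.pts_Y)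
  note pb\<sigma> = pb_cone[OF \<sigma>]
  obtain F G where FG: "F \<in> Y.R (pb \<sigma>)" "G \<in> Y.R (pb \<sigma>)" "G y0 \<noteq> 0" "{x\<in>Y.U (pb \<sigma>). G x \<noteq> 0} \<subseteq> preim Y.Y p W"
    "\<forall>x\<in>Y.U (pb \<sigma>). G x \<noteq> 0 \<longrightarrow> h x = F x / G x"
    by (rule Y.Y_reg_local[OF h pb\<sigma> y0W y0U])
  have rel: "h y * G y = F y" if "y \<in> Y.U (pb \<sigma>)" "y \<in> preim Y.Y p W" for y
    by (rule relation_extends[OF W h pb\<sigma> FG(1,2) y0U FG(3,4,5) that])
  obtain A c where G_eq: "G = (\<lambda>x. \<Sum>m\<in>A. c m * Y.ch m x)" "finite A" "A \<subseteq> Y.S (pb \<sigma>)" by (rule Y.RE[OF FG(2)])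
  obtain B d where F_eq: "F = (\<lambda>x. \<Sum>m\<in>B. d m * Y.ch m x)" "finite B" "B \<subseteq> Y.S (pb \<sigma>)" by (rule Y.RE[OF FG(1)])
  define I where "I = A \<union> B"
  have I: "finite I" "I \<subseteq> Y.S (pb \<sigma>)" "\<And>m. m \<in> I \<Longrightarrow> m \<in> carrier M"
    using G_eq F_eq Y.S_carrier by (auto simp: I_def)
  define c' where "c' m = (if m \<in> A then c m else 0)" for m
  define d' where "d' m = (if m \<in> B then d m else 0)" for m
  have G': "G x = (\<Sum>m\<in>I. c' m * Y.ch m x)" for x
    unfolding G_eq(1) by (rule sum.mono_neutral_cong_left) (use I G_eq in \<open>auto simp: I_def c'_def\<close>)
  have F': "F x = (\<Sum>m\<in>I. d' m * Y.ch m x)" for x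
    unfolding F_eq(1) by (rule sum.mono_neutral_cong_left) (use I F_eq in \<open>auto simp: I_def d'_def\<close>)
  \<comment> \<open>Restriction to the acting group turns equality of weights into equality of
    functions, so that weights can index the components.\<close>
  define w where "w m = restrict (\<lambda>s. ev s m) H" for m
  define Gw where "Gw \<theta> x = (\<Sum>m\<in>{m\<in>I. w m = \<theta>}. c' m * Y.ch m x)" for \<theta> x
  define Fw where "Fw \<theta> x = (\<Sum>m\<in>{m\<in>I. w m = \<theta>}. d' m * Y.ch m x)" for \<theta> x
  have split: "(\<Sum>m\<in>I. t m) = (\<Sum>\<theta>\<in>w ` I. \<Sum>m\<in>{m\<in>I. w m = \<theta>}. t m)" for t :: "'m \<Rightarrow> complex"
    by (rule sum.image_gen[OF I(1)])
  have rel_w: "h y * Gw \<theta> y = Fw \<theta> y" if y: "y \<in> Y.U (pb \<sigma>)" "y \<in> preim Y.Y p W" and \<theta>: "\<theta> \<in> w ` I" for y \<theta>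
  proof -
    have yp: "y \<in> toric_points M pr \<Sigma>" using Y.chart_points[OF y(1)] .
    have z: "(\<Sum>\<theta>\<in>w ` I. (h y * Gw \<theta> y - Fw \<theta> y) * \<theta> s) = 0" if s: "s \<in> H" for s
    proof -
      have ap: "act s y \<in> toric_points M pr \<Sigma>" by (rule act_point[OF yp s])
      have "act s y \<in> Y.U (pb \<sigma>)" using ap y(1) by (simp add: toric_chart_def act_def)
      moreover have "act s y \<in> preim Y.Y p W" using ap p_act[OF yp s] y(2) by (simp add: preim_def Y.pts_Y)
      ultimately have "h y * G (act s y) = F (act s y)" using rel inv[OF s y(2)] by metis
      moreover have "G (act s y) = (\<Sum>\<theta>\<in>w ` I. Gw \<theta> y * \<theta> s)"
      proof -
        have "G (act s y) = (\<Sum>m\<in>I. (c' m * Y.ch m y) * ev s m)"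
          unfolding G' using I(3) by (intro sum.cong refl) (auto simp: ch_act[OF yp])
        also have "\<dots> = (\<Sum>\<theta>\<in>w ` I. Gw \<theta> y * \<theta> s)"
          unfolding split Gw_def sum_distrib_right using s by (intro sum.cong refl) (auto simp: w_def)
        finally show ?thesis .
      qed
      moreover have "F (act s y) = (\<Sum>\<theta>\<in>w ` I. Fw \<theta> y * \<theta> s)"
      proof -
        have "F (act s y) = (\<Sum>m\<in>I. (d' m * Y.ch m y) * ev s m)"
          unfolding F' using I(3) by (intro sum.cong refl) (auto simp: ch_act[OF yp])
        also have "\<dots> = (\<Sum>\<theta>\<in>w ` I. Fw \<theta> y * \<theta> s)"
          unfolding split Fw_def sum_distrib_right using s by (intro sum.cong refl) (auto simp: w_def)
        finally show ?thesis .
      qed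
      ultimately have "h y * (\<Sum>\<theta>\<in>w ` I. Gw \<theta> y * \<theta> s) - (\<Sum>\<theta>\<in>w ` I. Fw \<theta> y * \<theta> s) = 0" by simp
      then show ?thesis unfolding sum_distrib_left sum_subtractf[symmetric] by (simp only: left_diff_distrib mult.assoc)
    qed
    have "h y * Gw \<theta> y - Fw \<theta> y = 0"
    proof (rule Dedekind_independence[of "w ` I" H "\<lambda>\<theta>. \<theta>" "\<lambda>\<theta>. h y * Gw \<theta> y - Fw \<theta> y" \<theta>])
      show "\<exists>r\<in>H. \<forall>i\<in>w ` I. i r = i s * i t" if st: "s \<in> H" "t \<in> H" for s t
      proof -
        obtain r where "r \<in> H" "\<forall>m\<in>carrier M. ev r m = ev s m * ev t m" using H_mult[OF st] by auto
        then show ?thesis using I(3) st by (intro bexI[of _ r]) (auto simp: w_def)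
      qed
      show "\<exists>s\<in>H. i s \<noteq> j s" if "i \<in> w ` I" "j \<in> w ` I" "i \<noteq> j" for i j
      proof (rule ccontr)
        assume "\<not> (\<exists>s\<in>H. i s \<noteq> j s)"
        then have "i = j" using that(1,2) by (intro extensionalityI[of i H j]) (auto simp: w_def)
        with that(3) show False by simp
      qed
      show "\<exists>s\<in>H. i s \<noteq> 0" if "i \<in> w ` I" for i
        using that H_one ev_nonzero I(3) by (auto simp: w_def)
    qed (use I z \<theta> in auto)
    then show ?thesis by simp
  qed
  have "\<exists>\<theta>\<in>w ` I. Gw \<theta> y0 \<noteq> 0"
  proof (rule ccontr)
    assume "\<not> (\<exists>\<theta>\<in>w ` I. Gw \<theta> y0 \<noteq> 0)"
    then have "(\<Sum>\<theta>\<in>w ` I. Gw \<theta> y0) = 0" by (intro sum.neutral) auto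
    then have "G y0 = 0" unfolding G' split Gw_def[symmetric] .
    with FG(3) show False by simp
  qed
  then obtain \<theta> where \<theta>: "\<theta> \<in> w ` I" "Gw \<theta> y0 \<noteq> 0" by auto
  have "\<exists>m0\<in>{m\<in>I. w m = \<theta>}. Y.ch m0 y0 \<noteq> 0"
  proof (rule ccontr)
    assume "\<not> (\<exists>m0\<in>{m\<in>I. w m = \<theta>}. Y.ch m0 y0 \<noteq> 0)"
    then have "Gw \<theta> y0 = 0" unfolding Gw_def by (intro sum.neutral) auto
    with \<theta>(2) show False by simp
  qed
  then obtain m0 where m0: "m0 \<in> I" "w m0 = \<theta>" "Y.ch m0 y0 \<noteq> 0" by auto
  have m0P: "m0 \<in> Y.P (pb \<sigma>)" using Y.ch_nonzero[OF y0(1)] m0(3) y0(3) by simp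
  define n0 where "n0 = inv\<^bsub>M\<^esub> m0"
  have n0P: "n0 \<in> Y.P (pb \<sigma>)" unfolding n0_def by (rule Y.P_inv[OF pb\<sigma> m0P])
  have n0S: "n0 \<in> Y.S (pb \<sigma>)" using n0P Y.P_sub_S by auto
  have n0c: "n0 \<in> carrier M" using Y.P_carrier[OF n0P] .
  \<comment> \<open>All characters of the chosen component have the weight of \<open>m0\<close>, so
    their quotients by \<open>m0\<close> are invariant and come from \<open>M'\<close> by
    \<open>ev_inv\<close>; \<open>pb_dual\<close> shows that they are regular on the chart of
    \<sigma>.\<close>
  have "\<forall>m. \<exists>n. m \<in> {m\<in>I. w m = \<theta>} \<longrightarrow> n \<in> Z.S \<sigma> \<and> \<iota> n = m \<otimes>\<^bsub>M\<^esub> n0"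
  proof
    fix m
    show "\<exists>n. m \<in> {m\<in>I. w m = \<theta>} \<longrightarrow> n \<in> Z.S \<sigma> \<and> \<iota> n = m \<otimes>\<^bsub>M\<^esub> n0"
    proof (cases "m \<in> {m\<in>I. w m = \<theta>}")
      case True
      then have m: "m \<in> I" "w m = w m0" "m \<in> carrier M" using m0 I by auto
      have "ev s (m \<otimes>\<^bsub>M\<^esub> n0) = 1" if s: "s \<in> H" for s
      proof -
        have "ev s m = ev s m0" using m(2) s unfolding w_def by (metis restrict_apply')
        moreover have "ev s m0 * ev s n0 = 1"
        proof -
          have "m0 \<otimes>\<^bsub>M\<^esub> n0 = \<one>\<^bsub>M\<^esub>" using I(3)[OF m0(1)] by (simp add: n0_def)
          moreover have "ev s \<one>\<^bsub>M\<^esub> * ev s \<one>\<^bsub>M\<^esub> = ev s \<one>\<^bsub>M\<^esub>" using ev_mult[OF s, of "\<one>\<^bsub>M\<^esub>" "\<one>\<^bsub>M\<^esub>"] by simp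
          ultimately show ?thesis
            using ev_mult[OF s I(3)[OF m0(1)] n0c] ev_nonzero[OF s, of "\<one>\<^bsub>M\<^esub>"] by simp
        qed
        ultimately show ?thesis using ev_mult[OF s m(3) n0c] by simp
      qed
      then obtain n where n: "n \<in> carrier M'" "m \<otimes>\<^bsub>M\<^esub> n0 = \<iota> n"
        using ev_inv[of "m \<otimes>\<^bsub>M\<^esub> n0"] m(3) n0c by auto
      have "m \<in> Y.S (pb \<sigma>)" using m(1) I(2) by blast
      from Y.S_mult[OF pb\<sigma> this n0S] have "\<iota> n \<in> Y.S (pb \<sigma>)" unfolding n(2) .
      moreover have "pr' n (q u) = pr (\<iota> n) u" if "u \<in> pb \<sigma>" for u
        using pr_q[OF n(1), of u] that pb\<sigma> by auto
      ultimately have "n \<in> Z.S \<sigma>" by (intro pb_dual[OF \<sigma> n(1)]) (auto simp: dual_semigroup_def)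
      with n(2) show ?thesis by auto
    qed auto
  qed
  then obtain nn where nn': "\<forall>m. m \<in> {m\<in>I. w m = \<theta>} \<longrightarrow> nn m \<in> Z.S \<sigma> \<and> \<iota> (nn m) = m \<otimes>\<^bsub>M\<^esub> n0"
    by (rule choice[THEN exE])
  have nn: "nn m \<in> Z.S \<sigma>" "\<iota> (nn m) = m \<otimes>\<^bsub>M\<^esub> n0" if "m \<in> {m\<in>I. w m = \<theta>}" for m
    using nn' that by auto
  have fin: "finite {m\<in>I. w m = \<theta>}" using I(1) by simp
  define g where "g x = (\<Sum>m\<in>{m\<in>I. w m = \<theta>}. c' m * Z.ch (nn m) x)" for x
  define f where "f x = (\<Sum>m\<in>{m\<in>I. w m = \<theta>}. d' m * Z.ch (nn m) x)" for x
  have gR: "g \<in> Z.R \<sigma>" unfolding g_def by (rule Z.R_sumI[OF fin nn(1)])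
  have fR: "f \<in> Z.R \<sigma>" unfolding f_def by (rule Z.R_sumI[OF fin nn(1)])
  have ch_nn: "Z.ch (nn m) (p y) = Y.ch m y * Y.ch n0 y" if "m \<in> {m\<in>I. w m = \<theta>}" "y \<in> Y.U (pb \<sigma>)" for m y
    using p_ch[OF \<sigma> that(2) nn(1)[OF that(1)]] nn(2)[OF that(1)] Y.ch_mult[OF that(2) _ n0S] that(1) I(2) by auto
  have gp: "g (p y) = Gw \<theta> y * Y.ch n0 y" and fp: "f (p y) = Fw \<theta> y * Y.ch n0 y" if "y \<in> Y.U (pb \<sigma>)" for y
    unfolding g_def Gw_def f_def Fw_def sum_distrib_right using ch_nn[OF _ that] by (auto intro!: sum.cong)
  have gz: "g z \<noteq> 0"
    using gp[OF y0U] \<theta>(2) y0 Y.ch_nonzero[OF y0(1), of n0] n0P by auto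
  have rel2: "h y * g (p y) = f (p y)" if "y \<in> Y.U (pb \<sigma>)" "y \<in> preim Y.Y p W" for y
    using gp[OF that(1)] fp[OF that(1)] rel_w[OF that \<theta>(1)] by (simp add: mult.assoc[symmetric])
  obtain g2 where g2: "g2 \<in> Z.R \<sigma>" "g2 z \<noteq> 0" "{x\<in>Z.U \<sigma>. g2 x \<noteq> 0} \<subseteq> W"
    by (rule Z.Y_open_local[OF W \<sigma> z zU])
  obtain gg where gg: "gg \<in> Z.R \<sigma>" "\<And>x. x \<in> Z.U \<sigma> \<Longrightarrow> gg x = g x * g2 x" using Z.R_mult[OF \<sigma> gR g2(1)] by metis
  obtain ff where ff: "ff \<in> Z.R \<sigma>" "\<And>x. x \<in> Z.U \<sigma> \<Longrightarrow> ff x = f x * g2 x" using Z.R_mult[OF \<sigma> fR g2(1)] by metis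
  have "h y = ff (p y) / gg (p y)" if y: "y \<in> Y.U (pb \<sigma>)" "gg (p y) \<noteq> 0" for y
  proof -
    have yp: "y \<in> toric_points M pr \<Sigma>" using Y.chart_points[OF y(1)] .
    have pU: "p y \<in> Z.U \<sigma>" using p_chart[OF yp \<sigma>] y(1) by simp
    have n: "g (p y) \<noteq> 0" "g2 (p y) \<noteq> 0" using y(2) gg(2)[OF pU] by auto
    then have "p y \<in> W" using g2(3) pU by auto
    then have "y \<in> preim Y.Y p W" using yp by (simp add: preim_def Y.pts_Y)
    from rel2[OF y(1) this] show ?thesis using n gg(2)[OF pU] ff(2)[OF pU] by (simp add: field_simps)
  qed
  moreover have "gg z \<noteq> 0" "{x\<in>Z.U \<sigma>. gg x \<noteq> 0} \<subseteq> W" using gg(2) gz g2 zU by auto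
  ultimately show ?thesis using zU
    by (intro bexI[OF _ \<sigma>] bexI[OF _ ff(1)] bexI[OF _ gg(1)] conjI ballI impI)
qed

theorem good_quotient_p: "good_quotient H act Y.Y Z.Y p"
  unfolding good_quotient_def
proof (intro conjI ballI allI impI p_affine)
  fix s y assume "s \<in> H" "y \<in> pts Y.Y"
  then show "p (act s y) = p y" using p_act Y.pts_Y by auto
next
  fix W assume W: "openin (ztop Z.Y) W"
  let ?V = "preim Y.Y p W"
  have Wp: "W \<subseteq> toric_points M' pr' \<Sigma>'" using openin_subset[OF W] Z.pts_Y by simp
  have surj: "\<exists>y\<in>?V. p y = z" if "z \<in> W" for z
  proof -
    have "z \<in> toric_points M' pr' \<Sigma>'" using Wp that by auto
    then obtain y where "y \<in> toric_points M pr \<Sigma>" "p y = z" by (rule p_surj)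
    then show ?thesis using that by (intro bexI[of _ y]) (auto simp: preim_def Y.pts_Y)
  qed
  show "bij_betw (\<lambda>h. \<lambda>y\<in>?V. h (p y)) (reg Z.Y W)
          {h \<in> reg Y.Y ?V. \<forall>s\<in>H. \<forall>y\<in>?V. h (act s y) = h y}"
  proof (rule bij_betw_imageI, rule inj_onI)
    fix h1 h2 assume h: "h1 \<in> reg Z.Y W" "h2 \<in> reg Z.Y W" "(\<lambda>y\<in>?V. h1 (p y)) = (\<lambda>y\<in>?V. h2 (p y))"
    show "h1 = h2"
    proof (rule extensionalityI[of _ W])
      show "h1 \<in> extensional W" "h2 \<in> extensional W" using h(1,2) Z.Y_reg_iff by auto
      fix z assume "z \<in> W"
      from surj[OF this] obtain y where y: "y \<in> ?V" "p y = z" by auto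
      then show "h1 z = h2 z" using fun_cong[OF h(3), of y] by simp
    qed
  next
    show "(\<lambda>h. \<lambda>y\<in>?V. h (p y)) ` reg Z.Y W = {h \<in> reg Y.Y ?V. \<forall>s\<in>H. \<forall>y\<in>?V. h (act s y) = h y}"
    proof (rule subset_antisym; rule subsetI)
    fix k assume "k \<in> (\<lambda>h. \<lambda>y\<in>?V. h (p y)) ` reg Z.Y W"
    then obtain h where h: "h \<in> reg Z.Y W" "k = (\<lambda>y\<in>?V. h (p y))" by auto
    have "k \<in> reg Y.Y ?V" using p_morphism W h unfolding fmorphism_def by simp
    moreover have "k (act s y) = k y" if "s \<in> H" "y \<in> ?V" for s y
    proof -
      have "y \<in> toric_points M pr \<Sigma>" "p y \<in> W" using that(2) by (auto simp: preim_def Y.pts_Y)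
      then have "p (act s y) = p y" "act s y \<in> ?V" using act_point p_act that(1) by (auto simp: preim_def Y.pts_Y)
      then show ?thesis using that(2) h(2) by simp
    qed
    ultimately show "k \<in> {h \<in> reg Y.Y ?V. \<forall>s\<in>H. \<forall>y\<in>?V. h (act s y) = h y}" by simp
  next
    fix h assume "h \<in> {h \<in> reg Y.Y ?V. \<forall>s\<in>H. \<forall>y\<in>?V. h (act s y) = h y}"
    then have h: "h \<in> reg Y.Y ?V" and inv: "\<And>s y. s \<in> H \<Longrightarrow> y \<in> ?V \<Longrightarrow> h (act s y) = h y" by auto
    \<comment> \<open>The choice in the fibre does not matter, since \<open>loc\<close> expresses
      \<open>h\<close> through the point below alone.\<close>
    define k where "k = (\<lambda>z\<in>W. h (SOME y. y \<in> ?V \<and> p y = z))"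
    have sm: "(SOME y. y \<in> ?V \<and> p y = z) \<in> ?V \<and> p (SOME y. y \<in> ?V \<and> p y = z) = z" if "z \<in> W" for z
      by (rule someI_ex) (use surj[OF that] in auto)
    have loc: "\<exists>\<sigma>\<in>\<Sigma>'. \<exists>f\<in>Z.R \<sigma>. \<exists>g\<in>Z.R \<sigma>. z \<in> Z.U \<sigma> \<and> g z \<noteq> 0 \<and> {x\<in>Z.U \<sigma>. g x \<noteq> 0} \<subseteq> W \<and>
      (\<forall>x\<in>Z.U \<sigma>. g x \<noteq> 0 \<longrightarrow> (\<forall>y\<in>?V. p y = x \<longrightarrow> h y = f x / g x))" if z: "z \<in> W" for z
    proof -
      obtain \<sigma> f g where fg: "\<sigma> \<in> \<Sigma>'" "f \<in> Z.R \<sigma>" "g \<in> Z.R \<sigma>" "z \<in> Z.U \<sigma>" "g z \<noteq> 0" "{x\<in>Z.U \<sigma>. g x \<noteq> 0} \<subseteq> W"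
        "\<forall>y\<in>Y.U (pb \<sigma>). g (p y) \<noteq> 0 \<longrightarrow> h y = f (p y) / g (p y)"
        using invariant_descends[OF W h inv z] by auto
      have "h y = f x / g x" if "x \<in> Z.U \<sigma>" "g x \<noteq> 0" "y \<in> ?V" "p y = x" for x y
      proof -
        have "y \<in> toric_points M pr \<Sigma>" using that by (auto simp: preim_def Y.pts_Y)
        from p_chart[OF this fg(1)] have "y \<in> Y.U (pb \<sigma>)" using that by simp
        then show ?thesis using fg(7) that by auto
      qed
      then show ?thesis using fg(4,5,6) by (intro bexI[OF _ fg(1)] bexI[OF _ fg(2)] bexI[OF _ fg(3)]) auto
    qed
    have kp: "k (p y) = h y" if y: "y \<in> ?V" for y
    proof -
      have pW: "p y \<in> W" using y by (simp add: preim_def)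
      obtain \<sigma> f g where fg: "p y \<in> Z.U \<sigma>" "g (p y) \<noteq> 0"
        "\<forall>x\<in>Z.U \<sigma>. g x \<noteq> 0 \<longrightarrow> (\<forall>y\<in>?V. p y = x \<longrightarrow> h y = f x / g x)"
        using loc[OF pW] by auto
      then show ?thesis using sm[OF pW] y pW by (auto simp: k_def)
    qed
    have "k \<in> reg Z.Y W" unfolding Z.Y_reg_iff
    proof (intro conjI ballI)
      show "k \<in> extensional W" by (simp add: k_def)
      fix z assume z: "z \<in> W"
      obtain \<sigma> f g where fg: "\<sigma> \<in> \<Sigma>'" "f \<in> Z.R \<sigma>" "g \<in> Z.R \<sigma>" "z \<in> Z.U \<sigma>" "g z \<noteq> 0" "{x\<in>Z.U \<sigma>. g x \<noteq> 0} \<subseteq> W"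
        "\<forall>x\<in>Z.U \<sigma>. g x \<noteq> 0 \<longrightarrow> (\<forall>y\<in>?V. p y = x \<longrightarrow> h y = f x / g x)"
        using loc[OF z] by auto
      have "k x = f x / g x" if "x \<in> Z.U \<sigma>" "g x \<noteq> 0" for x
      proof -
        have "x \<in> W" using fg(6) that by auto
        then show ?thesis using sm[of x] fg(7) that by (auto simp: k_def)
      qed
      then show "\<exists>\<sigma>\<in>\<Sigma>'. \<exists>f\<in>Z.R \<sigma>. \<exists>g\<in>Z.R \<sigma>. z \<in> Z.U \<sigma> \<and> g z \<noteq> 0 \<and> {y\<in>Z.U \<sigma>. g y \<noteq> 0} \<subseteq> W \<and>
          (\<forall>y\<in>Z.U \<sigma>. g y \<noteq> 0 \<longrightarrow> k y = f y / g y)"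
        using fg(4,5,6) by (intro bexI[OF _ fg(1)] bexI[OF _ fg(2)] bexI[OF _ fg(3)]) auto
    qed
    moreover have "h = (\<lambda>y\<in>?V. k (p y))"
      using kp h by (intro extensionalityI[of h ?V]) (auto simp: Y.Y_reg_iff)
    ultimately show "h \<in> (\<lambda>h. \<lambda>y\<in>?V. h (p y)) ` reg Z.Y W" by auto
    qed
  qed
qed

end

section \<open>Simplicial fans and star subdivisions\<close>

abbreviation cone_of :: "'u::real_vector set \<Rightarrow> 'u set" where "cone_of U \<equiv> convex_cone hull U"

lemma cone_of_sum:
  assumes "finite V" "\<And>u. u \<in> V \<Longrightarrow> 0 \<le> c u" "V \<subseteq> U"
  shows "(\<Sum>u\<in>V. c u *\<^sub>R u) \<in> cone_of U"
  using assms
proof (induction V rule: finite_induct)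
  case (insert u V)
  have "c u *\<^sub>R u \<in> cone_of U" using insert.prems by (intro convex_cone_hull_mul hull_inc) auto
  with insert show ?case by (simp add: convex_cone_hull_add)
qed (simp add: convex_cone_hull_contains_0)

lemma cone_of_finite:
  assumes "finite U"
  shows "cone_of U = {\<Sum>u\<in>U. c u *\<^sub>R u | c. \<forall>u. 0 \<le> c u}"
proof
  have conv: "convex_cone {\<Sum>u\<in>U. c u *\<^sub>R u | c. \<forall>u. 0 \<le> c u}" (is "convex_cone ?C")
    unfolding convex_cone_iff
  proof (intro conjI ballI allI impI)
    show "0 \<in> ?C" by (intro CollectI exI[of _ "\<lambda>_. 0"]) simp
  next
    fix x y assume "x \<in> ?C" "y \<in> ?C"
    then obtain c d where "x = (\<Sum>u\<in>U. c u *\<^sub>R u)" "\<forall>u. 0 \<le> c u" "y = (\<Sum>u\<in>U. d u *\<^sub>R u)" "\<forall>u. 0 \<le> d u" by auto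
    then show "x + y \<in> ?C"
      by (intro CollectI exI[of _ "\<lambda>u. c u + d u"]) (simp add: scaleR_add_left sum.distrib)
  next
    fix x k assume "x \<in> ?C" "(0::real) \<le> k"
    then obtain c where "x = (\<Sum>u\<in>U. c u *\<^sub>R u)" "\<forall>u. 0 \<le> c u" by auto
    with \<open>0 \<le> k\<close> show "k *\<^sub>R x \<in> ?C"
      by (intro CollectI exI[of _ "\<lambda>u. k * c u"]) (simp add: scaleR_sum_right)
  qed
  have "U \<subseteq> ?C"
  proof
    fix w assume w: "w \<in> U"
    have "(\<Sum>u\<in>U. (if u = w then 1 else 0) *\<^sub>R u) = (\<Sum>u\<in>U. if u = w then u else 0)"
      by (rule sum.cong) auto
    then have "w = (\<Sum>u\<in>U. (if u = w then 1 else 0) *\<^sub>R u)" using w assms by simp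
    then show "w \<in> ?C" by (intro CollectI exI[of _ "\<lambda>u. if u = w then 1 else 0"]) simp
  qed
  then show "cone_of U \<subseteq> ?C" using conv by (rule hull_minimal)
  show "?C \<subseteq> cone_of U"
  proof
    fix x assume "x \<in> ?C"
    then obtain c where x: "x = (\<Sum>u\<in>U. c u *\<^sub>R u)" "\<forall>u. 0 \<le> c u" by auto
    then show "x \<in> cone_of U" using assms by (auto intro!: cone_of_sum)
  qed
qed

lemma cone_of_subset: "U \<subseteq> cone_of V \<Longrightarrow> cone_of U \<subseteq> cone_of V"
  by (simp add: hull_minimal convex_cone_convex_cone_hull)

text \<open>Faces are defined by open segments, whose end points must differ. If
  \<open>x \<noteq> y\<close>, then \<open>x + y\<close> is the midpoint of \<open>2 x\<close> and
  \<open>2 y\<close>, and \<open>2 x\<close> is the midpoint of \<open>x\<close> and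
  \<open>3 x\<close>; if \<open>x = y\<close>, the second segment already suffices.\<close>

lemma face_cone_in:
  assumes f: "\<tau> face_of cone_of U" and z: "z \<in> \<tau>" and zxy: "z = x + y" and x: "x \<in> cone_of U" and y: "y \<in> cone_of U"
  shows "x \<in> \<tau>"
proof (cases "x = y")
  case True
  have con: "convex_cone (cone_of U)" by (rule convex_cone_convex_cone_hull)
  show ?thesis
  proof (cases "x = 0")
    case True then show ?thesis using z zxy \<open>x = y\<close> by simp
  next
    case False
    have "3 *\<^sub>R x \<in> cone_of U" using convex_cone_scaleR[OF con _ x, of 3] by simp
    moreover have "x \<noteq> 3 *\<^sub>R x" using False scaleR_cancel_right[of 1 x 3] by simp
    then have "z \<in> open_segment x (3 *\<^sub>R x)"
      unfolding in_segment using zxy True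
      by (intro conjI exI[of _ "1/2"]) (auto simp: algebra_simps scaleR_2 simp flip: scaleR_add_left)
    ultimately show ?thesis using face_ofD[OF f _ x _ z] by blast
  qed
next
  case False
  have con: "convex_cone (cone_of U)" by (rule convex_cone_convex_cone_hull)
  have x2: "2 *\<^sub>R x \<in> cone_of U" and y2: "2 *\<^sub>R y \<in> cone_of U" using x y convex_cone_scaleR[OF con] by auto
  have zs: "z \<in> open_segment (2 *\<^sub>R x) (2 *\<^sub>R y)"
    unfolding in_segment using zxy False by (intro conjI exI[of _ "1/2"]) auto
  have x2t: "2 *\<^sub>R x \<in> \<tau>" using face_ofD[OF f zs x2 y2 z] by auto
  show ?thesis
  proof (cases "x = 0")
    case True then show ?thesis using x2t by simp
  next
    case False
    have "x \<noteq> 3 *\<^sub>R x" using False scaleR_cancel_right[of 1 x 3] by simp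
    then have "2 *\<^sub>R x \<in> open_segment x (3 *\<^sub>R x)"
      unfolding in_segment
      by (intro conjI exI[of _ "1/2"]) (auto simp: algebra_simps simp flip: scaleR_add_left)
    moreover have "3 *\<^sub>R x \<in> cone_of U" using convex_cone_scaleR[OF con _ x, of 3] by simp
    ultimately show ?thesis using face_ofD[OF f _ x _ x2t] by blast
  qed
qed

definition combination :: "'u::real_vector set set \<Rightarrow> ('u \<Rightarrow> real) \<Rightarrow> 'u \<Rightarrow> bool" where
  "combination \<S> c x \<longleftrightarrow> (\<forall>u. 0 \<le> c u) \<and> {u. c u \<noteq> 0} \<in> \<S> \<and> x = (\<Sum>u | c u \<noteq> 0. c u *\<^sub>R u)"

text \<open>Cones are represented by their sets of generators. The assumption \<open>uniq\<close> makes the generators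
  of a cone independent and intersections of cones common faces.\<close>

locale simplicial_fan =
  fixes \<S> :: "'u::euclidean_space set set"
  assumes fin: "finite \<S>" "\<And>A. A \<in> \<S> \<Longrightarrow> finite A"
    and sub: "\<And>A B. A \<in> \<S> \<Longrightarrow> B \<subseteq> A \<Longrightarrow> B \<in> \<S>"
    and uniq: "\<And>c d x. combination \<S> c x \<Longrightarrow> combination \<S> d x \<Longrightarrow> c = d"
    and pure: "\<And>A. A \<in> \<S> \<Longrightarrow> \<exists>U\<in>\<S>. A \<subseteq> U \<and> card U = DIM('u)"
    and nonempty: "{} \<in> \<S>"
begin

lemma combI:
  assumes "U \<in> \<S>" "\<And>u. u \<in> U \<Longrightarrow> 0 \<le> c u" "x = (\<Sum>u\<in>U. c u *\<^sub>R u)"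
  shows "combination \<S> (\<lambda>u. if u \<in> U then c u else 0) x"
proof -
  let ?c = "\<lambda>u. if u \<in> U then c u else 0"
  have s: "{u. ?c u \<noteq> 0} \<subseteq> U" by auto
  have "x = (\<Sum>u\<in>U. ?c u *\<^sub>R u)" unfolding assms(3) by (rule sum.cong) auto
  also have "\<dots> = (\<Sum>u | ?c u \<noteq> 0. ?c u *\<^sub>R u)"
    by (rule sum.mono_neutral_right[OF fin(2)[OF assms(1)] s]) auto
  finally show ?thesis unfolding combination_def using sub[OF assms(1) s] assms(2) by auto
qed

lemma comb_sum:
  assumes "combination \<S> c x" "finite U" "{u. c u \<noteq> 0} \<subseteq> U"
  shows "x = (\<Sum>u\<in>U. c u *\<^sub>R u)"
proof -
  have "x = (\<Sum>u | c u \<noteq> 0. c u *\<^sub>R u)" using assms(1) by (simp add: combination_def)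
  also have "\<dots> = (\<Sum>u\<in>U. c u *\<^sub>R u)" by (rule sum.mono_neutral_left[OF assms(2,3)]) auto
  finally show ?thesis .
qed

lemma mem_cone:
  assumes U: "U \<in> \<S>"
  shows "x \<in> cone_of U \<longleftrightarrow> (\<exists>c. combination \<S> c x \<and> {u. c u \<noteq> 0} \<subseteq> U)"
proof
  assume "x \<in> cone_of U"
  then obtain c where c: "x = (\<Sum>u\<in>U. c u *\<^sub>R u)" "\<forall>u. 0 \<le> c u" using cone_of_finite[OF fin(2)[OF U]] by auto
  show "\<exists>c. combination \<S> c x \<and> {u. c u \<noteq> 0} \<subseteq> U"
    by (rule exI[of _ "\<lambda>u. if u \<in> U then c u else 0"]) (use combI[OF U _ c(1)] c(2) in auto)
next
  assume "\<exists>c. combination \<S> c x \<and> {u. c u \<noteq> 0} \<subseteq> U"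
  then obtain c where c: "combination \<S> c x" "{u. c u \<noteq> 0} \<subseteq> U" by auto
  have "x = (\<Sum>u\<in>U. c u *\<^sub>R u)" by (rule comb_sum[OF c(1) fin(2)[OF U] c(2)])
  moreover have "(\<Sum>u\<in>U. c u *\<^sub>R u) \<in> cone_of U"
    using c(1) fin(2)[OF U] by (intro cone_of_sum) (auto simp: combination_def)
  ultimately show "x \<in> cone_of U" by simp
qed

lemma cone_inter:
  assumes "U \<in> \<S>" "V \<in> \<S>"
  shows "cone_of U \<inter> cone_of V = cone_of (U \<inter> V)"
proof
  show "cone_of (U \<inter> V) \<subseteq> cone_of U \<inter> cone_of V" by (simp add: hull_mono)
  show "cone_of U \<inter> cone_of V \<subseteq> cone_of (U \<inter> V)"
  proof
    fix x assume "x \<in> cone_of U \<inter> cone_of V"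
    then obtain c d where c: "combination \<S> c x" "{u. c u \<noteq> 0} \<subseteq> U" and d: "combination \<S> d x" "{u. d u \<noteq> 0} \<subseteq> V"
      using mem_cone assms by auto
    from uniq[OF c(1) d(1)] c d show "x \<in> cone_of (U \<inter> V)" using mem_cone[of "U \<inter> V" x] sub[OF assms(1)] by auto
  qed
qed

lemma comb_single: "{u} \<in> \<S> \<Longrightarrow> combination \<S> (\<lambda>w. if w = u then 1 else 0) u"
  using combI[of "{u}" "\<lambda>_. 1" u] by simp

lemma cone_mem_vertex:
  assumes "U \<in> \<S>" "{u} \<in> \<S>" "u \<in> cone_of U"
  shows "u \<in> U"
proof -
  obtain c where c: "combination \<S> c u" "{u. c u \<noteq> 0} \<subseteq> U" using mem_cone assms by auto
  from uniq[OF c(1) comb_single[OF assms(2)]] c(2) show ?thesis by auto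
qed

lemma cone_mono_iff:
  assumes "U \<in> \<S>" "V \<in> \<S>"
  shows "cone_of U \<subseteq> cone_of V \<longleftrightarrow> U \<subseteq> V"
proof
  assume s: "cone_of U \<subseteq> cone_of V"
  show "U \<subseteq> V"
  proof
    fix u assume u: "u \<in> U"
    then have "u \<in> cone_of V" using s hull_subset[of U convex_cone] by auto
    moreover have "{u} \<in> \<S>" using sub[OF assms(1)] u by auto
    ultimately show "u \<in> V" using cone_mem_vertex assms by auto
  qed
qed (rule hull_mono)

lemma independent:
  assumes U: "U \<in> \<S>"
  shows "independent U"
proof
  assume "dependent U"
  then obtain k where k: "(\<Sum>u\<in>U. k u *\<^sub>R u) = 0" "\<exists>u\<in>U. k u \<noteq> 0"
    using dependent_finite[OF fin(2)[OF U]] by auto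
  \<comment> \<open>Splitting a linear relation into its positive and negative parts gives two
    nonnegative expressions of one point.\<close>
  let ?x = "\<Sum>u\<in>U. max (k u) 0 *\<^sub>R u"
  have "(\<Sum>u\<in>U. max (k u) 0 *\<^sub>R u) - (\<Sum>u\<in>U. max (- k u) 0 *\<^sub>R u) = (\<Sum>u\<in>U. k u *\<^sub>R u)"
    unfolding sum_subtractf[symmetric] scaleR_left_diff_distrib[symmetric] by (rule sum.cong) (auto simp: max_def)
  then have eq: "?x = (\<Sum>u\<in>U. max (- k u) 0 *\<^sub>R u)" using k(1) by simp
  have "(\<lambda>u. if u \<in> U then max (k u) 0 else 0) = (\<lambda>u. if u \<in> U then max (- k u) 0 else 0)"
    by (rule uniq[OF combI[OF U _ refl] combI[OF U _ eq]]) auto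
  then have "max (k u) 0 = max (- k u) 0" if "u \<in> U" for u using that by metis
  then have "k u = 0" if "u \<in> U" for u using that by (fastforce simp: max_def split: if_splits)
  with k(2) show False by auto
qed

lemma card_le: "U \<in> \<S> \<Longrightarrow> card U \<le> DIM('u)"
  using independent_bound[OF independent] by simp

text \<open>A nonempty face is closed under nonnegative multiples and sums and contains the summands
  of its elements, so the generators lying in it span it. Conversely, if a point of an open segment
  has support in \<open>A\<close>, uniqueness of coordinates and positivity of the two weights force
  both end points into the cone of \<open>A\<close>.\<close>

lemma face_cone:
  assumes U: "U \<in> \<S>"
  shows "\<tau> face_of cone_of U \<and> \<tau> \<noteq> {} \<longleftrightarrow> (\<exists>A\<subseteq>U. \<tau> = cone_of A)"
proof
  assume f: "\<tau> face_of cone_of U \<and> \<tau> \<noteq> {}"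
  have scale: "k *\<^sub>R z \<in> \<tau>" if z: "z \<in> \<tau>" and k: "0 \<le> k" for z k
  proof -
    have zU: "z \<in> cone_of U" using f z face_of_imp_subset by auto
    have m: "k' *\<^sub>R z \<in> \<tau>" if "0 \<le> k'" "k' \<le> 1" for k'
    proof (rule face_cone_in[OF conjunct1[OF f] z])
      show "z = k' *\<^sub>R z + (1 - k') *\<^sub>R z" by (simp add: algebra_simps)
    qed (use zU that in \<open>auto intro: convex_cone_hull_mul\<close>)
    show ?thesis
    proof (cases "k \<le> 1")
      case False
      show ?thesis
      proof (cases "z = 0")
        case False
        have "z \<in> open_segment 0 (k *\<^sub>R z) "
          unfolding in_segment using False \<open>\<not> k \<le> 1\<close> by (intro conjI exI[of _ "1/k"]) auto
        moreover have "k *\<^sub>R z \<in> cone_of U" by (rule convex_cone_hull_mul[OF zU k])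
        ultimately show ?thesis using face_ofD[OF conjunct1[OF f], of z 0 "k *\<^sub>R z"] z convex_cone_hull_contains_0 by blast
      qed (use z in simp)
    qed (use m k in auto)
  qed
  have add: "x + y \<in> \<tau>" if "x \<in> \<tau>" "y \<in> \<tau>" for x y
  proof -
    have "convex \<tau>" using f face_of_imp_convex by auto
    then have "(1/2) *\<^sub>R x + (1/2) *\<^sub>R y \<in> \<tau>" using that by (intro convexD) auto
    from scale[OF this, of 2] show ?thesis by (simp add: algebra_simps)
  qed
  have "convex_cone \<tau>" unfolding convex_cone_iff using scale add f
    by (metis all_not_in_conv order_refl scaleR_zero_left)
  define A where "A = U \<inter> \<tau>"
  have "cone_of A \<subseteq> \<tau>" unfolding A_def by (rule hull_minimal) (use \<open>convex_cone \<tau>\<close> in auto)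
  moreover have "\<tau> \<subseteq> cone_of A"
  proof
    fix z assume z: "z \<in> \<tau>"
    then have "z \<in> cone_of U" using f face_of_imp_subset by auto
    then obtain c where c: "z = (\<Sum>u\<in>U. c u *\<^sub>R u)" "\<forall>u. 0 \<le> c u" using cone_of_finite[OF fin(2)[OF U]] by auto
    have uA: "u \<in> A" if u: "u \<in> U" "c u \<noteq> 0" for u
    proof -
      have "c u *\<^sub>R u \<in> \<tau>"
      proof (rule face_cone_in[OF conjunct1[OF f] z])
        show "z = c u *\<^sub>R u + (\<Sum>w\<in>U - {u}. c w *\<^sub>R w)"
          unfolding c(1) by (rule sum.remove[OF fin(2)[OF U] u(1)])
        show "c u *\<^sub>R u \<in> cone_of U" using u c(2) by (intro convex_cone_hull_mul hull_inc) auto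
        show "(\<Sum>w\<in>U - {u}. c w *\<^sub>R w) \<in> cone_of U"
          by (rule cone_of_sum) (use c(2) fin(2)[OF U] in auto)
      qed
      from scale[OF this, of "1 / c u"] show ?thesis using u c(2) by (simp add: A_def)
    qed
    have "z = (\<Sum>u\<in>A. c u *\<^sub>R u)"
      unfolding c(1) by (rule sum.mono_neutral_right[OF fin(2)[OF U]]) (use uA in \<open>auto simp: A_def\<close>)
    then show "z \<in> cone_of A"
      using c(2) fin(2)[OF U] by (auto intro!: cone_of_sum simp: A_def)
  qed
  ultimately show "\<exists>A\<subseteq>U. \<tau> = cone_of A" by (intro exI[of _ A]) (auto simp: A_def)
next
  assume "\<exists>A\<subseteq>U. \<tau> = cone_of A"
  then obtain A where A: "A \<subseteq> U" "\<tau> = cone_of A" by auto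
  have AS: "A \<in> \<S>" by (rule sub[OF U A(1)])
  have "cone_of A face_of cone_of U"
    unfolding face_of_def
  proof (intro conjI ballI impI)
    show "cone_of A \<subseteq> cone_of U" by (rule hull_mono[OF A(1)])
    show "convex (cone_of A)" by (rule convex_convex_cone_hull)
    fix a b x assume ab: "a \<in> cone_of U" "b \<in> cone_of U" and x: "x \<in> cone_of A" and seg: "x \<in> open_segment a b"
    obtain c where c: "a = (\<Sum>u\<in>U. c u *\<^sub>R u)" "\<forall>u. 0 \<le> c u" using ab(1) cone_of_finite[OF fin(2)[OF U]] by auto
    obtain d where d: "b = (\<Sum>u\<in>U. d u *\<^sub>R u)" "\<forall>u. 0 \<le> d u" using ab(2) cone_of_finite[OF fin(2)[OF U]] by auto
    obtain t where t: "0 < t" "t < 1" "x = (1 - t) *\<^sub>R a + t *\<^sub>R b" using seg by (auto simp: in_segment)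
    have xc: "x = (\<Sum>u\<in>U. ((1 - t) * c u + t * d u) *\<^sub>R u)"
      unfolding t(3) c(1) d(1) by (simp add: scaleR_sum_right scaleR_add_left sum.distrib)
    obtain e where e: "combination \<S> e x" "{u. e u \<noteq> 0} \<subseteq> A" using mem_cone[OF AS] x by auto
    have cx: "combination \<S> (\<lambda>u. if u \<in> U then (1 - t) * c u + t * d u else 0) x"
      by (rule combI[OF U _ xc]) (use c d t in auto)
    have zero: "c u = 0 \<and> d u = 0" if u: "u \<in> U" "u \<notin> A" for u
    proof -
      have "(1 - t) * c u + t * d u = 0" using fun_cong[OF uniq[OF cx e(1)], of u] e(2) u by auto
      moreover have "0 \<le> (1 - t) * c u" "0 \<le> t * d u" using c d t by auto
      ultimately have "(1 - t) * c u = 0" "t * d u = 0" by linarith+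
      then show ?thesis using t by simp
    qed
    have "a = (\<Sum>u\<in>A. c u *\<^sub>R u)" "b = (\<Sum>u\<in>A. d u *\<^sub>R u)"
      unfolding c(1) d(1) by (rule sum.mono_neutral_right[OF fin(2)[OF U] A(1)]; use zero in auto)+
    then show "a \<in> cone_of A" "b \<in> cone_of A"
      using c(2) d(2) fin(2)[OF AS] by (auto intro!: cone_of_sum)
  qed
  with A show "\<tau> face_of cone_of U \<and> \<tau> \<noteq> {}" using convex_cone_hull_nonempty by auto
qed

lemma pointed:
  assumes U: "U \<in> \<S>" and x: "x \<in> cone_of U" "- x \<in> cone_of U"
  shows "x = 0"
proof -
  obtain c where c: "combination \<S> c x" "{u. c u \<noteq> 0} \<subseteq> U" using mem_cone[OF U] x(1) by auto
  obtain d where d: "combination \<S> d (- x)" "{u. d u \<noteq> 0} \<subseteq> U" using mem_cone[OF U] x(2) by auto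
  have "(\<Sum>u\<in>U. (c u + d u) *\<^sub>R u) = x + - x"
    using comb_sum[OF c(1) fin(2)[OF U] c(2)] comb_sum[OF d(1) fin(2)[OF U] d(2)]
    by (simp add: scaleR_add_left sum.distrib)
  then have "c u + d u = 0" if "u \<in> U" for u
    using independent[OF U] dependent_finite[OF fin(2)[OF U]] that by auto
  then have "c u = 0" if "u \<in> U" for u using that c(1) d(1) unfolding combination_def
    by (metis add_nonneg_eq_0_iff)
  then show ?thesis using comb_sum[OF c(1) fin(2)[OF U] c(2)] by simp
qed

lemma is_fan:
  assumes "\<Union>\<S> \<subseteq> N"
  shows "is_fan N (cone_of ` \<S>)"
  unfolding is_fan_def
proof (intro conjI ballI allI impI)
  show "finite (cone_of ` \<S>)" using fin by simp
next
  fix \<sigma> assume "\<sigma> \<in> cone_of ` \<S>"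
  then obtain U where U: "U \<in> \<S>" "\<sigma> = cone_of U" by auto
  then show "\<exists>S. finite S \<and> S \<subseteq> N \<and> \<sigma> = cone_of S" using fin assms by (intro exI[of _ U]) auto
  fix x assume "x \<in> \<sigma> \<and> - x \<in> \<sigma>"
  then show "x = 0" using pointed[OF U(1)] U(2) by auto
next
  fix \<sigma> \<tau> assume "\<sigma> \<in> cone_of ` \<S>" and t: "\<tau> face_of \<sigma> \<and> \<tau> \<noteq> {}"
  then obtain U where U: "U \<in> \<S>" "\<sigma> = cone_of U" by auto
  with t face_cone[OF U(1)] obtain A where "A \<subseteq> U" "\<tau> = cone_of A" by auto
  then show "\<tau> \<in> cone_of ` \<S>" using sub[OF U(1)] by auto
next
  fix \<sigma> \<sigma>' assume "\<sigma> \<in> cone_of ` \<S>" "\<sigma>' \<in> cone_of ` \<S>"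
  then obtain U V where U: "U \<in> \<S>" "\<sigma> = cone_of U" and V: "V \<in> \<S>" "\<sigma>' = cone_of V" by auto
  have "\<sigma> \<inter> \<sigma>' = cone_of (U \<inter> V)" using cone_inter U V by auto
  then show "\<sigma> \<inter> \<sigma>' face_of \<sigma>" "\<sigma> \<inter> \<sigma>' face_of \<sigma>'"
    using face_cone[OF U(1), of "\<sigma> \<inter> \<sigma>'"] face_cone[OF V(1), of "\<sigma> \<inter> \<sigma>'"] U V by auto
qed

lemma max_cones_eq: "max_cones (cone_of ` \<S>) = cone_of ` {U\<in>\<S>. card U = DIM('u)}"
proof
  show "max_cones (cone_of ` \<S>) \<subseteq> cone_of ` {U\<in>\<S>. card U = DIM('u)}"
  proof
    fix \<sigma> assume "\<sigma> \<in> max_cones (cone_of ` \<S>)"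
    then obtain U where U: "U \<in> \<S>" "\<sigma> = cone_of U" and m: "\<And>V. V \<in> \<S> \<Longrightarrow> cone_of U \<subseteq> cone_of V \<Longrightarrow> cone_of V = cone_of U"
      by (auto simp: max_cones_def)
    obtain V where V: "V \<in> \<S>" "U \<subseteq> V" "card V = DIM('u)" using pure[OF U(1)] by auto
    then have "cone_of V = cone_of U" using m hull_mono by blast
    then show "\<sigma> \<in> cone_of ` {U\<in>\<S>. card U = DIM('u)}" using U V by auto
  qed
  show "cone_of ` {U\<in>\<S>. card U = DIM('u)} \<subseteq> max_cones (cone_of ` \<S>)"
  proof
    fix \<sigma> assume "\<sigma> \<in> cone_of ` {U\<in>\<S>. card U = DIM('u)}"
    then obtain U where U: "U \<in> \<S>" "\<sigma> = cone_of U" "card U = DIM('u)" by auto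
    have "cone_of V = cone_of U" if V: "V \<in> \<S>" "cone_of U \<subseteq> cone_of V" for V
    proof -
      have "U = V" using cone_mono_iff[OF U(1) V(1)] V(2) card_le[OF V(1)] U(3)
        by (intro card_seteq[OF fin(2)[OF V(1)]]) auto
      then show ?thesis by simp
    qed
    then show "\<sigma> \<in> max_cones (cone_of ` \<S>)" using U by (auto simp: max_cones_def)
  qed
qed

end

section \<open>The star subdivision of a simplicial fan at one point\<close>

lemma cone_of_eqI: "U \<subseteq> cone_of V \<Longrightarrow> V \<subseteq> cone_of U \<Longrightarrow> cone_of U = cone_of V"
  by (simp add: cone_of_subset subset_antisym)

lemma cone_of_span: "cone_of U \<subseteq> span U"
  by (rule hull_minimal) (auto simp: convex_cone_iff span_base span_add span_mul span_zero)

lemma scaled_in_cone: "0 \<le> k \<Longrightarrow> k *\<^sub>R u \<in> cone_of {u}"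
  by (rule convex_cone_hull_mul[OF hull_inc]) auto

locale star_point = simplicial_fan \<S> for \<S> :: "'u::euclidean_space set set" +
  fixes v :: 'u and l :: "'u \<Rightarrow> real" and T :: "'u set"
  assumes l: "combination \<S> l v" and T: "T = {u. l u \<noteq> 0}" and v0: "v \<noteq> 0"
begin

text \<open>The stellar subdivision in combinatorial form: \<open>T\<close> generates the smallest
  cone containing \<open>v\<close>, and the cones containing \<open>T\<close> give way to the joins
  of \<open>v\<close> with the faces of the star of \<open>T\<close> that do not contain
  \<open>T\<close>. If \<open>v\<close> is already a generator, then \<open>T = {v}\<close> and
  nothing changes.\<close>

definition star :: "'u set set" where
  "star = {A \<in> \<S>. \<not> T \<subseteq> A} \<union> {insert v B | B. B \<in> \<S> \<and> \<not> T \<subseteq> B \<and> T \<union> B \<in> \<S>}"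

lemma TS: "T \<in> \<S>" using l T by (simp add: combination_def)

lemma l_pos: "t \<in> T \<Longrightarrow> 0 < l t" using l T by (auto simp: combination_def order_less_le)

lemma l_nonneg: "0 \<le> l t" using l by (simp add: combination_def)

lemma l_zero: "t \<notin> T \<Longrightarrow> l t = 0" using T by simp

lemma v_sum: "v = (\<Sum>t\<in>T. l t *\<^sub>R t)" using l T by (simp add: combination_def)

lemma T_ne: "T \<noteq> {}" using v_sum v0 by auto

lemma v_vertex:
  assumes "A \<in> \<S>" "v \<in> A"
  shows "T = {v}"
proof -
  have "{v} \<in> \<S>" using sub[OF assms(1)] assms(2) by auto
  from uniq[OF l comb_single[OF this]] T show ?thesis by auto
qed

lemma v_notin: "B \<in> \<S> \<Longrightarrow> \<not> T \<subseteq> B \<Longrightarrow> v \<notin> B"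
  using v_vertex by auto

lemma v_in_cone:
  assumes U: "U \<in> \<S>"
  shows "v \<in> cone_of U \<longleftrightarrow> T \<subseteq> U"
proof
  assume "v \<in> cone_of U"
  then obtain c where c: "combination \<S> c v" "{u. c u \<noteq> 0} \<subseteq> U" using mem_cone[OF U] by auto
  from uniq[OF l c(1)] c(2) T show "T \<subseteq> U" by simp
next
  assume "T \<subseteq> U"
  then show "v \<in> cone_of U" using l T by (intro iffD2[OF mem_cone[OF U]] exI[of _ l]) simp
qed

text \<open>Substituting \<open>v = \<Sum> l t t\<close> translates coordinates of the subdivision
  into coordinates of the old fan. What makes this reversible is that some \<open>t\<close> in
  \<open>T\<close> gets nothing but the share of \<open>v\<close>. The update
  \<open>c(v := 0)\<close> covers the case that \<open>v\<close> itself belongs to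
  \<open>T\<close>.\<close>

lemma star_comb:
  assumes c: "combination star c x"
  obtains t where "t \<in> T" "(c(v := 0)) t = 0"
    "combination \<S> (\<lambda>u. (c(v := 0)) u + c v * l u) x" "0 \<le> c v"
proof -
  let ?A = "{u. c u \<noteq> 0}" and ?B = "{u. (c(v := 0)) u \<noteq> 0}" and ?d = "\<lambda>u. (c(v := 0)) u + c v * l u"
  have A: "?A \<in> star" "\<And>u. 0 \<le> c u" "x = (\<Sum>u\<in>?A. c u *\<^sub>R u)" using c by (auto simp: combination_def)
  have BA: "?B = ?A - {v}" by auto
  have finA: "finite ?A" using A(1) fin(2) unfolding star_def by auto
  have B: "?B \<in> \<S>" "\<not> T \<subseteq> ?B" and TB: "c v \<noteq> 0 \<Longrightarrow> T \<union> ?B \<in> \<S>"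
  proof -
    have "?B \<in> \<S> \<and> \<not> T \<subseteq> ?B \<and> (c v \<noteq> 0 \<longrightarrow> T \<union> ?B \<in> \<S>)"
    proof (cases "?A \<in> \<S> \<and> \<not> T \<subseteq> ?A")
      case True
      then have "c v = 0" using v_notin by auto
      with True show ?thesis unfolding BA using sub by (auto simp: subset_eq)
    next
      case False
      then obtain B where B: "?A = insert v B" "B \<in> \<S>" "\<not> T \<subseteq> B" "T \<union> B \<in> \<S>" using A(1) unfolding star_def by auto
      then have "?B = B" unfolding BA using v_notin by auto
      with B show ?thesis by auto
    qed
    then show "?B \<in> \<S>" "\<not> T \<subseteq> ?B" "c v \<noteq> 0 \<Longrightarrow> T \<union> ?B \<in> \<S>" by auto
  qed
  from B(2) obtain t where t: "t \<in> T" "(c(v := 0)) t = 0" by auto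
  have finTB: "finite (T \<union> ?B)" using fin(2) TS B(1) by auto
  have "x = (\<Sum>u\<in>insert v ?A. c u *\<^sub>R u)"
    unfolding A(3) by (rule sum.mono_neutral_left) (use finA in auto)
  also have "\<dots> = c v *\<^sub>R v + (\<Sum>u\<in>?B. c u *\<^sub>R u)"
    unfolding BA using finA by (simp add: sum.insert_remove)
  also have "(\<Sum>u\<in>?B. c u *\<^sub>R u) = (\<Sum>u\<in>?B. (c(v := 0)) u *\<^sub>R u)"
    by (rule sum.cong) auto
  also have "(\<Sum>u\<in>?B. (c(v := 0)) u *\<^sub>R u) = (\<Sum>u\<in>T \<union> ?B. (c(v := 0)) u *\<^sub>R u)"
    by (rule sum.mono_neutral_left[OF finTB]) auto
  also have "c v *\<^sub>R v = (\<Sum>u\<in>T \<union> ?B. (c v * l u) *\<^sub>R u)"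
  proof -
    have "c v *\<^sub>R v = (\<Sum>u\<in>T. (c v * l u) *\<^sub>R u)" by (subst v_sum) (simp add: scaleR_sum_right)
    also have "\<dots> = (\<Sum>u\<in>T \<union> ?B. (c v * l u) *\<^sub>R u)"
      by (rule sum.mono_neutral_left[OF finTB]) (auto simp: l_zero)
    finally show ?thesis .
  qed
  finally have x: "x = (\<Sum>u\<in>T \<union> ?B. ?d u *\<^sub>R u)"
    by (simp add: sum.distrib[symmetric] scaleR_add_left add.commute)
  have d_nonneg: "0 \<le> ?d u" for u using A(2) l_nonneg by auto
  have "combination \<S> ?d x"
  proof (cases "c v = 0")
    case True
    then have eq: "?d = c" by auto
    have "?A = ?B" using True by auto
    then show ?thesis unfolding eq combination_def using A(2,3) B(1) by simp
  next
    case False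
    have s: "{u. ?d u \<noteq> 0} \<subseteq> T \<union> ?B" using l_zero by auto
    have "x = (\<Sum>u | ?d u \<noteq> 0. ?d u *\<^sub>R u)"
      unfolding x by (rule sum.mono_neutral_right[OF finTB s]) auto
    then show ?thesis unfolding combination_def using d_nonneg sub[OF TB[OF False] s] by auto
  qed
  with t A(2) show thesis using that by auto
qed

text \<open>At a \<open>t\<close> in \<open>T\<close> where the rest of \<open>c\<close> vanishes,
  the common old coordinate equals \<open>c v * l t\<close> and is at least
  \<open>d v * l t\<close>. By symmetry the coefficients of \<open>v\<close> agree, and the others
  follow.\<close>

lemma star_uniq:
  assumes c: "combination star c x" and d: "combination star d x"
  shows "c = d"
proof -
  obtain t where t: "t \<in> T" "(c(v := 0)) t = 0" "combination \<S> (\<lambda>u. (c(v := 0)) u + c v * l u) x" by (rule star_comb[OF c])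
  obtain s where s: "s \<in> T" "(d(v := 0)) s = 0" "combination \<S> (\<lambda>u. (d(v := 0)) u + d v * l u) x" by (rule star_comb[OF d])
  have nn: "0 \<le> c u" "0 \<le> d u" for u using c d by (auto simp: combination_def)
  have eq: "(c(v := 0)) u + c v * l u = (d(v := 0)) u + d v * l u" for u
    using fun_cong[OF uniq[OF t(3) s(3)], of u] by simp
  have "d v * l t \<le> c v * l t" using eq[of t] t(2) nn[of t] by (auto split: if_splits)
  moreover have "c v * l s \<le> d v * l s" using eq[of s] s(2) nn[of s] by (auto split: if_splits)
  ultimately have v: "c v = d v" using l_pos t(1) s(1) by (simp add: order_antisym)
  have "c u = d u" for u using eq[of u] v by (cases "u = v") auto
  then show ?thesis by auto
qed

lemma star_decomp:
  assumes c: "combination \<S> c x"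
  shows "\<exists>A\<in>star. x \<in> cone_of A"
proof (cases "T \<subseteq> {u. c u \<noteq> 0}")
  case False
  then have "{u. c u \<noteq> 0} \<in> star" using c by (auto simp: star_def combination_def)
  moreover have "x \<in> cone_of {u. c u \<noteq> 0}" using mem_cone c by (auto simp: combination_def)
  ultimately show ?thesis by auto
next
  case True
  let ?A = "{u. c u \<noteq> 0}"
  have A: "?A \<in> \<S>" "\<And>u. 0 \<le> c u" using c by (auto simp: combination_def)
  \<comment> \<open>The largest multiple of \<open>v\<close> that can be split off with all
    coordinates staying nonnegative; it makes the coordinate at some \<open>t\<close> in
    \<open>T\<close> vanish.\<close>
  define g where "g = Min ((\<lambda>t. c t / l t) ` T)"
  have finT: "finite T" using fin TS by auto
  have g_le: "g * l t \<le> c t" if "t \<in> T" for t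
  proof -
    have "g \<le> c t / l t" unfolding g_def using finT that by simp
    then show ?thesis using l_pos[OF that] by (simp add: field_simps)
  qed
  have "g \<in> (\<lambda>t. c t / l t) ` T" unfolding g_def using finT T_ne by (intro Min_in) auto
  then obtain t where t: "t \<in> T" "g = c t / l t" by auto
  have g0: "0 \<le> g" using t A l_nonneg by simp
  define d where "d u = c u - g * l u" for u
  have d_nonneg: "0 \<le> d u" for u using g_le[of u] l_zero[of u] A(2)[of u] by (cases "u \<in> T") (auto simp: d_def)
  have dt: "d t = 0" using t l_pos[of t] by (simp add: d_def)
  have dA: "{u. d u \<noteq> 0} \<subseteq> ?A"
  proof
    fix u assume "u \<in> {u. d u \<noteq> 0}"
    then show "u \<in> ?A" using True l_zero[of u] by (cases "u \<in> T") (auto simp: d_def)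
  qed
  define B where "B = {u. d u \<noteq> 0}"
  have B: "B \<in> \<S>" "\<not> T \<subseteq> B" "T \<union> B \<in> \<S>"
    using sub[OF A(1)] dA True dt t(1) by (auto simp: B_def)
  have finB: "finite B" using B fin by auto
  have finA: "finite ?A" using A fin by auto
  have "x = (\<Sum>u\<in>?A. c u *\<^sub>R u)" using c by (simp add: combination_def)
  also have "\<dots> = (\<Sum>u\<in>?A. d u *\<^sub>R u + (g * l u) *\<^sub>R u)"
    by (rule sum.cong) (auto simp: d_def scaleR_add_left[symmetric])
  also have "\<dots> = (\<Sum>u\<in>?A. d u *\<^sub>R u) + (\<Sum>u\<in>?A. (g * l u) *\<^sub>R u)" by (rule sum.distrib)
  also have "(\<Sum>u\<in>?A. (g * l u) *\<^sub>R u) = (\<Sum>u\<in>T. (g * l u) *\<^sub>R u)"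
    by (rule sum.mono_neutral_right[OF finA True]) (auto simp: l_zero)
  also have "(\<Sum>u\<in>T. (g * l u) *\<^sub>R u) = g *\<^sub>R v" by (subst v_sum) (simp add: scaleR_sum_right)
  also have "(\<Sum>u\<in>?A. d u *\<^sub>R u) = (\<Sum>u\<in>B. d u *\<^sub>R u)"
    by (rule sum.mono_neutral_right[OF finA dA[folded B_def]]) (auto simp: B_def)
  finally have x: "x = (\<Sum>u\<in>B. d u *\<^sub>R u) + g *\<^sub>R v" .
  have "insert v B \<in> star" using B by (auto simp: star_def)
  moreover have "x \<in> cone_of (insert v B)" unfolding x
  proof (rule convex_cone_hull_add)
    show "(\<Sum>u\<in>B. d u *\<^sub>R u) \<in> cone_of (insert v B)" using finB d_nonneg by (intro cone_of_sum) auto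
    show "g *\<^sub>R v \<in> cone_of (insert v B)" using g0 by (intro convex_cone_hull_mul hull_inc) auto
  qed
  ultimately show ?thesis by auto
qed

lemma star_refines:
  assumes "A \<in> star"
  shows "\<exists>U\<in>\<S>. cone_of A \<subseteq> cone_of U"
proof (cases "A \<in> \<S>")
  case False
  with assms obtain B where B: "A = insert v B" "T \<union> B \<in> \<S>" by (auto simp: star_def)
  have "v \<in> cone_of (T \<union> B)" using v_in_cone[OF B(2)] by auto
  then have "insert v B \<subseteq> cone_of (T \<union> B)" using hull_subset[of "T \<union> B" convex_cone] by auto
  then show ?thesis using B cone_of_subset by metis
qed auto

lemma star_maximal:
  assumes U: "U \<in> \<S>" "T \<subseteq> U" "card U = DIM('u)" and t: "t \<in> T"
  shows "insert v (U - {t}) \<in> star" "card (insert v (U - {t})) = DIM('u)"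
proof -
  have "T \<union> (U - {t}) = U" using U(2) t by auto
  then have B: "U - {t} \<in> \<S>" "\<not> T \<subseteq> U - {t}" "T \<union> (U - {t}) \<in> \<S>"
    using sub[OF U(1), of "U - {t}"] U(1) t by auto
  then show "insert v (U - {t}) \<in> star" by (auto simp: star_def)
  have "v \<notin> U - {t}" using v_notin B by auto
  then show "card (insert v (U - {t})) = DIM('u)"
    using U t fin(2)[OF U(1)] by (simp add: card_Suc_Diff1 subset_iff)
qed

lemma simplicial_star: "simplicial_fan star"
proof
  have "star \<subseteq> \<S> \<union> insert v ` \<S>" by (auto simp: star_def)
  then show "finite star" by (rule finite_subset) (use fin(1) in simp)
  show "finite A" if "A \<in> star" for A using that fin(2) by (auto simp: star_def)
  show "B \<in> star" if A: "A \<in> star" and BA: "B \<subseteq> A" for A B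
  proof (cases "A \<in> \<S> \<and> \<not> T \<subseteq> A")
    case True
    then have "B \<in> \<S>" "\<not> T \<subseteq> B" using BA sub[of A B] by auto
    then show ?thesis by (simp add: star_def)
  next
    case False
    then obtain C where C: "A = insert v C" "C \<in> \<S>" "\<not> T \<subseteq> C" "T \<union> C \<in> \<S>" using A unfolding star_def by auto
    show ?thesis
    proof (cases "v \<in> B")
      case True
      have "B = insert v (B - {v})" "B - {v} \<subseteq> C" using True BA C by auto
      moreover have "B - {v} \<in> \<S>" "\<not> T \<subseteq> B - {v}" "T \<union> (B - {v}) \<in> \<S>"
        using sub[OF C(2), of "B - {v}"] sub[OF C(4), of "T \<union> (B - {v})"] \<open>B - {v} \<subseteq> C\<close> C(3) by auto
      ultimately show ?thesis unfolding star_def by blast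
    next
      case False
      then have "B \<subseteq> C" using BA C by auto
      then show ?thesis unfolding star_def using sub[OF C(2)] C(3) by auto
    qed
  qed
  show "c = d" if "combination star c x" "combination star d x" for c d x by (rule star_uniq[OF that])
  show "\<exists>U\<in>star. A \<subseteq> U \<and> card U = DIM('u)" if A: "A \<in> star" for A
  proof (cases "A \<in> \<S> \<and> \<not> T \<subseteq> A")
    case True
    obtain U where U: "U \<in> \<S>" "A \<subseteq> U" "card U = DIM('u)" using pure True by auto
    show ?thesis
    proof (cases "T \<subseteq> U")
      case False
      then show ?thesis using U by (intro bexI[of _ U]) (auto simp: star_def)
    next
      case T: True
      obtain t where t: "t \<in> T" "t \<notin> A" using True by auto
      then show ?thesis using star_maximal[OF U(1) T U(3) t(1)] U(2)
        by (intro bexI[of _ "insert v (U - {t})"]) auto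
    qed
  next
    case False
    then obtain C where C: "A = insert v C" "C \<in> \<S>" "\<not> T \<subseteq> C" "T \<union> C \<in> \<S>" using A unfolding star_def by auto
    obtain U where U: "U \<in> \<S>" "T \<union> C \<subseteq> U" "card U = DIM('u)" using pure[OF C(4)] by auto
    obtain t where t: "t \<in> T" "t \<notin> C" using C by auto
    then show ?thesis using star_maximal[OF U(1) _ U(3) t(1)] U(2) C(1)
      by (intro bexI[of _ "insert v (U - {t})"]) auto
  qed
  show "{} \<in> star" using nonempty T_ne by (auto simp: star_def)
qed

interpretation st: simplicial_fan star by (rule simplicial_star)

text \<open>\<open>star_refinement\<close> speaks of arbitrary independent generators of a cone,
  which therefore have to be matched with those in the collection. Each \<open>u\<close> spans an
  extreme ray, so every summand in its expansion by \<open>V\<close> is a multiple of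
  \<open>u\<close>, and a nonzero one identifies the ray.\<close>

lemma same_cone_rays:
  assumes U: "independent U" "card U = DIM('u)" and V: "V \<in> \<S>" and eq: "cone_of U = cone_of V"
  obtains \<rho> where "bij_betw \<rho> U V" "\<And>u. u \<in> U \<Longrightarrow> cone_of {u} = cone_of {\<rho> u}"
proof -
  have finU: "finite U" using U(1) independent_bound by auto
  have "\<exists>a\<in>V. cone_of {u} = cone_of {a}" if u: "u \<in> U" for u
  proof -
    have u0: "u \<noteq> 0" using U(1) u dependent_zero by auto
    have uV: "u \<in> cone_of V" using u eq hull_subset[of U convex_cone] by auto
    then obtain c where c: "u = (\<Sum>a\<in>V. c a *\<^sub>R a)" "\<forall>a. 0 \<le> c a" using cone_of_finite[OF fin(2)[OF V]] by auto
    have ray: "\<exists>k\<ge>0. c a *\<^sub>R a = k *\<^sub>R u" if a: "a \<in> V" for a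
    proof -
      have "c a *\<^sub>R a \<in> cone_of U"
        unfolding eq by (rule convex_cone_hull_mul[OF hull_inc[OF a]]) (use c(2) in auto)
      then obtain d where d: "c a *\<^sub>R a = (\<Sum>w\<in>U. d w *\<^sub>R w)" "\<forall>w. 0 \<le> d w"
        unfolding cone_of_finite[OF finU] by auto
      have "(\<Sum>b\<in>V - {a}. c b *\<^sub>R b) \<in> cone_of U"
        unfolding eq by (rule cone_of_sum) (use c(2) fin(2)[OF V] in auto)
      then obtain e where e: "(\<Sum>b\<in>V - {a}. c b *\<^sub>R b) = (\<Sum>w\<in>U. e w *\<^sub>R w)" "\<forall>w. 0 \<le> e w"
        unfolding cone_of_finite[OF finU] by auto
      have "u = (\<Sum>w\<in>U. (d w + e w) *\<^sub>R w)"
        unfolding scaleR_add_left sum.distrib d(1)[symmetric] e(1)[symmetric]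
        unfolding c(1) by (rule sum.remove[OF fin(2)[OF V] a])
      moreover have "u = (\<Sum>w\<in>U. (if w = u then 1 else 0) *\<^sub>R w)"
      proof -
        have "(\<Sum>w\<in>U. (if w = u then 1 else 0) *\<^sub>R w) = (\<Sum>w\<in>U. if w = u then w else 0)" by (rule sum.cong) auto
        then show ?thesis using u finU by simp
      qed
      ultimately have "(\<Sum>w\<in>U. (d w + e w - (if w = u then 1 else 0)) *\<^sub>R w) = 0"
        by (simp add: scaleR_diff_left sum_subtractf)
      from independentD[OF U(1) finU order_refl this]
      have "d w + e w = (if w = u then 1 else 0)" if "w \<in> U" for w
        using that by fastforce
      then have "d w = 0" if "w \<in> U" "w \<noteq> u" for w
        using that d(2) e(2) by (metis add_nonneg_eq_0_iff)
      then have "(\<Sum>w\<in>U. d w *\<^sub>R w) = d u *\<^sub>R u"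
        using u finU by (subst sum.remove[OF finU u]) (simp add: sum.neutral)
      then show ?thesis using d by auto
    qed
    have "\<exists>a\<in>V. c a *\<^sub>R a \<noteq> 0"
    proof (rule ccontr)
      assume "\<not> ?thesis"
      then have "u = 0" unfolding c(1) by (intro sum.neutral) auto
      with u0 show False by simp
    qed
    then obtain a where a: "a \<in> V" "c a *\<^sub>R a \<noteq> 0" by auto
    obtain k where k: "k \<ge> 0" "c a *\<^sub>R a = k *\<^sub>R u" using ray[OF a(1)] by auto
    have ca: "c a > 0" using a c(2) by (auto simp: order_less_le)
    have kp: "k > 0" using k a by (auto simp: order_less_le)
    have "a = (k / c a) *\<^sub>R u" using arg_cong[OF k(2), of "\<lambda>x. (1 / c a) *\<^sub>R x"] ca by simp
    then have "a \<in> cone_of {u}" using kp ca scaled_in_cone[of "k / c a" u] by simp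
    moreover have "u = (c a / k) *\<^sub>R a" using arg_cong[OF k(2), of "\<lambda>x. (1 / k) *\<^sub>R x"] kp by simp
    then have "u \<in> cone_of {a}" using kp ca scaled_in_cone[of "c a / k" a] by simp
    ultimately show ?thesis using a(1) by (intro bexI[of _ a] cone_of_eqI) auto
  qed
  then obtain \<rho> where \<rho>: "\<And>u. u \<in> U \<Longrightarrow> \<rho> u \<in> V" "\<And>u. u \<in> U \<Longrightarrow> cone_of {u} = cone_of {\<rho> u}" by metis
  have "inj_on \<rho> U"
  proof (rule inj_onI)
    fix u w assume uw: "u \<in> U" "w \<in> U" "\<rho> u = \<rho> w"
    have "cone_of {u} = cone_of {w}" using \<rho>(2)[OF uw(1)] \<rho>(2)[OF uw(2)] uw(3) by simp
    then have "u \<in> span {w}" using hull_inc[of u "{u}" convex_cone] cone_of_span[of "{w}"] by auto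
    show "u = w"
    proof (rule ccontr)
      assume "u \<noteq> w"
      then have "span {w} \<subseteq> span (U - {u})" using uw by (intro span_mono) auto
      with \<open>u \<in> span {w}\<close> U(1) uw(1) show False by (auto simp: dependent_def)
    qed
  qed
  moreover have "\<rho> ` U = V"
  proof (rule card_seteq[OF fin(2)[OF V]])
    show "card V \<le> card (\<rho> ` U)" using card_image[OF \<open>inj_on \<rho> U\<close>] U(2) card_le[OF V] by simp
  qed (use \<rho> in auto)
  ultimately show thesis using that[of \<rho>] \<rho>(2) by (auto simp: bij_betw_def)
qed

lemma star_refinement_star:
  assumes N: "\<Union>\<S> \<subseteq> N" "v \<in> N"
  shows "star_refinement N (cone_of ` \<S>) v (cone_of ` star)"
  unfolding star_refinement_def
proof (intro conjI allI impI ballI)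
  have "\<Union>star \<subseteq> N" using N by (auto simp: star_def)
  then show "is_fan N (cone_of ` star)" by (rule st.is_fan)
  show "fan_refines (cone_of ` star) (cone_of ` \<S>)"
    unfolding fan_refines_def
  proof (intro conjI ballI)
    show "\<Union> (cone_of ` star) = \<Union> (cone_of ` \<S>)"
    proof
      show "\<Union> (cone_of ` star) \<subseteq> \<Union> (cone_of ` \<S>)" using star_refines by fastforce
      show "\<Union> (cone_of ` \<S>) \<subseteq> \<Union> (cone_of ` star)"
      proof
        fix x assume "x \<in> \<Union> (cone_of ` \<S>)"
        then obtain c where "combination \<S> c x" using mem_cone by auto
        from star_decomp[OF this] show "x \<in> \<Union> (cone_of ` star)" by auto
      qed
    qed
    fix \<tau> assume "\<tau> \<in> cone_of ` star"
    then show "\<exists>\<sigma>\<in>cone_of ` \<S>. \<tau> \<subseteq> \<sigma>" using star_refines by auto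
  qed
next
  fix U u
  assume U: "independent U \<and> card U = DIM('u) \<and> cone_of U \<in> cone_of ` \<S> \<and> v \<in> cone_of U" and u: "u \<in> U"
    and ind: "independent (insert v (U - {u})) \<and> card (insert v (U - {u})) = DIM('u)"
  then obtain V where V: "V \<in> \<S>" "cone_of U = cone_of V" by auto
  obtain \<rho> where \<rho>: "bij_betw \<rho> U V" "\<And>u. u \<in> U \<Longrightarrow> cone_of {u} = cone_of {\<rho> u}"
    using same_cone_rays[OF _ _ V] U by metis
  have mem: "w \<in> cone_of {\<rho> w}" "\<rho> w \<in> cone_of {w}" if "w \<in> U" for w
    using \<rho>(2)[OF that] hull_inc[of w "{w}"] hull_inc[of "\<rho> w" "{\<rho> w}"] by auto
  have im: "\<rho> ` (U - {u}) = V - {\<rho> u}" using \<rho>(1) u by (auto simp: bij_betw_def inj_on_def)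
  have sub1: "U - {u} \<subseteq> cone_of (V - {\<rho> u})"
  proof
    fix w assume w: "w \<in> U - {u}"
    then have "\<rho> w \<in> V - {\<rho> u}" using im by auto
    then have "cone_of {\<rho> w} \<subseteq> cone_of (V - {\<rho> u})" by (intro hull_mono) auto
    then show "w \<in> cone_of (V - {\<rho> u})" using mem(1)[of w] w by auto
  qed
  have sub2: "V - {\<rho> u} \<subseteq> cone_of (U - {u})"
  proof
    fix a assume "a \<in> V - {\<rho> u}"
    then obtain w where w: "w \<in> U - {u}" "a = \<rho> w" using im by auto
    then have "cone_of {w} \<subseteq> cone_of (U - {u})" by (intro hull_mono) auto
    then show "a \<in> cone_of (U - {u})" using mem(2)[of w] w by auto
  qed
  have m: "cone_of X \<subseteq> cone_of (insert v X)" for X by (rule hull_mono) auto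
  have "cone_of (insert v (U - {u})) = cone_of (insert v (V - {\<rho> u}))"
    by (rule cone_of_eqI) (use sub1 sub2 m hull_inc[of v "insert v _" convex_cone] in auto)
  moreover have "insert v (V - {\<rho> u}) \<in> star"
  proof (rule star_maximal(1)[OF V(1)])
    show T: "T \<subseteq> V" using v_in_cone[OF V(1)] U V(2) by auto
    show "card V = DIM('u)" using bij_betw_same_card[OF \<rho>(1)] U by simp
    \<comment> \<open>If the omitted generator had coefficient zero, \<open>v\<close> would depend
      on the remaining ones, against the independence of the requested generators.\<close>
    show "\<rho> u \<in> T"
    proof (rule ccontr)
      assume "\<rho> u \<notin> T"
      then have "T \<subseteq> V - {\<rho> u}" using T by auto
      then have "v \<in> cone_of (V - {\<rho> u})" using v_in_cone[of "V - {\<rho> u}"] sub[OF V(1)] by auto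
      then have "v \<in> cone_of (U - {u})" using cone_of_subset[OF sub2] by auto
      then have vs: "v \<in> span (U - {u})" using cone_of_span by auto
      have "v \<notin> U - {u}"
      proof
        assume "v \<in> U - {u}"
        then have "card (insert v (U - {u})) = card (U - {u})" by (simp add: insert_absorb)
        moreover have "card (U - {u}) < card U" using u U independent_bound by (intro psubset_card_mono) auto
        ultimately show False using ind U by simp
      qed
      then have "insert v (U - {u}) - {v} = U - {u}" by auto
      then show False using ind vs unfolding dependent_def by (metis insertI1)
    qed
  qed
  ultimately show "cone_of (insert v (U - {u})) \<in> cone_of ` star" by auto
qed

text \<open>Minimality enters only through the fact that \<open>star\<close> refines
  \<open>\<Sigma>2\<close>. A maximal cone of \<open>star\<close> that is an old cone lies in a cone
  of \<open>\<Sigma>2\<close>, which lies in an old cone, so all three coincide; the other maximal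
  cones are requested explicitly.\<close>

theorem star_subdivision_eq:
  assumes N: "\<Union>\<S> \<subseteq> N" "v \<in> N" and sd: "star_subdivision N (cone_of ` \<S>) v \<Sigma>2"
  shows "\<Sigma>2 = cone_of ` star"
proof -
  have ref: "star_refinement N (cone_of ` \<S>) v \<Sigma>2" using sd by (simp add: star_subdivision_def)
  have min: "fan_refines (cone_of ` star) \<Sigma>2"
    using sd star_refinement_star[OF N] by (simp add: star_subdivision_def)
  have fan: "is_fan N \<Sigma>2" and fr: "fan_refines \<Sigma>2 (cone_of ` \<S>)"
    using ref by (auto simp: star_refinement_def)
  have maxc: "cone_of U \<in> \<Sigma>2" if U: "U \<in> star" "card U = DIM('u)" for U
  proof (cases "U \<in> \<S> \<and> \<not> T \<subseteq> U")
    case True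
    obtain \<sigma> where \<sigma>: "\<sigma> \<in> \<Sigma>2" "cone_of U \<subseteq> \<sigma>" using min U by (auto simp: fan_refines_def)
    obtain W where W: "W \<in> \<S>" "\<sigma> \<subseteq> cone_of W" using fr \<sigma>(1) by (auto simp: fan_refines_def)
    have "U \<subseteq> W" using cone_mono_iff[of U W] True W \<sigma> by auto
    then have "U = W" using card_le[OF W(1)] U(2) by (intro card_seteq[OF fin(2)[OF W(1)]]) auto
    then show ?thesis using \<sigma> W by auto
  next
    case False
    then obtain B where B: "U = insert v B" "B \<in> \<S>" "\<not> T \<subseteq> B" "T \<union> B \<in> \<S>" using U unfolding star_def by auto
    have vB: "v \<notin> B" using v_notin B by auto
    have finB: "finite B" using fin B by auto
    obtain t where t: "t \<in> T" "t \<notin> B" using B by auto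
    have "card (insert t B) = DIM('u)" using U(2) B(1) vB t finB by simp
    moreover have "insert t B \<subseteq> T \<union> B" using t by auto
    ultimately have eq: "insert t B = T \<union> B"
      using card_le[OF B(4)] by (intro card_seteq[OF fin(2)[OF B(4)]]) auto
    have TB: "T \<union> B \<in> \<S>" "card (T \<union> B) = DIM('u)" using B(4) eq \<open>card (insert t B) = DIM('u)\<close> by auto
    have "v \<in> cone_of (T \<union> B)" using v_in_cone[OF TB(1)] by auto
    moreover have "T \<union> B - {t} = B" using eq t by auto
    moreover have "independent (insert v B)" using st.independent[OF U(1)] B(1) by simp
    moreover have "\<forall>U. independent U \<and> card U = DIM('u) \<and> cone_of U \<in> cone_of ` \<S> \<and> v \<in> cone_of U \<longrightarrow>
        (\<forall>u\<in>U. independent (insert v (U - {u})) \<and> card (insert v (U - {u})) = DIM('u) \<longrightarrow>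
           cone_of (insert v (U - {u})) \<in> \<Sigma>2)"
      using ref unfolding star_refinement_def by (elim conjE)
    from this[rule_format, of "T \<union> B" t] have "independent (T \<union> B) \<Longrightarrow> v \<in> cone_of (T \<union> B) \<Longrightarrow>
        independent (insert v (T \<union> B - {t})) \<Longrightarrow> card (insert v (T \<union> B - {t})) = DIM('u) \<Longrightarrow>
        cone_of (insert v (T \<union> B - {t})) \<in> \<Sigma>2" using TB t(1) by simp
    ultimately show ?thesis using independent[OF TB(1)] U(2) B(1) by simp
  qed
  have faces: "\<tau> \<in> \<Sigma>2" if "\<sigma> \<in> \<Sigma>2" "\<tau> face_of \<sigma>" "\<tau> \<noteq> {}" for \<sigma> \<tau>
    using fan that by (auto simp: is_fan_def)
  have sub1: "cone_of A \<in> \<Sigma>2" if A: "A \<in> star" for A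
  proof -
    obtain U where U: "U \<in> star" "A \<subseteq> U" "card U = DIM('u)" using st.pure[OF A] by auto
    have "cone_of A face_of cone_of U \<and> cone_of A \<noteq> {}" using st.face_cone[OF U(1)] U(2) by auto
    then show ?thesis using faces[OF maxc[OF U(1,3)]] by auto
  qed
  have "\<sigma> \<in> cone_of ` star" if \<sigma>: "\<sigma> \<in> \<Sigma>2" for \<sigma>
  proof -
    obtain S where S: "\<sigma> = cone_of S" using fan \<sigma> by (auto simp: is_fan_def)
    \<comment> \<open>Some cone of \<open>star\<close> contains a relative interior point of
      \<sigma>. The intersection of the two is a face of \<sigma> through that point, hence all of
      \<sigma>, and also a face of the cone of \<open>star\<close>.\<close>
    have "rel_interior \<sigma> \<noteq> {}"
      unfolding S by (metis convex_convex_cone_hull convex_cone_hull_nonempty rel_interior_eq_empty)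
    then obtain x where x: "x \<in> rel_interior \<sigma>" by auto
    then have "x \<in> \<Union>\<Sigma>2" using \<sigma> rel_interior_subset by auto
    also have "\<Union>\<Sigma>2 = \<Union>(cone_of ` \<S>)" using fr by (simp add: fan_refines_def)
    finally obtain c where "combination \<S> c x" using mem_cone by auto
    from star_decomp[OF this] obtain A where A: "A \<in> star" "x \<in> cone_of A" by auto
    have f: "\<sigma> \<inter> cone_of A face_of \<sigma>" "\<sigma> \<inter> cone_of A face_of cone_of A"
      using fan \<sigma> sub1[OF A(1)] by (auto simp: is_fan_def)
    have "\<not> disjnt (\<sigma> \<inter> cone_of A) (rel_interior \<sigma>)"
      using x A(2) rel_interior_subset[of \<sigma>] unfolding disjnt_def by blast
    then have "\<sigma> \<subseteq> \<sigma> \<inter> cone_of A" using subset_of_face_of[OF f(1) order_refl] by (simp add: disjnt_def)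
    then have eq: "\<sigma> \<inter> cone_of A = \<sigma>" by auto
    have "\<sigma> \<noteq> {}" using x rel_interior_subset by auto
    with f(2) eq st.face_cone[OF A(1), of \<sigma>] obtain A' where "A' \<subseteq> A" "\<sigma> = cone_of A'" by auto
    then show ?thesis using st.sub[OF A(1)] by auto
  qed
  with sub1 show ?thesis by auto
qed

end

section \<open>Rounding functions\<close>

definition rvec :: "int^'n \<Rightarrow> real^'n" where "rvec x = (\<chi> j. of_int (x $ j))"

lemma rvec_add: "rvec (x + y) = rvec x + rvec y" by (simp add: rvec_def vec_eq_iff)
lemma rvec_diff: "rvec (x - y) = rvec x - rvec y" by (simp add: rvec_def vec_eq_iff)
lemma rvec_zero: "rvec 0 = 0" by (simp add: rvec_def vec_eq_iff)
lemma rvec_axis: "rvec (axis j 1) = axis j 1" by (simp add: rvec_def vec_eq_iff axis_def)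



text \<open>A function that grows along the axes and is constant on steps that no \<open>f u\<close>
  notices is monotone along such paths; this is how comparisons of the \<open>f u\<close> turn into
  comparisons of other functions.\<close>

definition step :: "('u \<Rightarrow> int^'n \<Rightarrow> int) \<Rightarrow> 'u set \<Rightarrow> int^'n \<Rightarrow> int^'n \<Rightarrow> bool" where
  "step f U x x' \<longleftrightarrow> (\<exists>j. x' = x + axis j 1) \<or> (\<exists>j. x = x' + axis j 1 \<and> (\<forall>u\<in>U. f u x = f u x'))"

lemma step_weaken:
  assumes det: "\<And>x y. (\<forall>u\<in>U. f u x = f u y) \<Longrightarrow> (\<forall>u\<in>U'. f' u x = f' u y)"
    and "(step f U)\<^sup>*\<^sup>* x y"
  shows "(step f' U')\<^sup>*\<^sup>* x y"
  using assms(2)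
proof (induction rule: rtranclp_induct)
  case (step y z)
  have "step f' U' y z" using step.hyps(2) det[of y z] unfolding step_def by auto
  with step.IH show ?case by (rule rtranclp.rtrancl_into_rtrancl)
qed simp

lemma step_mono:
  fixes f' :: "'u \<Rightarrow> int^'n \<Rightarrow> int"
  assumes det: "\<And>x y. (\<forall>u\<in>U. f u x = f u y) \<Longrightarrow> (\<forall>u\<in>U'. f' u x = f' u y)"
    and mono: "\<And>u x j. u \<in> U' \<Longrightarrow> f' u x \<le> f' u (x + axis j 1)"
    and "(step f U)\<^sup>*\<^sup>* x y" and u: "u \<in> U'"
  shows "f' u x \<le> f' u y"
  using assms(3)
proof (induction rule: rtranclp_induct)
  case (step y z)
  have "f' u y \<le> f' u z" using step.hyps(2) det[of y z] mono[OF u] u unfolding step_def by auto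
  with step.IH show ?case by simp
qed simp

text \<open>If the end points agree under all \<open>f' u\<close>, monotonicity keeps these
  functions constant along the whole path, so every step may be walked in the opposite
  direction.\<close>

lemma step_reverse:
  fixes f' :: "'u \<Rightarrow> int^'n \<Rightarrow> int"
  assumes det: "\<And>x y. (\<forall>u\<in>U. f u x = f u y) \<Longrightarrow> (\<forall>u\<in>U'. f' u x = f' u y)"
    and mono: "\<And>u x j. u \<in> U' \<Longrightarrow> f' u x \<le> f' u (x + axis j 1)"
    and "(step f U)\<^sup>*\<^sup>* x y" and "\<forall>u\<in>U'. f' u x = f' u y"
  shows "(step f' U')\<^sup>*\<^sup>* y x"
  using assms(3,4)
proof (induction rule: rtranclp_induct)
  case (step y z)
  have yz: "f' u y \<le> f' u z" if "u \<in> U'" for u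
    using step_mono[OF det mono r_into_rtranclp[of "step f U"] that] step.hyps(2) by auto
  have xy: "f' u x \<le> f' u y" if "u \<in> U'" for u
    using step_mono[OF det mono step.hyps(1) that] by auto
  have eq: "\<forall>u\<in>U'. f' u x = f' u y" "\<forall>u\<in>U'. f' u z = f' u y"
    using yz xy step.prems by (auto simp: order_antisym)
  have "step f' U' z y" using step.hyps(2) eq(2) unfolding step_def by auto
  with step.IH[OF eq(1)] show ?case by (rule converse_rtranclp_into_rtranclp[rotated])
qed simp

text \<open>On the class of \<open>x\<close>, the gnat family will have the coefficient \<open>x \<bullet> u - f u x\<close> at the divisor of
  \<open>u\<close>. The point of \<open>surj\<close> and \<open>order\<close> is that they survive star subdivisions and imply
  \<open>in_cone\<close> and \<open>zero_face\<close> below.\<close>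

locale tower = simplicial_fan \<S> for \<S> :: "(real^'n) set set" +
  fixes cl :: "int^'n \<Rightarrow> 'c" and f :: "real^'n \<Rightarrow> int^'n \<Rightarrow> int"
  assumes cl_fin: "finite (range cl)"
    and cl_diff: "\<And>x y. cl x = cl y \<Longrightarrow> cl (x - y) = cl 0"
    and vert_int: "\<And>u m. {u} \<in> \<S> \<Longrightarrow> cl m = cl 0 \<Longrightarrow> rvec m \<bullet> u \<in> \<int>"
    and vert_sum: "\<And>u. {u} \<in> \<S> \<Longrightarrow> (\<Sum>j\<in>UNIV. u $ j) = 1"
    and f_mono: "\<And>u x j. {u} \<in> \<S> \<Longrightarrow> f u x \<le> f u (x + axis j 1)"
    and f_shift: "\<And>u x m. {u} \<in> \<S> \<Longrightarrow> cl m = cl 0 \<Longrightarrow> real_of_int (f u (x + m)) = f u x + rvec m \<bullet> u"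
    and f_zero: "\<And>u. {u} \<in> \<S> \<Longrightarrow> f u 0 = 0"
    and surj: "\<And>U p. U \<in> \<S> \<Longrightarrow> card U = CARD('n) \<Longrightarrow> \<exists>x. \<forall>u\<in>U. f u x = p u"
    and order: "\<And>U x x'. U \<in> \<S> \<Longrightarrow> card U = CARD('n) \<Longrightarrow> (\<forall>u\<in>U. f u x \<le> f u x') \<Longrightarrow> (step f U)\<^sup>*\<^sup>* x x'"
begin

lemma vertex: "U \<in> \<S> \<Longrightarrow> u \<in> U \<Longrightarrow> {u} \<in> \<S>"
  using sub[of U "{u}"] by simp

text \<open>In a maximal \<open>U\<close> containing \<open>A\<close> the remaining generators may
  compare wrongly, so the path goes through a point \<open>y\<close> that has the values of
  \<open>x'\<close> on \<open>A\<close> and is above both elsewhere. The descent from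
  \<open>y\<close> to \<open>x'\<close> is a reversed ascent along which nothing on \<open>A\<close>
  changes.\<close>

lemma order_face:
  assumes A: "A \<in> \<S>" and le: "\<forall>u\<in>A. f u x \<le> f u x'"
  shows "(step f A)\<^sup>*\<^sup>* x x'"
proof -
  obtain U where U: "U \<in> \<S>" "A \<subseteq> U" "card U = CARD('n)" using pure[OF A] by auto
  obtain y where y: "\<forall>u\<in>U. f u y = (if u \<in> A then f u x' else max (f u x) (f u x'))"
    using surj[OF U(1,3), of "\<lambda>u. if u \<in> A then f u x' else max (f u x) (f u x')"] by auto
  have det: "(\<forall>u\<in>U. f u x = f u y) \<Longrightarrow> (\<forall>u\<in>A. f u x = f u y)" for x y using U(2) by auto
  have "(step f U)\<^sup>*\<^sup>* x y" by (rule order[OF U(1,3)]) (use y le in auto)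
  then have 1: "(step f A)\<^sup>*\<^sup>* x y" by (rule step_weaken[where U=U and f=f and U'=A and f'=f, rotated]) (rule det)
  have "(step f U)\<^sup>*\<^sup>* x' y" by (rule order[OF U(1,3)]) (use y in auto)
  then have "(step f A)\<^sup>*\<^sup>* y x'"
    by (rule step_reverse[of U f A f, OF det f_mono, rotated 2]) (use y U(2) vertex[OF A] in auto)
  with 1 show ?thesis by (rule rtranclp_trans)
qed

text \<open>By the pigeonhole principle: two of the points over the multiples of \<open>d\<close> have the same class.\<close>

lemma lattice_direction:
  assumes U: "U \<in> \<S>" "card U = CARD('n)"
  obtains m k where "cl m = cl 0" "(k::int) \<ge> 1" "\<forall>u\<in>U. rvec m \<bullet> u = real_of_int (k * d u)"
proof -
  have "\<forall>t::nat. \<exists>x. \<forall>u\<in>U. f u x = int t * d u" by (intro allI surj[OF U])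
  then obtain x where x: "\<forall>t. \<forall>u\<in>U. f u (x t) = int t * d u" by (rule choice[THEN exE])
  have "\<not> inj_on (\<lambda>t. cl (x t)) (UNIV :: nat set)"
    using cl_fin finite_imageD[of "\<lambda>t. cl (x t)" UNIV] finite_subset[of "range (\<lambda>t. cl (x t))" "range cl"] by auto
  then obtain s t where "s \<noteq> t" "cl (x s) = cl (x t)" by (auto simp: inj_on_def)
  then obtain s t where st: "s < t" "cl (x s) = cl (x t)" by (metis linorder_neqE_nat)
  define m where "m = x t - x s"
  have m: "cl m = cl 0" unfolding m_def using cl_diff st(2) by simp
  show thesis
  proof (rule that[OF m, of "int t - int s"])
    show "1 \<le> int t - int s" using st by simp
    show "\<forall>u\<in>U. rvec m \<bullet> u = real_of_int ((int t - int s) * d u)"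
    proof
      fix u assume u: "u \<in> U"
      have "real_of_int (f u (x s + m)) = f u (x s) + rvec m \<bullet> u" by (rule f_shift[OF vertex[OF U(1) u] m])
      then show "rvec m \<bullet> u = real_of_int ((int t - int s) * d u)" using x u by (simp add: m_def algebra_simps)
    qed
  qed
qed

lemma basis_expansion:
  assumes U: "U \<in> \<S>" "card U = CARD('n)"
  obtains c where "y = (\<Sum>u\<in>U. c u *\<^sub>R u)"
proof -
  have "span U = UNIV" using independent[OF U(1)] U(2) card_ge_dim_independent[of U UNIV] dim_UNIV by auto
  then show ?thesis using that span_finite[OF fin(2)[OF U(1)]] by (metis (no_types, lifting) UNIV_I imageE)
qed

section \<open>Functions that are monotone in the rounding functions, and the cones they
  force\<close>

context
  fixes W :: "int^'n \<Rightarrow> real" and y :: "real^'n"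
  assumes W_shift: "\<And>x m. cl m = cl 0 \<Longrightarrow> W (x + m) = W x + rvec m \<bullet> y"
    and W_mono: "\<And>x j. W x \<le> W (x + axis j 1)"
begin

lemma W_order:
  assumes A: "A \<in> \<S>" and zero: "\<And>x j. (\<forall>u\<in>A. f u (x + axis j 1) = f u x) \<Longrightarrow> W (x + axis j 1) = W x"
    and le: "\<forall>u\<in>A. f u x \<le> f u x'"
  shows "W x \<le> W x'"
  using order_face[OF A le]
proof (induction rule: rtranclp_induct)
  case (step y z)
  have "W y \<le> W z" using step.hyps(2) zero W_mono unfolding step_def by force
  with step.IH show ?case by simp
qed simp

text \<open>A lattice vector \<open>m\<close> that is positive on one \<open>u\<close> of the basis
  and zero on the others gives \<open>W 0 \<le> W m\<close>, that is, \<open>c u \<ge> 0\<close>. If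
  \<open>u\<close> is not in \<open>A\<close>, the functions indexed by \<open>A\<close> do not see
  \<open>m\<close> at all, so also \<open>W m \<le> W 0\<close> and \<open>c u = 0\<close>.\<close>

lemma in_cone:
  assumes A: "A \<in> \<S>" and zero: "\<And>x j. (\<forall>u\<in>A. f u (x + axis j 1) = f u x) \<Longrightarrow> W (x + axis j 1) = W x"
  shows "y \<in> cone_of A"
proof -
  obtain U where U: "U \<in> \<S>" "A \<subseteq> U" "card U = CARD('n)" using pure[OF A] by auto
  have finU: "finite U" using fin(2) U by auto
  obtain c where c: "y = (\<Sum>u\<in>U. c u *\<^sub>R u)" by (rule basis_expansion[OF U(1,3)])
  have cu: "0 \<le> c u \<and> (u \<notin> A \<longrightarrow> c u = 0)" if u: "u \<in> U" for u
  proof -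
    obtain m k where m: "cl m = cl 0" "(k::int) \<ge> 1"
      "\<forall>w\<in>U. rvec m \<bullet> w = real_of_int (k * (if w = u then 1 else 0))"
      by (rule lattice_direction[OF U(1,3), of "\<lambda>w. if w = u then 1 else 0"])
    have "rvec m \<bullet> y = (\<Sum>w\<in>U. c w * (rvec m \<bullet> w))" unfolding c by (simp add: inner_sum_right)
    also have "\<dots> = (\<Sum>w\<in>U. if w = u then c u * k else 0)" by (rule sum.cong) (auto simp: m(3))
    also have "\<dots> = c u * k" using u finU by simp
    finally have my: "rvec m \<bullet> y = c u * k" .
    have fm: "f w m = k * (if w = u then 1 else 0)" if "w \<in> U" for w
    proof -
      have "real_of_int (f w (0 + m)) = f w 0 + rvec m \<bullet> w" by (rule f_shift[OF vertex[OF U(1) that] m(1)])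
      then have "real_of_int (f w m) = real_of_int (k * (if w = u then 1 else 0))"
        using f_zero[OF vertex[OF U(1) that]] m(3)[rule_format, OF that] by simp
      then show ?thesis by (simp only: of_int_eq_iff)
    qed
    have f0: "f w 0 = 0" if "w \<in> U" for w using f_zero[OF vertex[OF U(1) that]] .
    have Wm: "W m = W 0 + c u * k" using W_shift[OF m(1), of 0] my by simp
    have "W 0 \<le> W m" by (rule W_order[OF A zero]) (use fm f0 U(2) m(2) in auto)
    moreover have "W m \<le> W 0" if "u \<notin> A" by (rule W_order[OF A zero]) (use fm f0 U(2) that in auto)
    ultimately have "0 \<le> c u * k" "u \<notin> A \<Longrightarrow> c u * k \<le> 0" using Wm by auto
    then show ?thesis using m(2) by (auto simp: zero_le_mult_iff mult_le_0_iff)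
  qed
  have "y = (\<Sum>u\<in>A. c u *\<^sub>R u)"
    unfolding c by (rule sum.mono_neutral_right[OF finU U(2)]) (use cu in auto)
  moreover have "(\<Sum>u\<in>A. c u *\<^sub>R u) \<in> cone_of A"
    using cu U(2) finite_subset[OF U(2) finU] by (intro cone_of_sum) auto
  ultimately show ?thesis by simp
qed

text \<open>Let \<open>m\<close> vanish on \<open>A\<close> and be large on the rest of
  \<open>U\<close>. Then \<open>x + m\<close> dominates \<open>x + axis j 1\<close> in all
  \<open>f u\<close>, while \<open>W (x + m) = W x\<close> because \<open>y\<close> lies in the cone
  of \<open>A\<close>.\<close>

lemma zero_face:
  assumes U: "U \<in> \<S>" "card U = CARD('n)" and A: "A \<subseteq> U"
    and zero: "\<And>x j. (\<forall>u\<in>U. f u (x + axis j 1) = f u x) \<Longrightarrow> W (x + axis j 1) = W x"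
    and y: "y \<in> cone_of A" and eq: "\<forall>u\<in>A. f u (x + axis j 1) = f u x"
  shows "W (x + axis j 1) = W x"
proof -
  have finU: "finite U" using fin(2) U by auto
  \<comment> \<open>A bound for all increments at once; the sum serves because each increment is
    nonnegative.\<close>
  define K where "K = (\<Sum>u\<in>U. f u (x + axis j 1) - f u x)"
  have K: "f u (x + axis j 1) - f u x \<le> K" if "u \<in> U" for u
    unfolding K_def by (rule member_le_sum[OF that]) (use finU f_mono vertex[OF U(1)] in \<open>auto simp: diff_ge_0_iff_ge\<close>)
  have K0: "0 \<le> K" unfolding K_def by (rule sum_nonneg) (use f_mono vertex[OF U(1)] in auto)
  obtain m k where m: "cl m = cl 0" "(k::int) \<ge> 1"
    "\<forall>w\<in>U. rvec m \<bullet> w = real_of_int (k * (if w \<in> A then 0 else K))"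
    by (rule lattice_direction[OF U, of "\<lambda>w. if w \<in> A then 0 else K"])
  have finA: "finite A" using finite_subset[OF A finU] .
  obtain c where c: "y = (\<Sum>u\<in>A. c u *\<^sub>R u)" using y unfolding cone_of_finite[OF finA] by auto
  have "rvec m \<bullet> y = (\<Sum>w\<in>A. c w * (rvec m \<bullet> w))" unfolding c by (simp add: inner_sum_right)
  also have "\<dots> = 0" by (rule sum.neutral) (use m(3) A in auto)
  finally have my: "rvec m \<bullet> y = 0" .
  have fm: "f w (x + m) = f w x + k * (if w \<in> A then 0 else K)" if "w \<in> U" for w
  proof -
    have "real_of_int (f w (x + m)) = f w x + rvec m \<bullet> w" by (rule f_shift[OF vertex[OF U(1) that] m(1)])
    then have "real_of_int (f w (x + m)) = real_of_int (f w x + k * (if w \<in> A then 0 else K))"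
      using m(3)[rule_format, OF that] by simp
    then show ?thesis by (simp only: of_int_eq_iff)
  qed
  have kK: "K \<le> k * K" using K0 m(2) mult_right_mono[of 1 k K] by simp
  have "W (x + axis j 1) \<le> W (x + m)"
    by (rule W_order[OF U(1) zero]) (use fm eq K kK in \<open>fastforce split: if_splits\<close>)+
  then show ?thesis using W_shift[OF m(1), of x] my W_mono[of x j] by simp
qed

end

end

section \<open>A star subdivision at a point with coordinate sum 1 preserves the properties of a
  tower\<close>

locale tower_star = tower \<S> cl f + star_point \<S> v l T
  for \<S> :: "(real^'n) set set" and cl :: "int^'n \<Rightarrow> 'c" and f v l T +
  assumes v_int: "\<And>m. cl m = cl 0 \<Longrightarrow> rvec m \<bullet> v \<in> \<int>"
    and v_one: "(\<Sum>j\<in>UNIV. v $ j) = 1"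
begin

definition a :: "int^'n \<Rightarrow> real" where "a x = (\<Sum>t\<in>T. l t * f t x)"

definition f' :: "real^'n \<Rightarrow> int^'n \<Rightarrow> int" where "f' = f(v := \<lambda>x. \<lfloor>a x\<rfloor>)"

lemma finT: "finite T" using fin TS by auto

text \<open>All generators and \<open>v\<close> lie on the hyperplane where the coordinates sum to
  1, so \<open>v\<close> is a convex combination. This is where juniority provides the inequalities
  used in \<open>f'_surj\<close> and \<open>f'_order\<close>.\<close>

lemma l_sum: "(\<Sum>t\<in>T. l t) = 1"
proof -
  have "(\<Sum>j\<in>UNIV. v $ j) = (\<Sum>j\<in>UNIV. \<Sum>t\<in>T. l t * t $ j)" by (subst v_sum) simp
  also have "\<dots> = (\<Sum>t\<in>T. l t * (\<Sum>j\<in>UNIV. t $ j))" by (subst sum.swap) (simp add: sum_distrib_left)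
  also have "\<dots> = (\<Sum>t\<in>T. l t)" by (rule sum.cong) (auto simp: vert_sum vertex[OF TS])
  finally show ?thesis using v_one by simp
qed

lemma l_le: "t \<in> T \<Longrightarrow> l t \<le> 1"
  using member_le_sum[of t T l] l_sum l_nonneg finT by auto

lemma l_le2:
  assumes "t \<in> T" "s \<in> T" "t \<noteq> s"
  shows "l t + l s \<le> 1"
proof -
  have "(\<Sum>u\<in>{t, s}. l u) \<le> (\<Sum>u\<in>T. l u)" by (rule sum_mono2[OF finT]) (use assms l_nonneg in auto)
  then show ?thesis using assms l_sum by simp
qed

lemma f'_other: "u \<noteq> v \<Longrightarrow> f' u = f u" by (simp add: f'_def)
lemma f'_v: "f' v x = \<lfloor>a x\<rfloor>" by (simp add: f'_def)

lemma star_vertex: "{u} \<in> star \<Longrightarrow> u = v \<or> {u} \<in> \<S>"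
  by (auto simp: star_def)

lemma a_mono: "a x \<le> a (x + axis j 1)"
  unfolding a_def by (intro sum_mono mult_left_mono) (auto simp: l_nonneg f_mono vertex[OF TS])

lemma f'_mono: "{u} \<in> star \<Longrightarrow> f' u x \<le> f' u (x + axis j 1)"
  using star_vertex[of u] f_mono[of u] floor_mono[OF a_mono] by (cases "u = v") (auto simp: f'_other f'_v)

lemma f'_zero: "{u} \<in> star \<Longrightarrow> f' u 0 = 0"
  using star_vertex[of u] f_zero[of u] f_zero[OF vertex[OF TS]]
  by (cases "u = v") (auto simp: f'_other f'_v a_def)

lemma a_shift:
  assumes "cl m = cl 0"
  shows "a (x + m) = a x + rvec m \<bullet> v"
proof -
  have "a (x + m) = (\<Sum>t\<in>T. l t * (f t x + rvec m \<bullet> t))"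
    unfolding a_def by (rule sum.cong) (auto simp: f_shift[OF vertex[OF TS] assms])
  also have "\<dots> = a x + rvec m \<bullet> v"
    by (subst v_sum) (simp add: a_def inner_sum_right sum.distrib distrib_left)
  finally show ?thesis .
qed

lemma f'_shift:
  assumes "{u} \<in> star" "cl m = cl 0"
  shows "real_of_int (f' u (x + m)) = f' u x + rvec m \<bullet> u"
proof (cases "u = v")
  case True
  obtain k where k: "rvec m \<bullet> v = of_int k" using v_int[OF assms(2)] by (auto elim: Ints_cases)
  show ?thesis using True a_shift[OF assms(2), of x] k by (simp add: f'_v)
next
  case False
  then show ?thesis using star_vertex[OF assms(1)] f_shift[OF _ assms(2), of u x] by (simp add: f'_other)
qed

lemma old_max:
  assumes "U \<in> \<S>" "\<not> T \<subseteq> U" "u \<in> U"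
  shows "f' u = f u"
  using v_notin[OF assms(1,2)] assms(3) by (intro f'_other) auto

lemma new_max:
  assumes U: "U \<in> star" "card U = CARD('n)" "\<not> (U \<in> \<S> \<and> \<not> T \<subseteq> U)"
  obtains B t where "U = insert v B" "v \<notin> B" "t \<in> T" "t \<notin> B" "insert t B \<in> \<S>" "card (insert t B) = CARD('n)"
    "T - {t} \<subseteq> B"
proof -
  from U obtain B where B: "U = insert v B" "B \<in> \<S>" "\<not> T \<subseteq> B" "T \<union> B \<in> \<S>" unfolding star_def by auto
  have vB: "v \<notin> B" using v_notin B by auto
  have finB: "finite B" using fin B by auto
  obtain t where t: "t \<in> T" "t \<notin> B" using B by auto
  have c: "card (insert t B) = CARD('n)" using U(2) B(1) vB t finB by simp
  moreover have "insert t B \<subseteq> T \<union> B" using t by auto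
  ultimately have eq: "insert t B = T \<union> B"
    using card_le[OF B(4)] by (intro card_seteq[OF fin(2)[OF B(4)]]) auto
  show thesis by (rule that[OF B(1) vB t _ c]) (use eq B(4) in auto)
qed

lemma f'_surj:
  assumes U: "U \<in> star" "card U = CARD('n)"
  shows "\<exists>x. \<forall>u\<in>U. f' u x = p u"
proof (cases "U \<in> \<S> \<and> \<not> T \<subseteq> U")
  case True
  then show ?thesis using surj[of U p] U(2) old_max[of U] by auto
next
  case False
  obtain B t where B: "U = insert v B" "v \<notin> B" "t \<in> T" "t \<notin> B" "insert t B \<in> \<S>" "card (insert t B) = CARD('n)"
    "T - {t} \<subseteq> B" by (rule new_max[OF U False])
  define r where "r = (\<Sum>s\<in>T - {t}. l s * p s)"
  \<comment> \<open>The least value at \<open>t\<close> for which the interpolation reaches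
    \<open>p v\<close>. It overshoots by less than \<open>l t\<close>, hence by less than 1, and the
    floor is \<open>p v\<close>.\<close>
  define k where "k = \<lceil>(p v - r) / l t\<rceil>"
  obtain x where x: "\<forall>u\<in>insert t B. f u x = (if u = t then k else p u)"
    using surj[OF B(5,6), of "\<lambda>u. if u = t then k else p u"] by auto
  have "a x = l t * f t x + (\<Sum>s\<in>T - {t}. l s * f s x)" unfolding a_def by (rule sum.remove[OF finT B(3)])
  also have "(\<Sum>s\<in>T - {t}. l s * f s x) = r" unfolding r_def by (rule sum.cong) (use x B(7) in auto)
  finally have ax: "a x = l t * k + r" using x by simp
  have lt: "0 < l t" "l t \<le> 1" using l_pos l_le B(3) by auto
  have "(p v - r) / l t \<le> k" "k < (p v - r) / l t + 1" unfolding k_def by linarith+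
  then have "p v - r \<le> l t * k" "l t * k < (p v - r) + l t" using lt by (auto simp: field_simps)
  then have "\<lfloor>a x\<rfloor> = p v" using ax lt by (intro floor_unique) auto
  moreover have "f' u x = p u" if "u \<in> B" for u
  proof -
    have "u \<noteq> t" "u \<noteq> v" using that B(2,4) by auto
    then show ?thesis using x that by (simp add: f'_other)
  qed
  ultimately have "\<forall>u\<in>U. f' u x = p u" using B(1) by (auto simp: f'_v)
  then show ?thesis by auto
qed

text \<open>The new step path lowers \<open>f t\<close> for the omitted \<open>t\<close> as long as the floor stays the same, and
  otherwise raises some \<open>f s\<close> with \<open>s \<in> T\<close> that still has to grow; this cannot
  raise the floor because of \<open>l t + l s \<le> 1\<close>.\<close>

lemma f'_order:
  assumes U: "U \<in> star" "card U = CARD('n)" and le: "\<forall>u\<in>U. f' u x \<le> f' u x'"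
  shows "(step f' U)\<^sup>*\<^sup>* x x'"
proof (cases "U \<in> \<S> \<and> \<not> T \<subseteq> U")
  case True
  then have eq: "f' u = f u" if "u \<in> U" for u using old_max that by auto
  have "(step f U)\<^sup>*\<^sup>* x x'" by (rule order) (use True U(2) le eq in auto)
  then show ?thesis by (rule step_weaken[rotated]) (use eq in auto)
next
  case False
  obtain B t where B: "U = insert v B" "v \<notin> B" "t \<in> T" "t \<notin> B" "insert t B \<in> \<S>" "card (insert t B) = CARD('n)"
    "T - {t} \<subseteq> B" by (rule new_max[OF U False])
  let ?W = "insert t B"
  note W = B(5,6)
  have finB: "finite B" using fin(2)[OF W(1)] by simp
  have f'B: "f' u = f u" if "u \<in> B" for u using that B(2) by (intro f'_other) auto
  have a_eq: "a x = l t * f t x + (\<Sum>s\<in>T - {t}. l s * f s x)" for x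
    unfolding a_def by (rule sum.remove[OF finT B(3)])
  have det: "(\<forall>u\<in>?W. f u x = f u y) \<Longrightarrow> (\<forall>u\<in>U. f' u x = f' u y)" for x y
  proof -
    assume e: "\<forall>u\<in>?W. f u x = f u y"
    have "(\<Sum>s\<in>T - {t}. l s * f s x) = (\<Sum>s\<in>T - {t}. l s * f s y)"
      by (rule sum.cong) (use e B(7) in auto)
    then have "a x = a y" using e a_eq[of x] a_eq[of y] by simp
    then show "\<forall>u\<in>U. f' u x = f' u y" using e f'B by (auto simp: B(1) f'_v)
  qed
  interpret st: simplicial_fan star by (rule simplicial_star)
  have mono: "f' u x \<le> f' u (x + axis j 1)" if "u \<in> U" for u x j
    using f'_mono[of u] st.sub[OF U(1), of "{u}"] that by auto
  \<comment> \<open>A descent is obtained as a reversed ascent that no function of the new cone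
    notices.\<close>
  have lower: "(step f' U)\<^sup>*\<^sup>* x y" if "\<forall>u\<in>?W. f u y \<le> f u x" "\<forall>u\<in>U. f' u y = f' u x" for x y
    by (rule step_reverse[OF det mono order[OF W that(1)] that(2)])
  have raise: "(step f' U)\<^sup>*\<^sup>* x y" if "\<forall>u\<in>?W. f u x \<le> f u y" for x y
    by (rule step_weaken[OF det order[OF W that]])
  show ?thesis using le
  proof (induction "(\<Sum>u\<in>B. nat (f u x' - f u x)) + nat (f t x - f t x')" arbitrary: x rule: less_induct)
    case less
    have leB: "f u x \<le> f u x'" if "u \<in> B" for u using less.prems f'B that B(1) by auto
    have lev: "\<lfloor>a x\<rfloor> \<le> \<lfloor>a x'\<rfloor>" using less.prems B(1) by (auto simp: f'_v)
    show ?case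
    proof (cases "f t x \<le> f t x'")
      case True
      then show ?thesis using leB by (intro raise) auto
    next
      case gt: False
      show ?thesis
      proof (cases "\<lfloor>a x - l t\<rfloor> = \<lfloor>a x\<rfloor>")
        case True
        obtain y where y: "\<forall>u\<in>?W. f u y = (if u = t then f t x - 1 else f u x)"
          using surj[OF W, of "\<lambda>u. if u = t then f t x - 1 else f u x"] by auto
        have yB: "f u y = f u x" if "u \<in> B" for u using y that B(4) by auto
        have yt: "f t y = f t x - 1" using y by simp
        have "(\<Sum>s\<in>T - {t}. l s * f s y) = (\<Sum>s\<in>T - {t}. l s * f s x)"
          by (rule sum.cong) (use yB B(7) in auto)
        then have "a y = a x - l t" using a_eq[of x] a_eq[of y] yt by (simp add: algebra_simps)
        then have eq: "\<forall>u\<in>U. f' u y = f' u x" using True yB f'B by (auto simp: B(1) f'_v)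
        have "(step f' U)\<^sup>*\<^sup>* x y" by (rule lower) (use yB yt eq in auto)
        moreover have "(step f' U)\<^sup>*\<^sup>* y x'"
        proof (rule less.hyps)
          have "(\<Sum>u\<in>B. nat (f u x' - f u y)) = (\<Sum>u\<in>B. nat (f u x' - f u x))"
            by (rule sum.cong) (use yB in auto)
          then show "(\<Sum>u\<in>B. nat (f u x' - f u y)) + nat (f t y - f t x')
              < (\<Sum>u\<in>B. nat (f u x' - f u x)) + nat (f t x - f t x')" using yt gt by simp
          show "\<forall>u\<in>U. f' u y \<le> f' u x'" using less.prems eq by auto
        qed
        ultimately show ?thesis by (rule rtranclp_trans)
      next
        case False
        have lt: "0 < l t" using l_pos B(3) by auto
        \<comment> \<open>Since subtracting \<open>l t\<close> would change the floor, the
          fractional part of \<open>a x\<close> is less than \<open>l t\<close>.\<close>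
        have small: "a x < \<lfloor>a x\<rfloor> + l t"
        proof (rule ccontr)
          assume "\<not> a x < \<lfloor>a x\<rfloor> + l t"
          then have "\<lfloor>a x - l t\<rfloor> = \<lfloor>a x\<rfloor>" using lt by (intro floor_unique) linarith+
          with False show False by simp
        qed
        \<comment> \<open>Otherwise \<open>x'\<close> has the same values on \<open>T\<close> except
          for a smaller one at \<open>t\<close>; then \<open>a x'\<close> falls below the floor of
          \<open>a x\<close>, against the comparison at \<open>v\<close>.\<close>
        have "\<exists>s\<in>T - {t}. f s x < f s x'"
        proof (rule ccontr)
          assume "\<not> (\<exists>s\<in>T - {t}. f s x < f s x')"
          then have "\<forall>s\<in>T - {t}. f s x = f s x'" using leB B(7) by (meson order_antisym_conv not_less subsetD)
          then have "(\<Sum>s\<in>T - {t}. l s * f s x') = (\<Sum>s\<in>T - {t}. l s * f s x)" by (intro sum.cong) auto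
          then have "a x' = a x - l t * (f t x - f t x')" using a_eq[of x] a_eq[of x'] by (simp add: algebra_simps)
          moreover have "l t * 1 \<le> l t * (f t x - f t x')" using gt lt by (intro mult_left_mono) linarith+
          ultimately have "a x' < \<lfloor>a x\<rfloor>" using small by linarith
          then show False using lev by linarith
        qed
        then obtain s where s: "s \<in> T" "s \<noteq> t" "f s x < f s x'" by auto
        have sB: "s \<in> B" using s B(7) by auto
        obtain y where y: "\<forall>u\<in>?W. f u y = (if u = s then f s x + 1 else f u x)"
          using surj[OF W, of "\<lambda>u. if u = s then f s x + 1 else f u x"] by auto
        have yB: "f u y = (if u = s then f s x + 1 else f u x)" if "u \<in> B" for u using y that by auto
        have yt: "f t y = f t x" using y s by simp
        have "(\<Sum>r\<in>T - {t}. l r * f r y) = (\<Sum>r\<in>T - {t}. l r * f r x + (if r = s then l s else 0))"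
          by (rule sum.cong) (use yB B(7) in \<open>auto simp: algebra_simps\<close>)
        also have "\<dots> = (\<Sum>r\<in>T - {t}. l r * f r x) + l s"
          using s finT by (simp add: sum.distrib)
        finally have ay: "a y = a x + l s" using a_eq[of x] a_eq[of y] yt by simp
        have "a y < \<lfloor>a x\<rfloor> + 1" using ay small l_le2[OF B(3) s(1)] s(2) by simp
        then have vy: "\<lfloor>a y\<rfloor> = \<lfloor>a x\<rfloor>" using ay l_nonneg[of s] by (intro floor_unique) linarith+
        have "(step f' U)\<^sup>*\<^sup>* x y" by (rule raise) (use yB yt in auto)
        moreover have "(step f' U)\<^sup>*\<^sup>* y x'"
        proof (rule less.hyps)
          have "(\<Sum>u\<in>B. nat (f u x' - f u y)) < (\<Sum>u\<in>B. nat (f u x' - f u x))"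
            by (rule sum_strict_mono_ex1[OF finB]) (use yB s sB in \<open>auto intro!: bexI[of _ s]\<close>)
          then show "(\<Sum>u\<in>B. nat (f u x' - f u y)) + nat (f t y - f t x')
              < (\<Sum>u\<in>B. nat (f u x' - f u x)) + nat (f t x - f t x')" using yt by simp
          show "\<forall>u\<in>U. f' u y \<le> f' u x'" using leB yB s f'B vy lev by (auto simp: B(1) f'_v)
        qed
        ultimately show ?thesis by (rule rtranclp_trans)
      qed
    qed
  qed
qed

theorem tower_star: "tower star cl f'"
proof -
  interpret st: simplicial_fan star by (rule simplicial_star)
  show ?thesis
  proof unfold_locales
    show "rvec m \<bullet> u \<in> \<int>" if "{u} \<in> star" "cl m = cl 0" for u m
      using star_vertex[OF that(1)] vert_int[OF _ that(2)] v_int[OF that(2)] by auto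
    show "(\<Sum>j\<in>UNIV. u $ j) = 1" if "{u} \<in> star" for u
      using star_vertex[OF that] vert_sum v_one by auto
  qed (use cl_fin cl_diff f'_mono f'_shift f'_zero f'_surj f'_order in auto)
qed

end

section \<open>Characters of the group\<close>

lemma group_SL: "group (SL :: (complex^'n^'n) monoid)"
proof (rule groupI)
  fix A :: "complex^'n^'n" assume A: "A \<in> carrier SL"
  then have "invertible A" by (simp add: SL_def invertible_det_nz)
  then obtain B where B: "A ** B = mat 1" "B ** A = mat 1" by (auto simp: invertible_def)
  have "det A * det B = 1" using B(1) by (metis det_I det_mul)
  then show "\<exists>B\<in>carrier SL. B \<otimes>\<^bsub>SL\<^esub> A = \<one>\<^bsub>SL\<^esub>" using A B by (auto simp: SL_def)
qed (auto simp: SL_def det_mul matrix_mul_assoc)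

locale mckay =
  fixes G :: "(complex^'n^'n) set" and X :: "complex^'n^'n"
  assumes subG: "subgroup G SL" and finG: "finite G" and commG: "comm_group (SL\<lparr>carrier := G\<rparr>)"
    and eigen: "eigen_coordinates G X"
begin

abbreviation "H \<equiv> SL\<lparr>carrier := G\<rparr>"
abbreviation "\<chi>' \<equiv> chi G X"
abbreviation "te \<equiv> tens G X"
abbreviation "wv \<equiv> weight_vec G X"

sublocale H: comm_group H by (rule commG)

lemma G_mult: "g \<in> G \<Longrightarrow> h \<in> G \<Longrightarrow> g ** h \<in> G"
  using subgroup.m_closed[OF subG] by (auto simp: SL_def)

lemma G_one: "mat 1 \<in> G" using subgroup.one_closed[OF subG] by (simp add: SL_def)

lemma G_SL: "g \<in> G \<Longrightarrow> g \<in> carrier SL" using subgroup.subset[OF subG] by auto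

lemma chi_eq:
  assumes g: "g \<in> G"
  shows "(X *v (g *v v)) $ j = \<chi>' j g * (X *v v) $ j"
proof -
  have "\<exists>c. \<forall>v. (X *v (g *v v)) $ j = c * (X *v v) $ j" using eigen g by (simp add: eigen_coordinates_def)
  then obtain c where c: "\<forall>v. (X *v (g *v v)) $ j = c * (X *v v) $ j" by (rule exE)
  have inv: "invertible X" using eigen by (simp add: eigen_coordinates_def)
  then obtain Y where Y: "X ** Y = mat 1" by (auto simp: invertible_def)
  have y: "(X *v (Y *v axis j 1)) $ j = 1" by (simp add: matrix_vector_mul_assoc Y axis_def)
  have "(THE c. \<forall>v. (X *v (g *v v)) $ j = c * (X *v v) $ j) = c"
  proof (rule the_equality)
    show "\<forall>v. (X *v (g *v v)) $ j = c * (X *v v) $ j" by (rule c)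
    fix d assume "\<forall>v. (X *v (g *v v)) $ j = d * (X *v v) $ j"
    then have "c * (X *v (Y *v axis j 1)) $ j = d * (X *v (Y *v axis j 1)) $ j" using c by metis
    then show "d = c" using y by simp
  qed
  then show ?thesis using c g by (simp add: chi_def)
qed

lemma chi_unique:
  assumes "\<forall>v. (X *v (g *v v)) $ j = c * (X *v v) $ j" "g \<in> G"
  shows "\<chi>' j g = c"
proof -
  have inv: "invertible X" using eigen by (simp add: eigen_coordinates_def)
  then obtain Y where Y: "X ** Y = mat 1" by (auto simp: invertible_def)
  have y: "(X *v (Y *v axis j 1)) $ j = 1" by (simp add: matrix_vector_mul_assoc Y axis_def)
  show ?thesis using assms(1) chi_eq[OF assms(2), of "Y *v axis j 1" j] y by simp
qed

lemma chi_mult: "g \<in> G \<Longrightarrow> h \<in> G \<Longrightarrow> \<chi>' j (g ** h) = \<chi>' j g * \<chi>' j h"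
  by (rule chi_unique) (auto simp: matrix_vector_mul_assoc[symmetric] chi_eq G_mult)

lemma chi_one: "\<chi>' j (mat 1) = 1"
  by (rule chi_unique) (auto simp: G_one)

lemma G_inv:
  assumes "g \<in> G"
  obtains h where "h \<in> G" "g ** h = mat 1" "h ** g = mat 1"
  using H.r_inv[of g] H.l_inv[of g] H.inv_closed[of g] assms that[of "inv\<^bsub>H\<^esub> g"] by (simp add: SL_def)

lemma Irr_iff: "i \<in> Irr G \<longleftrightarrow>
    (\<forall>g\<in>G. i g \<noteq> 0) \<and> (\<forall>g\<in>G. \<forall>h\<in>G. i (g ** h) = i g * i h) \<and> i \<in> extensional G"
  by (auto simp: Irr_def hom_def Cstar_def SL_def)

lemma char_nonzero: "i \<in> Irr G \<Longrightarrow> g \<in> G \<Longrightarrow> i g \<noteq> 0"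
  by (auto simp: Irr_def hom_def Cstar_def)

lemma char_mult: "i \<in> Irr G \<Longrightarrow> g \<in> G \<Longrightarrow> h \<in> G \<Longrightarrow> i (g ** h) = i g * i h"
  by (auto simp: Irr_def hom_def Cstar_def SL_def)

lemma char_one:
  assumes "i \<in> Irr G"
  shows "i (mat 1) = 1"
proof -
  have "i (mat 1) * i (mat 1) = i (mat 1)" using char_mult[OF assms G_one G_one] by simp
  then show ?thesis using char_nonzero[OF assms G_one] by simp
qed

lemma chi_Irr: "\<chi>' j \<in> Irr G"
proof -
  have "\<chi>' j g \<noteq> 0" if g: "g \<in> G" for g
  proof -
    obtain h where "h \<in> G" "g ** h = mat 1" by (rule G_inv[OF g])
    then have "\<chi>' j g * \<chi>' j h = 1" using chi_mult[OF g, of h j] chi_one by simp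
    then show ?thesis by auto
  qed
  moreover have "\<chi>' j \<in> extensional G" unfolding chi_def by simp
  ultimately show ?thesis by (auto simp: Irr_def hom_def Cstar_def SL_def chi_mult)
qed

lemma triv_Irr: "triv G \<in> Irr G"
  by (auto simp: Irr_def hom_def Cstar_def SL_def triv_def G_mult)

lemma tens_Irr: "i \<in> Irr G \<Longrightarrow> te i j \<in> Irr G"
  using char_nonzero[OF chi_Irr] by (simp add: Irr_iff tens_def G_mult chi_mult)

lemma tens_apply: "g \<in> G \<Longrightarrow> te i j g = i g * \<chi>' j g" by (simp add: tens_def)

lemma tens_comm: "te (te i j) j' = te (te i j') j"
  by (auto simp: tens_def intro!: restrict_ext)

lemma char_ext: "i \<in> Irr G \<Longrightarrow> k \<in> Irr G \<Longrightarrow> (\<And>g. g \<in> G \<Longrightarrow> i g = k g) \<Longrightarrow> i = k"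
  by (rule extensionalityI[of i G]) (auto simp: Irr_def)

lemma tens_inj: "inj_on (\<lambda>i. te i j) (Irr G)"
proof (rule inj_onI)
  fix i k assume ik: "i \<in> Irr G" "k \<in> Irr G" "te i j = te k j"
  show "i = k"
  proof (rule char_ext[OF ik(1,2)])
    fix g assume g: "g \<in> G"
    then show "i g = k g" using fun_cong[OF ik(3), of g] char_nonzero[OF chi_Irr g] by (simp add: tens_apply)
  qed
qed

lemma char_root:
  assumes i: "i \<in> Irr G" and g: "g \<in> G"
  shows "i g ^ card G = 1"
proof -
  have "i (g [^]\<^bsub>H\<^esub> n) = i g ^ n \<and> g [^]\<^bsub>H\<^esub> n \<in> G" for n :: nat
  proof (induction n)
    case 0
    then show ?case using char_one[OF i] G_one by (simp add: SL_def)
  next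
    case (Suc n)
    have "g [^]\<^bsub>H\<^esub> Suc n = g [^]\<^bsub>H\<^esub> n ** g" by (simp add: SL_def)
    then show ?case using Suc char_mult[OF i _ g] G_mult g by simp
  qed
  moreover have "g [^]\<^bsub>H\<^esub> card G = mat 1"
    using H.pow_order_eq_1[of g] g by (simp add: order_def SL_def)
  ultimately show ?thesis using char_one[OF i] by metis
qed

lemma cardG: "0 < card G" using finG G_one card_gt_0_iff by blast

lemma finite_Irr: "finite (Irr G)"
proof (rule finite_subset)
  show "Irr G \<subseteq> G \<rightarrow>\<^sub>E {z. z ^ card G = 1}"
    using char_root by (auto simp: Irr_def PiE_def)
  show "finite (G \<rightarrow>\<^sub>E {z::complex. z ^ card G = 1})"
    using finite_roots_unity[of "card G"] cardG by (intro finite_PiE finG) auto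
qed

lemma faithful:
  assumes g: "g \<in> G" and "\<And>j. \<chi>' j g = 1"
  shows "g = mat 1"
proof -
  have inv: "invertible X" using eigen by (simp add: eigen_coordinates_def)
  then obtain Y where Y: "Y ** X = mat 1" by (auto simp: invertible_def)
  have "g *v v = mat 1 *v v" for v
  proof -
    have "X *v (g *v v) = X *v v" using chi_eq[OF g, of v] assms(2) by (simp add: vec_eq_iff)
    then have "Y *v (X *v (g *v v)) = Y *v (X *v v)" by simp
    then show ?thesis by (simp add: matrix_vector_mul_assoc Y matrix_mul_assoc)
  qed
  then show ?thesis by (simp add: matrix_eq)
qed

lemma character_sum:
  assumes mult: "\<And>g h. g \<in> G \<Longrightarrow> h \<in> G \<Longrightarrow> \<psi> (g ** h) = \<psi> g * \<psi> h"
    and nz: "(\<Sum>g\<in>G. \<psi> g) \<noteq> (0::complex)" and a: "a \<in> G"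
  shows "\<psi> a = 1"
proof -
  have inj: "inj_on (\<lambda>g. a ** g) G"
  proof (rule inj_onI)
    fix g h assume "a ** g = a ** h"
    moreover obtain b where "b ** a = mat 1" by (rule G_inv[OF a])
    ultimately have "b ** a ** g = b ** a ** h" by (metis matrix_mul_assoc)
    then show "g = h" using \<open>b ** a = mat 1\<close> by simp
  qed
  then have im: "(\<lambda>g. a ** g) ` G = G" using G_mult[OF a] by (intro endo_inj_surj finG) auto
  have "(\<Sum>g\<in>G. \<psi> g) = (\<Sum>g\<in>G. \<psi> (a ** g))"
    using sum.reindex[OF inj, of \<psi>] im by simp
  also have "\<dots> = \<psi> a * (\<Sum>g\<in>G. \<psi> g)" unfolding sum_distrib_left by (rule sum.cong) (auto simp: mult a)
  finally show ?thesis using nz by simp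
qed

text \<open>Every character is a product of the \<open>\<chi>\<^sub>j\<close>, by orthogonality: the \<open>\<chi>\<^sub>j\<close> separate the
  elements of \<open>G\<close>.\<close>

lemma Irr_induct:
  assumes i: "i \<in> Irr G" and base: "P (triv G)" and step: "\<And>i j. i \<in> Irr G \<Longrightarrow> P i \<Longrightarrow> P (te i j)"
  shows "P i"
proof -
  define Hs where "Hs = {i \<in> Irr G. P i}"
  have fin: "finite Hs" unfolding Hs_def using finite_Irr by simp
  have sub: "Hs \<subseteq> Irr G" by (auto simp: Hs_def)
  have bij: "(\<lambda>h. te h j) ` Hs = Hs" for j
    by (rule endo_inj_surj[OF fin]) (use inj_on_subset[OF tens_inj sub] step tens_Irr in \<open>auto simp: Hs_def\<close>)
  have zero: "(\<Sum>h\<in>Hs. h g) = 0" if g: "g \<in> G" "g \<noteq> mat 1" for g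
  proof -
    obtain j where j: "\<chi>' j g \<noteq> 1" using faithful g by auto
    have "(\<Sum>h\<in>Hs. h g) = (\<Sum>h\<in>Hs. (te h j) g)"
      using sum.reindex[OF inj_on_subset[OF tens_inj sub], of "\<lambda>h. h g" j] bij[of j] by simp
    also have "\<dots> = \<chi>' j g * (\<Sum>h\<in>Hs. h g)"
      unfolding sum_distrib_left by (rule sum.cong) (auto simp: tens_apply g)
    finally show ?thesis using j by simp
  qed
  \<comment> \<open>The sum of the scalar products of \<open>i\<close> with the members of
    \<open>Hs\<close>. Since the sum of the members vanishes off the identity, it equals the number
    of members; so some \<open>h\<close> is not orthogonal to \<open>i\<close>, and then
    \<open>h = i\<close>.\<close>
  have "(\<Sum>h\<in>Hs. \<Sum>g\<in>G. inverse (i g) * h g) = (\<Sum>g\<in>G. inverse (i g) * (\<Sum>h\<in>Hs. h g))"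
    by (subst sum.swap) (simp add: sum_distrib_left)
  also have "\<dots> = (\<Sum>g\<in>{mat 1}. inverse (i g) * (\<Sum>h\<in>Hs. h g))"
    by (rule sum.mono_neutral_right[OF finG]) (use zero G_one in auto)
  also have "\<dots> = (\<Sum>h\<in>Hs. h (mat 1))" using char_one[OF i] by simp
  also have "\<dots> = (\<Sum>h\<in>Hs. 1)" by (rule sum.cong) (use char_one sub in auto)
  also have "\<dots> = of_nat (card Hs)" by simp
  also have "\<dots> \<noteq> 0" using fin base triv_Irr by (auto simp: Hs_def)
  finally have ne: "(\<Sum>h\<in>Hs. \<Sum>g\<in>G. inverse (i g) * h g) \<noteq> 0" .
  have "\<exists>h\<in>Hs. (\<Sum>g\<in>G. inverse (i g) * h g) \<noteq> 0"
  proof (rule ccontr)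
    assume "\<not> ?thesis"
    then have "(\<Sum>h\<in>Hs. \<Sum>g\<in>G. inverse (i g) * h g) = 0" by (intro sum.neutral) auto
    with ne show False by simp
  qed
  then obtain h where h: "h \<in> Hs" "(\<Sum>g\<in>G. inverse (i g) * h g) \<noteq> 0" by auto
  have hI: "h \<in> Irr G" using h sub by auto
  have "inverse (i a) * h a = 1" if "a \<in> G" for a
    by (rule character_sum[OF _ h(2) that]) (auto simp: char_mult[OF i] char_mult[OF hI])
  then have "i = h" using char_nonzero[OF i] by (intro char_ext[OF i hI]) (simp add: field_simps)
  then show ?thesis using h by (simp add: Hs_def)
qed

text \<open>The weight of the Laurent monomial with exponent vector \<open>x\<close>. It spreads the
  integer vectors over the vertices of the McKay quiver, with unit steps covering arrows by
  \<open>cl_step\<close>, so that functions on the quiver can be studied on a lattice.\<close>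

definition cl :: "int^'n \<Rightarrow> 'n gchar" where
  "cl x = (\<lambda>g\<in>G. \<Prod>j\<in>UNIV. \<chi>' j g powi (x $ j))"

lemma chi_nz: "g \<in> G \<Longrightarrow> \<chi>' j g \<noteq> 0" by (rule char_nonzero[OF chi_Irr])

lemma cl_zero: "cl 0 = triv G" by (auto simp: cl_def triv_def)

lemma cl_add: "g \<in> G \<Longrightarrow> cl (x + y) g = cl x g * cl y g"
  by (simp add: cl_def power_int_add chi_nz prod.distrib)

lemma cl_Irr: "cl x \<in> Irr G"
proof -
  have "(\<Prod>j\<in>UNIV. \<chi>' j (g ** h) powi (x $ j)) = (\<Prod>j\<in>UNIV. \<chi>' j g powi (x $ j)) * (\<Prod>j\<in>UNIV. \<chi>' j h powi (x $ j))"
    if "g \<in> G" "h \<in> G" for g h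
    using that by (simp add: chi_mult power_int_mult_distrib prod.distrib)
  then show ?thesis by (auto simp: Irr_def hom_def Cstar_def SL_def cl_def G_mult chi_nz)
qed

lemma cl_axis: "cl (axis j 1) = \<chi>' j"
proof (rule char_ext[OF cl_Irr chi_Irr])
  fix g assume g: "g \<in> G"
  have "(\<Prod>k\<in>UNIV. \<chi>' k g powi (axis j 1 $ k)) = (\<Prod>k\<in>UNIV. if k = j then \<chi>' j g else 1)"
    by (rule prod.cong) (auto simp: axis_def)
  then show "cl (axis j 1) g = \<chi>' j g" using g by (simp add: cl_def)
qed

lemma cl_step: "cl (x + axis j 1) = te (cl x) j"
  by (rule char_ext[OF cl_Irr tens_Irr[OF cl_Irr]]) (simp add: cl_add tens_apply cl_axis)

lemma cl_surj:
  assumes "i \<in> Irr G"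
  obtains x where "cl x = i"
proof -
  have "\<exists>x. cl x = i"
  proof (rule Irr_induct[OF assms])
    show "\<exists>x. cl x = triv G" using cl_zero by (intro exI[of _ 0])
    fix i j assume "\<exists>x. cl x = i"
    then obtain x where "cl x = i" by (rule exE)
    then show "\<exists>x. cl x = te i j" using cl_step[of x j] by (intro exI[of _ "x + axis j 1"]) simp
  qed
  then show ?thesis using that by auto
qed

lemma cl_range: "range cl = Irr G"
proof
  show "range cl \<subseteq> Irr G" using cl_Irr by auto
  show "Irr G \<subseteq> range cl"
  proof
    fix i assume "i \<in> Irr G"
    then obtain x where "cl x = i" by (rule cl_surj)
    then show "i \<in> range cl" by auto
  qed
qed

lemma cl_neg_add: "cl x g * cl (y - x) g = cl y g" if "g \<in> G"
  using cl_add[OF that, of x "y - x"] by simp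

lemma cl_diff: "cl x = cl y \<Longrightarrow> cl (x - y) = cl 0"
proof -
  assume e: "cl x = cl y"
  show ?thesis
  proof (rule char_ext[OF cl_Irr cl_Irr])
    fix g assume g: "g \<in> G"
    have "cl y g * cl (x - y) g = cl x g" by (rule cl_neg_add[OF g])
    then show "cl (x - y) g = cl 0 g" using e char_nonzero[OF cl_Irr g, of y] g by (simp add: cl_zero triv_def)
  qed
qed

lemma cl_shift: "cl m = cl 0 \<Longrightarrow> cl (x + m) = cl x"
  by (rule char_ext[OF cl_Irr cl_Irr]) (simp add: cl_add cl_zero triv_def)

subsection \<open>Weights and lattices\<close>

lemma weight_exp:
  assumes g: "g \<in> G"
  shows "0 \<le> wv g $ j" "wv g $ j < 1"
    "\<chi>' j g = exp (2 * of_real pi * \<i> * of_real (wv g $ j))"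
proof -
  interpret SL: group "SL :: (complex^'n^'n) monoid" by (rule group_SL)
  define r where "r = SL.ord g"
  have pow: "g [^]\<^bsub>SL\<^esub> n \<in> G \<and> \<chi>' j (g [^]\<^bsub>SL\<^esub> n) = \<chi>' j g ^ n" for n :: nat
  proof (induction n)
    case 0
    then show ?case using G_one chi_one by (simp add: SL_def)
  next
    case (Suc n)
    have "g [^]\<^bsub>SL\<^esub> Suc n = g [^]\<^bsub>SL\<^esub> n ** g" by (simp add: SL_def)
    then show ?case using Suc G_mult g chi_mult by simp
  qed
  have rr: "g [^]\<^bsub>SL\<^esub> r = \<one>\<^bsub>SL\<^esub>" unfolding r_def by (rule SL.pow_ord_eq_1[OF G_SL[OF g]])
  \<comment> \<open>\<open>ord\<close> takes the value 0 on elements of infinite order, so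
    finiteness of \<open>G\<close> enters here; with \<open>r = 0\<close> the weights would be
    meaningless.\<close>
  have "r \<noteq> 0"
  proof
    assume "r = 0"
    then have "inj (\<lambda>n::nat. g [^]\<^bsub>SL\<^esub> n)"
    proof -
      assume r0: "r = 0"
      have "g [^]\<^bsub>SL\<^esub> n \<noteq> g [^]\<^bsub>SL\<^esub> m" if "n < m" for n m :: nat
      proof
        assume e: "g [^]\<^bsub>SL\<^esub> n = g [^]\<^bsub>SL\<^esub> m"
        have gc: "g \<in> carrier SL" by (rule G_SL[OF g])
        have "g [^]\<^bsub>SL\<^esub> n \<otimes>\<^bsub>SL\<^esub> g [^]\<^bsub>SL\<^esub> (m - n) = g [^]\<^bsub>SL\<^esub> n"
          using that e SL.nat_pow_mult[OF gc, of n "m - n"] by simp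
        then have "g [^]\<^bsub>SL\<^esub> (m - n) = \<one>\<^bsub>SL\<^esub>"
          using gc by (metis SL.l_cancel_one' SL.nat_pow_closed)
        then have "r dvd m - n" unfolding r_def using SL.pow_eq_id[OF gc] by simp
        then show False using r0 that by simp
      qed
      then show ?thesis by (metis injI linorder_neqE_nat)
    qed
    then have "infinite (range (\<lambda>n::nat. g [^]\<^bsub>SL\<^esub> n))" using range_inj_infinite by blast
    moreover have "range (\<lambda>n::nat. g [^]\<^bsub>SL\<^esub> n) \<subseteq> G" using pow by auto
    ultimately show False using finG finite_subset by blast
  qed
  then have r1: "1 \<le> r" by simp
  have "\<chi>' j g ^ r = \<chi>' j (\<one>\<^bsub>SL\<^esub>)" using pow[of r] rr by simp
  then have "\<chi>' j g \<in> {z. z ^ r = 1}" using chi_one by (simp add: SL_def)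
  then obtain a where a: "a < r" "\<chi>' j g = exp (2 * of_real pi * \<i> * of_nat a / of_nat r)"
    using complex_roots_unity[OF r1] by auto
  have "(THE a. a < r \<and> \<chi>' j g = exp (2 * of_real pi * \<i> * of_nat a / of_nat r)) = a"
  proof (rule the_equality)
    fix b assume b: "b < r \<and> \<chi>' j g = exp (2 * of_real pi * \<i> * of_nat b / of_nat r)"
    then have "b mod r = a mod r" using a complex_root_unity_eq[OF r1, of b a] by simp
    then show "b = a" using a b by simp
  qed (use a in auto)
  then have w: "wv g $ j = real a / real r" by (simp add: weight_vec_def Let_def r_def)
  show "0 \<le> wv g $ j" "wv g $ j < 1" using w a by auto
  show "\<chi>' j g = exp (2 * of_real pi * \<i> * of_real (wv g $ j))" unfolding a(2) w by simp
qed

lemma cl_exp: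
  assumes g: "g \<in> G"
  shows "cl x g = exp (2 * of_real pi * \<i> * of_real (rvec x \<bullet> wv g))"
proof -
  have "cl x g = (\<Prod>j\<in>UNIV. exp (of_int (x $ j) * (2 * of_real pi * \<i> * of_real (wv g $ j))))"
    using g weight_exp(3)[OF g] by (simp add: cl_def exp_power_int)
  also have "\<dots> = exp (\<Sum>j\<in>UNIV. of_int (x $ j) * (2 * of_real pi * \<i> * of_real (wv g $ j)))"
    by (simp add: exp_sum)
  also have "(\<Sum>j\<in>UNIV. of_int (x $ j) * (2 * of_real pi * \<i> * of_real (wv g $ j))) = 2 * of_real pi * \<i> * of_real (rvec x \<bullet> wv g)"
    by (simp add: inner_vec_def rvec_def sum_distrib_left mult_ac)
  finally show ?thesis .
qed

lemma exp_int: "exp (2 * of_real pi * \<i> * of_real t) = (1::complex) \<longleftrightarrow> t \<in> \<int>"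
proof
  assume "exp (2 * of_real pi * \<i> * of_real t) = (1::complex)"
  then obtain n :: int where "2 * pi * t = of_int (2 * n) * pi" by (auto simp: exp_eq_1)
  then have "t = of_int n" by simp
  then show "t \<in> \<int>" by simp
next
  assume "t \<in> \<int>"
  then obtain n where "t = of_int n" by (auto elim: Ints_cases)
  then show "exp (2 * of_real pi * \<i> * of_real t) = (1::complex)"
    by (auto simp: exp_eq_1)
qed

lemma cl_triv_iff: "cl x = cl 0 \<longleftrightarrow> (\<forall>g\<in>G. rvec x \<bullet> wv g \<in> \<int>)"
proof
  assume e: "cl x = cl 0"
  show "\<forall>g\<in>G. rvec x \<bullet> wv g \<in> \<int>"
  proof
    fix g assume g: "g \<in> G"
    have "cl x g = 1" using e g by (simp add: cl_zero triv_def)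
    then show "rvec x \<bullet> wv g \<in> \<int>" using cl_exp[OF g] exp_int by metis
  qed
next
  assume i: "\<forall>g\<in>G. rvec x \<bullet> wv g \<in> \<int>"
  show "cl x = cl 0"
  proof (rule char_ext[OF cl_Irr cl_Irr])
    fix g assume g: "g \<in> G"
    have "cl x g = 1" using i g cl_exp[OF g] exp_int by metis
    then show "cl x g = cl 0 g" using g by (simp add: cl_zero triv_def)
  qed
qed

lemma wv_N_G: "g \<in> G \<Longrightarrow> wv g \<in> N_G G X"
proof -
  assume g: "g \<in> G"
  have "(\<Sum>h\<in>G. of_int (if h = g then 1 else 0) *\<^sub>R wv h) = (\<Sum>h\<in>G. if h = g then wv h else 0)"
    by (rule sum.cong) auto
  then have "wv g = 0 + (\<Sum>h\<in>G. of_int (if h = g then 1 else 0) *\<^sub>R wv h)" using g finG by simp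
  then show ?thesis unfolding N_G_def by (intro CollectI exI[of _ 0] exI[of _ "\<lambda>h. if h = g then 1 else 0"]) auto
qed

lemma axis_N_G: "axis j 1 \<in> N_G G X"
  unfolding N_G_def by (intro CollectI exI[of _ "axis j 1"] exI[of _ "\<lambda>h. 0"]) (auto simp: axis_def)

text \<open>Pairing with the basis vectors makes an element of M_G integral, and pairing with the
  weight vectors gives the exponents of its character values; so M_G is the lattice of invariant
  Laurent monomials.\<close>

lemma M_G_carrier: "carrier (M_G G X) = rvec ` {x. cl x = cl 0}"
proof
  show "carrier (M_G G X) \<subseteq> rvec ` {x. cl x = cl 0}"
  proof
    fix m assume "m \<in> carrier (M_G G X)"
    then have m: "\<And>v. v \<in> N_G G X \<Longrightarrow> m \<bullet> v \<in> \<int>" by (simp add: M_G_def)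
    have "m $ j \<in> \<int>" for j using m[OF axis_N_G[of j]] by (simp add: inner_axis)
    then have "\<forall>j. \<exists>k. m $ j = of_int k" by (auto elim: Ints_cases)
    then obtain k where k: "\<forall>j. m $ j = of_int (k j)" by metis
    have mr: "m = rvec (\<chi> j. k j)" using k by (simp add: rvec_def vec_eq_iff)
    have "cl (\<chi> j. k j) = cl 0" unfolding cl_triv_iff using m wv_N_G mr by auto
    with mr show "m \<in> rvec ` {x. cl x = cl 0}" by auto
  qed
  show "rvec ` {x. cl x = cl 0} \<subseteq> carrier (M_G G X)"
  proof
    fix m assume "m \<in> rvec ` {x. cl x = cl 0}"
    then obtain x where x: "cl x = cl 0" "m = rvec x" by auto
    have "m \<bullet> v \<in> \<int>" if v: "v \<in> N_G G X" for v
    proof -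
      obtain z c where z: "v = z + (\<Sum>g\<in>G. of_int (c g) *\<^sub>R wv g)" "\<forall>j. z $ j \<in> \<int>" using v by (auto simp: N_G_def)
      have "m \<bullet> z \<in> \<int>" unfolding x(2) inner_vec_def using z(2) by (intro Ints_sum) (auto simp: rvec_def)
      moreover have "m \<bullet> (\<Sum>g\<in>G. of_int (c g) *\<^sub>R wv g) \<in> \<int>"
        unfolding inner_sum_right using x cl_triv_iff by (intro Ints_sum) auto
      ultimately show ?thesis unfolding z(1) by (simp add: inner_add_right)
    qed
    then show "m \<in> carrier (M_G G X)" by (simp add: M_G_def)
  qed
qed

end

section \<open>The component \<open>\<V>\<close> and its torus\<close>

context mckay
begin

lemma finite_Arr: "finite (Arr G)" by (simp add: Arr_def finite_Irr)

text \<open>The torus is taken from the equations of \<open>R_var\<close>; that it equals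
  \<open>T_V\<close> is known only after \<V> has been identified with its closure.\<close>

definition T0 :: "'n rpoint set" where
  "T0 = {p \<in> R_var G X. \<forall>e\<in>Arr G. p e \<noteq> 0}"

lemma T0_iff: "p \<in> T0 \<longleftrightarrow> p \<in> extensional (Arr G) \<and> (\<forall>i\<in>Irr G. \<forall>j. p (i, j) \<noteq> 0) \<and>
    (\<forall>i\<in>Irr G. \<forall>j j'. p (te i j, j') * p (i, j) = p (te i j', j) * p (i, j'))"
  unfolding T0_def R_var_def Arr_def by (auto simp: PiE_def)

section \<open>Points of the torus as products of a scalar and a coboundary\<close>

context
  fixes p assumes p: "p \<in> T0"
begin

text \<open>The transpose of multiplication by the j-th coordinate on the G-constellation of
  \<open>p\<close>, acting on functions on the vertices. The equations of \<open>R_var\<close> say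
  that these operators commute.\<close>

definition Op :: "'n \<Rightarrow> ('n gchar \<Rightarrow> complex) \<Rightarrow> 'n gchar \<Rightarrow> complex" where
  "Op j f i = (if i \<in> Irr G then p (i, j) * f (te i j) else 0)"

lemma Op_comm: "Op j (Op k f) = Op k (Op j f)"
proof
  fix i
  show "Op j (Op k f) i = Op k (Op j f) i"
  proof (cases "i \<in> Irr G")
    case True
    have "p (te i j, k) * p (i, j) = p (te i k, j) * p (i, k)" using p True unfolding T0_iff by blast
    then show ?thesis using True tens_Irr[OF True] tens_comm[of i j k] by (simp add: Op_def mult.assoc[symmetric]) (simp add: mult.commute)
  qed (simp add: Op_def)
qed

lemma Op_pow_comm: "(Op j ^^ n) (Op k f) = Op k ((Op j ^^ n) f)"
  by (induction n) (auto simp: Op_comm)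

lemma Op_sum: "Op j (\<lambda>i. \<Sum>l\<in>A. c l * h l i) = (\<lambda>i. \<Sum>l\<in>A. c l * Op j (h l) i)"
  by (rule ext) (simp add: Op_def sum_distrib_left mult_ac)

lemma Op_scale: "Op j (\<lambda>i. c * h i) = (\<lambda>i. c * Op j h i)"
  by (rule ext) (simp add: Op_def mult_ac)

lemma Op_pow_scale: "(Op j ^^ n) (\<lambda>i. c * h i) = (\<lambda>i. c * (Op j ^^ n) h i)"
  by (induction n) (auto simp: Op_scale)

lemma p_nz: "i \<in> Irr G \<Longrightarrow> p (i, j) \<noteq> 0" using p by (simp add: T0_iff)

text \<open>The power with exponent \<open>card G\<close> leads every vertex back to itself, so it
  acts by a scalar \<open>Q i\<close> at each \<open>i\<close>. Because it commutes with the other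
  operators, \<open>Q\<close> is constant along arrows, hence on the connected quiver.\<close>

lemma Op_pow_card: "\<exists>\<alpha>. \<alpha> \<noteq> 0 \<and> (\<forall>f. (\<forall>i. i \<notin> Irr G \<longrightarrow> f i = 0) \<longrightarrow> (Op j ^^ card G) f = (\<lambda>i. \<alpha> * f i))"
proof -
  define tp where "tp n i = ((\<lambda>k. te k j) ^^ n) i" for n and i :: "'n gchar"
  have tp_Irr: "tp n i \<in> Irr G" if "i \<in> Irr G" for n i
    by (induction n) (auto simp: tp_def that tens_Irr)
  have tp_val: "tp n i g = i g * \<chi>' j g ^ n" if "g \<in> G" for n i g
    by (induction n) (auto simp: tp_def tens_apply that)
  have tp_card: "tp (card G) i = i" if "i \<in> Irr G" for i
    using tp_val char_root[OF chi_Irr] by (intro char_ext[OF tp_Irr[OF that] that]) simp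
  define P where "P n i = (\<Prod>l<n. p (tp l i, j))" for n i
  have tpS: "tp l (te i j) = tp (Suc l) i" for l i
    unfolding tp_def by (simp only: funpow_Suc_right comp_apply)
  have Op_pow: "(Op j ^^ n) f i = P n i * f (tp n i)" if "i \<in> Irr G" for n f i
    using that
  proof (induction n arbitrary: i)
    case (Suc n)
    have "P (Suc n) i = p (i, j) * P n (te i j)"
      unfolding P_def by (subst prod.lessThan_Suc_shift) (simp add: tpS, simp add: tp_def)
    then show ?case using Suc.IH[OF tens_Irr[OF Suc.prems]] Suc.prems by (simp add: Op_def tpS)
  qed (simp add: P_def tp_def)
  define Q where "Q i = P (card G) i" for i
  have QOp: "(Op j ^^ card G) f i = Q i * f i" if "i \<in> Irr G" for f i
    using Op_pow[OF that] tp_card[OF that] by (simp add: Q_def)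
  have Q_step: "Q (te i k) = Q i" if i: "i \<in> Irr G" for i k
  proof -
    let ?f = "\<lambda>_. 1::complex"
    have "(Op j ^^ card G) (Op k ?f) i = Op k ((Op j ^^ card G) ?f) i" by (simp add: Op_pow_comm)
    then have "Q i * p (i, k) = p (i, k) * Q (te i k)" using i tens_Irr[OF i] by (simp add: QOp, simp add: Op_def QOp)
    then show ?thesis using p_nz[OF i, of k] by simp
  qed
  have Q: "Q i = Q (triv G)" if "i \<in> Irr G" for i
    by (rule Irr_induct[OF that, where P="\<lambda>i. Q i = Q (triv G)"]) (use Q_step in auto)
  have "Q (triv G) \<noteq> 0" unfolding Q_def P_def using p_nz tp_Irr[OF triv_Irr] by simp
  moreover have "(Op j ^^ card G) f = (\<lambda>i. Q (triv G) * f i)" if "\<forall>i. i \<notin> Irr G \<longrightarrow> f i = 0" for f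
  proof
    fix i
    show "(Op j ^^ card G) f i = Q (triv G) * f i"
    proof (cases "i \<in> Irr G")
      case False
      obtain n where "card G = Suc n" using cardG by (cases "card G") auto
      then show ?thesis using False that by (simp add: Op_def)
    qed (use QOp Q in auto)
  qed
  ultimately show ?thesis by auto
qed

text \<open>On \<open>f\<close> the power with exponent \<open>card G\<close> of \<open>Op j\<close>
  is a scalar \<alpha>. For each root \<open>s\<close> of \<alpha> of that order, the discrete
  Fourier sum is zero or an eigenvector, and together they add up to \<open>card G\<close> times
  \<open>f\<close>, so one is nonzero. Being a polynomial in \<open>Op j\<close> applied to
  \<open>f\<close>, it stays an eigenvector of the operators treated before.\<close>

lemma eigenvector_step:
  assumes f: "\<exists>i\<in>Irr G. f i \<noteq> 0" "\<forall>i. i \<notin> Irr G \<longrightarrow> f i = 0"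
  obtains c s where "\<exists>i\<in>Irr G. (\<Sum>l<card G. c l * (Op j ^^ l) f i) \<noteq> 0"
    "Op j (\<lambda>i. \<Sum>l<card G. c l * (Op j ^^ l) f i) = (\<lambda>i. s * (\<Sum>l<card G. c l * (Op j ^^ l) f i))"
proof -
  let ?r = "card G"
  obtain \<alpha> where \<alpha>: "\<alpha> \<noteq> 0" "(Op j ^^ ?r) f = (\<lambda>i. \<alpha> * f i)" using Op_pow_card[of j] f(2) by auto
  define \<beta> where "\<beta> = exp (Ln \<alpha> / of_nat ?r)"
  have \<beta>: "\<beta> ^ ?r = \<alpha>" "\<beta> \<noteq> 0" using \<alpha>(1) cardG by (auto simp: \<beta>_def exp_of_nat_mult[symmetric])
  define \<omega> where "\<omega> k = exp (2 * of_real pi * \<i> * of_nat k / of_nat ?r)" for k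
  have \<omega>r: "\<omega> k ^ ?r = 1" for k unfolding \<omega>_def using complex_root_unity[of ?r k] cardG by simp
  have \<omega>0: "\<omega> k \<noteq> 0" for k by (simp add: \<omega>_def)
  have \<omega>m: "\<omega> k ^ l = \<omega> l ^ k" for k l
    unfolding \<omega>_def exp_of_nat_mult[symmetric] by (simp add: mult_ac)
  define s where "s k = \<omega> k * \<beta>" for k
  have s: "s k ^ ?r = \<alpha>" "s k \<noteq> 0" for k using \<beta> \<omega>r \<omega>0 by (auto simp: s_def power_mult_distrib)
  define g where "g k i = (\<Sum>l<?r. inverse (s k ^ l) * (Op j ^^ l) f i)" for k i
  have eig: "Op j (g k) = (\<lambda>i. s k * g k i)" for k
  proof
    fix i
    have "Op j (g k) i = (\<Sum>l<?r. inverse (s k ^ l) * (Op j ^^ Suc l) f i)"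
      unfolding g_def Op_sum by simp
    also have "\<dots> = (\<Sum>l<?r. s k * (inverse (s k ^ Suc l) * (Op j ^^ Suc l) f i))"
      by (rule sum.cong) (use s in \<open>auto simp: field_simps\<close>)
    also have "\<dots> = s k * (\<Sum>l<?r. inverse (s k ^ Suc l) * (Op j ^^ Suc l) f i)" by (simp add: sum_distrib_left)
    also have "(\<Sum>l<?r. inverse (s k ^ Suc l) * (Op j ^^ Suc l) f i) = g k i + (inverse (s k ^ ?r) * (Op j ^^ ?r) f i - f i)"
    proof -
      have "(\<Sum>l<Suc ?r. inverse (s k ^ l) * (Op j ^^ l) f i) = f i + (\<Sum>l<?r. inverse (s k ^ Suc l) * (Op j ^^ Suc l) f i)"
        by (subst sum.lessThan_Suc_shift) simp
      moreover have "(\<Sum>l<Suc ?r. inverse (s k ^ l) * (Op j ^^ l) f i) = g k i + inverse (s k ^ ?r) * (Op j ^^ ?r) f i"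
        by (simp add: g_def)
      ultimately have "f i + (\<Sum>l<?r. inverse (s k ^ Suc l) * (Op j ^^ Suc l) f i) = g k i + inverse (s k ^ ?r) * (Op j ^^ ?r) f i"
        by (rule trans[OF sym])
      then show ?thesis by (simp only: add_diff_eq eq_diff_eq add.commute)
    qed
    also have "inverse (s k ^ ?r) * (Op j ^^ ?r) f i - f i = 0" using s \<alpha> by simp
    finally show "Op j (g k) i = s k * g k i" by simp
  qed
  obtain i0 where i0: "i0 \<in> Irr G" "f i0 \<noteq> 0" using f(1) by auto
  have "(\<Sum>k<?r. g k i0) = (\<Sum>l<?r. (\<Sum>k<?r. inverse (s k ^ l)) * (Op j ^^ l) f i0)"
    unfolding g_def by (subst sum.swap) (simp add: sum_distrib_right)
  also have "\<dots> = (\<Sum>l<?r. if l = 0 then of_nat ?r * f i0 else 0)"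
  proof (rule sum.cong[OF refl])
    fix l assume l: "l \<in> {..<?r}"
    show "(\<Sum>k<?r. inverse (s k ^ l)) * (Op j ^^ l) f i0 = (if l = 0 then of_nat ?r * f i0 else 0)"
    proof (cases "l = 0")
      case False
      have ne: "\<omega> l \<noteq> 1" unfolding \<omega>_def using complex_root_unity_eq_1[of ?r l] l False by (auto dest: dvd_imp_le)
      have "(\<Sum>k<?r. inverse (s k ^ l)) = (\<Sum>k<?r. inverse (\<beta> ^ l) * inverse (\<omega> l) ^ k)"
        by (rule sum.cong) (auto simp: s_def power_mult_distrib \<omega>m[of _ l] power_inverse)
      also have "\<dots> = inverse (\<beta> ^ l) * (\<Sum>k<?r. inverse (\<omega> l) ^ k)" by (simp add: sum_distrib_left)
      also have "(\<Sum>k<?r. inverse (\<omega> l) ^ k) = 0"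
        using ne \<omega>r[of l] by (subst geometric_sum) (auto simp: power_inverse)
      finally show ?thesis using False by simp
    qed simp
  qed
  also have "\<dots> = of_nat ?r * f i0" using cardG by (simp add: sum.delta)
  finally have "(\<Sum>k<?r. g k i0) \<noteq> 0" using i0 cardG by simp
  then obtain k where "g k i0 \<noteq> 0" by (metis sum.neutral)
  then have "\<exists>i\<in>Irr G. (\<Sum>l<?r. inverse (s k ^ l) * (Op j ^^ l) f i) \<noteq> 0"
    using i0(1) by (intro bexI[of _ i0]) (simp add: g_def)
  then show thesis by (rule that[of "\<lambda>l. inverse (s k ^ l)" "s k"]) (use eig[of k] in \<open>simp add: g_def[abs_def]\<close>)
qed

text \<open>The \<open>t i\<close> form a common eigenvector of the commuting operators \<open>Op j\<close>; it has no zeros because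
  the quiver is connected.\<close>

lemma T0_param_aux:
  "\<exists>s t. (\<forall>j. s j \<noteq> 0) \<and> (\<forall>i\<in>Irr G. t i \<noteq> 0) \<and> (\<forall>i\<in>Irr G. \<forall>j. p (i, j) = s j * t (te i j) / t i)"
proof -
  have "\<exists>f. (\<exists>i\<in>Irr G. f i \<noteq> 0) \<and> (\<forall>i. i \<notin> Irr G \<longrightarrow> f i = 0) \<and> (\<forall>j\<in>J. \<exists>s. Op j f = (\<lambda>i. s * f i))" for J :: "'n set"
    using finite[of J]
  proof (induction J rule: finite_induct)
    case empty
    show ?case using triv_Irr by (intro exI[of _ "\<lambda>i. if i \<in> Irr G then 1 else 0"]) auto
  next
    case (insert j J)
    then obtain f where f: "\<exists>i\<in>Irr G. f i \<noteq> 0" "\<forall>i. i \<notin> Irr G \<longrightarrow> f i = 0" "\<forall>k\<in>J. \<exists>s. Op k f = (\<lambda>i. s * f i)" by auto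
    obtain c s where cs: "\<exists>i\<in>Irr G. (\<Sum>l<card G. c l * (Op j ^^ l) f i) \<noteq> 0"
      "Op j (\<lambda>i. \<Sum>l<card G. c l * (Op j ^^ l) f i) = (\<lambda>i. s * (\<Sum>l<card G. c l * (Op j ^^ l) f i))"
      by (rule eigenvector_step[OF f(1,2)])
    let ?g = "\<lambda>i. \<Sum>l<card G. c l * (Op j ^^ l) f i"
    have out: "(Op j ^^ l) f i = 0" if "i \<notin> Irr G" for l i
      using that f(2) by (cases l) (auto simp: Op_def)
    have "\<exists>s. Op k ?g = (\<lambda>i. s * ?g i)" if k: "k \<in> J" for k
    proof -
      obtain s where s: "Op k f = (\<lambda>i. s * f i)" using f(3) k by auto
      have "Op k ?g = (\<lambda>i. \<Sum>l<card G. c l * Op k ((Op j ^^ l) f) i)" by (rule Op_sum)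
      also have "\<dots> = (\<lambda>i. \<Sum>l<card G. c l * (s * (Op j ^^ l) f i))"
        by (simp only: Op_pow_comm[symmetric] s Op_pow_scale)
      also have "\<dots> = (\<lambda>i. s * ?g i)" by (simp add: sum_distrib_left mult_ac)
      finally show ?thesis by auto
    qed
    with cs(2) have "\<forall>k\<in>insert j J. \<exists>s. Op k ?g = (\<lambda>i. s * ?g i)" by auto
    moreover have "\<forall>i. i \<notin> Irr G \<longrightarrow> ?g i = 0" using out by simp
    ultimately show ?case using cs(1) by (intro exI[of _ ?g] conjI)
  qed
  from this[of UNIV] obtain f where f: "\<exists>i\<in>Irr G. f i \<noteq> 0" "\<forall>j. \<exists>s. Op j f = (\<lambda>i. s * f i)" by auto
  from choice[OF f(2)] obtain s where s: "\<forall>j. Op j f = (\<lambda>i. s j * f i)" by (rule exE)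
  have eq: "p (i, j) * f (te i j) = s j * f i" if "i \<in> Irr G" for i j
    using fun_cong[OF s[rule_format, of j], of i] that by (simp add: Op_def)
  have te_surj: "(\<lambda>i. te i j) ` Irr G = Irr G" for j
    by (rule endo_inj_surj[OF finite_Irr _ tens_inj]) (use tens_Irr in auto)
  have s0: "s j \<noteq> 0" for j
  proof
    assume sj: "s j = 0"
    obtain i where i: "i \<in> Irr G" "f i \<noteq> 0" using f(1) by auto
    then obtain k where k: "k \<in> Irr G" "i = te k j" using te_surj[of j] by blast
    then show False using eq[OF k(1), of j] sj p_nz[OF k(1), of j] i by simp
  qed
  have iff: "f (te i j) \<noteq> 0 \<longleftrightarrow> f i \<noteq> 0" if "i \<in> Irr G" for i j
    using eq[OF that, of j] s0[of j] p_nz[OF that, of j] by (metis mult_eq_0_iff)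
  have same: "f i \<noteq> 0 \<longleftrightarrow> f (triv G) \<noteq> 0" if "i \<in> Irr G" for i
    by (rule Irr_induct[OF that, where P="\<lambda>i. f i \<noteq> 0 \<longleftrightarrow> f (triv G) \<noteq> 0"]) (use iff in auto)
  then have f0: "f i \<noteq> 0" if "i \<in> Irr G" for i using f(1) that by auto
  show ?thesis
  proof (intro exI[of _ s] exI[of _ "\<lambda>i. inverse (f i)"] conjI allI ballI)
    fix i j assume i: "i \<in> Irr G"
    show "p (i, j) = s j * inverse (f (te i j)) / inverse (f i)"
      using eq[OF i, of j] f0[OF i] f0[OF tens_Irr[OF i], of j] by (simp add: field_simps)
  qed (use s0 f0 in auto)
qed

end

lemma T0_param:
  assumes "p \<in> T0"
  obtains s t where "\<forall>j. s j \<noteq> 0" "\<forall>i\<in>Irr G. t i \<noteq> 0"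
    "\<forall>i\<in>Irr G. \<forall>j. p (i, j) = s j * t (te i j) / t i"
  using T0_param_aux[OF assms] by blast

lemma T0_I:
  assumes "\<And>j. s j \<noteq> 0" "\<And>i. i \<in> Irr G \<Longrightarrow> t i \<noteq> 0"
  shows "(\<lambda>(i, j)\<in>Arr G. s j * t (te i j) / t i) \<in> T0"
  unfolding T0_iff
proof (intro conjI ballI allI)
  fix i j j' assume i: "i \<in> Irr G"
  have "t (te i j) \<noteq> 0" "t (te i j') \<noteq> 0" using assms(2) tens_Irr i by auto
  then show "(\<lambda>(i, j)\<in>Arr G. s j * t (te i j) / t i) (te i j, j') * (\<lambda>(i, j)\<in>Arr G. s j * t (te i j) / t i) (i, j) =
      (\<lambda>(i, j)\<in>Arr G. s j * t (te i j) / t i) (te i j', j) * (\<lambda>(i, j)\<in>Arr G. s j * t (te i j) / t i) (i, j')"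
    using i tens_Irr[OF i] tens_comm[of i j j'] by (simp add: Arr_def)
qed (use assms tens_Irr in \<open>auto simp: Arr_def\<close>)

lemma T0_mult: "p \<in> T0 \<Longrightarrow> q \<in> T0 \<Longrightarrow> tmult G p q \<in> T0"
proof -
  assume p: "p \<in> T0" and q: "q \<in> T0"
  have "(p (te i j, j') * q (te i j, j')) * (p (i, j) * q (i, j)) = (p (te i j', j) * q (te i j', j)) * (p (i, j') * q (i, j'))"
    if i: "i \<in> Irr G" for i j j'
  proof -
    have "p (te i j, j') * p (i, j) = p (te i j', j) * p (i, j')" "q (te i j, j') * q (i, j) = q (te i j', j) * q (i, j')"
      using p q i unfolding T0_iff by blast+
    then have "(p (te i j, j') * p (i, j)) * (q (te i j, j') * q (i, j)) = (p (te i j', j) * p (i, j')) * (q (te i j', j) * q (i, j'))"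
      by simp
    then show ?thesis by (simp only: mult_ac)
  qed
  then show ?thesis using p q unfolding T0_iff by (simp add: tmult_def Arr_def tens_Irr)
qed

lemma T0_one: "(\<lambda>e\<in>Arr G. 1) \<in> T0"
  unfolding T0_iff by (auto simp: Arr_def tens_Irr)

lemma T_bar_T0: "T_bar G X \<subseteq> T0"
proof
  fix p assume "p \<in> T_bar G X"
  then obtain t where t: "p = (\<lambda>(i, j)\<in>Arr G. inverse (t i) * t (te i j))" "\<forall>i\<in>Irr G. t i \<noteq> 0" by (auto simp: T_bar_def)
  have "(\<lambda>(i, j)\<in>Arr G. (1::complex) * t (te i j) / t i) \<in> T0" by (rule T0_I) (use t in auto)
  moreover have "(\<lambda>(i, j)\<in>Arr G. (1::complex) * t (te i j) / t i) = p" unfolding t(1) by (intro restrict_ext) (auto simp: field_simps)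
  ultimately show "p \<in> T0" by simp
qed

section \<open>Curves in the torus and its irreducibility\<close>

definition cocycle :: "('n arrow \<Rightarrow> 'k::ab_group_add) \<Rightarrow> bool" where
  "cocycle w \<longleftrightarrow> (\<forall>i\<in>Irr G. \<forall>j j'. w (te i j, j') + w (i, j) = w (te i j', j) + w (i, j'))"

definition move :: "'n rpoint \<Rightarrow> ('n arrow \<Rightarrow> complex) \<Rightarrow> complex \<Rightarrow> 'n rpoint" where
  "move p w z = (\<lambda>e\<in>Arr G. p e * exp (z * w e))"

lemma move_T0:
  assumes "p \<in> T0" and w: "cocycle w"
  shows "move p w z \<in> T0"
  unfolding T0_iff
proof (intro conjI ballI allI)
  have p: "p \<in> extensional (Arr G) \<and> (\<forall>i\<in>Irr G. \<forall>j. p (i, j) \<noteq> 0) \<and>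
    (\<forall>i\<in>Irr G. \<forall>j j'. p (te i j, j') * p (i, j) = p (te i j', j) * p (i, j'))"
    using assms(1) unfolding T0_iff .
  fix i j assume i: "i \<in> Irr G"
  show "move p w z (i, j) \<noteq> 0" using p i by (simp add: move_def Arr_def)
  fix j'
  have c: "w (te i j, j') + w (i, j) = w (te i j', j) + w (i, j')" using w i by (simp add: cocycle_def)
  have "move p w z (te i j, j') * move p w z (i, j) = (p (te i j, j') * p (i, j)) * exp (z * (w (te i j, j') + w (i, j)))"
    using i tens_Irr[OF i] by (simp add: move_def Arr_def distrib_left exp_add)
  also have "\<dots> = (p (te i j', j) * p (i, j')) * exp (z * (w (te i j', j) + w (i, j')))"
    using p i c by simp
  also have "\<dots> = move p w z (te i j', j) * move p w z (i, j')"
    using i tens_Irr[OF i] by (simp add: move_def Arr_def distrib_left exp_add)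
  finally show "move p w z (te i j, j') * move p w z (i, j) = move p w z (te i j', j) * move p w z (i, j')" .
qed (simp add: move_def)

lemma T0_connected:
  assumes p: "p \<in> T0" and q: "q \<in> T0"
  obtains w where "cocycle w" "move p w 0 = p" "move p w 1 = q"
proof -
  obtain s t where st: "\<forall>j. s j \<noteq> 0" "\<forall>i\<in>Irr G. t i \<noteq> 0"
    "\<forall>i\<in>Irr G. \<forall>j. p (i, j) = s j * t (te i j) / t i" by (rule T0_param[OF p])
  obtain s' t' where st': "\<forall>j. s' j \<noteq> 0" "\<forall>i\<in>Irr G. t' i \<noteq> 0"
    "\<forall>i\<in>Irr G. \<forall>j. q (i, j) = s' j * t' (te i j) / t' i" by (rule T0_param[OF q])
  \<comment> \<open>Logarithms are taken of the parameters and not of the coordinates: the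
    differences over vertices then form a cocycle whatever branch \<open>Ln\<close> selects.\<close>
  define w where "w = (\<lambda>(i, j). Ln (s' j / s j) + Ln (t' (te i j) / t (te i j)) - Ln (t' i / t i))"
  have "cocycle w" unfolding cocycle_def w_def using tens_comm by (simp add: algebra_simps)
  moreover have "move p w 0 = p"
    using p by (intro extensionalityI[of _ "Arr G"]) (auto simp: move_def T0_iff)
  moreover have "move p w 1 = q"
  proof (rule extensionalityI[of _ "Arr G"])
    fix e assume e: "e \<in> Arr G"
    then obtain i j where ij: "e = (i, j)" "i \<in> Irr G" by (auto simp: Arr_def)
    have nz: "s j \<noteq> 0" "s' j \<noteq> 0" "t i \<noteq> 0" "t' i \<noteq> 0" "t (te i j) \<noteq> 0" "t' (te i j) \<noteq> 0"
      using st(1,2) st'(1,2) ij(2) tens_Irr[OF ij(2), of j] by auto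
    have "exp (w e) = (s' j / s j) * (t' (te i j) / t (te i j)) / (t' i / t i)"
      using nz ij(1) by (simp add: w_def exp_diff exp_add)
    moreover have "p e = s j * t (te i j) / t i" "q e = s' j * t' (te i j) / t' i"
      using st(3) st'(3) ij by auto
    ultimately show "move p w 1 e = q e" using nz e by (simp add: move_def)
  qed (use q in \<open>auto simp: move_def T0_iff\<close>)
  ultimately show thesis by (rule that)
qed

text \<open>Any two points of the torus lie on a curve \<open>z \<mapsto> move p w z\<close>, so the identity theorem in one
  variable is enough for irreducibility.\<close>

definition hol :: "('n rpoint \<Rightarrow> complex) \<Rightarrow> bool" where
  "hol F \<longleftrightarrow> (\<forall>p\<in>T0. \<forall>w. cocycle w \<longrightarrow> (\<lambda>z. F (move p w z)) holomorphic_on UNIV)"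

lemma irreducible_T0:
  assumes F: "hol F" and E: "hol E" and FE: "\<And>p. p \<in> T0 \<Longrightarrow> F p * E p = 0"
  shows "(\<forall>p\<in>T0. F p = 0) \<or> (\<forall>p\<in>T0. E p = 0)"
proof (rule ccontr)
  assume "\<not> ((\<forall>p\<in>T0. F p = 0) \<or> (\<forall>p\<in>T0. E p = 0))"
  then obtain p q where p: "p \<in> T0" "F p \<noteq> 0" and q: "q \<in> T0" "E q \<noteq> 0" by auto
  obtain w where w: "cocycle w" "move p w 0 = p" "move p w 1 = q" by (rule T0_connected[OF p(1) q(1)])
  define a b where "a z = F (move p w z)" and "b z = E (move p w z)" for z
  have ha: "a holomorphic_on UNIV" and hb: "b holomorphic_on UNIV"
    using F E p(1) w(1) unfolding hol_def a_def[abs_def] b_def[abs_def] by auto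
  have "continuous_on UNIV a" by (rule holomorphic_on_imp_continuous_on[OF ha])
  then have op: "open {z. a z \<noteq> 0}" by (intro open_Collect_neq) auto
  have ne: "{z. a z \<noteq> 0} \<noteq> {}"
  proof -
    have "a 0 \<noteq> 0" using p(2) w(2) by (simp add: a_def)
    then show ?thesis by auto
  qed
  have b0: "b z = 0" if "z \<in> {z. a z \<noteq> 0}" for z
    using FE[OF move_T0[OF p(1) w(1)], of z] that by (simp add: a_def b_def)
  have "b 1 = 0"
    by (rule analytic_continuation_open[OF op open_UNIV ne connected_UNIV subset_UNIV hb holomorphic_on_const b0]) auto
  then show False using q w by (simp add: b_def)
qed

lemma hol_const: "hol (\<lambda>_. c)" by (simp add: hol_def)

lemma hol_coord: "e \<in> Arr G \<Longrightarrow> hol (\<lambda>p. p e)"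
  by (auto simp: hol_def move_def intro!: holomorphic_intros)

lemma hol_add: "hol F \<Longrightarrow> hol E \<Longrightarrow> hol (\<lambda>p. F p + E p)"
  by (auto simp: hol_def intro!: holomorphic_intros)

lemma hol_mult: "hol F \<Longrightarrow> hol E \<Longrightarrow> hol (\<lambda>p. F p * E p)"
  by (auto simp: hol_def intro!: holomorphic_intros)

lemma hol_sum: "(\<And>a. a \<in> A \<Longrightarrow> hol (F a)) \<Longrightarrow> hol (\<lambda>p. \<Sum>a\<in>A. F a p)"
  by (auto simp: hol_def intro!: holomorphic_intros)

lemma hol_prod: "(\<And>a. a \<in> A \<Longrightarrow> hol (F a)) \<Longrightarrow> hol (\<lambda>p. \<Prod>a\<in>A. F a p)"
  by (auto simp: hol_def intro!: holomorphic_intros)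

lemma hol_powi:
  assumes e: "e \<in> Arr G"
  shows "hol (\<lambda>p. p e powi k)"
  unfolding hol_def
proof (intro ballI allI impI)
  fix p and w :: "'n arrow \<Rightarrow> complex"
  assume p: "p \<in> T0" "cocycle w"
  have "move p w z e powi k = p e powi k * exp (of_int k * (z * w e))" for z
    using e by (simp add: move_def power_int_mult_distrib exp_power_int)
  then show "(\<lambda>z. move p w z e powi k) holomorphic_on UNIV" by (auto intro!: holomorphic_intros)
qed

lemma hol_poly: "f \<in> poly_fns (Arr G) \<Longrightarrow> hol f"
  by (induction rule: poly_fns.induct) (auto intro: hol_const hol_coord hol_add hol_mult)

subsection \<open>The closure of the torus\<close>

definition Vc :: "'n rpoint set" where
  "Vc = {p \<in> Arr G \<rightarrow>\<^sub>E UNIV. \<forall>f\<in>poly_fns (Arr G). (\<forall>x\<in>T0. f x = 0) \<longrightarrow> f p = 0}"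

lemma T0_sub_Vc: "T0 \<subseteq> Vc"
  by (auto simp: Vc_def T0_iff PiE_def)

lemma Vc_sub_R: "Vc \<subseteq> R_var G X"
proof
  fix p assume p: "p \<in> Vc"
  have "p (te i j, j') * p (i, j) - p (te i j', j) * p (i, j') = 0" if i: "i \<in> Irr G" for i j j'
  proof -
    have "(\<lambda>x. x (te i j, j') * x (i, j) - x (te i j', j) * x (i, j')) \<in> poly_fns (Arr G)"
      using i tens_Irr[OF i] by (intro poly_fns_diff poly_fns.mult poly_fns.coord) (auto simp: Arr_def)
    moreover have "\<forall>x\<in>T0. x (te i j, j') * x (i, j) - x (te i j', j) * x (i, j') = 0"
      using i by (auto simp: T0_iff)
    ultimately show ?thesis using p by (auto simp: Vc_def)
  qed
  then show "p \<in> R_var G X" using p by (auto simp: R_var_def Vc_def)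
qed

lemma closed_zariskiD:
  assumes "closedin (zariski I) C" "x \<in> I \<rightarrow>\<^sub>E UNIV" "x \<notin> C"
  obtains f where "f \<in> poly_fns I" "f x \<noteq> 0" "\<forall>y\<in>C. f y = 0"
proof -
  have "\<forall>x\<in>(I \<rightarrow>\<^sub>E UNIV) - C. \<exists>g\<in>poly_fns I. g x \<noteq> 0 \<and> (\<forall>y\<in>C. g y = 0)"
    using assms(1) unfolding closedin_zariski by (rule conjunct2)
  from bspec[OF this DiffI[OF assms(2,3)]] show ?thesis using that by auto
qed

lemma closed_Vc: "closedin (zariski (Arr G)) Vc"
  unfolding closedin_zariski
proof (intro conjI ballI)
  show "Vc \<subseteq> Arr G \<rightarrow>\<^sub>E UNIV" unfolding Vc_def by (rule Collect_subset)
  fix x assume x: "x \<in> (Arr G \<rightarrow>\<^sub>E UNIV) - Vc"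
  then have "\<not> (\<forall>f\<in>poly_fns (Arr G). (\<forall>x\<in>T0. f x = 0) \<longrightarrow> f x = 0)" unfolding Vc_def by simp
  then obtain f where f: "f \<in> poly_fns (Arr G)" "\<forall>x\<in>T0. f x = 0" "f x \<noteq> 0" by auto
  then show "\<exists>g\<in>poly_fns (Arr G). g x \<noteq> 0 \<and> (\<forall>y\<in>Vc. g y = 0)"
    by (intro bexI[OF _ f(1)]) (auto simp: Vc_def)
qed

lemma Vc_minimal: "closedin (zariski (Arr G)) C \<Longrightarrow> T0 \<subseteq> C \<Longrightarrow> Vc \<subseteq> C"
proof
  fix x assume C: "closedin (zariski (Arr G)) C" "T0 \<subseteq> C" and x: "x \<in> Vc"
  show "x \<in> C"
  proof (rule ccontr)
    assume n: "x \<notin> C"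
    have "x \<in> Arr G \<rightarrow>\<^sub>E UNIV" using x by (simp add: Vc_def)
    then obtain f where f: "f \<in> poly_fns (Arr G)" "f x \<noteq> 0" "\<forall>y\<in>C. f y = 0"
      by (rule closed_zariskiD[OF C(1) _ n])
    have "\<forall>y\<in>T0. f y = 0" using f(3) C(2) by auto
    then show False using x f(1,2) by (simp add: Vc_def)
  qed
qed

lemma T0_ext: "x \<in> T0 \<Longrightarrow> x \<in> Arr G \<rightarrow>\<^sub>E UNIV" by (simp add: T0_iff PiE_def)

lemma irreducible_Vc: "irreducible_in (zariski (Arr G)) Vc"
  unfolding irreducible_in_def
proof (intro conjI allI impI)
  show "Vc \<noteq> {}" using T0_one T0_sub_Vc by blast
  show "Vc \<subseteq> topspace (zariski (Arr G))" unfolding topspace_zariski Vc_def by (rule Collect_subset)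
  fix A B assume AB: "closedin (zariski (Arr G)) A \<and> closedin (zariski (Arr G)) B \<and> Vc \<subseteq> A \<union> B"
  have "T0 \<subseteq> A \<or> T0 \<subseteq> B"
  proof (rule ccontr)
    assume "\<not> (T0 \<subseteq> A \<or> T0 \<subseteq> B)"
    then obtain a b where a: "a \<in> T0" "a \<notin> A" and b: "b \<in> T0" "b \<notin> B" by auto
    obtain f where f: "f \<in> poly_fns (Arr G)" "f a \<noteq> 0" "\<forall>y\<in>A. f y = 0"
      by (rule closed_zariskiD[OF conjunct1[OF AB] T0_ext[OF a(1)] a(2)])
    obtain g where g: "g \<in> poly_fns (Arr G)" "g b \<noteq> 0" "\<forall>y\<in>B. g y = 0"
      by (rule closed_zariskiD[OF conjunct1[OF conjunct2[OF AB]] T0_ext[OF b(1)] b(2)])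
    have "f x * g x = 0" if "x \<in> T0" for x
    proof -
      have "x \<in> A \<or> x \<in> B" using AB T0_sub_Vc that by auto
      then show ?thesis using f(3) g(3) by auto
    qed
    from irreducible_T0[OF hol_poly[OF f(1)] hol_poly[OF g(1)] this] show False using f g a b by auto
  qed
  then show "Vc \<subseteq> A \<or> Vc \<subseteq> B" using Vc_minimal AB by auto
qed

lemma closed_coord: "e \<in> Arr G \<Longrightarrow> closedin (zariski (Arr G)) {p \<in> Arr G \<rightarrow>\<^sub>E UNIV. p e = 0}"
proof -
  assume e: "e \<in> Arr G"
  show ?thesis unfolding closedin_zariski
  proof (intro conjI ballI)
    show "{p \<in> Arr G \<rightarrow>\<^sub>E UNIV. p e = 0} \<subseteq> Arr G \<rightarrow>\<^sub>E UNIV" by (rule Collect_subset)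
    fix x :: "'n rpoint" assume "x \<in> (Arr G \<rightarrow>\<^sub>E UNIV) - {p \<in> Arr G \<rightarrow>\<^sub>E UNIV. p e = 0}"
    then show "\<exists>g\<in>poly_fns (Arr G). g x \<noteq> 0 \<and> (\<forall>y\<in>{p \<in> Arr G \<rightarrow>\<^sub>E UNIV. p e = 0}. g y = 0)"
      by (intro bexI[OF _ poly_fns.coord[OF e]]) auto
  qed
qed

lemma irreducible_Union:
  assumes "irreducible_in T C" "finite F" "\<And>A. A \<in> F \<Longrightarrow> closedin T A" "C \<subseteq> \<Union>F"
  shows "\<exists>A\<in>F. C \<subseteq> A"
  using assms(2-4)
proof (induction F rule: finite_induct)
  case empty
  then show ?case using assms(1) by (auto simp: irreducible_in_def)
next
  case (insert A F)
  have "closedin T (\<Union>F)" using insert by (intro closedin_Union) auto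
  then have "C \<subseteq> A \<or> C \<subseteq> \<Union>F" using insert.prems assms(1) unfolding irreducible_in_def by auto
  then show ?case using insert by auto
qed

text \<open>\<open>R_var\<close> is covered by the closure of the torus and the coordinate
  hyperplanes, finitely many closed sets, and an irreducible subset lies in one of them.\<close>

lemma component_sub_Vc:
  assumes C: "irreducible_in (zariski (Arr G)) C" "C \<subseteq> R_var G X" "\<forall>e\<in>Arr G. \<not> C \<subseteq> {p. p e = 0}"
  shows "C \<subseteq> Vc"
proof -
  let ?F = "insert Vc ((\<lambda>e. {p \<in> Arr G \<rightarrow>\<^sub>E UNIV. p e = 0}) ` Arr G)"
  have "C \<subseteq> \<Union>?F"
  proof
    fix p assume "p \<in> C"
    then have p: "p \<in> R_var G X" using C(2) by auto
    then have pE: "p \<in> Arr G \<rightarrow>\<^sub>E UNIV" by (simp add: R_var_def)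
    show "p \<in> \<Union>?F"
    proof (cases "\<exists>e\<in>Arr G. p e = 0")
      case False
      then have "p \<in> T0" using p by (simp add: T0_def)
      then show ?thesis using T0_sub_Vc by auto
    qed (use pE in auto)
  qed
  moreover have "finite ?F" using finite_Arr by simp
  moreover have "closedin (zariski (Arr G)) A" if "A \<in> ?F" for A using that closed_Vc closed_coord by auto
  ultimately obtain A where "A \<in> ?F" "C \<subseteq> A" using irreducible_Union[OF C(1), of ?F] by blast
  then show ?thesis using C(3) by auto
qed

lemma Vc_not_coord: "e \<in> Arr G \<Longrightarrow> \<not> Vc \<subseteq> {p. p e = 0}"
proof
  assume e: "e \<in> Arr G" and "Vc \<subseteq> {p. p e = 0}"
  then have "(\<lambda>e\<in>Arr G. 1::complex) e = 0" using T0_one T0_sub_Vc by blast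
  then show False using e by simp
qed

lemma V_var_eq: "V_var G X = Vc"
  unfolding V_var_def
proof (rule the_equality)
  have "C' = Vc" if "Vc \<subseteq> C'" "C' \<subseteq> R_var G X" "irreducible_in (zariski (Arr G)) C'" for C'
    using component_sub_Vc[OF that(3,2)] Vc_not_coord that(1) by blast
  then show "irreducible_component (zariski (Arr G)) (R_var G X) Vc \<and> (\<forall>e\<in>Arr G. \<not> Vc \<subseteq> {p. p e = 0})"
    unfolding irreducible_component_def using irreducible_Vc Vc_sub_R Vc_not_coord by auto
next
  fix C assume C: "irreducible_component (zariski (Arr G)) (R_var G X) C \<and> (\<forall>e\<in>Arr G. \<not> C \<subseteq> {p. p e = 0})"
  then have "C \<subseteq> Vc" using component_sub_Vc unfolding irreducible_component_def by auto
  then show "C = Vc" using C Vc_sub_R irreducible_Vc unfolding irreducible_component_def by auto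
qed

lemma T_V_eq: "T_V G X = T0"
  using T0_sub_Vc Vc_sub_R unfolding T_V_def V_var_eq T0_def by auto

end

section \<open>The lattices \<open>M\<^sub>\<V>\<close> and \<open>N\<^sub>\<V>\<close> in terms of cocycles\<close>

context mckay
begin

abbreviation "MV \<equiv> M_V G X"
abbreviation "lau \<equiv> laurent G X"

text \<open>Polymorphic in the coefficients, because real functions on the arrows describe points of
  the dual space and complex ones are logarithms of points of the torus.\<close>

definition pair :: "('n arrow \<Rightarrow> int) \<Rightarrow> ('n arrow \<Rightarrow> 'k::comm_ring_1) \<Rightarrow> 'k" where
  "pair c w = (\<Sum>e\<in>Arr G. of_int (c e) * w e)"

definition dlt :: "'n arrow \<Rightarrow> 'n arrow \<Rightarrow> int" where "dlt e e' = (if e' = e then 1 else 0)"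

lemma pair_left: "pair (\<lambda>e. c e + c' e) w = pair c w + pair c' w" "pair (\<lambda>e. c e - c' e) w = pair c w - pair c' w"
    "pair (\<lambda>e. - c e) w = - pair c w" "pair (\<lambda>e. 0) w = 0"
  by (simp_all add: pair_def algebra_simps sum.distrib sum_subtractf sum_negf)

lemma pair_right: "pair c (\<lambda>e. w e + w' e) = pair c w + pair c w'" "pair c (\<lambda>e. w e - w' e) = pair c w - pair c w'"
    "pair c (\<lambda>e. k * w e) = k * pair c w" "pair c (\<lambda>e. 0) = 0"
  by (simp_all add: pair_def algebra_simps sum.distrib sum_subtractf sum_distrib_left)

lemma pair_sum: "pair c (\<lambda>e. \<Sum>a\<in>A. w a e) = (\<Sum>a\<in>A. pair c (w a))"
  unfolding pair_def by (subst sum.swap) (simp add: sum_distrib_left)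

lemma pair_dlt: "e \<in> Arr G \<Longrightarrow> pair (dlt e) w = w e"
proof -
  assume e: "e \<in> Arr G"
  have "pair (dlt e) w = (\<Sum>e'\<in>Arr G. if e' = e then w e else 0)" unfolding pair_def dlt_def by (rule sum.cong) auto
  then show ?thesis using e finite_Arr by simp
qed

lemma pair_cong: "(\<And>e. e \<in> Arr G \<Longrightarrow> w e = w' e) \<Longrightarrow> pair c w = pair c w'"
  unfolding pair_def by (rule sum.cong) auto

lemma pair_Ints: "(\<And>e. e \<in> Arr G \<Longrightarrow> w e \<in> \<int>) \<Longrightarrow> pair c w \<in> \<int>"
  unfolding pair_def by (intro Ints_sum Ints_mult) auto

lemma lau_apply: "p \<in> T0 \<Longrightarrow> lau c p = (\<Prod>e\<in>Arr G. p e powi c e)"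
  by (simp add: laurent_def T_V_eq)

lemma lau_ext: "lau c \<in> extensional T0" by (simp add: laurent_def T_V_eq)

lemma lau_eqI: "(\<And>p. p \<in> T0 \<Longrightarrow> lau c p = lau c' p) \<Longrightarrow> lau c = lau c'"
  by (rule extensionalityI[OF lau_ext lau_ext])

definition expo :: "('n arrow \<Rightarrow> complex) \<Rightarrow> 'n rpoint" where "expo w = (\<lambda>e\<in>Arr G. exp (w e))"

lemma expo_move: "expo w = move (\<lambda>e\<in>Arr G. 1) w 1"
  unfolding expo_def move_def by (rule restrict_ext) simp

lemma expo_T0: "cocycle w \<Longrightarrow> expo w \<in> T0"
  unfolding expo_move by (rule move_T0[OF T0_one])

lemma T0_expo:
  assumes "p \<in> T0"
  obtains w where "cocycle w" "p = expo w"
proof -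
  obtain w where "cocycle w" "move (\<lambda>e\<in>Arr G. 1) w 0 = (\<lambda>e\<in>Arr G. 1)" "move (\<lambda>e\<in>Arr G. 1) w 1 = p"
    by (rule T0_connected[OF T0_one assms])
  then show ?thesis using that expo_move by auto
qed

lemma lau_expo: "cocycle w \<Longrightarrow> lau c (expo w) = exp (pair c w)"
  unfolding lau_apply[OF expo_T0] by (simp add: expo_def pair_def exp_sum[OF finite_Arr] exp_power_int)

lemma cocycle_of_real: "cocycle (w :: _ \<Rightarrow> real) \<Longrightarrow> cocycle (\<lambda>e. complex_of_real (w e))"
  unfolding cocycle_def by (simp add: of_real_add[symmetric] del: of_real_add)

lemma cocycle_Re: "cocycle w \<Longrightarrow> cocycle (\<lambda>e. Re (w e))" "cocycle w \<Longrightarrow> cocycle (\<lambda>e. Im (w e))"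
  unfolding cocycle_def plus_complex.sel[symmetric] by auto

lemma pair_of_real: "pair c (\<lambda>e. complex_of_real (w e)) = of_real (pair c w)"
  by (simp add: pair_def)

text \<open>Every point of the torus is \<open>expo w\<close>, and the real and imaginary parts of a
  complex cocycle are real cocycles. In the other direction, the exponential function is injective
  on the reals.\<close>

lemma lau_eq_iff: "lau c = lau c' \<longleftrightarrow> (\<forall>w::'n arrow \<Rightarrow> real. cocycle w \<longrightarrow> pair c w = pair c' w)"
proof
  assume e: "lau c = lau c'"
  show "\<forall>w::'n arrow \<Rightarrow> real. cocycle w \<longrightarrow> pair c w = pair c' w"
  proof (intro allI impI)
    fix w :: "'n arrow \<Rightarrow> real" assume "cocycle w"
    then have w: "cocycle (\<lambda>e. complex_of_real (w e))" by (rule cocycle_of_real)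
    have "complex_of_real (exp (pair c w)) = complex_of_real (exp (pair c' w))"
      using lau_expo[OF w, of c] lau_expo[OF w, of c'] e by (simp add: pair_of_real exp_of_real)
    then show "pair c w = pair c' w" by (simp only: of_real_eq_iff exp_inj_iff)
  qed
next
  assume e: "\<forall>w::'n arrow \<Rightarrow> real. cocycle w \<longrightarrow> pair c w = pair c' w"
  show "lau c = lau c'"
  proof (rule lau_eqI)
    fix p assume "p \<in> T0"
    then obtain w where w: "cocycle w" "p = expo w" by (rule T0_expo)
    have "pair c w = of_real (pair c (\<lambda>e. Re (w e))) + \<i> * of_real (pair c (\<lambda>e. Im (w e)))" for c
      by (simp add: complex_eq_iff pair_def)
    then have "pair c w = pair c' w" using e cocycle_Re[OF w(1)] by metis
    then show "lau c p = lau c' p" using w by (simp add: lau_expo)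
  qed
qed

lemma carrier_MV: "carrier MV = range lau" by (simp add: M_V_def)

lemma lau_carrier: "lau c \<in> carrier MV" by (simp add: carrier_MV)

lemma MV_E:
  assumes "m \<in> carrier MV"
  obtains c where "m = lau c"
  using assms carrier_MV by auto

lemma MV_mult: "m \<otimes>\<^bsub>MV\<^esub> m' = (\<lambda>p\<in>T0. m p * m' p)" by (simp add: M_V_def T_V_eq)

lemma lau_mult: "lau c \<otimes>\<^bsub>MV\<^esub> lau c' = lau (\<lambda>e. c e + c' e)"
  unfolding MV_mult
proof (rule extensionalityI[of _ T0])
  fix p assume p: "p \<in> T0"
  have "p e powi (c e + c' e) = p e powi c e * p e powi c' e" if "e \<in> Arr G" for e
    using p that unfolding T0_def by (intro power_int_add) auto
  then show "(\<lambda>p\<in>T0. lau c p * lau c' p) p = lau (\<lambda>e. c e + c' e) p"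
    using p by (simp add: lau_apply prod.distrib[symmetric] cong: prod.cong)
qed (auto simp: lau_ext)

lemma lau_one: "\<one>\<^bsub>MV\<^esub> = lau (\<lambda>e. 0)"
proof (rule extensionalityI[of _ T0])
  fix p assume "p \<in> T0"
  then show "\<one>\<^bsub>MV\<^esub> p = lau (\<lambda>e. 0) p" by (simp add: lau_apply M_V_def T_V_eq)
qed (auto simp: lau_ext M_V_def T_V_eq)

lemma comm_group_MV: "comm_group MV"
proof (rule comm_groupI)
  fix x assume "x \<in> carrier MV"
  then obtain c where "x = lau c" by (rule MV_E)
  then have "lau (\<lambda>e. - c e) \<otimes>\<^bsub>MV\<^esub> x = \<one>\<^bsub>MV\<^esub>" by (simp add: lau_mult lau_one)
  then show "\<exists>y\<in>carrier MV. y \<otimes>\<^bsub>MV\<^esub> x = \<one>\<^bsub>MV\<^esub>" using lau_carrier by blast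
qed (auto simp: carrier_MV lau_mult lau_one algebra_simps)

lemma xbar_lau: "e \<in> Arr G \<Longrightarrow> xbar G X e = lau (dlt e)"
proof (rule extensionalityI[of _ T0])
  fix p assume p: "p \<in> T0" and e: "e \<in> Arr G"
  have "lau (dlt e) p = (\<Prod>e'\<in>Arr G. if e' = e then p e else 1)"
    unfolding lau_apply[OF p] by (rule prod.cong) (auto simp: dlt_def)
  then show "xbar G X e p = lau (dlt e) p" using p e finite_Arr by (simp add: xbar_def T_V_eq)
qed (auto simp: lau_ext xbar_def T_V_eq)

lemma additive_Arr:
  fixes \<phi> :: "('n arrow \<Rightarrow> int) \<Rightarrow> real"
  assumes add: "\<And>c c'. \<phi> (\<lambda>e. c e + c' e) = \<phi> c + \<phi> c'" and loc: "\<And>c c'. (\<And>e. e \<in> Arr G \<Longrightarrow> c e = c' e) \<Longrightarrow> \<phi> c = \<phi> c'"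
  shows "\<phi> c = pair c (\<lambda>e. \<phi> (dlt e))"
proof -
  have z: "\<phi> (\<lambda>e. 0) = 0" using add[of "\<lambda>e. 0" "\<lambda>e. 0"] by simp
  have neg: "\<phi> (\<lambda>e. - c e) = - \<phi> c" for c using add[of c "\<lambda>e. - c e"] z by simp
  have nat: "\<phi> (\<lambda>e'. int k * c e') = k * \<phi> c" for k c
  proof (induction k)
    case (Suc k)
    then show ?case using add[of c "\<lambda>e'. int k * c e'"] by (simp add: algebra_simps)
  qed (simp add: z)
  have scale: "\<phi> (\<lambda>e'. k * c e') = k * \<phi> c" for k c
  proof (cases "0 \<le> k")
    case True
    then show ?thesis using nat[of "nat k" c] by simp
  next
    case False
    then show ?thesis using nat[of "nat (- k)" c] neg[of "\<lambda>e'. - k * c e'"] by simp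
  qed
  have "\<phi> (\<lambda>e. if e \<in> A then c e else 0) = (\<Sum>e\<in>A. c e * \<phi> (dlt e))" if "finite A" for A
    using that
  proof (induction A rule: finite_induct)
    case (insert a A)
    have "\<phi> (\<lambda>e. if e \<in> insert a A then c e else 0) = \<phi> (\<lambda>e. c a * dlt a e + (if e \<in> A then c e else 0))"
      by (rule loc) (use insert.hyps in \<open>auto simp: dlt_def\<close>)
    then show ?case using insert by (simp add: add scale)
  qed (simp add: z)
  from this[OF finite_Arr] have "\<phi> (\<lambda>e. if e \<in> Arr G then c e else 0) = pair c (\<lambda>e. \<phi> (dlt e))"
    by (simp add: pair_def)
  moreover have "\<phi> (\<lambda>e. if e \<in> Arr G then c e else 0) = \<phi> c" by (rule loc) auto
  ultimately show ?thesis by simp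
qed

lemma lau_cong: "(\<And>e. e \<in> Arr G \<Longrightarrow> c e = c' e) \<Longrightarrow> lau c = lau c'"
  by (rule lau_eqI) (auto simp: lau_apply intro!: prod.cong)

text \<open>The isomorphism from real cocycles on the arrows to \<open>(N\<^sub>\<V>)\<^sub>\<real>\<close>; its inverse evaluates at the
  \<open>xbar e\<close>.\<close>

definition wt :: "('n arrow \<Rightarrow> real) \<Rightarrow> 'n nvec" where
  "wt w = (\<lambda>m\<in>carrier MV. pair (SOME c. m = lau c) w)"

lemma wt_lau:
  assumes "cocycle w"
  shows "wt w (lau c) = pair c w"
proof -
  have "lau c = lau (SOME c'. lau c = lau c')" by (rule someI[of "\<lambda>c'. lau c = lau c'" c]) (rule refl)
  then have "pair c w = pair (SOME c'. lau c = lau c') w" using assms unfolding lau_eq_iff by blast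
  then show ?thesis by (simp add: wt_def lau_carrier)
qed

lemma wt_xbar: "cocycle w \<Longrightarrow> e \<in> Arr G \<Longrightarrow> wt w (xbar G X e) = w e"
  by (simp add: xbar_lau wt_lau pair_dlt)

lemma cocycle_ops:
  fixes w w' :: "'n arrow \<Rightarrow> 'a::ab_group_add" and k :: "'k::comm_ring_1"
  shows "cocycle w \<Longrightarrow> cocycle w' \<Longrightarrow> cocycle (\<lambda>e. w e + w' e)"
    "cocycle w \<Longrightarrow> cocycle w' \<Longrightarrow> cocycle (\<lambda>e. w e - w' e)"
    "cocycle (\<lambda>e. 0 :: 'a)"
    "cocycle v \<Longrightarrow> cocycle (\<lambda>e. k * v e)"
proof -
  have r: "(a + a') + (b + b') = (a + b) + (a' + b')" "(a - a') + (b - b') = (a + b) - (a' + b')" for a b a' b' :: 'a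
    by (simp_all add: algebra_simps)
  have sub: "(a + a') + (b + b') = (c + c') + (d + d')" "(a - a') + (b - b') = (c - c') + (d - d')"
    if "a + b = c + d" "a' + b' = c' + d'" for a b c d a' b' c' d' :: 'a
    using r(1)[of a a' b b'] r(1)[of c c' d d'] r(2)[of a a' b b'] r(2)[of c c' d d'] that by metis+
  show "cocycle (\<lambda>e. w e + w' e)" if "cocycle w" "cocycle w'"
    unfolding cocycle_def by (intro ballI allI sub) (use that in \<open>simp_all add: cocycle_def\<close>)
  show "cocycle (\<lambda>e. w e - w' e)" if "cocycle w" "cocycle w'"
    unfolding cocycle_def by (intro ballI allI sub) (use that in \<open>simp_all add: cocycle_def\<close>)
  show "cocycle (\<lambda>e. 0 :: 'a)" by (simp add: cocycle_def)
  show "cocycle v \<Longrightarrow> cocycle (\<lambda>e. k * v e)" unfolding cocycle_def by (simp add: distrib_left[symmetric])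
qed

lemma wt_N_V_R: "cocycle w \<Longrightarrow> wt w \<in> N_V_R G X"
  unfolding N_V_R_def hom_def by (auto simp: carrier_MV lau_mult wt_lau pair_left) (simp add: wt_def carrier_MV)

lemma N_V_R_hom:
  assumes u: "u \<in> N_V_R G X"
  shows "u (lau (\<lambda>e. c e + c' e)) = u (lau c) + u (lau c')"
  using u lau_carrier lau_mult[of c c'] unfolding N_V_R_def hom_def by (auto simp: lau_mult[symmetric])

lemma N_V_R_wt:
  assumes u: "u \<in> N_V_R G X"
  shows "cocycle (\<lambda>e. u (xbar G X e))" "u = wt (\<lambda>e. u (xbar G X e))"
proof -
  let ?w = "\<lambda>e. u (xbar G X e)"
  show co: "cocycle ?w"
    unfolding cocycle_def
  proof (intro ballI allI)
    fix i j j' assume i: "i \<in> Irr G"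
    have A: "(te i j, j') \<in> Arr G" "(i, j) \<in> Arr G" "(te i j', j) \<in> Arr G" "(i, j') \<in> Arr G"
      using i by (auto simp: Arr_def tens_Irr)
    have "lau (\<lambda>e. dlt (te i j, j') e + dlt (i, j) e) = lau (\<lambda>e. dlt (te i j', j) e + dlt (i, j') e)"
      unfolding lau_eq_iff by (auto simp: pair_left pair_dlt A cocycle_def i)
    then show "?w (te i j, j') + ?w (i, j) = ?w (te i j', j) + ?w (i, j')"
      by (simp add: xbar_lau A N_V_R_hom[OF u, symmetric])
  qed
  have "u (lau c) = pair c (\<lambda>e. u (lau (dlt e)))" for c
  proof (rule additive_Arr[of "\<lambda>c. u (lau c)"])
    fix c c' :: "'n arrow \<Rightarrow> int" assume "\<And>e. e \<in> Arr G \<Longrightarrow> c e = c' e"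
    then have "lau c = lau c'" by (rule lau_cong)
    then show "u (lau c) = u (lau c')" by simp
  qed (rule N_V_R_hom[OF u])
  also have "pair c (\<lambda>e. u (lau (dlt e))) = pair c ?w" for c by (rule pair_cong) (simp add: xbar_lau)
  finally have ul: "u (lau c) = pair c ?w" for c .
  show "u = wt ?w"
  proof (rule extensionalityI[of _ "carrier MV"])
    show "u \<in> extensional (carrier MV)" using u by (simp add: N_V_R_def)
    show "wt ?w \<in> extensional (carrier MV)" by (simp add: wt_def)
    fix m assume "m \<in> carrier MV"
    then obtain c where "m = lau c" by (rule MV_E)
    then show "u m = wt ?w m" using ul wt_lau[OF co] by simp
  qed
qed

lemma N_V_wt_iff: "cocycle w \<Longrightarrow> wt w \<in> N_V G X \<longleftrightarrow> (\<forall>e\<in>Arr G. w e \<in> \<int>)"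
proof
  assume w: "cocycle w" and n: "wt w \<in> N_V G X"
  show "\<forall>e\<in>Arr G. w e \<in> \<int>"
  proof
    fix e assume e: "e \<in> Arr G"
    have "wt w (lau (dlt e)) \<in> \<int>" using n lau_carrier unfolding N_V_def by simp
    then show "w e \<in> \<int>" using e by (simp add: wt_lau[OF w] pair_dlt)
  qed
next
  assume w: "cocycle w" and "\<forall>e\<in>Arr G. w e \<in> \<int>"
  then show "wt w \<in> N_V G X" unfolding N_V_def using wt_N_V_R[OF w] by (auto simp: carrier_MV wt_lau[OF w] intro: pair_Ints)
qed

lemma wt_cong: "(\<And>e. e \<in> Arr G \<Longrightarrow> w e = w' e) \<Longrightarrow> wt w = wt w'"
  unfolding wt_def by (intro restrict_ext pair_cong)

text \<open>By \<open>T0_param\<close>, applied to the point \<open>exp w\<close>, every real cocycle \<open>w\<close> has this form; \<open>y\<close> is its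
  image under \<open>q_G\<close>.\<close>

definition cob :: "real^'n \<Rightarrow> ('n gchar \<Rightarrow> real) \<Rightarrow> 'n arrow \<Rightarrow> real" where
  "cob y \<theta> e = y $ snd e + \<theta> (te (fst e) (snd e)) - \<theta> (fst e)"

lemma cob_apply: "cob y \<theta> (i, j) = y $ j + \<theta> (te i j) - \<theta> i"
  by (simp add: cob_def)

lemma cob_cocycle: "cocycle (cob y \<theta>)"
  unfolding cocycle_def cob_def using tens_comm by (simp add: algebra_simps)

lemma cocycle_cob:
  fixes w :: "'n arrow \<Rightarrow> real"
  assumes w: "cocycle w"
  obtains y \<theta> where "\<forall>e\<in>Arr G. w e = cob y \<theta> e"
proof -
  have "expo (\<lambda>e. of_real (w e)) \<in> T0" by (rule expo_T0[OF cocycle_of_real[OF w]])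
  then obtain s t where st: "\<forall>j. s j \<noteq> 0" "\<forall>i\<in>Irr G. t i \<noteq> 0"
    "\<forall>i\<in>Irr G. \<forall>j. expo (\<lambda>e. of_real (w e)) (i, j) = s j * t (te i j) / t i" by (rule T0_param)
  have "\<forall>e\<in>Arr G. w e = cob (\<chi> j. ln (cmod (s j))) (\<lambda>i. ln (cmod (t i))) e"
  proof
    fix e assume e: "e \<in> Arr G"
    then obtain i j where ij: "e = (i, j)" "i \<in> Irr G" by (auto simp: Arr_def)
    have "exp (complex_of_real (w e)) = s j * t (te i j) / t i"
      using st(3)[THEN bspec, OF ij(2), THEN spec, of j] e by (simp add: expo_def ij(1))
    then have "cmod (exp (complex_of_real (w e))) = cmod (s j) * cmod (t (te i j)) / cmod (t i)"
      by (simp add: norm_mult norm_divide)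
    then have "exp (w e) = cmod (s j) * cmod (t (te i j)) / cmod (t i)" by simp
    then have "w e = ln (cmod (s j) * cmod (t (te i j)) / cmod (t i))" by (metis ln_exp)
    then show "w e = cob (\<chi> j. ln (cmod (s j))) (\<lambda>i. ln (cmod (t i))) e"
      using st(1,2) ij tens_Irr[OF ij(2)] by (simp add: cob_def ln_mult ln_div)
  qed
  then show ?thesis by (rule that)
qed

subsection \<open>Monomials of paths and the projection \<open>q\<^sub>G\<close>\<close>

lemma int_vec_induct:
  fixes x :: "int^'n"
  assumes "P 0" and up: "\<And>x j. P x \<Longrightarrow> P (x + axis j 1)" and down: "\<And>x j. P x \<Longrightarrow> P (x - axis j 1)"
  shows "P x"
proof (induction "\<Sum>j\<in>UNIV. nat \<bar>x $ j\<bar>" arbitrary: x rule: less_induct)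
  case less
  show ?case
  proof (cases "x = 0")
    case False
    then obtain j where j: "x $ j \<noteq> 0" by (auto simp: vec_eq_iff)
    define y where "y = (if x $ j > 0 then x - axis j 1 else x + axis j 1)"
    have "(\<Sum>k\<in>UNIV. nat \<bar>y $ k\<bar>) < (\<Sum>k\<in>UNIV. nat \<bar>x $ k\<bar>)"
      by (rule sum_strict_mono_ex1) (use j in \<open>auto simp: y_def axis_def intro!: bexI[of _ j]\<close>)
    from less[OF this] have "P y" .
    then show ?thesis using up[of y j] down[of y j] by (auto simp: y_def split: if_splits)
  qed (use assms(1) in simp)
qed

text \<open>The monomial of a walk in the quiver from \<open>cl 0\<close> to \<open>cl x\<close>,
  where an arrow traversed backwards has exponent -1. Closed walks yield the invariant monomials of
  every degree in M_G.\<close>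

lemma path_monomial:
  obtains c where "\<forall>y \<theta>. pair c (cob y \<theta>) = rvec x \<bullet> y + \<theta> (cl x) - \<theta> (cl 0)"
proof -
  have "\<exists>c. \<forall>y \<theta>. pair c (cob y \<theta>) = rvec x \<bullet> y + \<theta> (cl x) - \<theta> (cl 0)"
  proof (induction x rule: int_vec_induct)
    case 1
    show ?case by (rule exI[of _ "\<lambda>e. 0"]) (simp add: pair_left rvec_zero)
  next
    case (2 x j)
    then obtain c where c: "\<forall>y \<theta>. pair c (cob y \<theta>) = rvec x \<bullet> y + \<theta> (cl x) - \<theta> (cl 0)" by (rule exE)
    have A: "(cl x, j) \<in> Arr G" by (simp add: Arr_def cl_Irr)
    show ?case
      by (rule exI[of _ "\<lambda>e. c e + dlt (cl x, j) e"])
         (simp add: pair_left pair_dlt[OF A] c cob_apply rvec_add rvec_axis inner_add_left inner_axis' cl_step)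
  next
    case (3 x j)
    then obtain c where c: "\<forall>y \<theta>. pair c (cob y \<theta>) = rvec x \<bullet> y + \<theta> (cl x) - \<theta> (cl 0)" by (rule exE)
    have A: "(cl (x - axis j 1), j) \<in> Arr G" by (simp add: Arr_def cl_Irr)
    have t: "te (cl (x - axis j 1)) j = cl x" using cl_step[of "x - axis j 1" j] by simp
    show ?case
      by (rule exI[of _ "\<lambda>e. c e - dlt (cl (x - axis j 1), j) e"])
         (simp add: pair_left pair_dlt[OF A] c cob_apply rvec_diff rvec_axis inner_diff_left inner_axis' t)
  qed
  then show ?thesis using that by auto
qed

definition degr :: "('n arrow \<Rightarrow> int) \<Rightarrow> int^'n" where
  "degr c = (\<chi> j. \<Sum>i\<in>Irr G. c (i, j))"

lemma pair_degr: "pair c (cob y (\<lambda>_. 0)) = rvec (degr c) \<bullet> y"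
proof -
  have "pair c (cob y (\<lambda>_. 0)) = (\<Sum>i\<in>Irr G. \<Sum>j\<in>UNIV. of_int (c (i, j)) * y $ j)"
    unfolding pair_def Arr_def by (subst sum.cartesian_product) (auto simp: cob_def intro: sum.cong)
  also have "\<dots> = rvec (degr c) \<bullet> y"
    by (subst sum.swap) (simp add: inner_vec_def rvec_def degr_def sum_distrib_right)
  finally show ?thesis .
qed

lemma M_V_to_M_lau: "M_V_to_M G X (lau c) = rvec (degr c)"
proof -
  have s: "(\<Sum>(i, j)\<in>Arr G. of_int (c (i, j)) *\<^sub>R axis j 1) = rvec (degr c)" for c
  proof -
    have "(\<Sum>(i, j)\<in>Arr G. of_int (c (i, j)) *\<^sub>R axis j (1::real)) $ k = rvec (degr c) $ k" for k
    proof -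
      have "(\<Sum>(i, j)\<in>Arr G. of_int (c (i, j)) *\<^sub>R axis j (1::real)) $ k = (\<Sum>i\<in>Irr G. \<Sum>j\<in>UNIV. of_int (c (i, j)) * (axis j 1 $ k))"
        unfolding Arr_def by (subst sum.cartesian_product) (auto intro: sum.cong)
      also have "\<dots> = (\<Sum>i\<in>Irr G. \<Sum>j\<in>UNIV. if j = k then of_int (c (i, k)) else 0)"
        by (intro sum.cong refl) (auto simp: axis_def)
      also have "\<dots> = rvec (degr c) $ k" by (simp add: rvec_def degr_def)
      finally show ?thesis .
    qed
    then show ?thesis by (simp add: vec_eq_iff)
  qed
  \<comment> \<open>The description in \<open>M_V_to_M\<close> is unambiguous: the cocycles
    \<open>cob y\<close> with zero vertex function see exactly the degree of a monomial.\<close>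
  have deg: "rvec (degr c) = rvec (degr c')" if "lau c = lau c'" for c'
  proof -
    have "rvec (degr c) \<bullet> y = rvec (degr c') \<bullet> y" for y
      using that cob_cocycle unfolding pair_degr[symmetric] lau_eq_iff by blast
    then show ?thesis using inner_eq_zero_iff by (metis vector_eq_rdot)
  qed
  show ?thesis unfolding M_V_to_M_def s
  proof (rule the_equality)
    fix f assume "\<exists>c'. lau c = lau c' \<and> f = rvec (degr c')"
    then obtain c' where "lau c = lau c'" "f = rvec (degr c')" by (elim exE conjE)
    then show "f = rvec (degr c)" using deg by simp
  qed (rule exI[of _ c], simp)
qed

lemma T_bar_cob: "expo (\<lambda>e. of_real (cob 0 \<theta> e)) \<in> T_bar G X"
  unfolding T_bar_def expo_def
  by (intro CollectI exI[of _ "\<lambda>i. exp (of_real (\<theta> i))"] conjI)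
     (auto simp: cob_def exp_add exp_minus exp_diff divide_simps fun_eq_iff)

lemma lau_tmult:
  assumes "p \<in> T0" "q \<in> T0"
  shows "lau c (tmult G p q) = lau c p * lau c q"
  using assms T0_mult[OF assms] by (simp add: lau_apply tmult_def power_int_mult_distrib prod.distrib)

lemma M_V_inv_iff: "m \<in> M_V_inv G X \<longleftrightarrow> m \<in> carrier MV \<and> (\<forall>s\<in>T_bar G X. m s = 1)"
proof -
  have "(\<forall>p\<in>T0. lau c (tmult G s p) = lau c p) \<longleftrightarrow> lau c s = 1" if s: "s \<in> T_bar G X" for c s
  proof -
    have s0: "s \<in> T0" using s T_bar_T0 by auto
    have nz: "lau c p \<noteq> 0" if p: "p \<in> T0" for p
    proof -
      obtain w where "cocycle w" "p = expo w" by (rule T0_expo[OF p])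
      then show ?thesis by (simp add: lau_expo)
    qed
    show ?thesis using lau_tmult[OF s0] nz T0_one by (metis mult_cancel_right1)
  qed
  then show ?thesis unfolding M_V_inv_def T_V_eq carrier_MV by auto
qed

text \<open>The class of the degree of an invariant monomial is seen on the points \<open>(\<chi>\<^sub>j(g))\<close> of \<open>T_bar\<close>.\<close>

lemma inv_degr:
  assumes m: "lau c \<in> M_V_inv G X"
  shows "cl (degr c) = cl 0" "pair c (cob y \<theta>) = rvec (degr c) \<bullet> y"
proof -
  have one: "lau c s = 1" if "s \<in> T_bar G X" for s using m that by (auto simp: M_V_inv_iff)
  show "cl (degr c) = cl 0"
  proof (rule char_ext[OF cl_Irr cl_Irr])
    fix g assume g: "g \<in> G"
    let ?s = "(\<lambda>(i, j)\<in>Arr G. inverse (i g) * te i j g)"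
    have sT: "?s \<in> T_bar G X" unfolding T_bar_def by (intro CollectI exI[of _ "\<lambda>i. i g"]) (use g char_nonzero in auto)
    have "lau c ?s = (\<Prod>e\<in>Arr G. \<chi>' (snd e) g powi c e)"
      unfolding lau_apply[OF subsetD[OF T_bar_T0 sT]]
      by (rule prod.cong) (auto simp: tens_apply[OF g] Arr_def char_nonzero[OF _ g] field_simps)
    also have "\<dots> = (\<Prod>i\<in>Irr G. \<Prod>j\<in>UNIV. \<chi>' j g powi c (i, j))"
      unfolding Arr_def by (subst prod.cartesian_product) (auto intro: prod.cong)
    also have "\<dots> = (\<Prod>j\<in>UNIV. \<Prod>i\<in>Irr G. \<chi>' j g powi c (i, j))" by (rule prod.swap)
    also have "\<dots> = (\<Prod>j\<in>UNIV. \<chi>' j g powi (degr c $ j))"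
    proof (rule prod.cong[OF refl])
      fix j
      show "(\<Prod>i\<in>Irr G. \<chi>' j g powi c (i, j)) = \<chi>' j g powi (degr c $ j)"
        unfolding degr_def using finite_Irr
        by (simp, induction rule: finite_induct) (auto simp: power_int_add chi_nz[OF g])
    qed
    also have "\<dots> = cl (degr c) g" using g by (simp add: cl_def)
    finally show "cl (degr c) g = cl 0 g" using one[OF sT] g by (simp add: cl_zero triv_def)
  qed
  have "exp (complex_of_real (pair c (cob 0 \<theta>))) = 1"
    using one[OF T_bar_cob, of \<theta>] lau_expo[OF cocycle_of_real[OF cob_cocycle], of c 0 \<theta>] by (simp add: pair_of_real)
  then have "complex_of_real (exp (pair c (cob 0 \<theta>))) = of_real 1" by (simp add: exp_of_real)
  then have z: "pair c (cob 0 \<theta>) = 0" by (simp only: of_real_eq_iff exp_eq_one_iff)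
  have "pair c (cob y \<theta>) = pair c (\<lambda>e. cob y (\<lambda>_. 0) e + cob 0 \<theta> e)"
    by (rule pair_cong) (simp add: cob_def)
  then show "pair c (cob y \<theta>) = rvec (degr c) \<bullet> y" using z by (simp add: pair_right pair_degr)
qed

lemma inv_unique:
  assumes "lau c \<in> M_V_inv G X" "lau c' \<in> M_V_inv G X" "rvec (degr c) = rvec (degr c')"
  shows "lau c = lau c'"
  unfolding lau_eq_iff
proof (intro allI impI)
  fix w :: "'n arrow \<Rightarrow> real" assume "cocycle w"
  then obtain y \<theta> where w: "\<forall>e\<in>Arr G. w e = cob y \<theta> e" by (rule cocycle_cob)
  have "pair c w = pair c (cob y \<theta>)" "pair c' w = pair c' (cob y \<theta>)" using w by (auto intro: pair_cong)
  then show "pair c w = pair c' w" using inv_degr(2)[OF assms(1)] inv_degr(2)[OF assms(2)] assms(3) by simp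
qed

lemma T_bar_pair:
  assumes "s \<in> T_bar G X" and z: "\<And>\<theta>. pair c (cob 0 \<theta>) = 0"
  shows "lau c s = 1"
proof -
  obtain t where t: "s = (\<lambda>(i, j)\<in>Arr G. inverse (t i) * t (te i j))" "\<forall>i\<in>Irr G. t i \<noteq> 0" using assms(1) by (auto simp: T_bar_def)
  define w where "w = (\<lambda>(i, j). Ln (t (te i j)) - Ln (t i))"
  have w: "cocycle w" unfolding cocycle_def w_def using tens_comm by (simp add: algebra_simps)
  have s: "s = expo w" unfolding t(1) expo_def
    by (rule restrict_ext) (use t(2) tens_Irr in \<open>auto simp: w_def Arr_def exp_diff field_simps\<close>)
  \<comment> \<open>The hypothesis concerns real \<theta>; it is applied to the real and the
    imaginary parts of the logarithms of \<open>t\<close>.\<close>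
  have "pair c w = of_real (pair c (cob 0 (\<lambda>i. Re (Ln (t i))))) + \<i> * of_real (pair c (cob 0 (\<lambda>i. Im (Ln (t i)))))"
    by (simp add: complex_eq_iff pair_def w_def cob_def case_prod_beta)
  then have "pair c w = 0" using z by simp
  then show ?thesis unfolding s by (simp add: lau_expo[OF w])
qed

lemma M_G_to_M_V_eq:
  assumes x: "cl x = cl 0"
  obtains c where "M_G_to_M_V G X (rvec x) = lau c" "lau c \<in> M_V_inv G X" "degr c = x"
    "\<forall>y \<theta>. pair c (cob y \<theta>) = rvec x \<bullet> y"
proof -
  obtain c where "\<forall>y \<theta>. pair c (cob y \<theta>) = rvec x \<bullet> y + \<theta> (cl x) - \<theta> (cl 0)" by (rule path_monomial)
  then have c: "\<forall>y \<theta>. pair c (cob y \<theta>) = rvec x \<bullet> y" using x by simp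
  have inv: "lau c \<in> M_V_inv G X" unfolding M_V_inv_iff using T_bar_pair c lau_carrier by simp
  have "rvec (degr c) \<bullet> y = rvec x \<bullet> y" for y using c by (simp add: pair_degr[symmetric])
  then have deg: "rvec (degr c) = rvec x" by (metis vector_eq_rdot)
  then have degx: "degr c = x" by (simp add: rvec_def vec_eq_iff)
  have "M_G_to_M_V G X (rvec x) = lau c" unfolding M_G_to_M_V_def
  proof (rule the_equality)
    show "lau c \<in> M_V_inv G X \<and> M_V_to_M G X (lau c) = rvec x" using inv deg by (simp add: M_V_to_M_lau)
    fix m assume m: "m \<in> M_V_inv G X \<and> M_V_to_M G X m = rvec x"
    then have "m \<in> carrier MV" by (simp add: M_V_inv_iff)
    then obtain c' where c': "m = lau c'" by (rule MV_E)
    then show "m = lau c" using inv_unique[of c' c] m inv deg by (simp add: M_V_to_M_lau)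
  qed
  then show ?thesis by (rule that[OF _ inv degx c])
qed

lemma inv_M_G:
  assumes "m \<in> carrier MV" "\<And>s. s \<in> T_bar G X \<Longrightarrow> m s = 1"
  shows "\<exists>f\<in>carrier (M_G G X). m = M_G_to_M_V G X f"
proof -
  obtain c where c: "m = lau c" using assms(1) by (rule MV_E)
  have inv: "lau c \<in> M_V_inv G X" using assms c by (simp add: M_V_inv_iff)
  have x: "cl (degr c) = cl 0" by (rule inv_degr[OF inv])
  obtain c' where c': "M_G_to_M_V G X (rvec (degr c)) = lau c'" "lau c' \<in> M_V_inv G X" "degr c' = degr c"
    by (rule M_G_to_M_V_eq[OF x])
  have "m = M_G_to_M_V G X (rvec (degr c))" using inv_unique[OF inv c'(2)] c c' by simp
  then show ?thesis using x M_G_carrier by auto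
qed

text \<open>The multiple by \<open>card G\<close> of each basis vector lies in M_G, so M_G separates
  vectors. The uniqueness required in the definition of \<open>q_G\<close> rests on this.\<close>

lemma card_axis_class: "cl (\<chi> k. if k = j then int (card G) else 0) = cl 0"
proof (rule char_ext[OF cl_Irr cl_Irr])
  fix g assume g: "g \<in> G"
  have "(\<Prod>k\<in>UNIV. \<chi>' k g powi (if k = j then int (card G) else 0)) = (\<Prod>k\<in>UNIV. if k = j then \<chi>' j g powi int (card G) else 1)"
    by (rule prod.cong) auto
  also have "\<dots> = 1" using char_root[OF chi_Irr g, of j] by simp
  finally show "cl (\<chi> k. if k = j then int (card G) else 0) g = cl 0 g"
    using g by (simp add: cl_def)
qed

lemma q_G_wt:
  assumes "\<And>e. e \<in> Arr G \<Longrightarrow> w e = cob y \<theta> e"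
  shows "q_G G X (wt w) = y"
proof -
  have w: "wt w = wt (cob y \<theta>)" by (rule wt_cong) (rule assms)
  have val: "wt w (M_G_to_M_V G X (rvec x)) = rvec x \<bullet> y" if x: "cl x = cl 0" for x
  proof -
    obtain c where "M_G_to_M_V G X (rvec x) = lau c" "\<forall>y \<theta>. pair c (cob y \<theta>) = rvec x \<bullet> y"
      by (rule M_G_to_M_V_eq[OF x])
    then show ?thesis by (simp add: w wt_lau[OF cob_cocycle])
  qed
  show ?thesis unfolding q_G_def
  proof (rule the_equality)
    show "\<forall>f\<in>carrier (M_G G X). f \<bullet> y = wt w (M_G_to_M_V G X f)" using val M_G_carrier by auto
    fix v assume v: "\<forall>f\<in>carrier (M_G G X). f \<bullet> v = wt w (M_G_to_M_V G X f)"
    have "v $ j = y $ j" for j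
    proof -
      let ?x = "\<chi> k. if k = j then int (card G) else 0"
      have r: "rvec ?x \<bullet> z = card G * z $ j" for z :: "real^'n"
      proof -
        have "rvec ?x \<bullet> z = (\<Sum>k\<in>UNIV. if k = j then card G * z $ j else 0)"
          unfolding inner_vec_def rvec_def by (rule sum.cong) auto
        then show ?thesis by simp
      qed
      have "rvec ?x \<bullet> v = rvec ?x \<bullet> y" using v val[OF card_axis_class] card_axis_class M_G_carrier by auto
      then show ?thesis using cardG by (simp add: r)
    qed
    then show "v = y" by (simp add: vec_eq_iff)
  qed
qed

end

section \<open>The fan of the normalization\<close>

lemma tendsto_fun_iff: "(f \<longlongrightarrow> l) F \<longleftrightarrow> (\<forall>i. ((\<lambda>x. f x i) \<longlongrightarrow> l i) F)"
  using limitin_componentwise[of "\<lambda>_. euclidean" UNIV f l F]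
  by (simp add: euclidean_product_topology limitin_canonical_iff)

lemma tendsto_powi_at_0:
  "((\<lambda>t::complex. t powi k) \<longlongrightarrow> l) (at 0) \<longleftrightarrow> 0 \<le> k \<and> l = (if k = 0 then 1 else 0)"
proof -
  have pos: "((\<lambda>t::complex. t powi k) \<longlongrightarrow> 0) (at 0)" if k: "0 < k" for k
  proof -
    have "((\<lambda>t::complex. t ^ nat k) \<longlongrightarrow> 0 ^ nat k) (at 0)" by (intro tendsto_intros)
    moreover have "(0::complex) ^ nat k = 0" using k by simp
    ultimately show ?thesis using k by (simp only: power_int_def) simp
  qed
  consider "k < 0" | "k = 0" | "0 < k" by linarith
  then show ?thesis
  proof cases
    case 1
    have "\<not> ((\<lambda>t::complex. t powi k) \<longlongrightarrow> l) (at 0)"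
    proof
      assume "((\<lambda>t::complex. t powi k) \<longlongrightarrow> l) (at 0)"
      then have "((\<lambda>t::complex. t powi k * t powi (- k)) \<longlongrightarrow> l * 0) (at 0)" using pos[of "- k"] 1 by (intro tendsto_mult) auto
      moreover have "eventually (\<lambda>t::complex. t powi k * t powi (- k) = 1) (at 0)"
        by (rule eventually_at_filter[THEN iffD2]) (auto simp: power_int_minus intro!: always_eventually)
      ultimately have "((\<lambda>t::complex. 1) \<longlongrightarrow> (0::complex)) (at (0::complex))" using tendsto_cong by fastforce
      then show False using tendsto_unique[of "at (0::complex)" "\<lambda>t. 1::complex" 0 1] by auto
    qed
    then show ?thesis using 1 by simp
  next
    case 2
    then show ?thesis using tendsto_unique[of "at (0::complex)" "\<lambda>t. 1::complex" l 1] by (auto intro: tendsto_const)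
  next
    case 3
    then show ?thesis using pos[OF 3] tendsto_unique[of "at (0::complex)" "\<lambda>t. t powi k" l 0] by auto
  qed
qed

context mckay
begin

section \<open>Cones of nonnegative cocycles as cones of orbits\<close>

definition intc :: "('n arrow \<Rightarrow> real) \<Rightarrow> bool" where
  "intc w \<longleftrightarrow> cocycle w \<and> (\<forall>e\<in>Arr G. w e \<in> \<int> \<and> 0 \<le> w e)"

definition supp :: "('n arrow \<Rightarrow> real) \<Rightarrow> 'n arrow set" where "supp w = {e\<in>Arr G. w e \<noteq> 0}"

definition realc :: "'n arrow set \<Rightarrow> ('n arrow \<Rightarrow> real) \<Rightarrow> bool" where
  "realc S w \<longleftrightarrow> cocycle w \<and> (\<forall>e\<in>Arr G. 0 \<le> w e) \<and> supp w \<subseteq> S"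

text \<open>An orbit of limit points is determined by its vanishing coordinates, and a one-parameter
  subgroup sends exactly the arrows of positive exponent to zero; \<open>S\<close> lists the arrows
  for which this is permitted.\<close>

definition Cone :: "'n arrow set \<Rightarrow> 'n nvec set" where "Cone S = wt ` {w. realc S w}"

lemma intc_realc: "intc w \<Longrightarrow> supp w \<subseteq> S \<Longrightarrow> realc S w" by (auto simp: intc_def realc_def)

lemma intc_add: "intc w \<Longrightarrow> intc w' \<Longrightarrow> intc (\<lambda>e. w e + w' e)"
  unfolding intc_def by (auto intro: cocycle_ops)

lemma intc_scale: "intc w \<Longrightarrow> intc (\<lambda>e. real n * w e)"
  unfolding intc_def using cocycle_ops(4)[of w "real n"] by auto

lemma intc_zero: "intc (\<lambda>e. 0)" unfolding intc_def using cocycle_ops(3)[where 'a=real] by auto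

lemma supp_add: "intc w \<Longrightarrow> intc w' \<Longrightarrow> supp (\<lambda>e. w e + w' e) = supp w \<union> supp w'"
  unfolding intc_def supp_def by (auto simp: add_nonneg_eq_0_iff)

lemma supp_scale: "0 < n \<Longrightarrow> supp (\<lambda>e. n * w e) = supp w" by (auto simp: supp_def)

lemma supp_zero: "supp (\<lambda>e. 0) = {}" by (simp add: supp_def)

lemma intc_N_V: "intc w \<Longrightarrow> wt w \<in> N_V G X" unfolding intc_def using N_V_wt_iff by auto

lemma approx_Arr:
  fixes w :: "'n arrow \<Rightarrow> real"
  assumes "0 < N"
  obtains k h where "0 < (k::int)" "\<forall>e\<in>Arr G. \<bar>k * w e - of_int (h e)\<bar> < 1 / real N"
proof -
  obtain b where b: "bij_betw b {..<card (Arr G)} (Arr G)"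
    using ex_bij_betw_nat_finite[OF finite_Arr] atLeast0LessThan by auto
  obtain q p where "0 < q" "q \<le> int (N ^ card (Arr G))"
    and qp: "\<And>i. i < card (Arr G) \<Longrightarrow> \<bar>of_int q * w (b i) - of_int (p i)\<bar> < 1/N"
    by (rule Dirichlet_approx_simult[OF assms, of "card (Arr G)" "\<lambda>i. w (b i)"]) blast
  have "\<forall>e\<in>Arr G. \<bar>q * w e - of_int (p (inv_into {..<card (Arr G)} b e))\<bar> < 1 / real N"
  proof
    fix e assume e: "e \<in> Arr G"
    let ?i = "inv_into {..<card (Arr G)} b e"
    have eb: "e \<in> b ` {..<card (Arr G)}" using b e by (simp add: bij_betw_def)
    have "?i < card (Arr G)" "b ?i = e" using inv_into_into[OF eb] f_inv_into_f[OF eb] by simp_all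
    then show "\<bar>q * w e - of_int (p ?i)\<bar> < 1 / real N" using qp[of ?i] by simp
  qed
  then show ?thesis by (rule that[OF \<open>0 < q\<close>])
qed

lemma int_small: "\<bar>of_int k :: real\<bar> < 1 \<Longrightarrow> k = 0" by linarith

text \<open>Good simultaneous approximations satisfy the linear equations of a cone exactly.\<close>

lemma approx:
  assumes w: "realc S w" and c: "pair c w = 0" and \<epsilon>: "0 < \<epsilon>"
  obtains k h where "(1::real) \<le> k" "intc h" "supp h \<subseteq> supp w" "pair c h = 0" "\<forall>e\<in>Arr G. \<bar>k * w e - h e\<bar> < \<epsilon>"
proof -
  \<comment> \<open>4 is the number of terms in a cocycle identity, and the sum of the coefficients
    of \<open>c\<close> controls the pairing: the errors in these integral equations then stay below
    1 and vanish. The bound by \<epsilon> gives the closeness.\<close>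
  obtain N where N: "max (max 4 (1 / \<epsilon>)) (\<Sum>e\<in>Arr G. \<bar>of_int (c e)\<bar>) < real N" using reals_Archimedean2 by blast
  then have N0: "0 < N" and N4: "1 / real N * 4 < 1" and N1: "1 / real N < 1" and Ne: "1 / real N < \<epsilon>"
    and Nc: "(\<Sum>e\<in>Arr G. \<bar>of_int (c e)\<bar>) * (1 / real N) < 1"
    using \<epsilon> by (auto simp: field_simps)
  obtain k h where k: "0 < (k::int)" and h: "\<forall>e\<in>Arr G. \<bar>k * w e - of_int (h e)\<bar> < 1 / real N"
    by (rule approx_Arr[OF N0])
  have co: "cocycle w" and pos: "\<And>e. e \<in> Arr G \<Longrightarrow> 0 \<le> w e" using w by (auto simp: realc_def)
  have "cocycle (\<lambda>e. real_of_int (h e))"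
    unfolding cocycle_def
  proof (intro ballI allI)
    fix i j j' assume i: "i \<in> Irr G"
    have A: "(te i j, j') \<in> Arr G" "(i, j) \<in> Arr G" "(te i j', j) \<in> Arr G" "(i, j') \<in> Arr G"
      using i by (auto simp: Arr_def tens_Irr)
    have "w (te i j, j') + w (i, j) = w (te i j', j) + w (i, j')" using co i by (simp add: cocycle_def)
    then have "k * w (te i j, j') + k * w (i, j) = k * w (te i j', j) + k * w (i, j')" by (simp flip: distrib_left)
    then have "\<bar>real_of_int (h (te i j, j') + h (i, j) - h (te i j', j) - h (i, j'))\<bar> < 1 / real N * 4"
      using h[rule_format, OF A(1)] h[rule_format, OF A(2)] h[rule_format, OF A(3)] h[rule_format, OF A(4)] by simp
    then have "h (te i j, j') + h (i, j) - h (te i j', j) - h (i, j') = 0" using N4 by (intro int_small) linarith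
    then have "h (te i j, j') + h (i, j) = h (te i j', j) + h (i, j')" by simp
    then show "real_of_int (h (te i j, j')) + real_of_int (h (i, j)) = real_of_int (h (te i j', j)) + real_of_int (h (i, j'))"
      by (simp only: of_int_add[symmetric])
  qed
  moreover have "0 \<le> h e" if e: "e \<in> Arr G" for e
  proof -
    have "0 \<le> k * w e" using k pos[OF e] by simp
    then have "real_of_int (h e) > -1" using h[rule_format, OF e] N1 by linarith
    then show ?thesis by linarith
  qed
  ultimately have hi: "intc (\<lambda>e. real_of_int (h e))" by (simp add: intc_def)
  have "h e = 0" if e: "e \<in> Arr G" "w e = 0" for e
    using h[rule_format, OF e(1)] N1 e(2) by (intro int_small) simp
  then have hs: "supp (\<lambda>e. real_of_int (h e)) \<subseteq> supp w" by (auto simp: supp_def)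
  have "\<bar>pair c (\<lambda>e. real_of_int (h e))\<bar> = \<bar>pair c (\<lambda>e. real_of_int (h e) - k * w e)\<bar>"
    by (simp add: pair_right c)
  also have "\<dots> \<le> (\<Sum>e\<in>Arr G. \<bar>of_int (c e)\<bar> * (1 / real N))"
    unfolding pair_def
  proof (rule order_trans[OF sum_abs], rule sum_mono)
    fix e assume e: "e \<in> Arr G"
    have "\<bar>real_of_int (h e) - k * w e\<bar> \<le> 1 / real N" using h[rule_format, OF e] by linarith
    then show "\<bar>of_int (c e) * (real_of_int (h e) - k * w e)\<bar> \<le> \<bar>of_int (c e)\<bar> * (1 / real N)"
      unfolding abs_mult by (rule mult_left_mono) simp
  qed
  also have "\<dots> < 1" using Nc unfolding sum_distrib_right .
  finally have "\<bar>real_of_int (\<Sum>e\<in>Arr G. c e * h e)\<bar> < 1" by (simp add: pair_def)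
  then have "(\<Sum>e\<in>Arr G. c e * h e) = 0" by (rule int_small)
  then have "real_of_int (\<Sum>e\<in>Arr G. c e * h e) = 0" by simp
  then have hc: "pair c (\<lambda>e. real_of_int (h e)) = 0" by (simp add: pair_def)
  show thesis
    by (rule that[OF _ hi hs hc, of k]) (use k h Ne in force)+
qed

lemma cone_iff: "u \<in> Cone S \<longleftrightarrow>
    u \<in> N_V_R G X \<and> (\<forall>e\<in>Arr G. 0 \<le> u (xbar G X e)) \<and> (\<forall>e\<in>Arr G - S. u (xbar G X e) = 0)"
proof
  assume "u \<in> Cone S"
  then obtain w where "u = wt w" "realc S w" by (auto simp: Cone_def)
  then show "u \<in> N_V_R G X \<and> (\<forall>e\<in>Arr G. 0 \<le> u (xbar G X e)) \<and> (\<forall>e\<in>Arr G - S. u (xbar G X e) = 0)"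
    by (auto simp: realc_def wt_N_V_R wt_xbar supp_def)
next
  assume u: "u \<in> N_V_R G X \<and> (\<forall>e\<in>Arr G. 0 \<le> u (xbar G X e)) \<and> (\<forall>e\<in>Arr G - S. u (xbar G X e) = 0)"
  have "realc S (\<lambda>e. u (xbar G X e))" using u N_V_R_wt(1)[of u] by (auto simp: realc_def supp_def)
  then show "u \<in> Cone S" unfolding Cone_def using N_V_R_wt(2)[of u] u by (intro image_eqI[of u wt]) auto
qed

lemma cone_wt: "cocycle w \<Longrightarrow> wt w \<in> Cone S \<longleftrightarrow> realc S w"
  by (auto simp: cone_iff realc_def wt_N_V_R wt_xbar supp_def)

lemma coneE:
  assumes "u \<in> Cone S"
  obtains w where "u = wt w" "realc S w" "cocycle w"
  using assms by (auto simp: Cone_def realc_def)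

lemma closed_cone: "closed (Cone S)"
proof -
  have cont: "continuous_on UNIV (\<lambda>u::'n nvec. u m)" for m by simp
  \<comment> \<open>Every clause, extensionality included, is an equation or inequality between
    finitely many coordinates of \<open>u\<close>, hence closed under pointwise convergence.\<close>
  have e: "Cone S = {u. (\<forall>m. m \<notin> carrier MV \<longrightarrow> u m = undefined) \<and>
      (\<forall>m m'. m \<in> carrier MV \<and> m' \<in> carrier MV \<longrightarrow> u (m \<otimes>\<^bsub>MV\<^esub> m') = u m + u m') \<and>
      (\<forall>e. e \<in> Arr G \<longrightarrow> 0 \<le> u (xbar G X e)) \<and> (\<forall>e. e \<in> Arr G - S \<longrightarrow> u (xbar G X e) = 0)}"
    unfolding set_eq_iff cone_iff N_V_R_def hom_def extensional_def by auto
  show ?thesis unfolding e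
    by (intro closed_Collect_conj closed_Collect_all closed_Collect_imp open_Collect_const
        closed_Collect_eq closed_Collect_le continuous_intros cont)
qed

definition limpt :: "('n arrow \<Rightarrow> real) \<Rightarrow> 'n rpoint" where
  "limpt w = (\<lambda>e\<in>Arr G. if w e = 0 then 1 else 0)"

lemma one_ps_limit_iff:
  assumes w: "cocycle w" and i: "\<forall>e\<in>Arr G. w e \<in> \<int>"
  shows "one_ps_limit G X (wt w) p \<longleftrightarrow> intc w \<and> p = limpt w"
proof -
  have "((\<lambda>t. one_ps G X (wt w) t e) \<longlongrightarrow> p e) (at 0) \<longleftrightarrow> (0 \<le> w e \<and> p e = limpt w e)" if e: "e \<in> Arr G" for e
  proof -
    obtain k where k: "w e = of_int k" using i e by (auto elim: Ints_cases)
    have "one_ps G X (wt w) t e = t powi k" for t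
      using e by (simp add: one_ps_def wt_xbar[OF w e] k)
    then show ?thesis using tendsto_powi_at_0[of k "p e"] e k by (simp add: limpt_def)
  qed
  moreover have "((\<lambda>t. one_ps G X (wt w) t e) \<longlongrightarrow> p e) (at 0) \<longleftrightarrow> p e = limpt w e" if e: "e \<notin> Arr G" for e
    using e tendsto_unique[of "at (0::complex)" "\<lambda>t. undefined::complex" "p e" undefined]
    by (auto simp: one_ps_def limpt_def)
  ultimately have "((\<lambda>t. one_ps G X (wt w) t e) \<longlongrightarrow> p e) (at 0) \<longleftrightarrow> (e \<in> Arr G \<longrightarrow> 0 \<le> w e) \<and> p e = limpt w e" for e
    by (cases "e \<in> Arr G") simp_all
  then show ?thesis
    unfolding one_ps_limit_def tendsto_fun_iff intc_def fun_eq_iff using w i by blast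
qed

lemma N_V_cases:
  assumes "u \<in> N_V G X"
  obtains w where "u = wt w" "cocycle w" "\<forall>e\<in>Arr G. w e \<in> \<int>"
proof -
  have u: "u \<in> N_V_R G X" using assms by (simp add: N_V_def)
  have "wt (\<lambda>e. u (xbar G X e)) \<in> N_V G X" using assms N_V_R_wt(2)[OF u] by simp
  then show ?thesis using that[OF N_V_R_wt(2,1)[OF u]] N_V_wt_iff[OF N_V_R_wt(1)[OF u]] by simp
qed

lemma limpt_in_orbit: "limpt w \<in> T_orbit G X (limpt w') \<longleftrightarrow> supp w = supp w'"
proof
  assume "limpt w \<in> T_orbit G X (limpt w')"
  then obtain s where s: "s \<in> T0" "limpt w = tmult G s (limpt w')" by (auto simp: T_orbit_def T_V_eq)
  have "w e = 0 \<longleftrightarrow> w' e = 0" if e: "e \<in> Arr G" for e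
    using fun_cong[OF s(2), of e] s(1) e by (auto simp: limpt_def tmult_def T0_def split: if_splits)
  then show "supp w = supp w'" by (auto simp: supp_def)
next
  assume s: "supp w = supp w'"
  have "w e = 0 \<longleftrightarrow> w' e = 0" if "e \<in> Arr G" for e
  proof -
    have "e \<in> supp w \<longleftrightarrow> e \<in> supp w'" using s by simp
    then show ?thesis using that by (simp add: supp_def)
  qed
  then have "limpt w = tmult G (\<lambda>e\<in>Arr G. 1) (limpt w')"
    unfolding limpt_def tmult_def by (intro restrict_ext) auto
  then show "limpt w \<in> T_orbit G X (limpt w')" using T0_one by (auto simp: T_orbit_def T_V_eq)
qed

lemma wt_scale: "cocycle w \<Longrightarrow> (\<lambda>m\<in>carrier MV. c * wt w m) = wt (\<lambda>e. c * w e)"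
  unfolding wt_def by (rule restrict_ext) (simp add: pair_right)

lemma realc_scale: "realc S w \<Longrightarrow> 0 \<le> c \<Longrightarrow> realc S (\<lambda>e. c * w e)"
  unfolding realc_def supp_def using cocycle_ops(4)[of w c] by auto

text \<open>The orbit supplies integral cocycles whose support is exactly \<open>supp w0\<close>,
  while the cone admits real cocycles of smaller support; the closure bridges the difference. The
  first equation is kept for \<open>cone_gens\<close>, where an inequality passes from integral
  cocycles to their limits.\<close>

lemma orbit_cone_eq:
  assumes w0: "intc w0"
  shows "orbit_cone G X (T_orbit G X (limpt w0)) = closure {wt (\<lambda>e. c * w e) | c w. 0 \<le> c \<and> intc w \<and> supp w = supp w0}"
    "orbit_cone G X (T_orbit G X (limpt w0)) = Cone (supp w0)"
proof -
  define A where "A = {wt (\<lambda>e. c * w e) | c w. 0 \<le> c \<and> intc w \<and> supp w = supp w0}"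
  have "{(\<lambda>m\<in>carrier MV. c * u m) | c u p. c \<ge> 0 \<and> u \<in> N_V G X \<and> p \<in> T_orbit G X (limpt w0) \<and> one_ps_limit G X u p} = A"
    (is "?B = A")
  proof
    show "?B \<subseteq> A"
    proof
      fix x assume "x \<in> ?B"
      then obtain c u p where x: "x = (\<lambda>m\<in>carrier MV. c * u m)" "c \<ge> 0" "u \<in> N_V G X"
        "p \<in> T_orbit G X (limpt w0)" "one_ps_limit G X u p" by auto
      obtain w where w: "u = wt w" "cocycle w" "\<forall>e\<in>Arr G. w e \<in> \<int>" by (rule N_V_cases[OF x(3)])
      have "intc w" "p = limpt w" using x(5) one_ps_limit_iff[OF w(2,3)] w(1) by auto
      moreover have "supp w = supp w0" using x(4) calculation limpt_in_orbit by simp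
      moreover have "x = wt (\<lambda>e. c * w e)" using x(1) w wt_scale by simp
      ultimately show "x \<in> A" unfolding A_def using x(2) by blast
    qed
    show "A \<subseteq> ?B"
    proof
      fix x assume "x \<in> A"
      then obtain c w where w: "x = wt (\<lambda>e. c * w e)" "0 \<le> c" "intc w" "supp w = supp w0" by (auto simp: A_def)
      have co: "cocycle w" "\<forall>e\<in>Arr G. w e \<in> \<int>" using w by (auto simp: intc_def)
      have "one_ps_limit G X (wt w) (limpt w)" using one_ps_limit_iff[OF co] w by simp
      moreover have "limpt w \<in> T_orbit G X (limpt w0)" using limpt_in_orbit w by simp
      moreover have "x = (\<lambda>m\<in>carrier MV. c * wt w m)" using wt_scale[OF co(1)] w by simp
      ultimately show "x \<in> ?B" using w(2) intc_N_V[OF w(3)] by blast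
    qed
  qed
  then have o: "orbit_cone G X (T_orbit G X (limpt w0)) = closure A" unfolding orbit_cone_def by simp
  then show "orbit_cone G X (T_orbit G X (limpt w0)) = closure {wt (\<lambda>e. c * w e) | c w. 0 \<le> c \<and> intc w \<and> supp w = supp w0}"
    unfolding A_def .
  have "closure A \<subseteq> Cone (supp w0)"
  proof (rule closure_minimal[OF _ closed_cone])
    show "A \<subseteq> Cone (supp w0)" unfolding A_def Cone_def using realc_scale[OF intc_realc] by auto
  qed
  moreover have "Cone (supp w0) \<subseteq> closure A"
  proof
    fix u assume "u \<in> Cone (supp w0)"
    then obtain w where w: "u = wt w" "realc (supp w0) w" "cocycle w" by (rule coneE)
    have "\<forall>n::nat. \<exists>x. x \<in> A \<and> (\<exists>v. cocycle v \<and> x = wt v \<and> (\<forall>e\<in>Arr G. \<bar>v e - w e\<bar> \<le> (1 + w0 e) * inverse (real (Suc n))))"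
    proof
      fix n :: nat
      let ?L = "real (Suc n)"
      obtain k h where k: "(1::real) \<le> k" and h: "intc h" "supp h \<subseteq> supp w" "\<forall>e\<in>Arr G. \<bar>k * w e - h e\<bar> < inverse ?L"
        by (rule approx[OF w(2) pair_left(4), of "inverse ?L"]) auto
      \<comment> \<open>\<open>h\<close> is an integral approximation of \<open>k\<close> times
        \<open>w\<close>. Adding \<open>w0\<close> once restores the full support, and its
        contribution after division is of order \<open>1 / ?L\<close>.\<close>
      define v where "v = (\<lambda>e. inverse (?L * k) * (?L * h e + w0 e))"
      have i: "intc (\<lambda>e. ?L * h e + w0 e)" by (intro intc_add intc_scale h w0)
      have "supp (\<lambda>e. ?L * h e + w0 e) = supp w0"
        using supp_add[OF intc_scale[OF h(1)] w0, of "Suc n"] supp_scale[of ?L h] h(2) w(2) unfolding realc_def by auto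
      then have "wt v \<in> A" unfolding A_def v_def using k i
        by (intro CollectI exI[of _ "inverse (?L * k)"] exI[of _ "\<lambda>e. ?L * h e + w0 e"]) auto
      moreover have "\<bar>v e - w e\<bar> \<le> (1 + w0 e) * inverse ?L" if e: "e \<in> Arr G" for e
      proof -
        have w0e: "0 \<le> w0 e" using w0 e by (simp add: intc_def)
        have k0: "k \<noteq> 0" "?L \<noteq> 0" using k by auto
        have g: "inverse (L * k) * (L * a + d) - x = inverse k * (a - k * x) + inverse L * (inverse k * d)"
          if "L \<noteq> 0" for L a d x :: real
          using that k0(1) by (simp add: field_simps)
        have ve: "v e - w e = inverse k * (h e - k * w e) + inverse ?L * (inverse k * w0 e)"
          unfolding v_def by (rule g[OF k0(2)])
        have ik: "0 \<le> inverse k" "inverse k \<le> 1" using k by (auto simp: field_simps)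
        have "\<bar>inverse k * (h e - k * w e)\<bar> \<le> 1 * inverse ?L"
          unfolding abs_mult using h(3)[rule_format, OF e] ik by (intro mult_mono) auto
        moreover have "inverse k * w0 e \<le> 1 * w0 e" using ik w0e by (intro mult_right_mono) auto
        then have "\<bar>inverse ?L * (inverse k * w0 e)\<bar> \<le> inverse ?L * w0 e" using ik w0e by (simp add: abs_mult mult_left_mono)
        ultimately have "\<bar>v e - w e\<bar> \<le> 1 * inverse ?L + inverse ?L * w0 e" unfolding ve by linarith
        then show ?thesis by (simp only: distrib_right mult.commute[of "inverse ?L"])
      qed
      moreover have "cocycle v" unfolding v_def using i by (intro cocycle_ops(4)) (simp add: intc_def)
      ultimately show "\<exists>x. x \<in> A \<and> (\<exists>v. cocycle v \<and> x = wt v \<and> (\<forall>e\<in>Arr G. \<bar>v e - w e\<bar> \<le> (1 + w0 e) * inverse ?L))"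
        by blast
    qed
    then obtain x where x: "\<forall>n::nat. x n \<in> A \<and> (\<exists>v. cocycle v \<and> x n = wt v \<and> (\<forall>e\<in>Arr G. \<bar>v e - w e\<bar> \<le> (1 + w0 e) * inverse (real (Suc n))))"
      by (rule choice[THEN exE])
    then have "\<forall>n. \<exists>v. cocycle v \<and> x n = wt v \<and> (\<forall>e\<in>Arr G. \<bar>v e - w e\<bar> \<le> (1 + w0 e) * inverse (real (Suc n)))" by simp
    then obtain v where v: "\<forall>n. cocycle (v n) \<and> x n = wt (v n) \<and> (\<forall>e\<in>Arr G. \<bar>v n e - w e\<bar> \<le> (1 + w0 e) * inverse (real (Suc n)))"
      by (rule choice[THEN exE])
    have lim: "(\<lambda>n. v n e) \<longlonglongrightarrow> w e" if e: "e \<in> Arr G" for e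
    proof (rule Lim_transform_bound[of "\<lambda>n. v n e - w e" "\<lambda>n. (1 + w0 e) * inverse (real (Suc n))", THEN LIM_zero_cancel])
      show "\<forall>\<^sub>F n in sequentially. norm (v n e - w e) \<le> norm ((1 + w0 e) * inverse (real (Suc n)))"
        using v e by (intro always_eventually allI) (auto intro: order_trans[OF _ abs_ge_self])
      show "(\<lambda>n. (1 + w0 e) * inverse (real (Suc n))) \<longlonglongrightarrow> 0"
        using tendsto_mult[OF tendsto_const[of "1 + w0 e"] LIMSEQ_inverse_real_of_nat] by simp
    qed
    have "x \<longlonglongrightarrow> u"
      unfolding tendsto_fun_iff
    proof
      fix m
      show "(\<lambda>n. x n m) \<longlonglongrightarrow> u m"
      proof (cases "m \<in> carrier MV")
        case True
        then obtain c where c: "m = lau c" by (rule MV_E)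
        have "(\<lambda>n. pair c (v n)) \<longlonglongrightarrow> pair c w" unfolding pair_def by (intro tendsto_intros lim)
        then show ?thesis using v w c by (simp add: wt_lau)
      next
        case False
        then show ?thesis using v w by (simp add: wt_def)
      qed
    qed
    moreover have "\<forall>\<^sub>F n in sequentially. x n \<in> closure A" using x closure_subset by (intro always_eventually) auto
    ultimately show "u \<in> closure A" by (intro Lim_in_closed_set[OF closed_closure _ trivial_limit_sequentially]) auto
  qed
  ultimately show "orbit_cone G X (T_orbit G X (limpt w0)) = Cone (supp w0)" using o by auto
qed

lemma poly_fns_tendsto:
  assumes "f \<in> poly_fns I" "(p \<longlongrightarrow> l) F"
  shows "((\<lambda>t. f (p t)) \<longlongrightarrow> f l) F"
  using assms(1)
proof induction
  case (coord v)
  then show ?case using assms(2) unfolding tendsto_fun_iff by auto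
qed (auto intro: tendsto_intros)

text \<open>Away from 0 the one-parameter subgroup runs inside the torus. Polynomials are
  continuous, so those vanishing on the torus vanish at the limit as well, which puts it in the
  Zariski closure.\<close>

lemma limpt_V_var:
  assumes "intc w"
  shows "limpt w \<in> V_var G X"
proof -
  have w: "cocycle w" "\<forall>e\<in>Arr G. w e \<in> \<int>" using assms by (auto simp: intc_def)
  have lim: "(one_ps G X (wt w) \<longlongrightarrow> limpt w) (at 0)"
    using one_ps_limit_iff[OF w] assms unfolding one_ps_limit_def by simp
  have T: "one_ps G X (wt w) t \<in> T0" if t: "t \<noteq> 0" for t
  proof -
    have "one_ps G X (wt w) t = expo (\<lambda>e. Ln t * of_real (w e))"
      unfolding one_ps_def expo_def
    proof (rule restrict_ext)
      fix e assume e: "e \<in> Arr G"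
      obtain k where k: "w e = of_int k" using w(2) e by (auto elim: Ints_cases)
      have "exp (of_int k * Ln t) = exp (Ln t) powi k" by (rule exp_power_int[symmetric])
      then show "t powi \<lfloor>wt w (xbar G X e)\<rfloor> = exp (Ln t * of_real (w e))" using t by (simp add: wt_xbar[OF w(1) e] k mult.commute)
    qed
    then show ?thesis using expo_T0[OF cocycle_ops(4)[OF cocycle_of_real[OF w(1)]]] by simp
  qed
  show ?thesis unfolding V_var_eq Vc_def
  proof (intro CollectI conjI ballI impI)
    show "limpt w \<in> Arr G \<rightarrow>\<^sub>E UNIV" by (simp add: limpt_def)
    fix f assume f: "f \<in> poly_fns (Arr G)" "\<forall>x\<in>T0. f x = 0"
    have "\<forall>\<^sub>F t in at 0. f (one_ps G X (wt w) t) = 0"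
      unfolding eventually_at_filter using f(2) T by (intro always_eventually) auto
    then have "((\<lambda>t. f (one_ps G X (wt w) t)) \<longlongrightarrow> 0) (at 0)" by (rule tendsto_eventually)
    with poly_fns_tendsto[OF f(1) lim] show "f (limpt w) = 0" by (rule tendsto_unique[rotated]) simp
  qed
qed

definition Zb :: "('n gchar \<Rightarrow> complex^'n^'n \<Rightarrow> rat) \<Rightarrow> (real^'n) set \<Rightarrow> 'n arrow set" where
  "Zb b \<sigma> = {e\<in>Arr G. dist_point G X b \<sigma> e \<noteq> 1}"

text \<open>Each \<open>Z \<in> F\<close> is the set of arrows that may vanish on one of the charts.\<close>

definition Fan :: "'n arrow set set \<Rightarrow> 'n nvec set set" where
  "Fan F = {Cone (supp w) | w. intc w \<and> (\<exists>Z\<in>F. supp w \<subseteq> Z)}"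

lemma Sigma_tilde_eq: "Sigma_tilde G X b \<Sigma> = Fan (Zb b ` max_cones \<Sigma>)"
proof -
  have V: "limpt w \<in> V_Sigma G X b \<Sigma> \<longleftrightarrow> (\<exists>\<sigma>\<in>max_cones \<Sigma>. supp w \<subseteq> Zb b \<sigma>)" if "intc w" for w
  proof -
    have "limpt w \<in> V_chart G X b \<sigma> \<longleftrightarrow> supp w \<subseteq> Zb b \<sigma>" for \<sigma>
      unfolding V_chart_def using limpt_V_var[OF that] by (auto simp: limpt_def supp_def Zb_def)
    then show ?thesis unfolding V_Sigma_def by auto
  qed
  show ?thesis
  proof
    show "Sigma_tilde G X b \<Sigma> \<subseteq> Fan (Zb b ` max_cones \<Sigma>)"
    proof
      fix x assume "x \<in> Sigma_tilde G X b \<Sigma>"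
      then obtain p u where x: "x = orbit_cone G X (T_orbit G X p)" "u \<in> N_V G X" "p \<in> V_Sigma G X b \<Sigma>" "one_ps_limit G X u p"
        unfolding Sigma_tilde_def toric_fan_of_def by auto
      obtain w where w: "u = wt w" "cocycle w" "\<forall>e\<in>Arr G. w e \<in> \<int>" by (rule N_V_cases[OF x(2)])
      have i: "intc w" "p = limpt w" using x(4) one_ps_limit_iff[OF w(2,3)] w(1) by auto
      show "x \<in> Fan (Zb b ` max_cones \<Sigma>)"
        unfolding Fan_def using x(1,3) i V[OF i(1)] orbit_cone_eq(2)[OF i(1)] by auto
    qed
    show "Fan (Zb b ` max_cones \<Sigma>) \<subseteq> Sigma_tilde G X b \<Sigma>"
    proof
      fix x assume "x \<in> Fan (Zb b ` max_cones \<Sigma>)"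
      then obtain w where w: "x = Cone (supp w)" "intc w" "\<exists>\<sigma>\<in>max_cones \<Sigma>. supp w \<subseteq> Zb b \<sigma>" unfolding Fan_def by auto
      have co: "cocycle w" "\<forall>e\<in>Arr G. w e \<in> \<int>" using w by (auto simp: intc_def)
      have "one_ps_limit G X (wt w) (limpt w)" using one_ps_limit_iff[OF co] w by simp
      then show "x \<in> Sigma_tilde G X b \<Sigma>"
        unfolding Sigma_tilde_def toric_fan_of_def using orbit_cone_eq(2)[OF w(2)] w V[OF w(2)] intc_N_V[OF w(2)]
        by (intro CollectI exI[of _ "wt w"] exI[of _ "limpt w"]) auto
    qed
  qed
qed

text \<open>By Dickson's lemma there are finitely many nonzero integral cocycles such that one of
  them can be subtracted from any other. Descent spreads an inequality from these to all integral
  cocycles of the cone, and closure spreads it to the real ones.\<close>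

lemma cone_gens:
  assumes w0: "intc w0"
  shows "\<exists>\<Gamma>. finite \<Gamma> \<and> \<Gamma> \<subseteq> Cone (supp w0) \<and> (\<forall>u\<in>\<Gamma>. \<forall>m\<in>carrier MV. u m \<in> \<int>) \<and>
      (\<forall>m\<in>carrier MV. (\<forall>u\<in>\<Gamma>. 0 \<le> u m) \<longrightarrow> (\<forall>u\<in>Cone (supp w0). 0 \<le> u m))"
proof -
  define D where "D = {w. intc w \<and> supp w \<subseteq> supp w0 \<and> supp w \<noteq> {}}"
  obtain B where B: "B \<subseteq> D" "finite B" "\<forall>w\<in>D. \<exists>b\<in>B. \<forall>e\<in>Arr G. nat \<lfloor>b e\<rfloor> \<le> nat \<lfloor>w e\<rfloor>"
    using Dickson[OF finite_Arr, of D "\<lambda>w e. nat \<lfloor>w e\<rfloor>"] by auto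
  have Bi: "intc b \<and> supp b \<subseteq> supp w0 \<and> supp b \<noteq> {}" if "b \<in> B" for b using B(1) that by (auto simp: D_def)
  have fl: "real (nat \<lfloor>w e\<rfloor>) = w e" if "intc w" "e \<in> Arr G" for w e
    using that unfolding intc_def by (auto elim!: Ints_cases)
  have nonneg: "0 \<le> pair c w" if c: "\<forall>b\<in>B. 0 \<le> pair c b" and w: "intc w" "supp w \<subseteq> supp w0" for c w
    using w
  proof (induction "\<Sum>e\<in>Arr G. nat \<lfloor>w e\<rfloor>" arbitrary: w rule: less_induct)
    case less
    show ?case
    proof (cases "supp w = {}")
      case True
      then have "pair c w = 0" unfolding pair_def supp_def by (intro sum.neutral) auto
      then show ?thesis by simp
    next
      case False
      then have "w \<in> D" using less.prems by (simp add: D_def)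
      then obtain b where b: "b \<in> B" "\<forall>e\<in>Arr G. nat \<lfloor>b e\<rfloor> \<le> nat \<lfloor>w e\<rfloor>" using B(3) by auto
      note bi = Bi[OF b(1)]
      define w' where "w' = (\<lambda>e. w e - b e)"
      have le: "b e \<le> w e" if e: "e \<in> Arr G" for e
        using b(2) e fl[OF less.prems(1) e] fl[of b, OF _ e] bi by (metis of_nat_le_iff)
      have i: "intc w'" unfolding intc_def w'_def using less.prems(1) bi le
        by (auto simp: intc_def intro: cocycle_ops)
      have s: "supp w' \<subseteq> supp w0"
      proof
        fix e assume "e \<in> supp w'"
        then have "e \<in> supp w \<or> e \<in> supp b" by (auto simp: supp_def w'_def)
        then show "e \<in> supp w0" using bi less.prems(2) by auto
      qed
      have "nat \<lfloor>w' e\<rfloor> \<le> nat \<lfloor>w e\<rfloor>" if e: "e \<in> Arr G" for e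
        using bi e unfolding w'_def intc_def by (intro nat_mono floor_mono) auto
      moreover obtain e0 where e0: "e0 \<in> Arr G" "b e0 \<noteq> 0" using bi by (auto simp: supp_def)
      have "nat \<lfloor>w' e0\<rfloor> < nat \<lfloor>w e0\<rfloor>"
      proof -
        have "real (nat \<lfloor>w' e0\<rfloor>) < real (nat \<lfloor>w e0\<rfloor>)"
          using fl[OF i e0(1)] fl[OF less.prems(1) e0(1)] e0 bi by (auto simp: w'_def intc_def order_less_le)
        then show ?thesis by simp
      qed
      ultimately have "(\<Sum>e\<in>Arr G. nat \<lfloor>w' e\<rfloor>) < (\<Sum>e\<in>Arr G. nat \<lfloor>w e\<rfloor>)"
        using e0 by (intro sum_strict_mono_ex1[OF finite_Arr]) auto
      from less.hyps[OF this i s] have "0 \<le> pair c w'" .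
      then show ?thesis using c b(1) unfolding w'_def pair_right by fastforce
    qed
  qed
  have fin: "finite (wt ` B)" using B by simp
  have sub: "wt ` B \<subseteq> Cone (supp w0)" using Bi intc_realc by (auto simp: Cone_def)
  have int: "\<forall>u\<in>wt ` B. \<forall>m\<in>carrier MV. u m \<in> \<int>" using Bi intc_N_V by (auto simp: N_V_def)
  have dual: "\<forall>u\<in>Cone (supp w0). 0 \<le> u m" if m: "m \<in> carrier MV" and pos: "\<forall>u\<in>wt ` B. 0 \<le> u m" for m
  proof
    fix u assume u: "u \<in> Cone (supp w0)"
    obtain c where c: "m = lau c" using m by (rule MV_E)
    have pb: "\<forall>b\<in>B. 0 \<le> pair c b" using pos Bi c by (auto simp: wt_lau intc_def)
    have "closure {wt (\<lambda>e. c * w e) | c w. 0 \<le> c \<and> intc w \<and> supp w = supp w0} \<subseteq> {u. 0 \<le> u m}"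
    proof (rule closure_minimal)
      show "closed {u::'n nvec. 0 \<le> u m}" by (intro closed_Collect_le continuous_intros continuous_on_product_coordinates)
      show "{wt (\<lambda>e. c * w e) | c w. 0 \<le> c \<and> intc w \<and> supp w = supp w0} \<subseteq> {u. 0 \<le> u m}"
      proof
        fix x assume "x \<in> {wt (\<lambda>e. c * w e) | c w. 0 \<le> c \<and> intc w \<and> supp w = supp w0}"
        then obtain a w where w: "x = wt (\<lambda>e. a * w e)" "0 \<le> a" "intc w" "supp w = supp w0" by auto
        have "x m = a * pair c w" unfolding w(1) c using w(3) by (subst wt_lau) (auto simp: intc_def pair_right intro: cocycle_ops)
        then show "x \<in> {u. 0 \<le> u m}" using w nonneg[OF pb w(3)] by simp
      qed
    qed
    then show "0 \<le> u m" using u orbit_cone_eq[OF w0] by auto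
  qed
  show ?thesis by (intro exI[of _ "wt ` B"] conjI fin sub int ballI impI) (erule (1) dual[THEN bspec])
qed

text \<open>Supports of integral cocycles add up, so the face contains one, \<open>w\<close>, of
  largest support. By \<open>approx\<close> every arrow in the support of a real cocycle of the face
  occurs in an integral one of the face. Conversely, a cocycle supported in \<open>supp w\<close> is
  a summand of a multiple of \<open>w\<close>, so \<open>m\<close> vanishes on it.\<close>

lemma cone_face:
  assumes w0: "intc w0" and m: "m \<in> carrier MV" "\<forall>u\<in>Cone (supp w0). 0 \<le> u m"
  obtains w where "intc w" "supp w \<subseteq> supp w0" "{u\<in>Cone (supp w0). u m = 0} = Cone (supp w)"
proof -
  obtain c where c: "m = lau c" using m(1) by (rule MV_E)
  define D where "D = {w. intc w \<and> supp w \<subseteq> supp w0 \<and> pair c w = 0}"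
  have ex: "\<exists>w\<in>D. T \<subseteq> supp w" if "finite T" "T \<subseteq> \<Union>(supp ` D)" for T
    using that
  proof (induction T rule: finite_induct)
    case empty
    have "(\<lambda>e. 0) \<in> D" by (simp add: D_def intc_zero supp_zero pair_right)
    then show ?case by auto
  next
    case (insert e T)
    then obtain w where w: "w \<in> D" "T \<subseteq> supp w" by auto
    obtain w' where w': "w' \<in> D" "e \<in> supp w'" using insert.prems by auto
    have "(\<lambda>e. w e + w' e) \<in> D" using w w' by (simp add: D_def intc_add supp_add pair_right)
    moreover have "insert e T \<subseteq> supp (\<lambda>e. w e + w' e)" using w w' by (subst supp_add) (auto simp: D_def)
    ultimately show ?case by (intro bexI)
  qed
  have "finite (\<Union>(supp ` D))" by (rule finite_subset[OF _ finite_Arr]) (auto simp: supp_def)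
  from ex[OF this subset_refl] obtain w where w: "w \<in> D" "\<Union>(supp ` D) \<subseteq> supp w" by (rule bexE)
  have wi: "intc w" "supp w \<subseteq> supp w0" "pair c w = 0" using w by (auto simp: D_def)
  have pos: "0 \<le> pair c v" if "realc (supp w0) v" for v
    using m(2) that c wt_lau[of v c] unfolding Cone_def realc_def by auto
  have "{u\<in>Cone (supp w0). u m = 0} = Cone (supp w)"
  proof
    show "{u\<in>Cone (supp w0). u m = 0} \<subseteq> Cone (supp w)"
    proof
      fix u assume u: "u \<in> {u\<in>Cone (supp w0). u m = 0}"
      then obtain v where v: "u = wt v" "realc (supp w0) v" "cocycle v" by (auto elim: coneE)
      have vz: "pair c v = 0" using u v c by (simp add: wt_lau)
      have "supp v \<subseteq> supp w"
      proof
        fix e assume e: "e \<in> supp v"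
        then have ve: "e \<in> Arr G" "0 < v e" using v(2) by (auto simp: supp_def realc_def order_less_le)
        obtain k h where h: "(1::real) \<le> k" "intc h" "supp h \<subseteq> supp v" "pair c h = 0" "\<forall>e'\<in>Arr G. \<bar>k * v e' - h e'\<bar> < v e"
          by (rule approx[OF v(2) vz ve(2)])
        have "1 * v e \<le> k * v e" by (rule mult_right_mono[OF h(1)]) (use ve(2) in simp)
        moreover have "\<bar>k * v e - h e\<bar> < v e" by (rule bspec[OF h(5) ve(1)])
        ultimately have "h e \<noteq> 0" by auto
        then have "e \<in> supp h" using ve by (simp add: supp_def)
        moreover have "h \<in> D" using h v(2) by (auto simp: D_def realc_def)
        ultimately show "e \<in> supp w" using w by auto
      qed
      then show "u \<in> Cone (supp w)" using v by (auto simp: Cone_def realc_def)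
    qed
    show "Cone (supp w) \<subseteq> {u\<in>Cone (supp w0). u m = 0}"
    proof
      fix u assume "u \<in> Cone (supp w)"
      then obtain v where v: "u = wt v" "realc (supp w) v" "cocycle v" by (rule coneE)
      have v0: "realc (supp w0) v" using v(2) wi(2) by (auto simp: realc_def)
      \<comment> \<open>The values of \<open>w\<close> on its support are positive integers, so
        \<open>K\<close> times \<open>w\<close> dominates \<open>v\<close>.\<close>
      define K where "K = (\<Sum>e\<in>Arr G. v e)"
      have ve: "0 \<le> v e \<and> v e \<le> K" if "e \<in> Arr G" for e
        using v(2) that finite_Arr unfolding K_def by (auto simp: realc_def intro: member_le_sum)
      have K0: "0 \<le> K" unfolding K_def using ve by (intro sum_nonneg) auto
      have wc: "cocycle w" using wi by (simp add: intc_def)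
      have "realc (supp w0) (\<lambda>e. K * w e - v e)"
        unfolding realc_def
      proof (intro conjI ballI)
        show "cocycle (\<lambda>e. K * w e - v e)" using wc v(3) cocycle_ops(4)[OF wc, of K] by (intro cocycle_ops(2)) auto
        show "supp (\<lambda>e. K * w e - v e) \<subseteq> supp w0"
        proof
          fix e assume "e \<in> supp (\<lambda>e. K * w e - v e)"
          then have "e \<in> supp w \<or> e \<in> supp v" by (auto simp: supp_def)
          then show "e \<in> supp w0" using wi(2) v0 by (auto simp: realc_def)
        qed
        fix e assume e: "e \<in> Arr G"
        show "0 \<le> K * w e - v e"
        proof (cases "e \<in> supp w")
          case True
          have "w e \<in> \<int>" using wi(1) e by (simp add: intc_def)
          then obtain k where k: "w e = of_int k" by (rule Ints_cases)
          moreover have "0 < w e" using True wi(1) e by (auto simp: intc_def supp_def order_less_le)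
          ultimately have "1 \<le> w e" by simp
          then have "K * 1 \<le> K * w e" using K0 by (intro mult_left_mono) auto
          then show ?thesis using ve[OF e] by simp
        next
          case False
          then have "w e = 0" "v e = 0" using v(2) e by (auto simp: realc_def supp_def)
          then show ?thesis by simp
        qed
      qed
      from pos[OF this] have "pair c v \<le> 0" using wi(3) by (simp add: pair_right)
      then have "pair c v = 0" using pos[OF v0] by simp
      then show "u \<in> {u\<in>Cone (supp w0). u m = 0}" using v v0 c by (auto simp: Cone_def wt_lau)
    qed
  qed
  with wi show ?thesis by (intro that) auto
qed

text \<open>Lattice points spanning the dual space: by \<open>cocycle_cob\<close>, real cocycles are
  their combinations. They supply the embedding of M_V into a power of the integers that
  \<open>toric_setting\<close> requires.\<close>

definition KV :: "'n nvec set" where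
  "KV = (\<lambda>j. wt (cob (axis j 1) (\<lambda>_. 0))) ` UNIV \<union> (\<lambda>i. wt (cob 0 (\<lambda>i'. if i' = i then 1 else 0))) ` Irr G"

lemma KV_sep:
  assumes m: "m \<in> carrier MV" and z: "\<And>u. u \<in> KV \<Longrightarrow> u m = 0"
  shows "m = \<one>\<^bsub>MV\<^esub>"
proof -
  obtain c where c: "m = lau c" using m by (rule MV_E)
  have z1: "pair c (cob (axis j 1) (\<lambda>_. 0)) = 0" for j
    using z[of "wt (cob (axis j 1) (\<lambda>_. 0))"] by (simp add: KV_def c wt_lau[OF cob_cocycle])
  have z2: "pair c (cob 0 (\<lambda>i'. if i' = i then 1 else 0)) = 0" if "i \<in> Irr G" for i
    using z[of "wt (cob 0 (\<lambda>i'. if i' = i then 1 else 0))"] that by (simp add: KV_def c wt_lau[OF cob_cocycle])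
  have "lau c = lau (\<lambda>e. 0)"
    unfolding lau_eq_iff
  proof (intro allI impI)
    fix w :: "'n arrow \<Rightarrow> real" assume "cocycle w"
    then obtain y \<theta> where w: "\<forall>e\<in>Arr G. w e = cob y \<theta> e" by (rule cocycle_cob)
    have "pair c w = pair c (\<lambda>e. (\<Sum>j\<in>UNIV. y $ j * cob (axis j 1) (\<lambda>_. 0) e) + (\<Sum>i\<in>Irr G. \<theta> i * cob 0 (\<lambda>i'. if i' = i then 1 else 0) e))"
    proof (rule pair_cong)
      fix e assume e: "e \<in> Arr G"
      obtain i j where ij: "e = (i, j)" "i \<in> Irr G" "te i j \<in> Irr G" using e tens_Irr by (auto simp: Arr_def)
      have "(\<Sum>k\<in>UNIV. y $ k * cob (axis k 1) (\<lambda>_. 0) e) = (\<Sum>k\<in>UNIV. if k = j then y $ j else 0)"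
        by (rule sum.cong) (auto simp: cob_def ij(1) axis_def)
      moreover have "(\<Sum>k\<in>Irr G. \<theta> k * cob 0 (\<lambda>i'. if i' = k then 1 else 0) e) =
          (\<Sum>k\<in>Irr G. (if te i j = k then \<theta> (te i j) else 0) - (if i = k then \<theta> i else 0))"
        by (rule sum.cong) (auto simp: cob_def ij(1))
      moreover have "\<dots> = \<theta> (te i j) - \<theta> i" using ij finite_Irr by (simp add: sum_subtractf)
      ultimately show "w e = (\<Sum>j\<in>UNIV. y $ j * cob (axis j 1) (\<lambda>_. 0) e) + (\<Sum>i\<in>Irr G. \<theta> i * cob 0 (\<lambda>i'. if i' = i then 1 else 0) e)"
        using w e by (simp add: ij(1) cob_apply)
    qed
    also have "\<dots> = 0" using z2 by (simp add: pair_right pair_sum z1)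
    finally show "pair c w = pair (\<lambda>e. 0) w" by (simp add: pair_left)
  qed
  then show ?thesis by (simp add: c lau_one)
qed

lemma cone_sub_N: "Cone S \<subseteq> N_V_R G X" by (auto simp: cone_iff)

lemma N_V_R_mult: "u \<in> N_V_R G X \<Longrightarrow> m \<in> carrier MV \<Longrightarrow> m' \<in> carrier MV \<Longrightarrow> u (m \<otimes>\<^bsub>MV\<^esub> m') = u m + u m'"
  by (auto simp: N_V_R_def hom_def)

lemma cob_int: "wt (cob y \<theta>) \<in> N_V G X" if "\<forall>j. y $ j \<in> \<int>" "\<forall>i. \<theta> i \<in> \<int>"
  using that by (auto simp: N_V_wt_iff[OF cob_cocycle] cob_def)

lemma KV_N: "KV \<subseteq> N_V G X"
  unfolding KV_def using cob_int by (auto simp: axis_def)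

lemma Fan_E:
  assumes "\<sigma> \<in> Fan F"
  obtains w Z where "\<sigma> = Cone (supp w)" "intc w" "Z \<in> F" "supp w \<subseteq> Z"
  using assms unfolding Fan_def by blast

lemma Fan_I: "intc w \<Longrightarrow> Z \<in> F \<Longrightarrow> supp w \<subseteq> Z \<Longrightarrow> Cone (supp w) \<in> Fan F"
  unfolding Fan_def by blast

lemma finite_Fan: "finite (Fan F)"
proof -
  have "supp w \<in> Pow (Arr G)" for w by (auto simp: supp_def)
  then have "Fan F \<subseteq> Cone ` Pow (Arr G)" unfolding Fan_def by auto
  then show "finite (Fan F)" by (rule finite_subset) (simp add: finite_Arr)
qed

lemma Fan_face:
  assumes \<sigma>: "\<sigma> \<in> Fan F" and m: "m \<in> dual_semigroup MV (\<lambda>m w. w m) \<sigma>"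
  shows "{u\<in>\<sigma>. u m = 0} \<in> Fan F"
proof -
  obtain w0 Z where w0: "\<sigma> = Cone (supp w0)" "intc w0" "Z \<in> F" "supp w0 \<subseteq> Z" using \<sigma> by (rule Fan_E)
  have m': "m \<in> carrier MV" "\<forall>u\<in>Cone (supp w0). 0 \<le> u m" using m w0 by (auto simp: dual_semigroup_def)
  obtain w where w: "intc w" "supp w \<subseteq> supp w0" "{u\<in>Cone (supp w0). u m = 0} = Cone (supp w)"
    by (rule cone_face[OF w0(2) m'])
  have "Cone (supp w) \<in> Fan F" by (rule Fan_I[OF w(1) w0(3)]) (use w(2) w0(4) in auto)
  then show ?thesis unfolding w0(1) w(3) .
qed

lemma Fan_inter:
  assumes "\<sigma> \<in> Fan F" "\<sigma>' \<in> Fan F"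
  shows "\<exists>m\<in>dual_semigroup MV (\<lambda>m w. w m) \<sigma>. \<sigma> \<inter> \<sigma>' = {u\<in>\<sigma>. u m = 0}"
proof -
  obtain w0 where w0: "\<sigma> = Cone (supp w0)" "intc w0" using assms(1) by (rule Fan_E)
  obtain w1 where w1: "\<sigma>' = Cone (supp w1)" "intc w1" using assms(2) by (rule Fan_E)
  \<comment> \<open>The product of all coordinates outside \<open>supp w1\<close>. On nonnegative
    cocycles it pairs to zero exactly when the support lies in \<open>supp w1\<close>.\<close>
  define c where "c = (\<lambda>e. if e \<in> supp w1 then 0 else 1 :: int)"
  have val: "wt w (lau c) = (\<Sum>e\<in>Arr G - supp w1. w e)" if "cocycle w" for w
    unfolding wt_lau[OF that] pair_def
    by (rule sum.mono_neutral_cong_right[OF finite_Arr]) (auto simp: c_def)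
  show "\<exists>m\<in>dual_semigroup MV (\<lambda>m w. w m) \<sigma>. \<sigma> \<inter> \<sigma>' = {u\<in>\<sigma>. u m = 0}"
  proof
    show "lau c \<in> dual_semigroup MV (\<lambda>m w. w m) \<sigma>"
      unfolding dual_semigroup_def w0(1)
    proof (intro CollectI conjI lau_carrier ballI)
      fix u assume "u \<in> Cone (supp w0)"
      then obtain w where w: "u = wt w" "realc (supp w0) w" "cocycle w" by (rule coneE)
      have "0 \<le> (\<Sum>e\<in>Arr G - supp w1. w e)" using w(2) by (intro sum_nonneg) (auto simp: realc_def)
      then show "0 \<le> u (lau c)" using val[OF w(3)] w(1) by simp
    qed
    show "\<sigma> \<inter> \<sigma>' = {u\<in>\<sigma>. u (lau c) = 0}"
    proof -
      have "u \<in> Cone (supp w1) \<longleftrightarrow> u (lau c) = 0" if u: "u \<in> Cone (supp w0)" for u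
      proof -
        obtain w where w: "u = wt w" "realc (supp w0) w" "cocycle w" using u by (rule coneE)
        have "(\<Sum>e\<in>Arr G - supp w1. w e) = 0 \<longleftrightarrow> (\<forall>e\<in>Arr G - supp w1. w e = 0)"
          using w(2) finite_Arr by (intro sum_nonneg_eq_0_iff) (auto simp: realc_def)
        also have "\<dots> \<longleftrightarrow> realc (supp w1) w" using w(2) by (auto simp: realc_def supp_def)
        finally show ?thesis using val[OF w(3)] cone_wt[OF w(3)] w(1) by simp
      qed
      then show ?thesis using w0(1) w1(1) by auto
    qed
  qed
qed

lemma toric_Fan: "toric_setting MV (\<lambda>m w. w m) (Fan F) KV"
  apply (rule toric_setting.intro)
  subgoal by (rule comm_group_MV)
  subgoal by (rule finite_Fan)
  subgoal for m m' u
  proof -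
    assume m: "m \<in> carrier MV" "m' \<in> carrier MV" and u: "u \<in> \<Union>(Fan F) \<union> KV"
    have "\<Union>(Fan F) \<union> KV \<subseteq> N_V_R G X"
      using KV_N cone_sub_N unfolding Fan_def N_V_def by auto
    then show "u (m \<otimes>\<^bsub>MV\<^esub> m') = u m + u m'" using N_V_R_mult[OF _ m] u by auto
  qed
  subgoal unfolding KV_def using finite_Irr by simp
  subgoal for m u using KV_N by (auto simp: N_V_def)
  subgoal by (rule KV_sep)
  subgoal for \<sigma> using cone_gens by (auto elim!: Fan_E)
  subgoal by (rule Fan_face)
  subgoal by (rule Fan_inter)
  done

end

section \<open>Extension of characters\<close>

lemma powi_char:
  assumes add: "\<And>k l::int. \<phi> (k + l) = \<phi> k * \<phi> l" and nz: "\<And>k. \<phi> k \<noteq> (0::complex)"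
  shows "\<phi> k = \<phi> 1 powi k"
proof -
  have z: "\<phi> 0 = 1" using add[of 0 0] nz[of 0] by simp
  show ?thesis
  proof (induction k rule: int_induct[where k=0])
    case base
    then show ?case using z by simp
  next
    case (step1 i)
    then show ?case using nz[of 1] by (simp add: add power_int_add_1)
  next
    case (step2 i)
    have "\<phi> i = \<phi> (i - 1) * \<phi> 1" using add[of "i - 1" 1] by simp
    then show ?case using step2 nz[of 1] power_int_minus_mult[of "\<phi> 1" i]
      by (simp add: power_int_diff)
  qed
qed

lemma Cstar_hom:
  "\<gamma> \<in> hom (M\<lparr>carrier := A\<rparr>) Cstar \<longleftrightarrow> (\<forall>a\<in>A. \<gamma> a \<noteq> 0) \<and> (\<forall>a\<in>A. \<forall>b\<in>A. \<gamma> (a \<otimes>\<^bsub>M\<^esub> b) = \<gamma> a * \<gamma> b)"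
  by (auto simp: hom_def Cstar_def)

context comm_group
begin

context
  fixes A \<gamma> b assumes A: "subgroup A G" and \<gamma>: "\<gamma> \<in> hom (G\<lparr>carrier := A\<rparr>) Cstar" and b: "b \<in> carrier G"
begin

lemma \<gamma>_nz: "a \<in> A \<Longrightarrow> \<gamma> a \<noteq> 0" using \<gamma> by (simp add: Cstar_hom)
lemma \<gamma>_mult: "a \<in> A \<Longrightarrow> a' \<in> A \<Longrightarrow> \<gamma> (a \<otimes> a') = \<gamma> a * \<gamma> a'" using \<gamma> by (simp add: Cstar_hom)

text \<open>If some positive power of \<open>b\<close> lies in \<open>A\<close>, the least such
  exponent \<open>d\<close> divides all others, and a d-th root of the value there serves as
  \<open>z\<close>. Otherwise only the zeroth power is constrained.\<close>

lemma power_root: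
  obtains z where "z \<noteq> 0" "\<forall>k::int. b [^] k \<in> A \<longrightarrow> \<gamma> (b [^] k) = z powi k"
proof (cases "\<exists>d::nat. 0 < d \<and> b [^] int d \<in> A")
  case False
  have k0: "k = 0" if "b [^] k \<in> A" for k :: int
  proof (rule ccontr)
    assume k: "k \<noteq> 0"
    have "b [^] (- k) \<in> A" using subgroup.m_inv_closed[OF A that] b by (simp add: int_pow_neg)
    then have "b [^] \<bar>k\<bar> \<in> A" using that by (cases "0 \<le> k") auto
    then show False using False k by (metis int_nat_eq abs_ge_zero nat_0_iff neq0_conv zero_less_abs_iff linorder_not_less)
  qed
  have g1: "\<gamma> \<one> = 1" using \<gamma>_mult[of \<one> \<one>] \<gamma>_nz[of \<one>] subgroup.one_closed[OF A] by simp
  show ?thesis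
  proof (rule that[of 1])
    show "\<forall>k::int. b [^] k \<in> A \<longrightarrow> \<gamma> (b [^] k) = 1 powi k"
    proof (intro allI impI)
      fix k :: int assume "b [^] k \<in> A"
      then have "k = 0" by (rule k0)
      then show "\<gamma> (b [^] k) = 1 powi k" using g1 by simp
    qed
  qed simp
next
  case True
  define d where "d = (LEAST d::nat. 0 < d \<and> b [^] int d \<in> A)"
  have d: "0 < d" "b [^] int d \<in> A" using LeastI_ex[OF True] by (auto simp: d_def)
  have least: "\<not> (0 < e \<and> b [^] int e \<in> A)" if "e < d" for e using not_less_Least that unfolding d_def by blast
  have mem: "b [^] (int d * k) \<in> A" for k
  proof -
    have "(b [^] int d) [^] k \<in> A" using group.int_pow_closed[OF subgroup.subgroup_is_group[OF A is_group], of "b [^] int d" k] d(2)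
      int_pow_consistent[OF A d(2)] by simp
    then show ?thesis using b by (simp add: int_pow_pow)
  qed
  define \<phi> where "\<phi> k = \<gamma> (b [^] (int d * k))" for k
  have \<phi>: "\<phi> k = \<phi> 1 powi k" for k
    by (rule powi_char) (auto simp: \<phi>_def \<gamma>_nz[OF mem] \<gamma>_mult[OF mem mem, symmetric] distrib_left int_pow_mult b)
  define z where "z = exp (Ln (\<phi> 1) / of_nat d)"
  have \<phi>1: "\<phi> 1 \<noteq> 0" unfolding \<phi>_def by (rule \<gamma>_nz[OF mem])
  have zd: "z ^ d = \<phi> 1" using \<phi>1 d by (simp add: z_def exp_of_nat_mult[symmetric])
  have "\<gamma> (b [^] k) = z powi k" if k: "b [^] k \<in> A" for k :: int
  proof -
    have "b [^] (k mod int d) = b [^] k \<otimes> b [^] (int d * (- (k div int d)))"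
      using b by (simp add: int_pow_mult[symmetric] minus_mult_div_eq_mod)
    then have "b [^] int (nat (k mod int d)) \<in> A" using subgroup.m_closed[OF A k mem[of "- (k div int d)"]] d by simp
    moreover have "nat (k mod int d) < d" using d by (simp add: nat_less_iff)
    note least[OF this]
    ultimately have "nat (k mod int d) = 0" by (simp only: neq0_conv[symmetric] simp_thms)
    moreover have "0 \<le> k mod int d" using d by simp
    ultimately have "k mod int d = 0" by linarith
    then have kd: "k = int d * (k div int d)" by (metis mult_div_mod_eq add_0_right)
    have "\<gamma> (b [^] k) = \<phi> (k div int d)" unfolding \<phi>_def using kd by simp
    also have "\<dots> = z powi k" by (subst \<phi>, subst kd) (simp add: power_int_mult zd)
    finally show ?thesis .
  qed
  then show ?thesis by (intro that[of z]) (auto simp: z_def)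
qed

lemma hom_extend_one:
  obtains A' \<gamma>' where "subgroup A' G" "A \<subseteq> A'" "b \<in> A'" "\<gamma>' \<in> hom (G\<lparr>carrier := A'\<rparr>) Cstar" "\<forall>a\<in>A. \<gamma>' a = \<gamma> a"
proof -
  obtain z where z: "z \<noteq> 0" "\<forall>k::int. b [^] k \<in> A \<longrightarrow> \<gamma> (b [^] k) = z powi k" by (rule power_root)
  have Ac: "a \<in> carrier G" if "a \<in> A" for a using subgroup.mem_carrier[OF A that] .
  have wd: "\<gamma> a * z powi k = \<gamma> a' * z powi l" if a: "a \<in> A" "a' \<in> A" and e: "a \<otimes> b [^] k = a' \<otimes> b [^] l" for a a' and k l :: int
  proof -
    have "a \<otimes> (b [^] (k - l) \<otimes> b [^] l) = a' \<otimes> b [^] l" using e b by (simp add: int_pow_mult[symmetric])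
    then have "(a \<otimes> b [^] (k - l)) \<otimes> b [^] l = a' \<otimes> b [^] l" using Ac a b by (simp add: m_assoc)
    then have e': "a \<otimes> b [^] (k - l) = a'" using Ac a b by (subst (asm) right_cancel) auto
    then have "b [^] (k - l) = inv a \<otimes> a'" using Ac a b by (metis inv_solve_left int_pow_closed)
    then have m: "b [^] (k - l) \<in> A" using subgroup.m_closed[OF A subgroup.m_inv_closed[OF A a(1)] a(2)] by simp
    have "\<gamma> a' = \<gamma> a * z powi (k - l)" using e' \<gamma>_mult[OF a(1) m] z(2) m by simp
    then show ?thesis using z(1) by (simp add: power_int_diff)
  qed
  define A' where "A' = {a \<otimes> b [^] k | a (k::int). a \<in> A}"
  define \<gamma>' where "\<gamma>' x = (THE y. \<exists>a\<in>A. \<exists>k::int. x = a \<otimes> b [^] k \<and> y = \<gamma> a * z powi k)" for x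
  have val: "\<gamma>' (a \<otimes> b [^] k) = \<gamma> a * z powi k" if a: "a \<in> A" for a and k :: int
    unfolding \<gamma>'_def
  proof (rule the_equality)
    show "\<exists>a'\<in>A. \<exists>l::int. a \<otimes> b [^] k = a' \<otimes> b [^] l \<and> \<gamma> a * z powi k = \<gamma> a' * z powi l" using a by blast
    fix y assume "\<exists>a'\<in>A. \<exists>l::int. a \<otimes> b [^] k = a' \<otimes> b [^] l \<and> y = \<gamma> a' * z powi l"
    then obtain a' l where l: "a' \<in> A" "a \<otimes> b [^] k = a' \<otimes> b [^] (l::int)" "y = \<gamma> a' * z powi l" by blast
    show "y = \<gamma> a * z powi k" using wd[OF a l(1,2)] l(3) by simp
  qed
  have prod: "(a \<otimes> b [^] k) \<otimes> (a' \<otimes> b [^] l) = (a \<otimes> a') \<otimes> b [^] (k + l)" if "a \<in> A" "a' \<in> A" for a a' and k l :: int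
    using Ac that b by (simp add: int_pow_mult m_ac)
  have "subgroup A' G"
  proof (rule subgroupI)
    show "A' \<subseteq> carrier G" using Ac b by (auto simp: A'_def)
    show "A' \<noteq> {}" using subgroup.one_closed[OF A] by (auto simp: A'_def)
  next
    fix x assume "x \<in> A'"
    then obtain a k where x: "x = a \<otimes> b [^] (k::int)" "a \<in> A" by (auto simp: A'_def)
    have "inv x = inv a \<otimes> b [^] (- k)" using Ac[OF x(2)] b x(1) by (simp add: inv_mult int_pow_neg)
    then show "inv x \<in> A'" unfolding A'_def using subgroup.m_inv_closed[OF A x(2)] by blast
  next
    fix x y assume "x \<in> A'" "y \<in> A'"
    then obtain a k a' l where x: "x = a \<otimes> b [^] (k::int)" "a \<in> A" "y = a' \<otimes> b [^] (l::int)" "a' \<in> A" unfolding A'_def by blast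
    show "x \<otimes> y \<in> A'" unfolding A'_def using prod[OF x(2,4), of k l] x subgroup.m_closed[OF A x(2,4)] by blast
  qed
  moreover have "A \<subseteq> A'"
  proof
    fix a assume a: "a \<in> A"
    then have "a = a \<otimes> b [^] (0::int)" using Ac by simp
    then show "a \<in> A'" unfolding A'_def using a by blast
  qed
  moreover have "b \<in> A'"
  proof -
    have "b = \<one> \<otimes> b [^] (1::int)" using b by (simp add: int_pow_1)
    then show ?thesis unfolding A'_def using subgroup.one_closed[OF A] by blast
  qed
  moreover have "\<gamma>' \<in> hom (G\<lparr>carrier := A'\<rparr>) Cstar"
    unfolding Cstar_hom
  proof (intro conjI ballI)
    fix x assume "x \<in> A'"
    then obtain a k where x: "x = a \<otimes> b [^] (k::int)" "a \<in> A" by (auto simp: A'_def)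
    then show "\<gamma>' x \<noteq> 0" using val \<gamma>_nz z(1) by simp
    fix y assume "y \<in> A'"
    then obtain a' l where y: "y = a' \<otimes> b [^] (l::int)" "a' \<in> A" by (auto simp: A'_def)
    show "\<gamma>' (x \<otimes> y) = \<gamma>' x * \<gamma>' y"
      using x y z(1) subgroup.m_closed[OF A x(2) y(2)] by (simp add: prod val \<gamma>_mult power_int_add)
  qed
  moreover have "\<forall>a\<in>A. \<gamma>' a = \<gamma> a"
  proof
    fix a assume a: "a \<in> A"
    show "\<gamma>' a = \<gamma> a" using val[OF a, of 0] Ac[OF a] by simp
  qed
  ultimately show thesis by (rule that)
qed

end

text \<open>The nonzero complex numbers form a divisible group, so characters extend; with finitely
  many generators to adjoin, induction takes the place of Zorn's lemma.\<close>

lemma hom_extend: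
  assumes "subgroup A G" "\<gamma> \<in> hom (G\<lparr>carrier := A\<rparr>) Cstar" "finite B" "B \<subseteq> carrier G"
    and gen: "\<And>A'. subgroup A' G \<Longrightarrow> B \<subseteq> A' \<Longrightarrow> A' = carrier G"
  obtains \<gamma>' where "\<gamma>' \<in> hom G Cstar" "\<forall>a\<in>A. \<gamma>' a = \<gamma> a"
proof -
  have "\<exists>A' \<gamma>'. subgroup A' G \<and> A \<subseteq> A' \<and> B' \<subseteq> A' \<and> \<gamma>' \<in> hom (G\<lparr>carrier := A'\<rparr>) Cstar \<and> (\<forall>a\<in>A. \<gamma>' a = \<gamma> a)"
    if "finite B'" "B' \<subseteq> carrier G" for B'
    using that
  proof (induction B' rule: finite_induct)
    case empty
    show ?case by (intro exI[of _ A] exI[of _ \<gamma>]) (use assms(1,2) in auto)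
  next
    case (insert x B')
    then obtain A' \<gamma>' where A': "subgroup A' G" "A \<subseteq> A'" "B' \<subseteq> A'" "\<gamma>' \<in> hom (G\<lparr>carrier := A'\<rparr>) Cstar" "\<forall>a\<in>A. \<gamma>' a = \<gamma> a"
      by auto
    have x: "x \<in> carrier G" using insert.prems by simp
    obtain A2 \<gamma>2 where "subgroup A2 G" "A' \<subseteq> A2" "x \<in> A2" "\<gamma>2 \<in> hom (G\<lparr>carrier := A2\<rparr>) Cstar" "\<forall>a\<in>A'. \<gamma>2 a = \<gamma>' a"
      by (rule hom_extend_one[OF A'(1,4) x])
    then show ?case using A' by (intro exI[of _ A2] exI[of _ \<gamma>2]) auto
  qed
  from this[OF assms(3,4)] obtain A' \<gamma>' where A': "subgroup A' G" "B \<subseteq> A'" "\<gamma>' \<in> hom (G\<lparr>carrier := A'\<rparr>) Cstar" "\<forall>a\<in>A. \<gamma>' a = \<gamma> a"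
    by (elim exE conjE)
  have "A' = carrier G" by (rule gen[OF A'(1,2)])
  then show thesis using A'(3,4) by (intro that[of \<gamma>']) auto
qed

end

context mckay
begin

sublocale MV: comm_group MV by (rule comm_group_MV)

lemma MV_generated:
  assumes A: "subgroup A MV" and x: "(\<lambda>e. lau (dlt e)) ` Arr G \<subseteq> A"
  shows "A = carrier MV"
proof
  show "A \<subseteq> carrier MV" by (rule subgroup.subset[OF A])
  have z: "lau (\<lambda>e. 0) \<in> A" using subgroup.one_closed[OF A] by (simp add: lau_one)
  have add: "lau (\<lambda>e. c e + c' e) \<in> A" if "lau c \<in> A" "lau c' \<in> A" for c c'
    using subgroup.m_closed[OF A that] by (simp add: lau_mult)
  have neg: "lau (\<lambda>e. - c e) \<in> A" if "lau c \<in> A" for c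
  proof -
    have "inv\<^bsub>MV\<^esub> (lau c) = lau (\<lambda>e. - c e)"
      by (rule MV.inv_equality) (simp_all add: lau_mult lau_one lau_carrier)
    then show ?thesis using subgroup.m_inv_closed[OF A that] by simp
  qed
  have scale: "lau (\<lambda>e. k * c e) \<in> A" if c: "lau c \<in> A" for k :: int and c
  proof (induction k rule: int_induct[where k=0])
    case (step1 i)
    then show ?case using add[OF step1(2) c] by (simp add: distrib_right)
  next
    case (step2 i)
    then show ?case using add[OF step2(2) neg[OF c]] by (simp add: left_diff_distrib)
  qed (simp add: z)
  have "lau c \<in> A" for c
  proof -
    have "lau (\<lambda>e. if e \<in> B then c e else 0) \<in> A" if "finite B" "B \<subseteq> Arr G" for B
      using that
    proof (induction B rule: finite_induct)
      case (insert a B)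
      have a: "lau (dlt a) \<in> A" using x insert.prems by auto
      have "lau (\<lambda>e. if e \<in> insert a B then c e else 0) = lau (\<lambda>e. c a * dlt a e + (if e \<in> B then c e else 0))"
        by (rule lau_cong) (use insert.hyps in \<open>auto simp: dlt_def\<close>)
      then show ?case using insert add[OF scale[OF a]] by simp
    qed (simp add: z)
    from this[OF finite_Arr subset_refl] have "lau (\<lambda>e. if e \<in> Arr G then c e else 0) \<in> A" .
    moreover have "lau (\<lambda>e. if e \<in> Arr G then c e else 0) = lau c" by (rule lau_cong) simp
    ultimately show ?thesis by simp
  qed
  then show "carrier MV \<subseteq> A" by (auto simp: carrier_MV)
qed

lemma lau_nz:
  assumes p: "p \<in> T0"
  shows "lau c p \<noteq> 0"
proof -
  obtain w where "cocycle w" "p = expo w" by (rule T0_expo[OF p])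
  then show ?thesis by (simp add: lau_expo)
qed

lemma eval_hom: "p \<in> T0 \<Longrightarrow> (\<lambda>m. m p) \<in> hom MV Cstar"
  by (auto simp: hom_def Cstar_def carrier_MV lau_nz MV_mult)

lemma hol_lau: "\<exists>E. hol E \<and> (\<forall>p\<in>T0. E p = lau c p)"
  by (intro exI[of _ "\<lambda>p. \<Prod>e\<in>Arr G. p e powi c e"] conjI hol_prod hol_powi) (auto simp: lau_apply)

lemma hol_lau_sum:
  assumes "finite A" "A \<subseteq> carrier MV"
  obtains E where "hol E" "\<forall>p\<in>T0. E p = (\<Sum>m\<in>A. c m * m p)"
proof -
  have "\<forall>m. \<exists>E. m \<in> A \<longrightarrow> hol E \<and> (\<forall>p\<in>T0. E p = m p)"
  proof
    fix m
    show "\<exists>E. m \<in> A \<longrightarrow> hol E \<and> (\<forall>p\<in>T0. E p = m p)"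
    proof (cases "m \<in> A")
      case True
      then have "m \<in> carrier MV" using assms(2) by auto
      then obtain a where "m = lau a" by (rule MV_E)
      then show ?thesis using hol_lau[of a] by simp
    qed simp
  qed
  then obtain E where E: "\<forall>m. m \<in> A \<longrightarrow> hol (E m) \<and> (\<forall>p\<in>T0. E m p = m p)" by (rule choice[THEN exE])
  show thesis
  proof (rule that[of "\<lambda>p. \<Sum>m\<in>A. c m * E m p"])
    show "hol (\<lambda>p. \<Sum>m\<in>A. c m * E m p)" using E by (intro hol_sum hol_mult hol_const) auto
    show "\<forall>p\<in>T0. (\<Sum>m\<in>A. c m * E m p) = (\<Sum>m\<in>A. c m * m p)" using E by (intro ballI sum.cong) auto
  qed
qed

lemma T_bar_mult:
  assumes "s \<in> T_bar G X" "t \<in> T_bar G X"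
  shows "tmult G s t \<in> T_bar G X"
proof -
  obtain a where a: "s = (\<lambda>(i, j)\<in>Arr G. inverse (a i) * a (te i j))" "\<forall>i\<in>Irr G. a i \<noteq> 0" using assms(1) by (auto simp: T_bar_def)
  obtain b where b: "t = (\<lambda>(i, j)\<in>Arr G. inverse (b i) * b (te i j))" "\<forall>i\<in>Irr G. b i \<noteq> 0" using assms(2) by (auto simp: T_bar_def)
  show ?thesis unfolding T_bar_def
    by (intro CollectI exI[of _ "\<lambda>i. a i * b i"] conjI) (use a(2) b(2) in \<open>auto simp: tmult_def a(1) b(1) intro!: restrict_ext\<close>)
qed

lemma T_bar_one: "(\<lambda>e\<in>Arr G. 1) \<in> T_bar G X"
  unfolding T_bar_def by (intro CollectI exI[of _ "\<lambda>i. 1"] conjI) (auto intro!: restrict_ext)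

lemma lau_at_one: "lau c (\<lambda>e\<in>Arr G. 1) = 1"
  by (simp add: lau_apply[OF T0_one])

lemma MG_E:
  assumes "f \<in> carrier (M_G G X)"
  obtains x where "f = rvec x" "cl x = cl 0"
  using assms M_G_carrier by auto

lemma q_G_pair:
  assumes u: "u \<in> N_V_R G X" and f: "f \<in> carrier (M_G G X)"
  shows "f \<bullet> q_G G X u = u (M_G_to_M_V G X f)"
proof -
  obtain x where x: "f = rvec x" "cl x = cl 0" using f by (rule MG_E)
  obtain c where c: "M_G_to_M_V G X (rvec x) = lau c" "\<forall>y \<theta>. pair c (cob y \<theta>) = rvec x \<bullet> y"
    by (rule M_G_to_M_V_eq[OF x(2)])
  let ?w = "\<lambda>e. u (xbar G X e)"
  note w = N_V_R_wt[OF u]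
  obtain y \<theta> where y: "\<forall>e\<in>Arr G. ?w e = cob y \<theta> e" by (rule cocycle_cob[OF w(1)])
  have uw: "u = wt (cob y \<theta>)" by (subst w(2)) (rule wt_cong, use y in simp)
  have "q_G G X u = y" by (subst uw) (rule q_G_wt, rule refl)
  moreover have "u (lau c) = rvec x \<bullet> y" by (subst uw) (simp add: wt_lau[OF cob_cocycle] c)
  ultimately show ?thesis using x c(1) by simp
qed

lemma \<iota>_closed: "f \<in> carrier (M_G G X) \<Longrightarrow> M_G_to_M_V G X f \<in> carrier MV"
  by (elim MG_E M_G_to_M_V_eq) (auto simp: lau_carrier)

lemma \<iota>_mult:
  assumes "f \<in> carrier (M_G G X)" "f' \<in> carrier (M_G G X)"
  shows "M_G_to_M_V G X (f + f') = M_G_to_M_V G X f \<otimes>\<^bsub>MV\<^esub> M_G_to_M_V G X f'"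
proof -
  obtain x where x: "f = rvec x" "cl x = cl 0" using assms(1) by (rule MG_E)
  obtain x' where x': "f' = rvec x'" "cl x' = cl 0" using assms(2) by (rule MG_E)
  have xx: "cl (x + x') = cl 0" using cl_shift[OF x'(2), of x] x by simp
  obtain c where c: "M_G_to_M_V G X (rvec x) = lau c" "\<forall>y \<theta>. pair c (cob y \<theta>) = rvec x \<bullet> y"
    by (rule M_G_to_M_V_eq[OF x(2)])
  obtain c' where c': "M_G_to_M_V G X (rvec x') = lau c'" "\<forall>y \<theta>. pair c' (cob y \<theta>) = rvec x' \<bullet> y"
    by (rule M_G_to_M_V_eq[OF x'(2)])
  obtain d where d: "M_G_to_M_V G X (rvec (x + x')) = lau d" "\<forall>y \<theta>. pair d (cob y \<theta>) = rvec (x + x') \<bullet> y"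
    by (rule M_G_to_M_V_eq[OF xx])
  have "lau d = lau (\<lambda>e. c e + c' e)"
    unfolding lau_eq_iff
  proof (intro allI impI)
    fix w :: "'n arrow \<Rightarrow> real" assume "cocycle w"
    then obtain y \<theta> where "\<forall>e\<in>Arr G. w e = cob y \<theta> e" by (rule cocycle_cob)
    then have "pair a w = pair a (cob y \<theta>)" for a by (intro pair_cong) simp
    then show "pair d w = pair (\<lambda>e. c e + c' e) w" by (simp add: pair_left c(2) c'(2) d(2) rvec_add inner_add_left)
  qed
  then show ?thesis using c(1) c'(1) d(1) x x' by (simp add: lau_mult rvec_add)
qed

lemma \<iota>_inj:
  assumes "f \<in> carrier (M_G G X)" "f' \<in> carrier (M_G G X)" "M_G_to_M_V G X f = M_G_to_M_V G X f'"
  shows "f = f'"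
proof -
  have "f \<bullet> y = f' \<bullet> y" for y
    using q_G_pair[OF wt_N_V_R[OF cob_cocycle[of y "\<lambda>_. 0"]] assms(1)]
      q_G_pair[OF wt_N_V_R[OF cob_cocycle[of y "\<lambda>_. 0"]] assms(2)] q_G_wt[of "cob y (\<lambda>_. 0)" y "\<lambda>_. 0"] assms(3) by simp
  then show ?thesis by (metis vector_eq_rdot)
qed

lemma \<iota>_eval:
  assumes "f \<in> carrier (M_G G X)" "s \<in> T_bar G X"
  shows "M_G_to_M_V G X f s = 1"
proof -
  obtain x where x: "f = rvec x" "cl x = cl 0" using assms(1) by (rule MG_E)
  obtain c where "M_G_to_M_V G X (rvec x) = lau c" "lau c \<in> M_V_inv G X"
    by (rule M_G_to_M_V_eq[OF x(2)])
  then show ?thesis using assms(2) x by (simp add: M_V_inv_iff)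
qed

lemma comm_group_MG: "comm_group (M_G G X)"
proof (rule comm_groupI)
  fix x assume x: "x \<in> carrier (M_G G X)"
  then have "- x \<in> carrier (M_G G X)" by (simp add: M_G_def)
  then show "\<exists>y\<in>carrier (M_G G X). y \<otimes>\<^bsub>M_G G X\<^esub> x = \<one>\<^bsub>M_G G X\<^esub>" by (intro bexI[of _ "- x"]) (simp_all add: M_G_def)
qed (auto simp: M_G_def inner_add_left)



text \<open>Since M_G embeds into M_V, a character of \<open>P\<close> can be read as one of the
  image of \<open>P\<close> and then extended.\<close>

lemma lift_char:
  assumes sub: "subgroup P (M_G G X)" and \<gamma>: "\<gamma> \<in> hom ((M_G G X)\<lparr>carrier := P\<rparr>) Cstar"
  obtains \<gamma>' where "\<gamma>' \<in> hom MV Cstar" "\<forall>f\<in>P. \<gamma>' (M_G_to_M_V G X f) = \<gamma> f"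
proof -
  interpret MG: comm_group "M_G G X" by (rule comm_group_MG)
  let ?\<iota> = "M_G_to_M_V G X"
  have Pc: "f \<in> carrier (M_G G X)" if "f \<in> P" for f using subgroup.mem_carrier[OF sub that] .
  have inj: "inj_on ?\<iota> P" by (rule inj_onI) (use \<iota>_inj Pc in blast)
  have mult: "?\<iota> (f \<otimes>\<^bsub>M_G G X\<^esub> f') = ?\<iota> f \<otimes>\<^bsub>MV\<^esub> ?\<iota> f'" if "f \<in> carrier (M_G G X)" "f' \<in> carrier (M_G G X)" for f f'
    using \<iota>_mult[OF that] by (simp add: M_G_def)
  have "group_hom (M_G G X) MV ?\<iota>"
    by (intro group_hom.intro group_hom_axioms.intro MG.is_group MV.is_group) (auto simp: hom_def \<iota>_closed mult)
  then have A: "subgroup (?\<iota> ` P) MV" by (rule group_hom.subgroup_img_is_subgroup[OF _ sub])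
  have \<gamma>0: "(\<lambda>m. \<gamma> (inv_into P ?\<iota> m)) \<in> hom (MV\<lparr>carrier := ?\<iota> ` P\<rparr>) Cstar"
    unfolding Cstar_hom
  proof (intro conjI ballI)
    fix a assume "a \<in> ?\<iota> ` P"
    then obtain f where f: "a = ?\<iota> f" "f \<in> P" by auto
    have v: "inv_into P ?\<iota> a = f" using inj f by simp
    show "\<gamma> (inv_into P ?\<iota> a) \<noteq> 0" using \<gamma> f(2) unfolding v by (simp add: Cstar_hom)
    fix b assume "b \<in> ?\<iota> ` P"
    then obtain h where h: "b = ?\<iota> h" "h \<in> P" by auto
    have v': "inv_into P ?\<iota> b = h" using inj h by simp
    have "a \<otimes>\<^bsub>MV\<^esub> b = ?\<iota> (f \<otimes>\<^bsub>M_G G X\<^esub> h)" using mult f h Pc by simp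
    then have "inv_into P ?\<iota> (a \<otimes>\<^bsub>MV\<^esub> b) = f \<otimes>\<^bsub>M_G G X\<^esub> h"
      using inv_into_f_f[OF inj subgroup.m_closed[OF sub f(2) h(2)]] by simp
    then show "\<gamma> (inv_into P ?\<iota> (a \<otimes>\<^bsub>MV\<^esub> b)) = \<gamma> (inv_into P ?\<iota> a) * \<gamma> (inv_into P ?\<iota> b)"
      unfolding v v' using \<gamma> f(2) h(2) by (simp add: Cstar_hom)
  qed
  obtain \<gamma>' where "\<gamma>' \<in> hom MV Cstar" "\<forall>a\<in>?\<iota> ` P. \<gamma>' a = \<gamma> (inv_into P ?\<iota> a)"
    by (rule MV.hom_extend[OF A \<gamma>0, of "(\<lambda>e. lau (dlt e)) ` Arr G"])
       (use finite_Arr lau_carrier MV_generated in auto)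
  then show thesis using inj by (intro that[of \<gamma>']) auto
qed

end

section \<open>Iterated star subdivisions of the orthant\<close>

definition axes :: "(real^'n) set" where "axes = range (\<lambda>j. axis j 1)"

lemma axis_inj: "inj (\<lambda>j. axis j (1::real))" by (auto simp: inj_on_def axis_eq_axis)

lemma finite_axes: "finite axes" by (simp add: axes_def)

lemma card_axes: "card (axes :: (real^'n) set) = CARD('n)"
  unfolding axes_def by (rule card_image[OF axis_inj])

lemma axis_in_axes: "axis j 1 \<in> axes" by (simp add: axes_def)

lemma sum_axes: "(\<Sum>u\<in>axes. g u) = (\<Sum>j\<in>UNIV. g (axis j 1))"
  unfolding axes_def by (simp add: sum.reindex[OF axis_inj])

lemma axes_component: "(\<Sum>u\<in>axes. c u *\<^sub>R u) $ j = c (axis j 1)"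
proof -
  have "(\<Sum>u\<in>axes. c u *\<^sub>R u) $ j = (\<Sum>k\<in>UNIV. if k = j then c (axis j 1) else 0)"
    unfolding sum_axes sum_component by (rule sum.cong) (auto simp: axis_def)
  then show ?thesis by simp
qed

lemma axes_expansion: "x = (\<Sum>u\<in>axes. (x \<bullet> u) *\<^sub>R u)"
  unfolding vec_eq_iff axes_component by (simp add: inner_axis)

lemma combination_axes:
  assumes "combination (Pow axes) c x"
  shows "c (axis j 1) = x $ j" "u \<notin> axes \<Longrightarrow> c u = 0"
proof -
  have s: "{u. c u \<noteq> 0} \<subseteq> axes" using assms by (simp add: combination_def)
  then show "u \<notin> axes \<Longrightarrow> c u = 0" by auto
  have "x = (\<Sum>u | c u \<noteq> 0. c u *\<^sub>R u)" using assms by (simp add: combination_def)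
  also have "\<dots> = (\<Sum>u\<in>axes. c u *\<^sub>R u)" by (rule sum.mono_neutral_left[OF finite_axes s]) auto
  finally show "c (axis j 1) = x $ j" using axes_component by metis
qed

lemma simplicial_axes: "simplicial_fan (Pow (axes :: (real^'n) set))"
proof
  fix c d and x :: "real^'n"
  assume c: "combination (Pow axes) c x" and d: "combination (Pow axes) d x"
  show "c = d"
  proof
    fix u
    show "c u = d u"
    proof (cases "u \<in> axes")
      case True
      then obtain j where "u = axis j 1" by (auto simp: axes_def)
      then show ?thesis using combination_axes(1)[OF c] combination_axes(1)[OF d] by simp
    qed (simp add: combination_axes(2)[OF c] combination_axes(2)[OF d])
  qed
qed (use finite_axes card_axes in \<open>auto intro: finite_subset\<close>)

lemma faces_axes: "(faces_sigma0 :: (real^'n) set set) = cone_of ` Pow axes"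
proof -
  interpret simplicial_fan "Pow (axes :: (real^'n) set)" by (rule simplicial_axes)
  have face: "\<tau> face_of cone_of axes \<and> \<tau> \<noteq> {} \<longleftrightarrow> (\<exists>A\<subseteq>axes. \<tau> = cone_of A)" for \<tau> :: "(real^'n) set"
    by (rule face_cone) simp
  show ?thesis unfolding faces_sigma0_def axes_def[symmetric] face by auto
qed

definition coord :: "real^'n \<Rightarrow> int^'n \<Rightarrow> int" where "coord u x = x $ inv_into UNIV (\<lambda>j. axis j 1) u"

lemma coord_axis: "coord (axis j 1) x = x $ j"
  unfolding coord_def by (simp add: inv_f_f[OF axis_inj])

context mckay
begin

text \<open>For the orthant the order of the rounding functions is the componentwise order, so
  forward steps alone connect comparable vectors.\<close>

lemma tower_axes: "tower (Pow axes) cl coord"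
proof -
  interpret simplicial_fan "Pow (axes :: (real^'n) set)" by (rule simplicial_axes)
  have ax: "U = axes" if "U \<in> Pow axes" "card U = CARD('n)" for U :: "(real^'n) set"
    using that by (intro card_subset_eq[OF finite_axes]) (auto simp: card_axes)
  show ?thesis
  proof unfold_locales
    show "finite (range cl)" using finite_Irr cl_range by simp
    show "cl (x - y) = cl 0" if "cl x = cl y" for x y using that by (rule cl_diff)
    fix u :: "real^'n" assume "{u} \<in> Pow axes"
    then obtain j where u: "u = axis j 1" by (auto simp: axes_def)
    show "rvec m \<bullet> u \<in> \<int>" for m unfolding u by (simp add: inner_axis rvec_def)
    have "(\<Sum>k\<in>UNIV. u $ k) = (\<Sum>k\<in>UNIV. if k = j then 1 else 0)" unfolding u by (rule sum.cong) (auto simp: axis_def)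
    then show "(\<Sum>k\<in>UNIV. u $ k) = 1" by simp
    show "coord u x \<le> coord u (x + axis k 1)" for x k unfolding u coord_axis by (simp add: axis_def)
    show "real_of_int (coord u (x + m)) = coord u x + rvec m \<bullet> u" for x m
      unfolding u coord_axis by (simp add: inner_axis rvec_def)
    show "coord u 0 = 0" unfolding u coord_axis by simp
  next
    fix U :: "(real^'n) set" and p assume "U \<in> Pow axes" "card U = CARD('n)"
    then have U: "U = axes" by (rule ax)
    show "\<exists>x. \<forall>u\<in>U. coord u x = p u"
      unfolding U axes_def by (rule exI[of _ "\<chi> j. p (axis j 1)"]) (auto simp: coord_axis)
  next
    fix U :: "(real^'n) set" and x x' assume "U \<in> Pow axes" "card U = CARD('n)" and le: "\<forall>u\<in>U. coord u x \<le> coord u x'"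
    then have U: "U = axes" using ax by simp
    have "x $ j \<le> x' $ j" for j using le axis_in_axes[of j] coord_axis unfolding U by metis
    then show "(step coord U)\<^sup>*\<^sup>* x x'"
    proof (induction "\<Sum>j\<in>UNIV. nat (x' $ j - x $ j)" arbitrary: x rule: less_induct)
      case less
      show ?case
      proof (cases "x = x'")
        case False
        then obtain j where "x $ j \<noteq> x' $ j" by (auto simp: vec_eq_iff)
        then have j: "x $ j < x' $ j" using less.prems[of j] by simp
        have "(step coord U)\<^sup>*\<^sup>* (x + axis j 1) x'"
        proof (rule less.hyps)
          show "(\<Sum>k\<in>UNIV. nat (x' $ k - (x + axis j 1) $ k)) < (\<Sum>k\<in>UNIV. nat (x' $ k - x $ k))"
            by (rule sum_strict_mono_ex1) (use j in \<open>auto simp: axis_def intro!: bexI[of _ j]\<close>)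
          show "(x + axis j 1) $ k \<le> x' $ k" for k using less.prems[of k] j by (auto simp: axis_def)
        qed
        moreover have "step coord U x (x + axis j 1)" unfolding step_def by blast
        ultimately show ?thesis by (rule converse_rtranclp_into_rtranclp[rotated])
      qed simp
    qed
  qed
qed

text \<open>The invariant of the iteration. The clause on the axes explains which arrows vanish
  because of a basis ray, and the clause on the orthant ensures that the next weight vector lies in
  the fan to be subdivided.\<close>

definition good :: "(real^'n) set set \<Rightarrow> (real^'n \<Rightarrow> int^'n \<Rightarrow> int) \<Rightarrow> bool" where
  "good \<S> f \<longleftrightarrow> tower \<S> cl f \<and> \<Union>\<S> \<subseteq> N_G G X \<and> (\<forall>j. {axis j 1} \<in> \<S> \<and> f (axis j 1) = (\<lambda>x. x $ j)) \<and>
     (\<forall>x. (\<forall>j. 0 \<le> x $ j) \<longrightarrow> (\<exists>c. combination \<S> c x))"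

lemma good_axes: "good (Pow axes) coord"
  unfolding good_def
proof (intro conjI allI impI tower_axes)
  interpret simplicial_fan "Pow (axes :: (real^'n) set)" by (rule simplicial_axes)
  show "\<Union> (Pow axes) \<subseteq> N_G G X" using axis_N_G by (auto simp: axes_def)
  show "{axis j 1} \<in> Pow axes" for j :: 'n by (simp add: axis_in_axes)
  show "coord (axis j 1) = (\<lambda>x. x $ j)" for j :: 'n by (rule ext) (rule coord_axis)
  show "\<exists>c. combination (Pow axes) c x" if "\<forall>j. 0 \<le> x $ j" for x :: "real^'n"
  proof -
    have "0 \<le> x \<bullet> u" if "u \<in> axes" for u using \<open>\<forall>j. 0 \<le> x $ j\<close> that by (auto simp: axes_def inner_axis)
    from combI[OF _ this axes_expansion] show ?thesis by auto
  qed
qed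

lemma good_star:
  assumes g: "good \<S> f" and k: "k \<in> junior G X" and sd: "star_subdivision (N_G G X) (cone_of ` \<S>) (wv k) \<Sigma>2"
  shows "\<exists>\<S>' f'. \<Sigma>2 = cone_of ` \<S>' \<and> good \<S>' f' \<and> (\<forall>u. {u} \<in> \<S>' \<longleftrightarrow> {u} \<in> \<S> \<or> u = wv k)"
proof -
  have kG: "k \<in> G" and k1: "(\<Sum>j\<in>UNIV. wv k $ j) = 1" using k by (auto simp: junior_def)
  interpret tower \<S> cl f using g by (simp add: good_def)
  have "\<forall>j. 0 \<le> wv k $ j" using weight_exp(1)[OF kG] by simp
  then obtain l where l: "combination \<S> l (wv k)" using g unfolding good_def by auto
  define T where "T = {u. l u \<noteq> 0}"
  have v0: "wv k \<noteq> 0" using k1 by auto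
  interpret tower_star \<S> cl f "wv k" l T
    by unfold_locales (use l v0 k1 kG cl_triv_iff in \<open>auto simp: T_def\<close>)
  have N: "\<Union>\<S> \<subseteq> N_G G X" "wv k \<in> N_G G X" using g wv_N_G[OF kG] by (auto simp: good_def)
  have \<Sigma>2: "\<Sigma>2 = cone_of ` star" by (rule star_subdivision_eq[OF N sd])
  have vs: "{wv k} \<in> star" unfolding star_def using nonempty T_ne TS by auto
  have vert: "{u} \<in> star \<longleftrightarrow> {u} \<in> \<S> \<or> u = wv k" for u
  proof
    assume u: "{u} \<in> \<S> \<or> u = wv k"
    show "{u} \<in> star"
    proof (cases "u = wv k")
      case False
      then have uS: "{u} \<in> \<S>" using u by simp
      have "\<not> T \<subseteq> {u}"
      proof
        assume "T \<subseteq> {u}"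
        then have T: "T = {u}" using T_ne by auto
        have "l u = 1" using l_sum T by simp
        then have "wv k = u" using v_sum T by simp
        with False show False by simp
      qed
      then show ?thesis using uS by (simp add: star_def)
    qed (use vs in simp)
  qed (use star_vertex in auto)
  \<comment> \<open>The entries of a weight vector are less than 1, so no subdivision redefines the
    rounding function of an axis.\<close>
  have other: "axis j 1 \<noteq> wv k" for j
  proof
    assume "axis j 1 = wv k"
    then have "wv k $ j = axis j 1 $ j" by simp
    then show False using weight_exp(2)[OF kG, of j] by simp
  qed
  have "good star f'"
    unfolding good_def
  proof (intro conjI allI impI tower_star)
    show "\<Union>star \<subseteq> N_G G X" using N by (auto simp: star_def)
    show "{axis j 1} \<in> star" for j using vert g by (simp add: good_def)
    show "f' (axis j 1) = (\<lambda>x. x $ j)" for j using f'_other[OF other] g by (simp add: good_def)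
    fix x :: "real^'n" assume "\<forall>j. 0 \<le> x $ j"
    then obtain c where c: "combination \<S> c x" using g unfolding good_def by auto
    interpret st: simplicial_fan star by (rule simplicial_star)
    obtain A where "A \<in> star" "x \<in> cone_of A" using star_decomp[OF c] by auto
    then show "\<exists>c. combination star c x" using st.mem_cone by auto
  qed
  then show ?thesis using \<Sigma>2 vert by (intro exI[of _ star] exI[of _ f']) simp
qed

lemma good_iterated:
  assumes "iterated_star (N_G G X) \<Sigma>1 vs \<Sigma>2" "\<Sigma>1 = cone_of ` \<S>" "good \<S> f" "set vs \<subseteq> wv ` junior G X"
  shows "\<exists>\<S>' f'. \<Sigma>2 = cone_of ` \<S>' \<and> good \<S>' f' \<and> (\<forall>u. {u} \<in> \<S>' \<longleftrightarrow> {u} \<in> \<S> \<or> u \<in> set vs)"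
  using assms
proof (induction arbitrary: \<S> f rule: iterated_star.induct)
  case (Nil \<Sigma>)
  then show ?case by auto
next
  case (Cons \<Sigma> v \<Sigma>' vs \<Sigma>'')
  obtain k where k: "k \<in> junior G X" "v = wv k" using Cons.prems(3) by auto
  have "star_subdivision (N_G G X) (cone_of ` \<S>) (wv k) \<Sigma>'" using Cons.hyps(1) Cons.prems(1) k by simp
  from good_star[OF Cons.prems(2) k(1) this] obtain \<S>1 f1 where
    1: "\<Sigma>' = cone_of ` \<S>1" "good \<S>1 f1" "\<forall>u. {u} \<in> \<S>1 \<longleftrightarrow> {u} \<in> \<S> \<or> u = wv k" by (elim exE conjE)
  have "set vs \<subseteq> wv ` junior G X" using Cons.prems(3) by simp
  from Cons.IH[OF 1(1,2) this] obtain \<S>2 f2 where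
    2: "\<Sigma>'' = cone_of ` \<S>2" "good \<S>2 f2" "\<forall>u. {u} \<in> \<S>2 \<longleftrightarrow> {u} \<in> \<S>1 \<or> u \<in> set vs" by (elim exE conjE)
  show ?case using 1 2 k by (intro exI[of _ \<S>2] exI[of _ f2]) auto
qed

lemma iterated_blowup:
  assumes "iterated_blowup_fan G X \<Sigma>"
  obtains \<S> f where "\<Sigma> = cone_of ` \<S>" "good \<S> f" "\<forall>u. {u} \<in> \<S> \<longleftrightarrow> u \<in> axes \<or> u \<in> wv ` junior G X"
proof -
  obtain gs where gs: "set gs = junior G X" "iterated_star (N_G G X) faces_sigma0 (map wv gs) \<Sigma>"
    using assms by (auto simp: iterated_blowup_fan_def)
  have "set (map wv gs) \<subseteq> wv ` junior G X" using gs(1) by simp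
  from good_iterated[OF gs(2) faces_axes good_axes this] obtain \<S> f where
    "\<Sigma> = cone_of ` \<S>" "good \<S> f" "\<forall>u. {u} \<in> \<S> \<longleftrightarrow> {u} \<in> Pow axes \<or> u \<in> set (map wv gs)" by (elim exE conjE)
  then show ?thesis using gs(1) by (intro that) auto
qed

end

section \<open>The gnat family\<close>

locale resolution = mckay G X for G :: "(complex^'n^'n) set" and X :: "complex^'n^'n" +
  fixes \<S> :: "(real^'n) set set" and f :: "real^'n \<Rightarrow> int^'n \<Rightarrow> int"
  assumes good: "good \<S> f" and verts: "{u} \<in> \<S> \<longleftrightarrow> u \<in> axes \<or> u \<in> wv ` junior G X"
begin

sublocale tower \<S> cl f using good by (simp add: good_def)

lemma f_axis: "f (axis j 1) x = x $ j" using good by (simp add: good_def)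

text \<open>The vertex part of the cocycle attached to \<open>u\<close>, which is minus the gnat
  coefficient. By \<open>f_shift\<close> it does not depend on the representative of the
  class.\<close>

definition th :: "real^'n \<Rightarrow> 'n gchar \<Rightarrow> real" where
  "th u i = f u (SOME x. cl x = i) - rvec (SOME x. cl x = i) \<bullet> u"

lemma th_cl:
  assumes u: "{u} \<in> \<S>"
  shows "th u (cl x) = f u x - rvec x \<bullet> u"
proof -
  define z where "z = (SOME z. cl z = cl x)"
  have "cl z = cl x" unfolding z_def by (rule someI[of "\<lambda>z. cl z = cl x" x]) (rule refl)
  then have "cl (z - x) = cl 0" by (rule mckay.cl_diff[OF mckay_axioms])
  from f_shift[OF u this, of x] show ?thesis by (simp add: th_def z_def[symmetric] rvec_diff inner_diff_left)
qed

text \<open>The standard lattice point over \<open>u\<close>: \<open>q_G\<close> sends it to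
  \<open>u\<close>, and its values on arrows are the increments of \<open>f u\<close>, hence
  nonnegative integers.\<close>

definition wu :: "real^'n \<Rightarrow> 'n arrow \<Rightarrow> real" where "wu u = cob u (th u)"

lemma wu_cl: "{u} \<in> \<S> \<Longrightarrow> wu u (cl x, j) = f u (x + axis j 1) - f u x"
  by (simp add: wu_def cob_apply cl_step[symmetric] th_cl rvec_add rvec_axis inner_add_left inner_axis')

lemma Arr_cl:
  assumes "e \<in> Arr G"
  obtains x j where "e = (cl x, j)"
proof -
  obtain i j where ij: "e = (i, j)" "i \<in> Irr G" using assms by (auto simp: Arr_def)
  obtain x where "cl x = i" using ij(2) by (rule cl_surj)
  then show ?thesis using ij(1) by (intro that[of x j]) simp
qed

lemma cl_Arr: "(cl x, j) \<in> Arr G" by (simp add: Arr_def cl_Irr)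

lemma intc_wu:
  assumes u: "{u} \<in> \<S>"
  shows "intc (wu u)"
  unfolding intc_def
proof (intro conjI ballI)
  show "cocycle (wu u)" unfolding wu_def by (rule cob_cocycle)
  fix e assume "e \<in> Arr G"
  then obtain x j where e: "e = (cl x, j)" by (rule Arr_cl)
  show "wu u e \<in> \<int>" "0 \<le> wu u e" using f_mono[OF u, of x j] by (simp_all add: e wu_cl[OF u])
qed

definition Zs :: "(real^'n) set \<Rightarrow> 'n arrow set" where "Zs U = (\<Union>u\<in>U. supp (wu u))"

lemma mem_Zs:
  assumes U: "U \<in> \<S>"
  shows "(cl x, j) \<in> Zs U \<longleftrightarrow> (\<exists>u\<in>U. f u (x + axis j 1) \<noteq> f u x)"
proof -
  have "(cl x, j) \<in> supp (wu u) \<longleftrightarrow> f u (x + axis j 1) \<noteq> f u x" if "u \<in> U" for u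
    using wu_cl[OF vertex[OF U that], of x j] by (simp add: supp_def cl_Arr)
  then show ?thesis by (simp add: Zs_def)
qed

lemma Zs_mono: "U \<subseteq> U' \<Longrightarrow> Zs U \<subseteq> Zs U'" by (auto simp: Zs_def)

lemma Zs_Arr: "Zs U \<subseteq> Arr G" by (auto simp: Zs_def supp_def)

lemma Zs_supp:
  assumes "U \<in> \<S>"
  obtains w where "intc w" "supp w = Zs U"
proof -
  have "\<exists>w. intc w \<and> supp w = Zs U'" if "finite U'" "U' \<subseteq> U" for U'
    using that
  proof (induction U' rule: finite_induct)
    case empty
    show ?case by (rule exI[of _ "\<lambda>e. 0"]) (simp add: intc_zero supp_zero Zs_def)
  next
    case (insert u U')
    then obtain w where w: "intc w" "supp w = Zs U'" by auto
    have i: "intc (wu u)" using insert.prems vertex[OF assms] by (intro intc_wu) auto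
    show ?case
      by (rule exI[of _ "\<lambda>e. wu u e + w e"]) (simp add: intc_add[OF i w(1)] supp_add[OF i w(1)] w(2) Zs_def)
  qed
  from this[OF fin(2)[OF assms] subset_refl] show ?thesis using that by auto
qed

lemma weight_rat: "wv g $ j \<in> \<rat>"
  unfolding weight_vec_def Let_def by simp

definition bnum :: "'n gchar \<Rightarrow> complex^'n^'n \<Rightarrow> rat" where
  "bnum i g = (SOME q. real_of_rat q = - th (wv g) i)"

text \<open>Weight vectors have rational entries and \<open>f\<close> has integral values, so the
  real number to be represented is rational and the choice in \<open>bnum\<close> succeeds.\<close>

lemma bnum_eq:
  assumes g: "g \<in> junior G X" and i: "i \<in> Irr G"
  shows "real_of_rat (bnum i g) = - th (wv g) i"
proof -
  obtain x where x: "cl x = i" using i by (rule cl_surj)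
  have u: "{wv g} \<in> \<S>" using g verts by simp
  have "rvec x \<bullet> wv g \<in> \<rat>" unfolding inner_vec_def by (intro Rats_sum) (simp add: rvec_def weight_rat)
  then have "- th (wv g) i \<in> \<rat>" using th_cl[OF u, of x] x by simp
  then have "\<exists>q. real_of_rat q = - th (wv g) i" by (metis Rats_cases)
  then show ?thesis unfolding bnum_def by (rule someI_ex)
qed

lemma gnat_defect_eq:
  assumes g: "g \<in> junior G X"
  shows "gnat_defect G X bnum (cl x) j g = f (wv g) (x + axis j 1) - f (wv g) x"
proof -
  have u: "{wv g} \<in> \<S>" using g verts by simp
  have "gnat_defect G X bnum (cl x) j g = wu (wv g) (cl x, j)"
    unfolding gnat_defect_def wu_def cob_apply using bnum_eq[OF g cl_Irr] bnum_eq[OF g tens_Irr[OF cl_Irr]] by simp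
  then show ?thesis using wu_cl[OF u] by simp
qed

lemma gnat_family_bnum: "gnat_family G X bnum"
  unfolding gnat_family_def
proof (intro conjI ballI allI)
  fix g assume g: "g \<in> junior G X"
  have u: "{wv g} \<in> \<S>" using g verts by simp
  have "th (wv g) (cl 0) = 0" using th_cl[OF u, of 0] f_zero[OF u] by (simp add: rvec_zero)
  then show "bnum (triv G) g = 0" using bnum_eq[OF g triv_Irr] by (simp add: cl_zero)
next
  fix i j g assume i: "i \<in> Irr G" and g: "g \<in> junior G X"
  have u: "{wv g} \<in> \<S>" using g verts by simp
  obtain x where x: "cl x = i" using i by (rule cl_surj)
  have "gnat_defect G X bnum i j g = real (nat (f (wv g) (x + axis j 1) - f (wv g) x))"
    using gnat_defect_eq[OF g, of x j] x f_mono[OF u, of x j] by simp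
  then show "gnat_defect G X bnum i j g \<in> \<nat>" by simp
qed

lemma ray_sub: "{u} \<in> \<S> \<Longrightarrow> U \<in> \<S> \<Longrightarrow> ray u \<subseteq> cone_of U \<longleftrightarrow> u \<in> U"
  unfolding ray_def using cone_mono_iff[of "{u}" U] by simp

text \<open>For an axis the increment of its coordinate along \<open>axis j 1\<close> is nonzero
  only if it is the j-th axis, which is the first clause of \<open>dist_point\<close>. For a weight
  vector the increment is the gnat defect, the second clause.\<close>

lemma dist_point_eq:
  assumes U: "U \<in> \<S>"
  shows "dist_point G X bnum (cone_of U) = (\<lambda>e\<in>Arr G. if e \<in> Zs U then 0 else 1)"
  unfolding dist_point_def
proof (rule restrict_ext)
  fix e assume "e \<in> Arr G"
  then obtain x j where e: "e = (cl x, j)" by (rule Arr_cl)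
  have ax: "{axis k (1::real)} \<in> \<S>" for k :: 'n by (simp add: verts axis_in_axes)
  have jn: "{wv g} \<in> \<S>" if "g \<in> junior G X" for g using that verts by simp
  have "(ray (axis j 1) \<subseteq> cone_of U \<or> (\<exists>g\<in>junior G X. ray (wv g) \<subseteq> cone_of U \<and> gnat_defect G X bnum (cl x) j g > 0))
      \<longleftrightarrow> (\<exists>u\<in>U. f u (x + axis j 1) \<noteq> f u x)" (is "?L \<longleftrightarrow> ?R")
  proof
    assume ?L
    then show ?R
    proof
      assume "ray (axis j 1) \<subseteq> cone_of U"
      then have "axis j 1 \<in> U" using ray_sub[OF ax U] by simp
      then show ?R by (rule bexI[rotated]) (simp add: f_axis)
    next
      assume "\<exists>g\<in>junior G X. ray (wv g) \<subseteq> cone_of U \<and> gnat_defect G X bnum (cl x) j g > 0"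
      then obtain g where g: "g \<in> junior G X" "ray (wv g) \<subseteq> cone_of U" "gnat_defect G X bnum (cl x) j g > 0" by auto
      have "wv g \<in> U" using ray_sub[OF jn[OF g(1)] U] g(2) by simp
      then show ?R by (rule bexI[rotated]) (use g gnat_defect_eq[OF g(1), of x j] in simp)
    qed
  next
    assume ?R
    then obtain u where u: "u \<in> U" "f u (x + axis j 1) \<noteq> f u x" by auto
    have uS: "{u} \<in> \<S>" by (rule vertex[OF U u(1)])
    then have "u \<in> axes \<or> u \<in> wv ` junior G X" using verts by simp
    then show ?L
    proof
      assume "u \<in> axes"
      then obtain k where k: "u = axis k 1" by (auto simp: axes_def)
      have "k = j"
      proof (rule ccontr)
        assume "k \<noteq> j"
        then have "(x + axis j 1) $ k = x $ k" by (simp add: axis_def)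
        then show False using u(2) by (simp only: k f_axis)
      qed
      then show ?L using ray_sub[OF uS U] u(1) k by simp
    next
      assume "u \<in> wv ` junior G X"
      then obtain g where g: "u = wv g" "g \<in> junior G X" by auto
      have "gnat_defect G X bnum (cl x) j g > 0" using gnat_defect_eq[OF g(2), of x j] u(2) f_mono[OF uS, of x j] g(1) by simp
      then show ?L using ray_sub[OF uS U] u(1) g by auto
    qed
  qed
  also have "\<dots> \<longleftrightarrow> e \<in> Zs U" using mem_Zs[OF U] e by simp
  finally show "(case e of (i, j) \<Rightarrow> if ray (axis j 1) \<subseteq> cone_of U \<or>
      (\<exists>g\<in>junior G X. ray (wv g) \<subseteq> cone_of U \<and> gnat_defect G X bnum i j g > 0) then 0 else 1) =
      (if e \<in> Zs U then 0 else (1::complex))"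
    by (simp add: e)
qed

lemma Zb_eq: "U \<in> \<S> \<Longrightarrow> Zb bnum (cone_of U) = Zs U"
  using Zs_Arr[of U] by (auto simp: Zb_def dist_point_eq split: if_splits)

abbreviation "\<Delta> \<equiv> cone_of ` \<S>"
definition "Zmax = Zs ` {U\<in>\<S>. card U = CARD('n)}"
abbreviation "St \<equiv> Fan Zmax"

lemma Sigma_tilde_Fan: "Sigma_tilde G X bnum \<Delta> = St"
proof -
  have "Zb bnum ` max_cones \<Delta> = Zmax"
    unfolding max_cones_eq Zmax_def image_image by (rule image_cong) (auto simp: Zb_eq)
  then show ?thesis by (simp add: Sigma_tilde_eq)
qed

subsection \<open>Preimages of cones\<close>

lemma ZmaxE:
  assumes "Z \<in> Zmax"
  obtains U where "U \<in> \<S>" "card U = CARD('n)" "Z = Zs U"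
  using assms by (auto simp: Zmax_def)

lemma Zs_sub_Zmax:
  assumes "U \<in> \<S>"
  obtains Z where "Z \<in> Zmax" "Zs U \<subseteq> Z"
proof -
  obtain U' where "U' \<in> \<S>" "U \<subseteq> U'" "card U' = CARD('n)" using pure[OF assms] by auto
  then show ?thesis using that[of "Zs U'"] Zs_mono by (auto simp: Zmax_def)
qed

lemma Cone_in_St:
  assumes U: "U \<in> \<S>"
  shows "Cone (Zs U) \<in> St"
proof -
  obtain w where w: "intc w" "supp w = Zs U" using U by (rule Zs_supp)
  obtain Z where "Z \<in> Zmax" "Zs U \<subseteq> Z" using U by (rule Zs_sub_Zmax)
  then show ?thesis using Fan_I[OF w(1), of Z Zmax] w(2) by simp
qed

context
  fixes U w y \<theta> assumes U: "U \<in> \<S>" and w: "realc (Zs U) w" and y: "\<forall>e\<in>Arr G. w e = cob y \<theta> e"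
begin

definition W :: "int^'n \<Rightarrow> real" where "W x = rvec x \<bullet> y + \<theta> (cl x)"

lemma W_diff: "W (x + axis j 1) - W x = w (cl x, j)"
  using y cl_Arr[of x j] by (simp add: W_def cob_apply cl_step rvec_add rvec_axis inner_add_left inner_axis')

lemma W_shift: "cl m = cl 0 \<Longrightarrow> W (x + m) = W x + rvec m \<bullet> y"
  using cl_shift[of m x] by (simp add: W_def rvec_add inner_add_left)

lemma W_mono: "W x \<le> W (x + axis j 1)"
proof -
  have "0 \<le> w (cl x, j)" using w cl_Arr[of x j] by (simp add: realc_def)
  then show ?thesis using W_diff[of x j] by simp
qed

lemma W_zero:
  assumes "\<forall>u\<in>U. f u (x + axis j 1) = f u x"
  shows "W (x + axis j 1) = W x"
proof -
  have "(cl x, j) \<notin> Zs U" using mem_Zs[OF U] assms by simp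
  then have "w (cl x, j) = 0" using w cl_Arr[of x j] by (auto simp: realc_def supp_def)
  then show ?thesis using W_diff[of x j] by simp
qed

lemma in_cone_U: "y \<in> cone_of U"
  by (rule in_cone[of W y, OF W_shift W_mono U W_zero])

lemma zero_face_U:
  assumes c: "card U = CARD('n)" and A: "A \<subseteq> U" "y \<in> cone_of A"
  shows "supp w \<subseteq> Zs A"
proof
  fix e assume e: "e \<in> supp w"
  then have eA: "e \<in> Arr G" "w e \<noteq> 0" by (auto simp: supp_def)
  obtain x j where xj: "e = (cl x, j)" using eA(1) by (rule Arr_cl)
  show "e \<in> Zs A"
  proof (rule ccontr)
    assume "e \<notin> Zs A"
    then have eq: "\<forall>u\<in>A. f u (x + axis j 1) = f u x" using mem_Zs[OF sub[OF U A(1)]] xj by simp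
    have "W (x + axis j 1) = W x"
      by (rule zero_face[of W y, OF W_shift W_mono U c A(1) W_zero A(2) eq])
    then show False using W_diff[of x j] eA(2) xj by simp
  qed
qed

end

text \<open>An element over the cone of \<open>U\<close> comes from the chart of some maximal
  \<open>V\<close>, so its image lies in both cones and hence in the cone of
  \<open>V \<inter> U\<close>. Then \<open>zero_face_U\<close> shrinks its support to
  \<open>Zs (V \<inter> U)\<close>, and the chart it came from no longer matters.\<close>

lemma preimage_cone:
  assumes U: "U \<in> \<S>"
  shows "q_G_preimage G X (cone_of U) \<inter> \<Union>St = Cone (Zs U)"
proof
  show "Cone (Zs U) \<subseteq> q_G_preimage G X (cone_of U) \<inter> \<Union>St"
  proof
    fix u assume u: "u \<in> Cone (Zs U)"
    then obtain w where w: "u = wt w" "realc (Zs U) w" "cocycle w" by (rule coneE)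
    obtain y \<theta> where y: "\<forall>e\<in>Arr G. w e = cob y \<theta> e" using w(3) by (rule cocycle_cob)
    have "q_G G X u = y" unfolding w(1) by (rule q_G_wt) (use y in simp)
    moreover have "y \<in> cone_of U" by (rule in_cone_U[OF U w(2) y])
    moreover have "u \<in> N_V_R G X" using u cone_sub_N by auto
    ultimately show "u \<in> q_G_preimage G X (cone_of U) \<inter> \<Union>St" using Cone_in_St[OF U] u by (auto simp: q_G_preimage_def)
  qed
  show "q_G_preimage G X (cone_of U) \<inter> \<Union>St \<subseteq> Cone (Zs U)"
  proof
    fix u assume u: "u \<in> q_G_preimage G X (cone_of U) \<inter> \<Union>St"
    then obtain \<tau> where \<tau>: "\<tau> \<in> St" "u \<in> \<tau>" by auto
    obtain w0 Z where w0: "\<tau> = Cone (supp w0)" "intc w0" "Z \<in> Zmax" "supp w0 \<subseteq> Z" using \<tau>(1) by (rule Fan_E)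
    obtain V where V: "V \<in> \<S>" "card V = CARD('n)" "Z = Zs V" using w0(3) by (rule ZmaxE)
    have "u \<in> Cone (supp w0)" using \<tau>(2) w0(1) by simp
    then obtain w where w: "u = wt w" "realc (supp w0) w" "cocycle w" by (rule coneE)
    have wV: "realc (Zs V) w" using w(2) w0(4) V(3) by (auto simp: realc_def)
    obtain y \<theta> where y: "\<forall>e\<in>Arr G. w e = cob y \<theta> e" using w(3) by (rule cocycle_cob)
    have "q_G G X u = y" unfolding w(1) by (rule q_G_wt) (use y in simp)
    then have "y \<in> cone_of U" using u by (simp add: q_G_preimage_def)
    moreover have "y \<in> cone_of V" by (rule in_cone_U[OF V(1) wV y])
    ultimately have "y \<in> cone_of (V \<inter> U)" using cone_inter[OF V(1) U] by auto
    then have "supp w \<subseteq> Zs (V \<inter> U)" by (intro zero_face_U[OF V(1) wV y V(2)]) auto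
    then have "supp w \<subseteq> Zs U" using Zs_mono[of "V \<inter> U" U] by auto
    then show "u \<in> Cone (Zs U)" using w by (auto simp: Cone_def realc_def)
  qed
qed

lemma q_G_Cone:
  assumes "\<tau> \<in> St"
  shows "\<exists>\<sigma>\<in>\<Delta>. q_G G X ` \<tau> \<subseteq> \<sigma>"
proof -
  obtain w0 Z where w0: "\<tau> = Cone (supp w0)" "intc w0" "Z \<in> Zmax" "supp w0 \<subseteq> Z" using assms by (rule Fan_E)
  obtain V where V: "V \<in> \<S>" "card V = CARD('n)" "Z = Zs V" using w0(3) by (rule ZmaxE)
  have "\<tau> \<subseteq> Cone (Zs V)" using w0 V by (auto simp: Cone_def realc_def)
  then have "q_G G X ` \<tau> \<subseteq> cone_of V" using preimage_cone[OF V(1)] by (auto simp: q_G_preimage_def)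
  then show ?thesis using V(1) by auto
qed

text \<open>The distinguished point of the ray is the limit point of \<open>wu (wv g)\<close>, so
  the cone of its orbit is \<open>Cone (Zs {wv g})\<close>, which \<open>preimage_cone\<close>
  recognizes.\<close>

lemma tau_E_eq:
  assumes g: "g \<in> junior G X"
  shows "tau_E G X bnum g = q_G_preimage G X (ray (wv g)) \<inter> \<Union>St"
proof -
  have u: "{wv g} \<in> \<S>" using g verts by simp
  have Z: "Zs {wv g} = supp (wu (wv g))" by (simp add: Zs_def)
  have "dist_point G X bnum (ray (wv g)) = limpt (wu (wv g))"
    unfolding ray_def dist_point_eq[OF u] limpt_def Z by (rule restrict_ext) (auto simp: supp_def)
  then have "tau_E G X bnum g = Cone (Zs {wv g})"
    unfolding tau_E_def using orbit_cone_eq(2)[OF intc_wu[OF u]] Z by simp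
  then show ?thesis using preimage_cone[OF u] by (simp add: ray_def)
qed

subsection \<open>The good quotient\<close>

lemma vert_N: "U \<in> \<S> \<Longrightarrow> u \<in> U \<Longrightarrow> m \<in> carrier (M_G G X) \<Longrightarrow> m \<bullet> u \<in> \<int>"
  using good unfolding good_def M_G_def by auto

lemma cone_face_MG:
  assumes U: "U \<in> \<S>" and m: "\<forall>u\<in>U. 0 \<le> m \<bullet> u"
  shows "{y\<in>cone_of U. m \<bullet> y = 0} = cone_of {u\<in>U. m \<bullet> u = 0}"
proof -
  have finU: "finite U" by (rule fin(2)[OF U])
  show ?thesis
  proof
    show "{y\<in>cone_of U. m \<bullet> y = 0} \<subseteq> cone_of {u\<in>U. m \<bullet> u = 0}"
    proof
      fix y assume y: "y \<in> {y\<in>cone_of U. m \<bullet> y = 0}"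
      then obtain c where c: "y = (\<Sum>u\<in>U. c u *\<^sub>R u)" "\<forall>u. 0 \<le> c u" using cone_of_finite[OF finU] by auto
      have "(\<Sum>u\<in>U. c u * (m \<bullet> u)) = 0" using y c(1) by (simp add: inner_sum_right)
      then have z: "\<forall>u\<in>U. c u * (m \<bullet> u) = 0" using sum_nonneg_eq_0_iff[OF finU, of "\<lambda>u. c u * (m \<bullet> u)"] c(2) m by simp
      have "y = (\<Sum>u\<in>{u\<in>U. m \<bullet> u = 0}. c u *\<^sub>R u)"
        unfolding c(1) by (rule sum.mono_neutral_right[OF finU]) (use z in auto)
      also have "\<dots> \<in> cone_of {u\<in>U. m \<bullet> u = 0}" by (rule cone_of_sum) (use finU c(2) in auto)
      finally show "y \<in> cone_of {u\<in>U. m \<bullet> u = 0}" .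
    qed
    show "cone_of {u\<in>U. m \<bullet> u = 0} \<subseteq> {y\<in>cone_of U. m \<bullet> y = 0}"
    proof
      fix y assume y: "y \<in> cone_of {u\<in>U. m \<bullet> u = 0}"
      obtain c where c: "y = (\<Sum>u\<in>{u\<in>U. m \<bullet> u = 0}. c u *\<^sub>R u)" using y cone_of_finite[of "{u\<in>U. m \<bullet> u = 0}"] finU by auto
      have "m \<bullet> y = 0" unfolding c by (simp add: inner_sum_right)
      moreover have "y \<in> cone_of U" using y hull_mono[of "{u\<in>U. m \<bullet> u = 0}" U convex_cone] by auto
      ultimately show "y \<in> {y\<in>cone_of U. m \<bullet> y = 0}" by simp
    qed
  qed
qed

lemma cone_nonneg:
  assumes U: "U \<in> \<S>" and m: "\<forall>u\<in>U. 0 \<le> m \<bullet> u" and y: "y \<in> cone_of U"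
  shows "0 \<le> m \<bullet> y"
proof -
  obtain c where c: "y = (\<Sum>u\<in>U. c u *\<^sub>R u)" "\<forall>u. 0 \<le> c u" using y cone_of_finite[OF fin(2)[OF U]] by auto
  show ?thesis unfolding c(1) inner_sum_right using c(2) m by (intro sum_nonneg) simp
qed

lemma toric_MG: "toric_setting (M_G G X) (\<bullet>) \<Delta> axes"
proof (rule toric_setting.intro)
  show "comm_group (M_G G X)" by (rule comm_group_MG)
  show "finite \<Delta>" using fin(1) by simp
  show "finite (axes :: (real^'n) set)" by (rule finite_axes)
  show "(m \<otimes>\<^bsub>M_G G X\<^esub> m') \<bullet> u = m \<bullet> u + m' \<bullet> u" for m m' u by (simp add: M_G_def inner_add_left)
  show "m \<bullet> u \<in> \<int>" if "m \<in> carrier (M_G G X)" "u \<in> axes" for m u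
    using that axis_N_G by (auto simp: M_G_def axes_def)
  show "m = \<one>\<^bsub>M_G G X\<^esub>" if "\<And>u. u \<in> axes \<Longrightarrow> m \<bullet> u = 0" for m
    using that[OF axis_in_axes] by (simp add: M_G_def vec_eq_iff inner_axis)
next
  fix \<sigma> assume "\<sigma> \<in> \<Delta>"
  then obtain U where U: "\<sigma> = cone_of U" "U \<in> \<S>" by auto
  show "\<exists>\<Gamma>. finite \<Gamma> \<and> \<Gamma> \<subseteq> \<sigma> \<and> (\<forall>u\<in>\<Gamma>. \<forall>m\<in>carrier (M_G G X). m \<bullet> u \<in> \<int>) \<and>
      (\<forall>m\<in>carrier (M_G G X). (\<forall>u\<in>\<Gamma>. 0 \<le> m \<bullet> u) \<longrightarrow> (\<forall>u\<in>\<sigma>. 0 \<le> m \<bullet> u))"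
    unfolding U(1) using fin(2)[OF U(2)] hull_subset[of U convex_cone] vert_N[OF U(2)] cone_nonneg[OF U(2)]
    by (intro exI[of _ U]) auto
  have pos: "\<forall>u\<in>U. 0 \<le> m \<bullet> u" if "m \<in> dual_semigroup (M_G G X) (\<bullet>) \<sigma>" for m
    using that hull_subset[of U convex_cone] unfolding dual_semigroup_def U(1) by auto
  show "{u\<in>\<sigma>. m \<bullet> u = 0} \<in> \<Delta>" if "m \<in> dual_semigroup (M_G G X) (\<bullet>) \<sigma>" for m
    unfolding U(1) cone_face_MG[OF U(2) pos[OF that]] using sub[OF U(2), of "{u\<in>U. m \<bullet> u = 0}"] by auto
  fix \<sigma>' assume "\<sigma>' \<in> \<Delta>"
  then obtain V where V: "\<sigma>' = cone_of V" "V \<in> \<S>" by auto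
  obtain U' where U': "U' \<in> \<S>" "U \<subseteq> U'" "card U' = CARD('n)" using pure[OF U(2)] by auto
  \<comment> \<open>A separating invariant monomial: zero on the common generators and positive on
    the other generators of \<sigma>, so that it cuts out the common face.\<close>
  obtain x k where x: "cl x = cl 0" "(k::int) \<ge> 1" "\<forall>u\<in>U'. rvec x \<bullet> u = real_of_int (k * (if u \<in> V then 0 else 1))"
    by (rule lattice_direction[OF U'(1,3), of "\<lambda>u. if u \<in> V then 0 else 1"])
  have xu: "rvec x \<bullet> u = (if u \<in> V then 0 else k)" if "u \<in> U" for u using x(3) U'(2) that by auto
  have nn: "\<forall>u\<in>U. 0 \<le> rvec x \<bullet> u" using xu x(2) by simp
  show "\<exists>m\<in>dual_semigroup (M_G G X) (\<bullet>) \<sigma>. \<sigma> \<inter> \<sigma>' = {u\<in>\<sigma>. m \<bullet> u = 0}"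
  proof
    show "rvec x \<in> dual_semigroup (M_G G X) (\<bullet>) \<sigma>"
      using x(1) M_G_carrier cone_nonneg[OF U(2) nn] by (auto simp: dual_semigroup_def U(1))
    have "{u\<in>U. rvec x \<bullet> u = 0} = U \<inter> V" using xu x(2) by (auto split: if_splits)
    then show "\<sigma> \<inter> \<sigma>' = {u\<in>\<sigma>. rvec x \<bullet> u = 0}"
      unfolding U(1) V(1) cone_face_MG[OF U(2) nn] cone_inter[OF U(2) V(2)] by simp
  qed
qed

definition pb :: "(real^'n) set \<Rightarrow> 'n nvec set" where
  "pb \<sigma> = q_G_preimage G X \<sigma> \<inter> \<Union>St"

lemma pb_cone: "\<sigma> \<in> \<Delta> \<Longrightarrow> pb \<sigma> \<in> St"
  using preimage_cone Cone_in_St by (auto simp: pb_def)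

text \<open>Every generator \<open>u\<close> of \<sigma> is the image of \<open>wt (wu u)\<close>,
  which lies in \<open>pb \<sigma>\<close>; so an inequality on the image of
  \<open>pb \<sigma>\<close> holds on \<sigma>.\<close>

lemma pb_dual:
  assumes \<sigma>: "\<sigma> \<in> \<Delta>" and m: "m \<in> carrier (M_G G X)" and pos: "\<And>u. u \<in> pb \<sigma> \<Longrightarrow> 0 \<le> m \<bullet> q_G G X u"
  shows "m \<in> dual_semigroup (M_G G X) (\<bullet>) \<sigma>"
proof -
  obtain U where U: "\<sigma> = cone_of U" "U \<in> \<S>" using \<sigma> by auto
  have "\<forall>u\<in>U. 0 \<le> m \<bullet> u"
  proof
    fix u assume u: "u \<in> U"
    have "intc (wu u)" by (rule intc_wu[OF vertex[OF U(2) u]])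
    then have "wt (wu u) \<in> Cone (Zs U)" using u unfolding Cone_def Zs_def by (auto intro!: imageI intc_realc)
    then have "wt (wu u) \<in> pb \<sigma>" unfolding pb_def U(1) preimage_cone[OF U(2)] .
    moreover have "q_G G X (wt (wu u)) = u" unfolding wu_def by (rule q_G_wt) (rule refl)
    ultimately show "0 \<le> m \<bullet> u" using pos by force
  qed
  then show ?thesis using m cone_nonneg[OF U(2)] by (auto simp: dual_semigroup_def U(1))
qed

text \<open>By \<open>lift_char\<close> the character extends to all of M_V, and the extension is
  restricted to the characters orthogonal to \<open>pb \<sigma>\<close>.\<close>

lemma lift:
  assumes \<sigma>: "\<sigma> \<in> \<Delta>" and \<gamma>: "\<gamma> \<in> hom ((M_G G X)\<lparr>carrier := perp (M_G G X) (\<bullet>) \<sigma>\<rparr>) Cstar"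
  shows "\<exists>\<gamma>'\<in>hom (MV\<lparr>carrier := perp MV (\<lambda>m w. w m) (pb \<sigma>)\<rparr>) Cstar. \<forall>f\<in>perp (M_G G X) (\<bullet>) \<sigma>. \<gamma>' (M_G_to_M_V G X f) = \<gamma> f"
proof -
  interpret MG: comm_group "M_G G X" by (rule comm_group_MG)
  have inv: "inv\<^bsub>M_G G X\<^esub> m = - m" if "m \<in> carrier (M_G G X)" for m
    by (rule MG.inv_equality) (use that in \<open>auto simp: M_G_def\<close>)
  have "subgroup (perp (M_G G X) (\<bullet>) \<sigma>) (M_G G X)"
  proof (rule MG.subgroupI)
    show "perp (M_G G X) (\<bullet>) \<sigma> \<noteq> {}" using MG.one_closed by (auto simp: perp_def M_G_def intro!: exI[of _ 0])
    show "inv\<^bsub>M_G G X\<^esub> a \<in> perp (M_G G X) (\<bullet>) \<sigma>" if "a \<in> perp (M_G G X) (\<bullet>) \<sigma>" for a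
      using that inv[of a] MG.inv_closed[of a] by (auto simp: perp_def)
  qed (auto simp: perp_def M_G_def inner_add_left)
  then obtain \<gamma>' where "\<gamma>' \<in> hom MV Cstar" "\<forall>f\<in>perp (M_G G X) (\<bullet>) \<sigma>. \<gamma>' (M_G_to_M_V G X f) = \<gamma> f"
    by (rule lift_char[OF _ \<gamma>])
  then show ?thesis by (intro bexI[of _ \<gamma>']) (auto simp: hom_def perp_def)
qed

lemma T_irred:
  assumes A: "finite A" "A \<subseteq> carrier MV" and B: "finite B" "B \<subseteq> carrier MV"
    and z: "\<And>\<gamma>. \<gamma> \<in> (\<lambda>p m. m p) ` T0 \<Longrightarrow> (\<Sum>m\<in>A. c m * \<gamma> m) * (\<Sum>m\<in>B. d m * \<gamma> m) = 0"
  shows "(\<forall>\<gamma>\<in>(\<lambda>p m. m p) ` T0. (\<Sum>m\<in>A. c m * \<gamma> m) = 0) \<or> (\<forall>\<gamma>\<in>(\<lambda>p m. m p) ` T0. (\<Sum>m\<in>B. d m * \<gamma> m) = 0)"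
proof -
  obtain E where E: "hol E" "\<forall>p\<in>T0. E p = (\<Sum>m\<in>A. c m * m p)" by (rule hol_lau_sum[OF A])
  obtain F where F: "hol F" "\<forall>p\<in>T0. F p = (\<Sum>m\<in>B. d m * m p)" by (rule hol_lau_sum[OF B])
  have "E p * F p = 0" if "p \<in> T0" for p using z[of "\<lambda>m. m p"] E(2) F(2) that by auto
  from irreducible_T0[OF E(1) F(1) this] show ?thesis using E(2) F(2) by auto
qed

lemma supp_zero_Fan: "Cone {} \<in> St"
  using Cone_in_St[OF nonempty] by (simp add: Zs_def)

lemma quotient: "toric_quotient MV (\<lambda>m w. w m) St KV (M_G G X) (\<bullet>) \<Delta> axes (M_G_to_M_V G X) (q_G G X) pb
    (Cone {}) ((\<lambda>p m. m p) ` T0) (T_bar G X) (\<lambda>s m. m s)"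
  apply (intro toric_quotient.intro toric_quotient_axioms.intro toric_Fan toric_MG)
  subgoal by (rule \<iota>_closed)
  subgoal for m m' using \<iota>_mult[of m m'] by (simp add: M_G_def)
  subgoal for m u
  proof -
    assume m: "m \<in> carrier (M_G G X)" and "u \<in> \<Union>St"
    then have "u \<in> N_V_R G X" using cone_sub_N unfolding Fan_def by auto
    then show "m \<bullet> q_G G X u = u (M_G_to_M_V G X m)" using m by (rule q_G_pair)
  qed
  subgoal by (rule q_G_Cone)
  subgoal by (rule pb_cone)
  subgoal for \<sigma> \<tau>
  proof -
    assume "\<tau> \<in> St"
    then have "\<tau> \<subseteq> N_V_R G X" "\<tau> \<subseteq> \<Union>St" using cone_sub_N unfolding Fan_def by auto
    then show "\<tau> \<subseteq> pb \<sigma> \<longleftrightarrow> q_G G X ` \<tau> \<subseteq> \<sigma>" unfolding pb_def q_G_preimage_def by auto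
  qed
  subgoal by (rule pb_dual)
  subgoal by (rule supp_zero_Fan)
  subgoal for \<tau> unfolding Fan_def Cone_def by (auto simp: realc_def)
  subgoal
  proof -
    have "u m = 0" if m: "m \<in> carrier MV" and u: "u \<in> Cone {}" for u m
    proof -
      obtain w where w: "u = wt w" "realc {} w" "cocycle w" using u by (rule coneE)
      obtain c where c: "m = lau c" using m by (rule MV_E)
      have "pair c w = pair c (\<lambda>e. 0)" by (rule pair_cong) (use w(2) in \<open>auto simp: realc_def supp_def\<close>)
      then show ?thesis using w c by (simp add: wt_lau pair_right)
    qed
    then show "perp MV (\<lambda>m w. w m) (Cone {}) = carrier MV" by (auto simp: perp_def)
  qed
  subgoal for \<gamma> using eval_hom by auto
  subgoal for \<gamma> \<delta>
  proof -
    assume "\<gamma> \<in> (\<lambda>p m. m p) ` T0" "\<delta> \<in> (\<lambda>p m. m p) ` T0"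
    then obtain p q where pq: "\<gamma> = (\<lambda>m. m p)" "\<delta> = (\<lambda>m. m q)" "p \<in> T0" "q \<in> T0" by auto
    show "\<exists>\<epsilon>\<in>(\<lambda>p m. m p) ` T0. \<forall>m\<in>carrier MV. \<epsilon> m = \<gamma> m * \<delta> m"
      by (rule bexI[of _ "\<lambda>m. m (tmult G p q)"]) (use T0_mult[OF pq(3,4)] lau_tmult[OF pq(3,4)] pq(1,2) in \<open>auto simp: carrier_MV\<close>)
  qed
  subgoal using T0_one by auto
  subgoal for m m'
  proof -
    assume m: "m \<in> carrier MV" "m' \<in> carrier MV" and ne: "m \<noteq> m'"
    obtain c where c: "m = lau c" using m(1) by (rule MV_E)
    obtain c' where c': "m' = lau c'" using m(2) by (rule MV_E)
    have "\<exists>p\<in>T0. m p \<noteq> m' p"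
    proof (rule ccontr)
      assume "\<not> ?thesis"
      then have "m = m'" unfolding c c' by (intro lau_eqI) auto
      with ne show False by simp
    qed
    then show "\<exists>\<gamma>\<in>(\<lambda>p m. m p) ` T0. \<gamma> m \<noteq> \<gamma> m'" by auto
  qed
  subgoal for A B c d by (rule T_irred)
  subgoal by (rule lift)
  subgoal for s t
  proof -
    assume s: "s \<in> T_bar G X" and t: "t \<in> T_bar G X"
    have s0: "s \<in> T0" "t \<in> T0" using s t T_bar_T0 by auto
    show "\<exists>r\<in>T_bar G X. \<forall>m\<in>carrier MV. m r = m s * m t"
      by (rule bexI[OF _ T_bar_mult[OF s t]]) (use lau_tmult[OF s0] in \<open>auto simp: carrier_MV\<close>)
  qed
  subgoal using T_bar_one lau_at_one by (auto simp: carrier_MV)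
  subgoal for s m m' using T_bar_T0 by (auto simp: MV_mult)
  subgoal for s m using T_bar_T0 lau_nz by (auto simp: carrier_MV)
  subgoal for s m using \<iota>_eval by simp
  subgoal for m using inv_M_G by simp
  done

theorem good_quotient_q_2:
  "good_quotient (T_bar G X) (V_bar_act G X) (V_bar G X bnum \<Delta>) (X_toric G X \<Delta>) (q_2 G X \<Delta>)"
proof -
  interpret Q: toric_quotient MV "\<lambda>m w. w m" St KV "M_G G X" "(\<bullet>)" \<Delta> axes "M_G_to_M_V G X" "q_G G X" pb
    "Cone {}" "(\<lambda>p m. m p) ` T0" "T_bar G X" "\<lambda>s m. m s"
    by (rule quotient)
  have "V_bar_act G X = Q.act" by (intro ext) (simp add: V_bar_act_def Q.act_def)
  moreover have "q_2 G X \<Delta> = Q.p" by (simp add: q_2_def Q.p_def)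
  ultimately show ?thesis using Q.good_quotient_p
    unfolding V_bar_def X_toric_def Sigma_tilde_Fan by simp
qed

end

theorem proposition6p1:
  fixes G :: "(complex^'n^'n) set" and X :: "complex^'n^'n" and \<Sigma> :: "(real^'n) set set"
  assumes "subgroup G SL" and "finite G" and "comm_group (SL\<lparr>carrier := G\<rparr>)"
    and "eigen_coordinates G X"
    and "iterated_blowup_fan G X \<Sigma>"
  shows "\<exists>b. gnat_family G X b \<and>
    (\<forall>\<tau>\<in>Sigma_tilde G X b \<Sigma>. \<exists>\<sigma>\<in>\<Sigma>. q_G G X ` \<tau> \<subseteq> \<sigma>) \<and>
    good_quotient (T_bar G X) (V_bar_act G X) (V_bar G X b \<Sigma>) (X_toric G X \<Sigma>) (q_2 G X \<Sigma>) \<and>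
    (\<forall>\<sigma>\<in>\<Sigma>. q_G_preimage G X \<sigma> \<inter> \<Union> (Sigma_tilde G X b \<Sigma>) \<in> Sigma_tilde G X b \<Sigma>) \<and>
    (\<forall>g\<in>junior G X.
       q_G_preimage G X (ray (weight_vec G X g)) \<inter> \<Union> (Sigma_tilde G X b \<Sigma>) = tau_E G X b g)"
proof -
  interpret mckay G X by (rule mckay.intro[OF assms(1-4)])
  obtain \<S> f where S: "\<Sigma> = cone_of ` \<S>" "good \<S> f" "\<forall>u. {u} \<in> \<S> \<longleftrightarrow> u \<in> axes \<or> u \<in> wv ` junior G X"
    using assms(5) by (rule iterated_blowup)
  interpret resolution G X \<S> f
    by (intro resolution.intro resolution_axioms.intro mckay_axioms S(2)) (use S(3) in simp)
  show ?thesis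
    unfolding S(1)
  proof (intro exI[of _ bnum] conjI ballI gnat_family_bnum good_quotient_q_2, unfold Sigma_tilde_Fan)
    show "\<exists>\<sigma>\<in>cone_of ` \<S>. q_G G X ` \<tau> \<subseteq> \<sigma>" if "\<tau> \<in> St" for \<tau> using that by (rule q_G_Cone)
    show "q_G_preimage G X \<sigma> \<inter> \<Union>St \<in> St" if "\<sigma> \<in> cone_of ` \<S>" for \<sigma> using pb_cone[OF that] by (simp add: pb_def)
    show "q_G_preimage G X (ray (wv g)) \<inter> \<Union>St = tau_E G X bnum g" if "g \<in> junior G X" for g
      using tau_E_eq[OF that] by simp
  qed
qed

end
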